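(* Let $\omega\subset\mathbb{R}^2$ be open, bounded, simply connected, with Lipschitz boundary. Let $\bar B,\bar S:\bar\omega\to\mathbb{R}^{2\times2}_{sym}$ be smooth, and for $v\in W^{2,2}(\omega,\mathbb{R})$ define $$\bar I_0(v)=\|\nabla^2v+\bar B\|^2_{L^2(\omega)}+\|\det\nabla^2v+\mathrm{curl}^T\mathrm{curl}\,\bar S\|^2_{H^{-2}(\omega)}.$$ Then, with some constants $c,C>0$ depending only on $\omega$, we have $$\inf\bar I_0\leq C\,\|\mathrm{curl}\,\bar B\|_{H^{-1}(\omega)}^2\Big(1+\|\bar B\|^2_{L^\infty(\omega)}+\|\mathrm{curl}\,\bar B\|_{H^{-1}(\omega)}^2\Big)+C\,\|\det\bar B+\mathrm{curl}^T\mathrm{curl}\,\bar S\|^2_{H^{-2}(\omega)},$$ $$\inf\bar I_0\geq c\,\|\mathrm{curl}\,\bar B\|_{H^{-1}(\omega)}^2+\frac{c}{1\vee a}\|\det\bar B+\mathrm{curl}^T\mathrm{curl}\,\bar S\|^2_{H^{-2}(\omega)},$$ where $$a=\|\bar B\|^2_{L^\infty(\omega)}+\|\det\bar B+\mathrm{curl}^T\mathrm{curl}\,\bar S\|^2_{H^{-2}(\omega)}+\|\mathrm{curl}\,\bar B\|_{H^{-1}(\omega)}^2\big(1+\|\bar B\|^2_{L^\infty(\omega)}+\|\mathrm{curl}\,\bar B\|_{H^{-1}(\omega)}^2\big).$$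
   Context: For $w:\omega\to\mathbb{R}^2$, $\mathrm{curl}\,w=\partial_1w_2-\partial_2w_1$; for $F:\omega\to\mathbb{R}^{2\times2}$, $\mathrm{curl}\,F$ is taken row-wise (a vector field in $\mathbb{R}^2$); for symmetric $F$, $\mathrm{curl}^T\mathrm{curl}\,F=\partial_{22}F_{11}-2\partial_{12}F_{12}+\partial_{11}F_{22}$. $H^{-1}(\omega)$ and $H^{-2}(\omega)$ are the duals of $W^{1,2}_0(\omega)$ and $W^{2,2}_0(\omega)$. $1\vee a=\max\{1,a\}$. The infimum is over $v\in W^{2,2}(\omega,\mathbb{R})$. *)

theory Defs
  imports "HOL-Analysis.Analysis" "HOL-Probability.Essential_Supremum"
begin

section \<open>Domains with Lipschitz boundary\<close>

text \<open>Near each boundary point the set is, after an orthogonal change of coordinates \<open>T\<close>,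
  the open epigraph of a Lipschitz function \<open>\<gamma>\<close>.\<close>

definition lipschitz_boundary :: "(real^2) set \<Rightarrow> bool" where
  "lipschitz_boundary \<omega> \<longleftrightarrow>
     (\<forall>p\<in>frontier \<omega>. \<exists>r>0. \<exists>(T :: real^2 \<Rightarrow> real^2) (\<gamma> :: real \<Rightarrow> real) L.
        orthogonal_transformation T \<and> L-lipschitz_on UNIV \<gamma> \<and>
        \<omega> \<inter> ball p r = {x \<in> ball p r. \<gamma> (T x $ 1) < T x $ 2})"


section \<open>Classical derivatives\<close>

definition partial_deriv :: "2 \<Rightarrow> (real^2 \<Rightarrow> 'b) \<Rightarrow> real^2 \<Rightarrow> 'b::real_normed_vector" where
  "partial_deriv i f x = frechet_derivative f (at x) (axis i 1)"

text \<open>Iterated partial derivatives are indexed by lists of directions instead of multi-indices.\<close>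

definition partial_derivs :: "2 list \<Rightarrow> (real^2 \<Rightarrow> 'b) \<Rightarrow> real^2 \<Rightarrow> 'b::real_normed_vector" where
  "partial_derivs is f = foldr partial_deriv is f"

text \<open>Only meant for open \<open>U\<close>.\<close>

definition smooth_on :: "(real^2) set \<Rightarrow> (real^2 \<Rightarrow> 'b::real_normed_vector) \<Rightarrow> bool" where
  "smooth_on U f \<longleftrightarrow> (\<forall>is. partial_derivs is f differentiable_on U)"

text \<open>\<open>C\<^sup>\<infinity>(closure \<omega>)\<close>: smooth in \<open>\<omega>\<close>, with all derivatives extending continuously to the closure.\<close>

definition smooth_on_closure :: "(real^2) set \<Rightarrow> (real^2 \<Rightarrow> 'b::real_normed_vector) \<Rightarrow> bool" where
  "smooth_on_closure \<omega> f \<longleftrightarrow>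
     smooth_on \<omega> f \<and> continuous_on (closure \<omega>) f \<and>
     (\<forall>is. \<exists>g. continuous_on (closure \<omega>) g \<and> (\<forall>x\<in>\<omega>. g x = partial_derivs is f x))"

definition curl :: "(real^2 \<Rightarrow> real^2) \<Rightarrow> real^2 \<Rightarrow> real" where
  "curl w x = partial_deriv 1 (\<lambda>y. w y $ 2) x - partial_deriv 2 (\<lambda>y. w y $ 1) x"

definition curl_rows :: "(real^2 \<Rightarrow> real^2^2) \<Rightarrow> real^2 \<Rightarrow> real^2" where
  "curl_rows F x = (\<chi> i. curl (\<lambda>y. F y $ i) x)"

definition curlT_curl :: "(real^2 \<Rightarrow> real^2^2) \<Rightarrow> real^2 \<Rightarrow> real" where
  "curlT_curl F x =
     partial_derivs [2,2] (\<lambda>y. F y $ 1 $ 1) x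
     - 2 * partial_derivs [1,2] (\<lambda>y. F y $ 1 $ 2) x
     + partial_derivs [1,1] (\<lambda>y. F y $ 2 $ 2) x"


section \<open>Lebesgue and Sobolev spaces\<close>

text \<open>Elements of these spaces are represented by functions on the whole plane, of which only
  the restriction to \<open>\<omega>\<close> (up to null sets) matters.\<close>

definition L2 :: "(real^2) set \<Rightarrow> (real^2 \<Rightarrow> 'b::euclidean_space) set" where
  "L2 \<omega> = {f \<in> borel_measurable (lebesgue_on \<omega>). integrable (lebesgue_on \<omega>) (\<lambda>x. (norm (f x))\<^sup>2)}"

definition L2_norm :: "(real^2) set \<Rightarrow> (real^2 \<Rightarrow> 'b::euclidean_space) \<Rightarrow> real" where
  "L2_norm \<omega> f = sqrt (\<integral>x. (norm (f x))\<^sup>2 \<partial>lebesgue_on \<omega>)"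

definition Linf_norm :: "(real^2) set \<Rightarrow> (real^2 \<Rightarrow> 'b::euclidean_space) \<Rightarrow> ennreal" where
  "Linf_norm \<omega> f = esssup (lebesgue_on \<omega>) (\<lambda>x. ennreal (norm (f x)))"

definition test_functions :: "(real^2) set \<Rightarrow> (real^2 \<Rightarrow> 'b::euclidean_space) set" where
  "test_functions \<omega> =
     {\<phi>. smooth_on UNIV \<phi> \<and> compact (closure {x. \<phi> x \<noteq> 0}) \<and> closure {x. \<phi> x \<noteq> 0} \<subseteq> \<omega>}"

definition is_weak_deriv ::
    "(real^2) set \<Rightarrow> 2 list \<Rightarrow> (real^2 \<Rightarrow> 'b::euclidean_space) \<Rightarrow> (real^2 \<Rightarrow> 'b) \<Rightarrow> bool" where
  "is_weak_deriv \<omega> is u g \<longleftrightarrow>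
     (\<forall>K. compact K \<and> K \<subseteq> \<omega> \<longrightarrow> integrable (lebesgue_on K) u \<and> integrable (lebesgue_on K) g) \<and>
     (\<forall>\<phi> :: real^2 \<Rightarrow> real. \<phi> \<in> test_functions \<omega> \<longrightarrow>
        (\<integral>x. partial_derivs is \<phi> x *\<^sub>R u x \<partial>lebesgue_on \<omega>) =
        (- 1) ^ length is *\<^sub>R (\<integral>x. \<phi> x *\<^sub>R g x \<partial>lebesgue_on \<omega>))"

definition weak_deriv ::
    "(real^2) set \<Rightarrow> 2 list \<Rightarrow> (real^2 \<Rightarrow> 'b::euclidean_space) \<Rightarrow> real^2 \<Rightarrow> 'b" where
  "weak_deriv \<omega> is u = (SOME g. is_weak_deriv \<omega> is u g)"

text \<open>\<open>W\<^sup>k\<^sup>,\<^sup>2(\<omega>)\<close>. The case of the empty list says that \<open>u\<close> itself is in \<open>L\<^sup>2\<close>.\<close>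

definition W2 :: "nat \<Rightarrow> (real^2) set \<Rightarrow> (real^2 \<Rightarrow> 'b::euclidean_space) set" where
  "W2 k \<omega> = {u. \<forall>is. length is \<le> k \<longrightarrow> (\<exists>g\<in>L2 \<omega>. is_weak_deriv \<omega> is u g)}"

definition W2_norm :: "nat \<Rightarrow> (real^2) set \<Rightarrow> (real^2 \<Rightarrow> 'b::euclidean_space) \<Rightarrow> real" where
  "W2_norm k \<omega> u = sqrt (\<Sum>is\<in>{is. length is \<le> k}. (L2_norm \<omega> (weak_deriv \<omega> is u))\<^sup>2)"

text \<open>\<open>W\<^sub>0\<^sup>k\<^sup>,\<^sup>2(\<omega>)\<close>: the closure of the test functions.\<close>

definition W2_0 :: "nat \<Rightarrow> (real^2) set \<Rightarrow> (real^2 \<Rightarrow> 'b::euclidean_space) set" where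
  "W2_0 k \<omega> = {u \<in> W2 k \<omega>. \<exists>\<phi>. (\<forall>n. \<phi> n \<in> test_functions \<omega>) \<and>
                (\<lambda>n. W2_norm k \<omega> (\<lambda>x. u x - \<phi> n x)) \<longlonglongrightarrow> 0}"

text \<open>The norm of \<open>f\<close> in \<open>H\<^sup>-\<^sup>k(\<omega>)\<close>, the dual of \<open>W\<^sub>0\<^sup>k\<^sup>,\<^sup>2(\<omega>)\<close>: the operator norm of the functional
  \<open>\<phi> \<mapsto> \<integral> f \<bullet> \<phi>\<close>, with the value \<open>\<infinity>\<close> if this functional is unbounded. It is to be used
  for \<open>f\<close> such that all products \<open>f \<bullet> \<phi>\<close> are integrable: \<open>f\<close> in \<open>L\<^sup>2\<close> for \<open>k = 1\<close>,
  \<open>f\<close> in \<open>L\<^sup>1\<close> for \<open>k = 2\<close> (the elements of \<open>W\<^sub>0\<^sup>2\<^sup>,\<^sup>2(\<omega>)\<close> are essentially bounded in two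
  dimensions).\<close>

definition H_minus_norm :: "nat \<Rightarrow> (real^2) set \<Rightarrow> (real^2 \<Rightarrow> 'b::euclidean_space) \<Rightarrow> ennreal" where
  "H_minus_norm k \<omega> f =
     (SUP \<phi>\<in>{\<phi> \<in> W2_0 k \<omega>. W2_norm k \<omega> \<phi> \<le> 1}. ennreal \<bar>\<integral>x. f x \<bullet> \<phi> x \<partial>lebesgue_on \<omega>\<bar>)"


section \<open>The functional\<close>

definition hessian :: "(real^2) set \<Rightarrow> (real^2 \<Rightarrow> real) \<Rightarrow> real^2 \<Rightarrow> real^2^2" where
  "hessian \<omega> v x = (\<chi> i j. weak_deriv \<omega> [i, j] v x)"

text \<open>The norm on \<^typ>\<open>real^2^2\<close> is the Frobenius norm.\<close>

definition I0 ::
    "(real^2) set \<Rightarrow> (real^2 \<Rightarrow> real^2^2) \<Rightarrow> (real^2 \<Rightarrow> real^2^2) \<Rightarrow> (real^2 \<Rightarrow> real) \<Rightarrow> ennreal" where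
  "I0 \<omega> B S v =
     ennreal (L2_norm \<omega> (\<lambda>x. hessian \<omega> v x + B x)) ^ 2
     + H_minus_norm 2 \<omega> (\<lambda>x. det (hessian \<omega> v x) + curlT_curl S x) ^ 2"

definition smooth_sym_field :: "(real^2) set \<Rightarrow> (real^2 \<Rightarrow> real^2^2) \<Rightarrow> bool" where
  "smooth_sym_field \<omega> F \<longleftrightarrow>
     smooth_on_closure \<omega> F \<and> (\<forall>x\<in>closure \<omega>. transpose (F x) = F x)"

end

theory Submission
  imports Defs "HOL-Computational_Algebra.Polynomial" "HOL-Complex_Analysis.Riemann_Mapping"
begin

text \<open>
  Lower bound: the rows of a Hessian are curl free, so \<open>curl B = curl (\<nabla>\<^sup>2v + B)\<close> is controlled in
  \<open>H\<^sup>-\<^sup>1\<close> by \<open>\<parallel>\<nabla>\<^sup>2v + B\<parallel>\<close>. The determinant is quadratic and elements of \<open>W\<^sub>0\<^sup>2\<^sup>,\<^sup>2\<close> are bounded, so replacing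
  \<open>det \<nabla>\<^sup>2v\<close> by \<open>det B\<close> changes the \<open>H\<^sup>-\<^sup>2\<close> norm by at most \<open>C (\<parallel>\<nabla>\<^sup>2v + B\<parallel>\<^sup>2 + \<parallel>B\<parallel>\<^sub>\<infinity> \<parallel>\<nabla>\<^sup>2v + B\<parallel>)\<close>.

  Upper bound: it remains to find \<open>v\<close> with \<open>\<parallel>\<nabla>\<^sup>2v + B\<parallel> \<le> C \<parallel>curl B\<parallel>\<close>, the last norm being that of \<open>H\<^sup>-\<^sup>1\<close>. The distance of \<open>-B\<close> from
  the Hessians is the norm of a field \<open>M\<close> which is orthogonal to all Hessians and satisfies
  \<open>\<parallel>M\<parallel>\<^sup>2 = \<integral> M : B\<close>. Extended by zero, \<open>M\<close> has vanishing double divergence in the whole plane, so its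
  mollification has potentials \<open>\<phi>1\<close>, \<open>\<phi>2\<close> with \<open>\<partial>\<^sub>2\<phi>1 = M\<^sub>1\<^sub>1\<close>, \<open>\<partial>\<^sub>1\<phi>2 = - M\<^sub>2\<^sub>2\<close> and
  \<open>\<partial>\<^sub>2\<phi>2 - \<partial>\<^sub>1\<phi>1 = M\<^sub>1\<^sub>2 + M\<^sub>2\<^sub>1\<close>. Their gradients are bounded by \<open>\<parallel>M\<parallel>\<close> (Korn), and they vanish away from
  the closure of \<open>\<omega>\<close> because its complement is connected. A partition of unity whose pieces are
  translated into \<open>\<omega>\<close>, which is possible at a Lipschitz boundary, turns \<open>\<phi>\<close> into a test field. Hence \<open>\<integral> M : B\<close> is
  the pairing of \<open>curl B\<close> with \<open>\<phi>\<close>, up to an arbitrarily small error, and \<open>\<parallel>M\<parallel> \<le> C \<parallel>curl B\<parallel>\<close>.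
\<close>

section \<open>Smooth functions\<close>

text \<open>The projection is onto Hessians of functions that are smooth in the whole plane. This is
  why the residual M, extended by zero, satisfies the double divergence equation across the
  boundary, without any trace of M. The class also contains the reflected kernels from which the
  potentials are built. The potentials vanish only outside a neighbourhood of
  \<open>closure \<omega>\<close>, so they are not admissible test fields yet; the inward
  translations repair this. M is merely square integrable, so every error of mollification and
  translation is put on the continuous field B. Its modulus of continuity depends on B, but it only
  governs how fast the error tends to zero: the bounds on potentials and cutoffs do not depend on
  the mollification or on the shift. Hence the final constant depends on \<omega> alone. All kernels
  are products of functions of one variable with explicit primitives, so that convolution with a
  primitive replaces integration along lines.\<close>

lemma partial_deriv_eq:
  "(f has_derivative f') (at x) \<Longrightarrow> partial_deriv i f x = f' (axis i 1)"
  unfolding partial_deriv_def using frechet_derivative_at by metis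

lemma has_derivative_partial_deriv:
  fixes f :: "real^2 \<Rightarrow> 'b::real_normed_vector"
  assumes "f differentiable (at x)"
  shows "(f has_derivative (\<lambda>h. h $ 1 *\<^sub>R partial_deriv 1 f x + h $ 2 *\<^sub>R partial_deriv 2 f x)) (at x)"
proof -
  let ?D = "frechet_derivative f (at x)"
  have D: "(f has_derivative ?D) (at x)" using assms frechet_derivative_works by blast
  then interpret bounded_linear ?D by (rule has_derivative_bounded_linear)
  have "?D h = h $ 1 *\<^sub>R partial_deriv 1 f x + h $ 2 *\<^sub>R partial_deriv 2 f x" for h
  proof -
    have "h = h $ 1 *\<^sub>R axis 1 1 + h $ 2 *\<^sub>R axis 2 1"
      by (simp add: vec_eq_iff forall_2 axis_def)
    then show ?thesis unfolding partial_deriv_def by (metis add scaleR)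
  qed
  then have "?D = (\<lambda>h. h $ 1 *\<^sub>R partial_deriv 1 f x + h $ 2 *\<^sub>R partial_deriv 2 f x)" by auto
  then show ?thesis using D by simp
qed

text \<open>The recursion peels off the innermost derivative, which suits inductions over products
  and compositions. In the lists used by \<open>smooth_on\<close> the head is the outermost
  derivative, so the two views are matched by splitting lists at the end.\<close>

fun n_smooth :: "nat \<Rightarrow> (real^2 \<Rightarrow> 'b::real_normed_vector) \<Rightarrow> bool" where
  "n_smooth 0 f \<longleftrightarrow> (\<forall>x. f differentiable (at x))"
| "n_smooth (Suc n) f \<longleftrightarrow> (\<forall>x. f differentiable (at x)) \<and> (\<forall>i. n_smooth n (partial_deriv i f))"

lemma partial_derivs_Nil [simp]: "partial_derivs [] f = f"
  and partial_derivs_Cons [simp]: "partial_derivs (i # is) f = partial_deriv i (partial_derivs is f)"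
  and partial_derivs_snoc: "partial_derivs (is @ [i]) f = partial_derivs is (partial_deriv i f)"
  by (simp_all add: partial_derivs_def)

lemma n_smooth_iff:
  "n_smooth n f \<longleftrightarrow> (\<forall>is. length is \<le> n \<longrightarrow> partial_derivs is f differentiable_on UNIV)"
proof (induction n arbitrary: f)
  case 0
  then show ?case by (simp add: differentiable_on_def)
next
  case (Suc n)
  have "(\<forall>is. length is \<le> Suc n \<longrightarrow> partial_derivs is f differentiable_on UNIV) \<longleftrightarrow>
    f differentiable_on UNIV \<and>
    (\<forall>i is. length is \<le> n \<longrightarrow> partial_derivs (is @ [i]) f differentiable_on UNIV)" (is "?L \<longleftrightarrow> ?R")
  proof
    assume L: ?L
    have "f differentiable_on UNIV" using L[rule_format, of "[]"] by simp
    moreover have "partial_derivs (is @ [i]) f differentiable_on UNIV" if "length is \<le> n" for i "is"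
      using L[rule_format, of "is @ [i]"] that by simp
    ultimately show ?R by blast
  next
    assume R: ?R
    show ?L
    proof (intro allI impI)
      fix js :: "2 list" assume "length js \<le> Suc n"
      then show "partial_derivs js f differentiable_on UNIV"
        using R by (cases js rule: rev_cases) auto
    qed
  qed
  then show ?case by (simp add: Suc partial_derivs_snoc differentiable_on_def)
qed

lemma smooth_iff_n_smooth: "smooth_on UNIV f \<longleftrightarrow> (\<forall>n. n_smooth n f)"
  unfolding smooth_on_def n_smooth_iff by blast

lemma n_smooth_differentiable: "n_smooth n f \<Longrightarrow> f differentiable (at x)"
  by (cases n) auto

lemma n_smooth_Suc_imp: "n_smooth (Suc n) f \<Longrightarrow> n_smooth n f"
  by (auto simp: n_smooth_iff simp del: n_smooth.simps)

lemma smooth_differentiable: "smooth_on UNIV f \<Longrightarrow> f differentiable (at x)"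
  unfolding smooth_iff_n_smooth using n_smooth_differentiable by blast

lemma smooth_partial_deriv: "smooth_on UNIV f \<Longrightarrow> smooth_on UNIV (partial_deriv i f)"
  unfolding smooth_iff_n_smooth by (metis n_smooth.simps(2))

lemma smooth_partial_derivs: "smooth_on UNIV f \<Longrightarrow> smooth_on UNIV (partial_derivs is f)"
  by (induction "is") (auto intro: smooth_partial_deriv)

lemma smooth_continuous: "smooth_on UNIV f \<Longrightarrow> continuous_on S f"
  by (meson continuous_at_imp_continuous_on differentiable_imp_continuous_within smooth_differentiable)

lemma smooth_borel: "smooth_on UNIV (f :: real^2 \<Rightarrow> 'b::euclidean_space) \<Longrightarrow> f \<in> borel_measurable borel"
  by (simp add: borel_measurable_continuous_onI smooth_continuous)

lemma partial_deriv_linear: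
  assumes "bounded_linear L" "f differentiable (at x)"
  shows "partial_deriv i (\<lambda>x. L (f x)) x = L (partial_deriv i f x)"
proof -
  have "(f has_derivative frechet_derivative f (at x)) (at x)"
    using assms(2) frechet_derivative_works by blast
  from bounded_linear.has_derivative[OF assms(1) this]
  show ?thesis unfolding partial_deriv_def[of i f] by (rule partial_deriv_eq)
qed

lemma n_smooth_linear: "bounded_linear L \<Longrightarrow> n_smooth n f \<Longrightarrow> n_smooth n (\<lambda>x. L (f x))"
proof (induction n arbitrary: f)
  case 0
  then show ?case by (auto intro: bounded_linear_imp_differentiable differentiable_compose)
next
  case (Suc n)
  have "partial_deriv i (\<lambda>x. L (f x)) = (\<lambda>x. L (partial_deriv i f x))" for i
    using Suc.prems by (intro ext partial_deriv_linear) auto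
  then show ?case using Suc by (auto intro: bounded_linear_imp_differentiable differentiable_compose)
qed

lemma smooth_linear: "bounded_linear L \<Longrightarrow> smooth_on UNIV f \<Longrightarrow> smooth_on UNIV (\<lambda>x. L (f x))"
  by (simp add: smooth_iff_n_smooth n_smooth_linear)

lemma partial_deriv_add:
  assumes "f differentiable (at x)" "g differentiable (at x)"
  shows "partial_deriv i (\<lambda>x. f x + g x) x = partial_deriv i f x + partial_deriv i g x"
  unfolding partial_deriv_def[of i f] partial_deriv_def[of i g]
  by (rule partial_deriv_eq[OF has_derivative_add]) (use assms frechet_derivative_works in blast)+

lemma n_smooth_add: "n_smooth n f \<Longrightarrow> n_smooth n g \<Longrightarrow> n_smooth n (\<lambda>x. f x + g x)"
proof (induction n arbitrary: f g)
  case (Suc n)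
  have "partial_deriv i (\<lambda>x. f x + g x) = (\<lambda>x. partial_deriv i f x + partial_deriv i g x)" for i
    using Suc.prems by (intro ext partial_deriv_add) auto
  then show ?case using Suc by auto
qed auto

lemma smooth_add: "smooth_on UNIV f \<Longrightarrow> smooth_on UNIV g \<Longrightarrow> smooth_on UNIV (\<lambda>x. f x + g x)"
  by (simp add: smooth_iff_n_smooth n_smooth_add)

lemma partial_deriv_const [simp]: "partial_deriv i (\<lambda>x. c) = (\<lambda>x. 0)"
  by (rule ext, rule partial_deriv_eq[of _ "\<lambda>_. 0"]) simp

lemma n_smooth_const: "n_smooth n (\<lambda>x. c)"
  by (induction n arbitrary: c) auto

lemma smooth_const: "smooth_on UNIV (\<lambda>x. c)"
  by (simp add: smooth_iff_n_smooth n_smooth_const)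

lemma smooth_sum:
  "(\<And>k. k \<in> I \<Longrightarrow> smooth_on UNIV (f k)) \<Longrightarrow> smooth_on UNIV (\<lambda>x. \<Sum>k\<in>I. f k x)"
  by (induction I rule: infinite_finite_induct) (auto intro: smooth_add smooth_const)

lemma partial_deriv_sum:
  "finite I \<Longrightarrow> (\<And>k. k \<in> I \<Longrightarrow> f k differentiable (at x)) \<Longrightarrow>
     partial_deriv i (\<lambda>x. \<Sum>k\<in>I. f k x) x = (\<Sum>k\<in>I. partial_deriv i (f k) x)"
  by (induction I rule: finite_induct) (auto simp: partial_deriv_add)

lemma partial_deriv_scaleR:
  fixes f :: "real^2 \<Rightarrow> real"
  assumes "f differentiable (at x)" "g differentiable (at x)"
  shows "partial_deriv i (\<lambda>x. f x *\<^sub>R g x) x = f x *\<^sub>R partial_deriv i g x + partial_deriv i f x *\<^sub>R g x"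
  unfolding partial_deriv_def[of i f] partial_deriv_def[of i g]
  by (rule partial_deriv_eq[OF has_derivative_scaleR]) (use assms frechet_derivative_works in blast)+

lemma n_smooth_scaleR:
  fixes f :: "real^2 \<Rightarrow> real"
  shows "n_smooth n f \<Longrightarrow> n_smooth n g \<Longrightarrow> n_smooth n (\<lambda>x. f x *\<^sub>R g x)"
proof (induction n arbitrary: f g)
  case 0
  then show ?case by (auto intro: differentiable_scaleR)
next
  case (Suc n)
  have "partial_deriv i (\<lambda>x. f x *\<^sub>R g x) =
      (\<lambda>x. f x *\<^sub>R partial_deriv i g x + partial_deriv i f x *\<^sub>R g x)" for i
    using Suc.prems by (intro ext partial_deriv_scaleR) auto
  moreover have "n_smooth n (\<lambda>x. f x *\<^sub>R partial_deriv i g x + partial_deriv i f x *\<^sub>R g x)" for i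
    using Suc.prems n_smooth_Suc_imp[OF Suc.prems(1)] n_smooth_Suc_imp[OF Suc.prems(2)] by (intro n_smooth_add Suc.IH) auto
  ultimately show ?case using Suc.prems by (auto intro: differentiable_scaleR)
qed

lemma smooth_scaleR:
  fixes f :: "real^2 \<Rightarrow> real"
  shows "smooth_on UNIV f \<Longrightarrow> smooth_on UNIV g \<Longrightarrow> smooth_on UNIV (\<lambda>x. f x *\<^sub>R g x)"
  by (simp add: smooth_iff_n_smooth n_smooth_scaleR)

lemma smooth_mult:
  fixes f :: "real^2 \<Rightarrow> real"
  shows "smooth_on UNIV f \<Longrightarrow> smooth_on UNIV g \<Longrightarrow> smooth_on UNIV (\<lambda>x. f x * g x)"
  using smooth_scaleR[of f g] by simp

lemma partial_deriv_mult:
  fixes f :: "real^2 \<Rightarrow> real"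
  assumes "f differentiable (at x)" "g differentiable (at x)"
  shows "partial_deriv i (\<lambda>x. f x * g x) x = f x * partial_deriv i g x + partial_deriv i f x * g x"
  using partial_deriv_scaleR[OF assms, of i] by simp

lemma smooth_uminus: "smooth_on UNIV f \<Longrightarrow> smooth_on UNIV (\<lambda>x. - f x)"
  by (rule smooth_linear[OF bounded_linear_minus[OF bounded_linear_ident]])

lemma partial_deriv_uminus:
  "f differentiable (at x) \<Longrightarrow> partial_deriv i (\<lambda>x. - f x) x = - partial_deriv i f x"
  by (rule partial_deriv_linear[OF bounded_linear_minus[OF bounded_linear_ident]])

lemma smooth_diff: "smooth_on UNIV f \<Longrightarrow> smooth_on UNIV g \<Longrightarrow> smooth_on UNIV (\<lambda>x. f x - g x)"
  using smooth_add[OF _ smooth_uminus] by fastforce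

lemma smooth_cmult: "smooth_on UNIV f \<Longrightarrow> smooth_on UNIV (\<lambda>x. c * f x :: real)"
  by (rule smooth_linear[OF bounded_linear_mult_right])

lemma partial_deriv_cmult:
  "f differentiable (at x) \<Longrightarrow> partial_deriv i (\<lambda>x. c * f x :: real) x = c * partial_deriv i f x"
  by (rule partial_deriv_linear[OF bounded_linear_mult_right])

lemma partial_deriv_affine:
  assumes "f differentiable (at (c *\<^sub>R x + a))"
  shows "partial_deriv i (\<lambda>x. f (c *\<^sub>R x + a)) x = c *\<^sub>R partial_deriv i f (c *\<^sub>R x + a)"
proof -
  let ?D = "frechet_derivative f (at (c *\<^sub>R x + a))"
  have D: "(f has_derivative ?D) (at (c *\<^sub>R x + a))" using assms frechet_derivative_works by blast
  have "((\<lambda>x. c *\<^sub>R x + a) has_derivative (\<lambda>h. c *\<^sub>R h)) (at x)"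
    by (auto intro!: derivative_eq_intros)
  from has_derivative_compose[OF this D]
  have "partial_deriv i (\<lambda>x. f (c *\<^sub>R x + a)) x = ?D (c *\<^sub>R axis i 1)"
    by (rule partial_deriv_eq)
  also have "\<dots> = c *\<^sub>R ?D (axis i 1)"
    using linear_scale[OF has_derivative_linear[OF D]] by simp
  finally show ?thesis by (simp add: partial_deriv_def)
qed

lemma differentiable_affine:
  fixes f :: "real^2 \<Rightarrow> 'b::real_normed_vector"
  assumes "f differentiable (at (c *\<^sub>R x + a))"
  shows "(\<lambda>x. f (c *\<^sub>R x + a)) differentiable (at x)"
proof -
  have "((\<lambda>x. c *\<^sub>R x + a) has_derivative (\<lambda>h. c *\<^sub>R h)) (at x)"
    by (auto intro!: derivative_eq_intros)
  then have "(\<lambda>x. c *\<^sub>R x + a) differentiable (at x)" using differentiable_def by blast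
  then show ?thesis using assms differentiable_chain_at[of "\<lambda>x. c *\<^sub>R x + a" x f]
    by (simp add: o_def)
qed

lemma n_smooth_affine: "n_smooth n f \<Longrightarrow> n_smooth n (\<lambda>x. f (c *\<^sub>R x + a))"
proof (induction n arbitrary: f)
  case (Suc n)
  have "partial_deriv i (\<lambda>x. f (c *\<^sub>R x + a)) = (\<lambda>x. c *\<^sub>R partial_deriv i f (c *\<^sub>R x + a))" for i
    using Suc.prems by (intro ext partial_deriv_affine) auto
  moreover have "n_smooth n (\<lambda>x. c *\<^sub>R partial_deriv i f (c *\<^sub>R x + a))" for i
    using Suc by (intro n_smooth_linear[OF bounded_linear_scaleR_right]) auto
  ultimately show ?case using Suc.prems by (auto intro: differentiable_affine)
qed (auto intro: differentiable_affine)

lemma smooth_affine: "smooth_on UNIV f \<Longrightarrow> smooth_on UNIV (\<lambda>x. f (c *\<^sub>R x + a))"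
  by (simp add: smooth_iff_n_smooth n_smooth_affine)

lemma smooth_translate: "smooth_on UNIV f \<Longrightarrow> smooth_on UNIV (\<lambda>x. f (x - a))"
  using smooth_affine[of f 1 "- a"] by simp

lemma smooth_reflect: "smooth_on UNIV f \<Longrightarrow> smooth_on UNIV (\<lambda>x. f (a - x))"
  using smooth_affine[of f "-1" "a"] by simp

lemma partial_deriv_translate:
  "f differentiable (at (x - a)) \<Longrightarrow> partial_deriv i (\<lambda>x. f (x - a)) x = partial_deriv i f (x - a)"
  using partial_deriv_affine[of f 1 x "- a" i] by simp

lemma partial_deriv_reflect:
  "f differentiable (at (a - x)) \<Longrightarrow> partial_deriv i (\<lambda>x. f (a - x)) x = - partial_deriv i f (a - x)"
  using partial_deriv_affine[of f "-1" x a i] by simp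

lemma smooth_vec2_iff:
  fixes f :: "real^2 \<Rightarrow> real^2"
  shows "smooth_on UNIV f \<longleftrightarrow> (\<forall>j. smooth_on UNIV (\<lambda>x. f x $ j))"
proof
  assume "smooth_on UNIV f"
  then show "\<forall>j. smooth_on UNIV (\<lambda>x. f x $ j)"
    by (auto intro: smooth_linear[OF bounded_linear_vec_nth])
next
  assume *: "\<forall>j. smooth_on UNIV (\<lambda>x. f x $ j)"
  have "smooth_on UNIV (\<lambda>x. f x $ j *\<^sub>R axis j (1::real))" for j :: 2
    using * by (auto intro: smooth_linear[OF bounded_linear_scaleR_left])
  then have "smooth_on UNIV (\<lambda>x. f x $ 1 *\<^sub>R axis 1 1 + f x $ 2 *\<^sub>R axis (2::2) (1::real))"
    by (intro smooth_add) auto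
  moreover have "(\<lambda>x. f x $ 1 *\<^sub>R axis 1 1 + f x $ 2 *\<^sub>R axis (2::2) (1::real)) = f"
    by (auto simp: vec_eq_iff forall_2 axis_def)
  ultimately show "smooth_on UNIV f" by simp
qed

lemma partial_deriv_nth:
  fixes f :: "real^2 \<Rightarrow> ('b::real_normed_vector)^'n"
  shows "f differentiable (at x) \<Longrightarrow> partial_deriv i (\<lambda>x. f x $ j) x = partial_deriv i f x $ j"
  by (rule partial_deriv_linear[OF bounded_linear_vec_nth])

text \<open>Differentiability is irrelevant here: both functions have the same set of derivatives at
  the point, so the choice inside \<open>frechet_derivative\<close> picks the same one.\<close>

lemma partial_deriv_cong:
  assumes "open U" "x \<in> U" "\<And>y. y \<in> U \<Longrightarrow> f y = g y"
  shows "partial_deriv i f x = partial_deriv i g x"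
proof -
  have "(f has_derivative D) (at x) \<longleftrightarrow> (g has_derivative D) (at x)" for D
    using has_derivative_transform_within_open[OF _ assms(1,2), of f D UNIV g]
      has_derivative_transform_within_open[OF _ assms(1,2), of g D UNIV f] assms(3) by auto
  then show ?thesis unfolding partial_deriv_def frechet_derivative_def by simp
qed

lemma partial_deriv_0_open: "open U \<Longrightarrow> x \<in> U \<Longrightarrow> (\<And>y. y \<in> U \<Longrightarrow> f y = 0) \<Longrightarrow> partial_deriv i f x = 0"
  using partial_deriv_cong[of U x f "\<lambda>_. 0" i] by simp

section \<open>Smooth functions of one variable and their tensor products\<close>

fun n_smooth1 :: "nat \<Rightarrow> (real \<Rightarrow> real) \<Rightarrow> bool" where
  "n_smooth1 0 f \<longleftrightarrow> (\<forall>x. f differentiable (at x))"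
| "n_smooth1 (Suc n) f \<longleftrightarrow> (\<forall>x. f differentiable (at x)) \<and> n_smooth1 n (deriv f)"

definition smooth1 :: "(real \<Rightarrow> real) \<Rightarrow> bool" where
  "smooth1 f \<longleftrightarrow> (\<forall>n. n_smooth1 n f)"

lemma n_smooth1_Suc_imp: "n_smooth1 (Suc n) f \<Longrightarrow> n_smooth1 n f"
  by (induction n arbitrary: f) auto

lemma smooth1_deriv: "smooth1 f \<Longrightarrow> smooth1 (deriv f)"
  unfolding smooth1_def by (metis n_smooth1.simps(2))

lemma smooth1_DERIV: "smooth1 f \<Longrightarrow> (f has_real_derivative deriv f x) (at x)"
  unfolding smooth1_def
  by (metis n_smooth1.simps(1) DERIV_deriv_iff_real_differentiable)

text \<open>Read from right to left, this makes primitives of smooth functions smooth; the step and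
  the ramp below are obtained that way.\<close>

lemma smooth1_iff_deriv:
  assumes "\<And>x. (f has_real_derivative g x) (at x)"
  shows "smooth1 f \<longleftrightarrow> smooth1 g"
proof -
  have "deriv f = g" using assms DERIV_imp_deriv by blast
  moreover have "\<forall>x. f differentiable (at x)" using assms real_differentiable_def by blast
  ultimately show ?thesis unfolding smooth1_def
    by (metis n_smooth1.elims(2,3) n_smooth1.simps(2))
qed

lemma deriv_eqI: "(\<And>x. (f has_real_derivative g x) (at x)) \<Longrightarrow> deriv f = g"
  using DERIV_imp_deriv by blast

lemma n_smooth1_add: "n_smooth1 n f \<Longrightarrow> n_smooth1 n g \<Longrightarrow> n_smooth1 n (\<lambda>x. f x + g x)"
proof (induction n arbitrary: f g)
  case (Suc n)
  have "deriv (\<lambda>x. f x + g x) = (\<lambda>x. deriv f x + deriv g x)"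
    using Suc.prems by (intro deriv_eqI DERIV_add) (auto simp: DERIV_deriv_iff_real_differentiable)
  then show ?case using Suc by auto
qed auto

lemma n_smooth1_mult: "n_smooth1 n f \<Longrightarrow> n_smooth1 n g \<Longrightarrow> n_smooth1 n (\<lambda>x. f x * g x)"
proof (induction n arbitrary: f g)
  case (Suc n)
  have "deriv (\<lambda>x. f x * g x) = (\<lambda>x. f x * deriv g x + deriv f x * g x)"
    using Suc.prems by (intro deriv_eqI DERIV_mult') (auto simp: DERIV_deriv_iff_real_differentiable)
  moreover have "n_smooth1 n (\<lambda>x. f x * deriv g x + deriv f x * g x)"
    using Suc.prems n_smooth1_Suc_imp[OF Suc.prems(1)] n_smooth1_Suc_imp[OF Suc.prems(2)] by (intro n_smooth1_add Suc.IH) auto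
  ultimately show ?case using Suc.prems by auto
qed auto

lemma n_smooth1_const: "n_smooth1 n (\<lambda>x. c)"
proof (induction n arbitrary: c)
  case (Suc n)
  have "deriv (\<lambda>x::real. c) = (\<lambda>x. 0)" by (intro deriv_eqI) simp
  then show ?case using Suc by auto
qed auto

lemma n_smooth1_affine: "n_smooth1 n f \<Longrightarrow> n_smooth1 n (\<lambda>x. f (c * x + a))"
proof (induction n arbitrary: f)
  case 0
  have "(\<lambda>x. c * x + a) differentiable (at x)" for x :: real by (auto intro!: derivative_intros)
  with 0 show ?case using differentiable_chain_at[of "\<lambda>x. c * x + a" _ f] by (auto simp: o_def)
next
  case (Suc n)
  have d: "((\<lambda>x. f (c * x + a)) has_real_derivative c * deriv f (c * x + a)) (at x)" for x
  proof -
    have "(f has_real_derivative deriv f (c * x + a)) (at (c * x + a))"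
      using Suc.prems by (auto simp: DERIV_deriv_iff_real_differentiable)
    moreover have "((\<lambda>x. c * x + a) has_real_derivative c) (at x)" by (auto intro!: derivative_eq_intros)
    ultimately have "((\<lambda>x. f (c * x + a)) has_real_derivative deriv f (c * x + a) * c) (at x)"
      by (rule DERIV_chain2)
    then show ?thesis by (simp only: mult.commute)
  qed
  have "n_smooth1 n (\<lambda>x. c * deriv f (c * x + a))"
    using Suc by (intro n_smooth1_mult n_smooth1_const) auto
  moreover have "deriv (\<lambda>x. f (c * x + a)) = (\<lambda>x. c * deriv f (c * x + a))"
    using d by (rule deriv_eqI)
  ultimately show ?case using d real_differentiable_def by auto
qed

lemma smooth1_mult: "smooth1 f \<Longrightarrow> smooth1 g \<Longrightarrow> smooth1 (\<lambda>x. f x * g x)"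
  and smooth1_const: "smooth1 (\<lambda>x. c)"
  and smooth1_affine: "smooth1 f \<Longrightarrow> smooth1 (\<lambda>x. f (c * x + a))"
  by (auto simp: smooth1_def n_smooth1_mult n_smooth1_const n_smooth1_affine)

text \<open>Every kernel of the development has this product form: a partial derivative acts on one
  factor only, and mixed derivatives commute for trivial reasons.\<close>

definition tens :: "(real \<Rightarrow> real) \<Rightarrow> (real \<Rightarrow> real) \<Rightarrow> real^2 \<Rightarrow> real" where
  "tens u v x = u (x $ 1) * v (x $ 2)"

lemma has_derivative_tens:
  assumes "(u has_real_derivative u') (at (x $ 1))" "(v has_real_derivative v') (at (x $ 2))"
  shows "(tens u v has_derivative (\<lambda>h. u (x $ 1) * (v' * h $ 2) + u' * h $ 1 * v (x $ 2))) (at x)"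
proof -
  have n: "((\<lambda>x. x $ j) has_derivative (\<lambda>h. h $ j)) (at x)" for j
    by (rule bounded_linear.has_derivative[OF bounded_linear_vec_nth has_derivative_ident])
  have "((\<lambda>x. u (x $ 1)) has_derivative (\<lambda>h. u' * h $ 1)) (at x)"
    using has_derivative_compose[OF n[of 1] assms(1)[unfolded has_field_derivative_def]] by simp
  moreover have "((\<lambda>x. v (x $ 2)) has_derivative (\<lambda>h. v' * h $ 2)) (at x)"
    using has_derivative_compose[OF n[of 2] assms(2)[unfolded has_field_derivative_def]] by simp
  ultimately show ?thesis
    unfolding tens_def[abs_def] by (rule has_derivative_mult)
qed

lemma n_smooth_tens: "n_smooth1 n u \<Longrightarrow> n_smooth1 n v \<Longrightarrow> n_smooth n (tens u v)"
  and partial_deriv_tens: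
    "(\<And>x. u differentiable (at x)) \<Longrightarrow> (\<And>x. v differentiable (at x)) \<Longrightarrow> partial_deriv 1 (tens u v) = tens (deriv u) v"
    "(\<And>x. u differentiable (at x)) \<Longrightarrow> (\<And>x. v differentiable (at x)) \<Longrightarrow> partial_deriv 2 (tens u v) = tens u (deriv v)"
proof -
  have D: "(tens u v has_derivative (\<lambda>h. u (x $ 1) * (deriv v (x $ 2) * h $ 2) + deriv u (x $ 1) * h $ 1 * v (x $ 2))) (at x)"
    if "\<And>x. u differentiable (at x)" "\<And>x. v differentiable (at x)" for u v x
    by (rule has_derivative_tens) (simp_all add: DERIV_deriv_iff_real_differentiable that)
  show p1: "partial_deriv 1 (tens u v) = tens (deriv u) v"
    if "\<And>x. u differentiable (at x)" "\<And>x. v differentiable (at x)" for u v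
    by (rule ext) (simp add: partial_deriv_eq[OF D[OF that]] axis_def tens_def)
  show p2: "partial_deriv 2 (tens u v) = tens u (deriv v)"
    if "\<And>x. u differentiable (at x)" "\<And>x. v differentiable (at x)" for u v
    by (rule ext) (simp add: partial_deriv_eq[OF D[OF that]] axis_def tens_def)
  show "n_smooth1 n u \<Longrightarrow> n_smooth1 n v \<Longrightarrow> n_smooth n (tens u v)"
  proof (induction n arbitrary: u v)
    case 0
    then show ?case using D[of u v] unfolding n_smooth.simps n_smooth1.simps differentiable_def[of "tens u v"] by blast
  next
    case (Suc n)
    then have "n_smooth1 n (deriv u)" "n_smooth1 n u" "n_smooth1 n (deriv v)" "n_smooth1 n v"
      using n_smooth1_Suc_imp by auto
    moreover have "tens u v differentiable (at x)" for x
      using D[of u v] Suc.prems unfolding n_smooth1.simps differentiable_def[of "tens u v"] by blast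
    ultimately show ?case using Suc by (auto simp: forall_2 p1 p2)
  qed
qed

lemma smooth_tens: "smooth1 u \<Longrightarrow> smooth1 v \<Longrightarrow> smooth_on UNIV (tens u v)"
  by (simp add: smooth1_def smooth_iff_n_smooth n_smooth_tens)

lemma smooth_tens_derivs:
  assumes "smooth1 u" "smooth1 v"
  shows "partial_deriv 1 (tens u v) = tens (deriv u) v" "partial_deriv 2 (tens u v) = tens u (deriv v)"
  by (intro partial_deriv_tens; use assms smooth1_DERIV real_differentiable_def in blast)+

text \<open>Splitting off the constant coefficient leaves the same expression with a higher power in
  front, so the power has to stay free in the induction.\<close>

lemma poly_exp_tendsto_0: "((\<lambda>s. s ^ k * poly p s * exp (- s)) \<longlongrightarrow> 0) at_top" for p :: "real poly"
proof (induction p arbitrary: k)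
  case 0
  then show ?case by simp
next
  case (pCons a p)
  have "((\<lambda>s. a * (s ^ k / exp s) + s ^ Suc k * poly p s * exp (- s)) \<longlongrightarrow> a * 0 + 0) at_top"
    by (intro tendsto_intros tendsto_power_div_exp_0 pCons)
  then show ?case by (simp add: exp_minus divide_simps algebra_simps)
qed

section \<open>A smooth step function\<close>

text \<open>The classical function exp(-1/t) with a polynomial in 1/t as prefactor. The family is
  closed under differentiation: with s = 1/t the prefactor p turns into the square of s times (p -
  p'), so smoothness follows by induction on the order.\<close>

definition flat :: "real poly \<Rightarrow> real \<Rightarrow> real" where
  "flat p t = (if 0 < t then poly p (1 / t) * exp (- (1 / t)) else 0)"

lemma DERIV_flat: "(flat p has_real_derivative flat ([:0, 0, 1:] * (p - pderiv p)) t) (at t)"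
proof -
  consider "t < 0" | "t > 0" | "t = 0" by linarith
  then show ?thesis
  proof cases
    case 1
    then have "((\<lambda>_. 0) has_real_derivative 0) (at t)" by simp
    then have "(flat p has_real_derivative 0) (at t)"
      by (rule has_field_derivative_transform_within_open[of _ _ _ "{..<0}"]) (use 1 in \<open>auto simp: flat_def\<close>)
    then show ?thesis using 1 by (simp add: flat_def)
  next
    case 2
    have "((\<lambda>t. poly p (1 / t) * exp (- (1 / t))) has_real_derivative
        poly p (1/t) * (exp (- (1/t)) * (1 / t^2)) + poly (pderiv p) (1 / t) * (- (1 / t^2)) * exp (- (1/t))) (at t)"
      using 2 by (auto intro!: derivative_eq_intros DERIV_chain2[OF poly_DERIV] simp: power2_eq_square)
    then have "(flat p has_real_derivative
        poly p (1/t) * (exp (- (1/t)) * (1 / t^2)) + poly (pderiv p) (1 / t) * (- (1 / t^2)) * exp (- (1/t))) (at t)"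
      by (rule has_field_derivative_transform_within_open[of _ _ _ "{0<..}"]) (use 2 in \<open>auto simp: flat_def\<close>)
    moreover have "poly p (1/t) * (exp (- (1/t)) * (1 / t^2)) + poly (pderiv p) (1 / t) * (- (1 / t^2)) * exp (- (1/t))
       = flat ([:0, 0, 1:] * (p - pderiv p)) t"
      using 2 by (simp add: flat_def power2_eq_square algebra_simps)
    ultimately show ?thesis by simp
  next
    case 3
    \<comment> \<open>The substitution s = 1/h turns the difference quotient at 0 into s times a
      polynomial in s times exp(-s).\<close>
    have "((\<lambda>h. flat p h / h) \<longlongrightarrow> 0) (at_right 0)"
    proof -
      have "((\<lambda>h. (inverse h) ^ 1 * poly p (inverse h) * exp (- inverse h)) \<longlongrightarrow> 0) (at_right (0::real))"
        by (rule filterlim_compose[OF poly_exp_tendsto_0 filterlim_inverse_at_top_right])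
      moreover have "\<forall>\<^sub>F h in at_right 0. (inverse h) ^ 1 * poly p (inverse h) * exp (- inverse h) = flat p h / h"
        by (auto simp: eventually_at_right_field flat_def divide_inverse intro!: exI[of _ 1])
      ultimately show ?thesis by (rule Lim_transform_eventually)
    qed
    moreover have "((\<lambda>h. flat p h / h) \<longlongrightarrow> 0) (at_left 0)"
    proof -
      have "\<forall>\<^sub>F h in at_left 0. 0 = flat p h / h"
        by (auto simp: eventually_at_left_field flat_def intro!: exI[of _ "-1"])
      then show ?thesis by (rule Lim_transform_eventually[OF tendsto_const])
    qed
    ultimately have "((\<lambda>h. flat p h / h) \<longlongrightarrow> 0) (at 0)"
      using filterlim_split_at by blast
    then have "(flat p has_real_derivative 0) (at 0)"
      by (simp add: DERIV_def flat_def)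
    then show ?thesis using 3 by (simp add: flat_def)
  qed
qed

lemma smooth1_flat: "smooth1 (flat p)"
proof -
  have "n_smooth1 n (flat p)" for n
  proof (induction n arbitrary: p)
    case 0
    then show ?case using DERIV_flat real_differentiable_def by auto
  next
    case (Suc n)
    then show ?case using DERIV_flat real_differentiable_def by (auto simp: deriv_eqI[OF DERIV_flat])
  qed
  then show ?thesis by (simp add: smooth1_def)
qed

lemma antiderivative_exists:
  assumes "continuous_on UNIV (f :: real \<Rightarrow> real)"
  obtains F where "\<And>x. (F has_real_derivative f x) (at x)" "F c = 0"
proof -
  obtain F where "\<forall>x :: real. -\<infinity> < ereal x \<longrightarrow> ereal x < \<infinity> \<longrightarrow> (F has_vector_derivative f x) (at x)"
    using einterval_antiderivative[of "-\<infinity>" "\<infinity>" f] assms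
    by (auto simp: continuous_on_eq_continuous_at)
  then have "\<And>x. (F has_real_derivative f x) (at x)"
    by (simp add: has_real_derivative_iff_has_vector_derivative)
  then have "\<And>x. ((\<lambda>x. F x - F c) has_real_derivative f x) (at x)"
    by (auto intro!: derivative_eq_intros)
  then show ?thesis using that by force
qed

lemma mono_of_deriv_nonneg:
  fixes F :: "real \<Rightarrow> real"
  assumes "\<And>x. (F has_real_derivative f x) (at x)" "\<And>x. a < x \<Longrightarrow> x < b \<Longrightarrow> 0 \<le> f x" "a \<le> b"
  shows "F a \<le> F b"
proof (rule DERIV_nonneg_imp_increasing_open[OF assms(3)])
  show "\<And>x. a < x \<Longrightarrow> x < b \<Longrightarrow> \<exists>y. (F has_real_derivative y) (at x) \<and> 0 \<le> y" using assms by blast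
  show "continuous_on {a..b} F" by (auto intro!: continuous_at_imp_continuous_on DERIV_isCont[OF assms(1)])
qed

lemma const_of_deriv_0:
  fixes F :: "real \<Rightarrow> real"
  assumes "\<And>x. (F has_real_derivative f x) (at x)" "\<And>x. a < x \<Longrightarrow> x < b \<Longrightarrow> f x = 0" "a \<le> b"
  shows "F a = F b"
proof (rule antisym)
  show "F a \<le> F b" by (rule mono_of_deriv_nonneg[OF assms(1)]) (use assms in auto)
  have "- F a \<le> - F b"
    by (rule mono_of_deriv_nonneg[of "\<lambda>x. - F x" "\<lambda>x. - f x"]) (use assms in \<open>auto intro: DERIV_minus\<close>)
  then show "F b \<le> F a" by simp
qed

lemma smooth1_continuous: "smooth1 f \<Longrightarrow> continuous_on S f"
  by (auto intro!: continuous_at_imp_continuous_on DERIV_isCont[OF smooth1_DERIV])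

text \<open>A nonnegative bump on the interval from -1 to 1 is integrated twice, starting at -1 each
  time.\<close>

lemma ramp_exists:
  "\<exists>q. smooth1 q \<and> (\<forall>t\<le>-1. q t = 0) \<and> (\<forall>t\<ge>1. deriv q t = 1) \<and>
     (\<forall>t. 0 \<le> deriv (deriv q) t) \<and> 0 < deriv (deriv q) 0"
proof -
  \<comment> \<open>Positive exactly for t strictly between -1 and 1.\<close>
  define r0 where "r0 = (\<lambda>t. flat 1 (1 * t + 1) * flat 1 ((-1) * t + 1))"
  have r0: "smooth1 r0" unfolding r0_def by (intro smooth1_mult smooth1_affine smooth1_flat)
  have r0_nonneg: "0 \<le> r0 t" for t by (simp add: r0_def flat_def)
  have r0_pos: "0 < r0 t" if "-1 < t" "t < 1" for t using that by (simp add: r0_def flat_def)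
  have r0_0: "r0 t = 0" if "t \<le> -1 \<or> 1 \<le> t" for t using that by (auto simp: r0_def flat_def)
  obtain p0 where p0: "\<And>x. (p0 has_real_derivative r0 x) (at x)" "p0 (-1) = 0"
    using antiderivative_exists[OF smooth1_continuous[OF r0]] by blast
  \<comment> \<open>The total integral of \<open>r0\<close>; dividing by it makes the step reach
    exactly 1.\<close>
  define m where "m = p0 1"
  have "p0 (-1) < p0 1"
  proof (rule DERIV_pos_imp_increasing_open[of "-1" 1 p0])
    show "continuous_on {-1..1} p0" by (auto intro!: continuous_at_imp_continuous_on DERIV_isCont[OF p0(1)])
  qed (use p0 r0_pos in \<open>auto intro: exI\<close>)
  then have m: "0 < m" using p0 m_def by simp
  define p where "p = (\<lambda>t. (1 / m) * p0 t)"
  have dp: "(p has_real_derivative (1 / m) * r0 x) (at x)" for x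
    unfolding p_def by (rule DERIV_cmult[OF p0(1)])
  have "smooth1 (\<lambda>t. (1 / m) * r0 t)" by (intro smooth1_mult smooth1_const r0)
  then have p: "smooth1 p" using smooth1_iff_deriv[of p "\<lambda>t. (1 / m) * r0 t"] dp by blast
  have p_lo: "p t = 0" if "t \<le> -1" for t
    using const_of_deriv_0[OF dp, of t "-1"] that r0_0 p0(2) by (simp add: p_def)
  have p_hi: "p t = 1" if "1 \<le> t" for t
    using const_of_deriv_0[OF dp, of 1 t] that r0_0 m by (simp add: p_def m_def)
  obtain q where q: "\<And>x. (q has_real_derivative p x) (at x)" "q (-1) = 0"
    using antiderivative_exists[OF smooth1_continuous[OF p]] by blast
  have "q t = 0" if "t \<le> -1" for t
    using const_of_deriv_0[OF q(1), of t "-1"] that p_lo q(2) by simp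
  moreover have "deriv q = p" using q(1) by (rule deriv_eqI)
  moreover have "deriv p = (\<lambda>t. (1 / m) * r0 t)" using dp by (rule deriv_eqI)
  moreover have "smooth1 q" using smooth1_iff_deriv q(1) p by blast
  ultimately show ?thesis using p_hi m r0_nonneg r0_pos[of 0]
    by (intro exI[of _ q]) auto
qed

text \<open>A primitive of a step function is needed because the kernel \<open>kern\<close> below is the second
  derivative in the vertical direction of a function that vanishes in a lower half plane.\<close>

definition ramp :: "real \<Rightarrow> real" where
  "ramp = (SOME q. smooth1 q \<and> (\<forall>t\<le>-1. q t = 0) \<and> (\<forall>t\<ge>1. deriv q t = 1) \<and>
     (\<forall>t. 0 \<le> deriv (deriv q) t) \<and> 0 < deriv (deriv q) 0)"

definition step :: "real \<Rightarrow> real" where "step = deriv ramp"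
definition bump :: "real \<Rightarrow> real" where "bump = deriv step"

lemma ramp_props:
  shows smooth_ramp: "smooth1 ramp" and ramp_0: "t \<le> -1 \<Longrightarrow> ramp t = 0"
    and step_1: "1 \<le> t \<Longrightarrow> step t = 1" and bump_nonneg: "0 \<le> bump t" and bump_pos: "0 < bump 0"
  using someI_ex[OF ramp_exists] unfolding ramp_def[symmetric] step_def bump_def by auto

lemma smooth_step: "smooth1 step" and smooth_bump: "smooth1 bump"
  using smooth1_deriv smooth_ramp unfolding bump_def step_def by auto

text \<open>Left of -1 the function vanishes on an open set. At -1 itself this argument breaks down,
  and continuity of the derivative takes over.\<close>

lemma deriv_lo_0:
  assumes "smooth1 f" "\<And>t. t \<le> -1 \<Longrightarrow> f t = 0" "t \<le> -1"
  shows "deriv f t = 0"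
proof -
  have "deriv f t = 0" if "t < -1" for t
  proof -
    have "((\<lambda>_. 0) has_real_derivative 0) (at t)" by simp
    then have "(f has_real_derivative 0) (at t)"
      by (rule has_field_derivative_transform_within_open[of _ _ _ "{..<-1}"]) (use that assms in auto)
    then show ?thesis by (rule DERIV_imp_deriv)
  qed
  moreover have "deriv f (-1) = 0"
  proof -
    have "isCont (deriv f) (-1)" using smooth1_DERIV[OF smooth1_deriv[OF assms(1)]] DERIV_isCont by blast
    then have "(deriv f \<longlongrightarrow> deriv f (-1)) (at_left (-1))"
      by (simp add: isCont_def filterlim_at_split)
    moreover have "(deriv f \<longlongrightarrow> 0) (at_left (-1))"
    proof -
      have "\<forall>\<^sub>F h in at_left (-1). 0 = deriv f h"
        using calculation \<open>\<And>t. t < -1 \<Longrightarrow> deriv f t = 0\<close> by (auto simp: eventually_at_left_field intro!: exI[of _ "-2"])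
      then show ?thesis by (rule Lim_transform_eventually[OF tendsto_const])
    qed
    ultimately show ?thesis using tendsto_unique trivial_limit_at_left_real by blast
  qed
  ultimately show ?thesis using assms(3) by (cases "t = -1") auto
qed

lemma step_0: "t \<le> -1 \<Longrightarrow> step t = 0"
  unfolding step_def using deriv_lo_0[OF smooth_ramp ramp_0] by simp

lemma bump_lo: "t \<le> -1 \<Longrightarrow> bump t = 0"
  unfolding bump_def using deriv_lo_0[OF smooth_step step_0] by simp

lemma DERIV_step: "(step has_real_derivative bump x) (at x)"
  unfolding bump_def by (rule smooth1_DERIV[OF smooth_step])

lemma step_bounds: "0 \<le> step t" "step t \<le> 1"
proof -
  have "step (min t (-1)) \<le> step t"
    by (rule mono_of_deriv_nonneg[OF DERIV_step]) (auto simp: bump_nonneg)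
  then show "0 \<le> step t" using step_0 by simp
  have "step t \<le> step (max t 1)"
    by (rule mono_of_deriv_nonneg[OF DERIV_step]) (auto simp: bump_nonneg)
  then show "step t \<le> 1" using step_1 by simp
qed

text \<open>Reflection: 1 - step(-t) vanishes for t at most -1 and has derivative bump(-t), so the
  statement about the left end applies.\<close>

lemma bump_hi:
  assumes "1 \<le> t" shows "bump t = 0"
proof -
  have d: "((\<lambda>t. 1 - step (- t)) has_real_derivative bump (- t)) (at t)" for t
    by (auto intro!: derivative_eq_intros DERIV_chain2[OF DERIV_step])
  have b: "smooth1 (\<lambda>t. bump ((-1) * t + 0))" by (intro smooth1_affine smooth_bump)
  have "smooth1 (\<lambda>t. 1 - step (- t))" using smooth1_iff_deriv[of "\<lambda>t. 1 - step (- t)" "\<lambda>t. bump (- t)"] d b by simp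
  then have "deriv (\<lambda>t. 1 - step (- t)) (- t) = 0"
    by (rule deriv_lo_0) (use step_1 assms in auto)
  then show ?thesis using DERIV_imp_deriv[OF d, of "- t"] by simp
qed

section \<open>Integration by parts and convolution\<close>

lemma integrable_bounded_support:
  fixes f :: "'a::euclidean_space \<Rightarrow> 'b::euclidean_space"
  assumes [measurable]: "f \<in> borel_measurable borel" and C: "\<And>x. norm (f x) \<le> C"
    and R: "\<And>x. R < norm x \<Longrightarrow> f x = 0"
  shows "integrable lborel f"
proof (rule Bochner_Integration.integrable_bound)
  show "integrable lborel (\<lambda>x::'a. indicator (cball 0 R) x *\<^sub>R C)"
    using emeasure_bounded_finite[OF bounded_cball, of "0::'a"] by (simp add: integrable_indicator_iff)
  show "AE x in lborel. norm (f x) \<le> norm (indicator (cball 0 R) x *\<^sub>R C)"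
    using C R order_trans[OF norm_ge_zero C] by (auto simp: indicator_def split: if_splits)
qed simp

lemma continuous_bounded_support:
  fixes f :: "'a::euclidean_space \<Rightarrow> 'b::euclidean_space"
  assumes f: "continuous_on UNIV f" and R: "\<And>x. R < norm x \<Longrightarrow> f x = 0"
  obtains C where "0 < C" "\<And>x. norm (f x) \<le> C"
proof -
  have "compact (f ` cball 0 R)"
    using f by (intro compact_continuous_image continuous_on_subset[OF f]) auto
  then obtain C where C: "0 < C" "\<And>y. y \<in> f ` cball 0 R \<Longrightarrow> norm y \<le> C"
    using bounded_pos compact_imp_bounded by metis
  have "norm (f x) \<le> C" for x
    using C R[of x] by (cases "R < norm x") auto
  then show ?thesis using that C(1) by blast
qed

lemma integrable_continuous_support:
  fixes f :: "'a::euclidean_space \<Rightarrow> 'b::euclidean_space"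
  assumes "continuous_on UNIV f" "\<And>x. R < norm x \<Longrightarrow> f x = 0"
  shows "integrable lborel f"
  using continuous_bounded_support[OF assms] integrable_bounded_support[OF borel_measurable_continuous_onI[OF assms(1)] _ assms(2)]
  by metis

lemma integral_lebesgue_on:
  fixes f :: "'a::euclidean_space \<Rightarrow> 'b::euclidean_space"
  assumes "S \<in> sets borel" "f \<in> borel_measurable borel"
  shows "integrable (lebesgue_on S) f \<longleftrightarrow> integrable lborel (\<lambda>x. indicator S x *\<^sub>R f x)"
    and "integral\<^sup>L (lebesgue_on S) f = (\<integral>x. indicator S x *\<^sub>R f x \<partial>lborel)"
proof -
  have S: "S \<inter> space lebesgue \<in> sets lebesgue" using assms(1) by simp
  have m: "(\<lambda>x. indicator S x *\<^sub>R f x) \<in> borel_measurable lborel" using assms by simp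
  show "integrable (lebesgue_on S) f \<longleftrightarrow> integrable lborel (\<lambda>x. indicator S x *\<^sub>R f x)"
    unfolding integrable_restrict_space[OF S] by (rule integrable_completion[OF m])
  show "integral\<^sup>L (lebesgue_on S) f = (\<integral>x. indicator S x *\<^sub>R f x \<partial>lborel)"
    unfolding integral_restrict_space[OF S] by (rule integral_completion[OF m])
qed

lemma lborel_integral_translate:
  fixes f :: "'a::euclidean_space \<Rightarrow> 'b::euclidean_space"
  assumes [measurable]: "f \<in> borel_measurable borel"
  shows "(\<integral>x. f (a + x) \<partial>lborel) = (\<integral>x. f x \<partial>lborel)"
    and "integrable lborel (\<lambda>x. f (a + x)) \<longleftrightarrow> integrable lborel f"
proof -
  have "(\<integral>x. f x \<partial>distr lborel borel ((+) a)) = (\<integral>x. f (a + x) \<partial>lborel)"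
    by (rule integral_distr) auto
  then show "(\<integral>x. f (a + x) \<partial>lborel) = (\<integral>x. f x \<partial>lborel)" by (simp add: lborel_distr_plus)
  have "integrable (distr lborel borel ((+) a)) f \<longleftrightarrow> integrable lborel (\<lambda>x. f (a + x))"
    by (rule integrable_distr_eq) auto
  then show "integrable lborel (\<lambda>x. f (a + x)) \<longleftrightarrow> integrable lborel f" by (simp add: lborel_distr_plus)
qed

lemma lborel_integral_reflect:
  fixes f :: "'a::euclidean_space \<Rightarrow> 'b::euclidean_space"
  assumes [measurable]: "f \<in> borel_measurable borel"
  shows "(\<integral>x. f (a - x) \<partial>lborel) = (\<integral>x. f x \<partial>lborel)"
    and "integrable lborel (\<lambda>x. f (a - x)) \<longleftrightarrow> integrable lborel f"
proof -
  have eq: "distr lborel borel (\<lambda>x. a - x) = (lborel :: 'a measure)"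
  proof -
    have "lborel = density (distr lborel borel (\<lambda>x. a + (-1) *\<^sub>R x)) (\<lambda>_. ennreal (\<bar>-1\<bar> ^ DIM('a)))"
      by (rule lborel_affine) simp
    then show ?thesis by (simp add: density_1)
  qed
  have "(\<integral>x. f x \<partial>distr lborel borel (\<lambda>x. a - x)) = (\<integral>x. f (a - x) \<partial>lborel)"
    by (rule integral_distr) auto
  then show "(\<integral>x. f (a - x) \<partial>lborel) = (\<integral>x. f x \<partial>lborel)" by (simp add: eq)
  have "integrable (distr lborel borel (\<lambda>x. a - x)) f \<longleftrightarrow> integrable lborel (\<lambda>x. f (a - x))"
    by (rule integrable_distr_eq) auto
  then show "integrable lborel (\<lambda>x. f (a - x)) \<longleftrightarrow> integrable lborel f" by (simp add: eq)
qed

lemma partial_deriv_DERIV: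
  fixes f :: "real^2 \<Rightarrow> real"
  assumes "\<And>x. f differentiable (at x)"
  shows "((\<lambda>t. f (x + t *\<^sub>R axis i 1)) has_real_derivative partial_deriv i f (x + t *\<^sub>R axis i 1)) (at t)"
proof -
  let ?y = "x + t *\<^sub>R axis i 1" let ?D = "frechet_derivative f (at ?y)"
  have D: "(f has_derivative ?D) (at ?y)" using assms frechet_derivative_works by blast
  have "((\<lambda>t. x + t *\<^sub>R axis i 1) has_derivative (\<lambda>s. s *\<^sub>R axis i 1)) (at t)"
    by (auto intro!: derivative_eq_intros)
  from has_derivative_compose[OF this D]
  have "((\<lambda>t. f (x + t *\<^sub>R axis i 1)) has_derivative (\<lambda>s. ?D (s *\<^sub>R axis i 1))) (at t)" .
  moreover have "?D (s *\<^sub>R axis i 1) = partial_deriv i f ?y * s" for s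
    using linear_scale[OF has_derivative_linear[OF D]] by (simp add: partial_deriv_def)
  ultimately show ?thesis by (simp add: has_field_derivative_def)
qed

text \<open>Difference quotients have integral zero by translation invariance, and they converge
  dominatedly to the derivative. Only a bounded derivative is assumed, not a continuous one, because
  the lemma is also applied to products with fields that are differentiable merely inside the
  domain. Measurability of the derivative comes from the same limit.\<close>

lemma integral_partial_deriv_eq_0:
  fixes f :: "real^2 \<Rightarrow> real"
  assumes d: "\<And>x. f differentiable (at x)" and C: "\<And>x. \<bar>partial_deriv i f x\<bar> \<le> C"
    and R: "\<And>x. R < norm x \<Longrightarrow> f x = 0"
  shows "integrable lborel (partial_deriv i f)" and "(\<integral>x. partial_deriv i f x \<partial>lborel) = 0"
proof -
  let ?e = "axis i 1 :: real^2"
  have cf: "continuous_on UNIV f"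
    using d by (simp add: continuous_at_imp_continuous_on differentiable_imp_continuous_within)
  then have f_borel [measurable]: "f \<in> borel_measurable borel" by (rule borel_measurable_continuous_onI)
  \<comment> \<open>Steps of length at most 1 keep a point of norm larger than R + 1 outside the
    ball of radius R, so the quotients have a common bounded support.\<close>
  define h where "h n = 1 / real (Suc n)" for n
  have h: "0 < h n" "h n \<le> 1" for n by (auto simp: h_def divide_simps)
  define g where "g n x = (f (h n *\<^sub>R ?e + x) - f x) / h n" for n x
  have g_borel: "g n \<in> borel_measurable borel" for n unfolding g_def[abs_def] by measurable
  have int_f: "integrable lborel f" by (rule integrable_continuous_support[OF cf R])
  have int_g: "(\<integral>x. g n x \<partial>lborel) = 0" for n
  proof -
    have "integrable lborel (\<lambda>x. f (h n *\<^sub>R ?e + x))" using int_f lborel_integral_translate(2)[OF f_borel] by blast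
    then show ?thesis unfolding g_def
      using int_f lborel_integral_translate(1)[OF f_borel, of "h n *\<^sub>R ?e"] by simp
  qed
  have lim: "(\<lambda>n. g n x) \<longlonglongrightarrow> partial_deriv i f x" for x
  proof -
    have "((\<lambda>t. (f (x + t *\<^sub>R ?e) - f x) / t) \<longlongrightarrow> partial_deriv i f x) (at 0)"
      using partial_deriv_DERIV[OF d, of x i 0] by (simp add: DERIV_def)
    moreover have "filterlim h (at 0) sequentially"
      using h LIMSEQ_Suc[OF lim_1_over_n] unfolding h_def[abs_def] filterlim_at by (auto simp: less_imp_neq)
    ultimately show ?thesis using filterlim_compose unfolding g_def by (fastforce simp: add.commute)
  qed
  have bnd: "norm (g n x) \<le> indicator (cball 0 (R + 1)) x *\<^sub>R C" for n x
  proof (cases "x \<in> cball 0 (R + 1)")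
    case True
    obtain t where "0 < t" "t < h n" "f (x + h n *\<^sub>R ?e) - f (x + 0 *\<^sub>R ?e) = (h n - 0) * partial_deriv i f (x + t *\<^sub>R ?e)"
      using MVT2[OF h(1)[of n], of "\<lambda>t. f (x + t *\<^sub>R ?e)" "\<lambda>t. partial_deriv i f (x + t *\<^sub>R ?e)"]
        partial_deriv_DERIV[OF d] by auto
    then have "g n x = partial_deriv i f (x + t *\<^sub>R ?e)" using h(1)[of n] by (simp add: g_def add.commute)
    then show ?thesis using C True by simp
  next
    case False
    then have x: "R + 1 < norm x" by auto
    have "norm x \<le> norm (h n *\<^sub>R ?e + x) + norm (h n *\<^sub>R ?e)"
      using norm_triangle_ineq4[of "h n *\<^sub>R ?e + x" "h n *\<^sub>R ?e"] by simp
    then have "R < norm (h n *\<^sub>R ?e + x)" using x h[of n] by simp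
    then show ?thesis using R x by (simp add: g_def False)
  qed
  have w: "integrable lborel (\<lambda>x::real^2. indicator (cball 0 (R + 1)) x *\<^sub>R C)"
    using emeasure_bounded_finite[OF bounded_cball, of "0::real^2"] by (simp add: integrable_indicator_iff)
  have m: "partial_deriv i f \<in> borel_measurable lborel"
    by (rule borel_measurable_LIMSEQ_real[where u = g]) (use lim g_borel in auto)
  show "integrable lborel (partial_deriv i f)"
    by (rule integrable_dominated_convergence[OF m _ w, where s = g]) (use lim bnd g_borel in auto)
  have "(\<lambda>n. \<integral>x. g n x \<partial>lborel) \<longlonglongrightarrow> (\<integral>x. partial_deriv i f x \<partial>lborel)"
    by (rule integral_dominated_convergence[OF m _ w, where s = g]) (use lim bnd g_borel in auto)
  then show "(\<integral>x. partial_deriv i f x \<partial>lborel) = 0" by (simp add: int_g LIMSEQ_const_iff)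
qed

lemma partial_deriv_support:
  assumes "\<And>x. R < norm x \<Longrightarrow> f x = 0" "R < norm x"
  shows "partial_deriv i f x = 0"
  by (rule partial_deriv_0_open[of "- cball 0 R"]) (use assms in auto)

lemma integration_by_parts:
  fixes f g :: "real^2 \<Rightarrow> real"
  assumes f: "smooth_on UNIV f" and g: "smooth_on UNIV g"
    and R: "\<And>x. R < norm x \<Longrightarrow> f x * g x = 0"
  shows "(\<integral>x. partial_deriv i f x * g x + f x * partial_deriv i g x \<partial>lborel) = 0"
proof -
  let ?p = "\<lambda>x. f x * g x"
  have s: "smooth_on UNIV ?p" by (rule smooth_mult[OF f g])
  have R': "partial_deriv i ?p x = 0" if "R < norm x" for x
    by (rule partial_deriv_support[of R ?p x, OF R that])
  obtain C where "\<And>x. norm (partial_deriv i ?p x) \<le> C"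
    by (rule continuous_bounded_support[OF smooth_continuous[OF smooth_partial_deriv[OF s]] R']) auto
  then have "(\<integral>x. partial_deriv i ?p x \<partial>lborel) = 0"
    using integral_partial_deriv_eq_0(2)[where f = ?p and i = i and C = C and R = R] smooth_differentiable[OF s] R by auto
  then show ?thesis
    using partial_deriv_mult[OF smooth_differentiable[OF f] smooth_differentiable[OF g]] by (simp add: add.commute)
qed

lemma integration_by_parts':
  fixes f g :: "real^2 \<Rightarrow> real"
  assumes f: "smooth_on UNIV f" and g: "smooth_on UNIV g"
    and R: "(\<forall>x. R < norm x \<longrightarrow> f x = 0) \<or> (\<forall>x. R < norm x \<longrightarrow> g x = 0)"
  shows "(\<integral>x. f x * partial_deriv i g x \<partial>lborel) = - (\<integral>x. partial_deriv i f x * g x \<partial>lborel)"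
proof -
  have R1: "f x * partial_deriv i g x = 0" "partial_deriv i f x * g x = 0" "f x * g x = 0" if "R < norm x" for x
    using R partial_deriv_support[where R = R and f = f and x = x and i = i] partial_deriv_support[where R = R and f = g and x = x and i = i] that by auto
  have "integrable lborel (\<lambda>x. f x * partial_deriv i g x)"
    by (rule integrable_continuous_support[OF _ R1(1)]) (intro continuous_intros smooth_continuous smooth_partial_deriv f g)
  moreover have "integrable lborel (\<lambda>x. partial_deriv i f x * g x)"
    by (rule integrable_continuous_support[OF _ R1(2)]) (intro continuous_intros smooth_continuous smooth_partial_deriv f g)
  ultimately show ?thesis
    using integration_by_parts[OF f g, where R = R and i = i] R1(3) by simp
qed

section \<open>Convolution with a smooth kernel\<close>

definition conv :: "(real^2 \<Rightarrow> real) \<Rightarrow> (real^2 \<Rightarrow> real) \<Rightarrow> real^2 \<Rightarrow> real" where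
  "conv m K x = (\<integral>y. m y * K (x - y) \<partial>lborel)"

lemma integrable_mult_bounded:
  fixes m :: "'a::euclidean_space \<Rightarrow> real"
  assumes m: "integrable lborel m" and [measurable]: "f \<in> borel_measurable borel"
    and b: "\<And>x. m x \<noteq> 0 \<Longrightarrow> \<bar>f x\<bar> \<le> C"
  shows "integrable lborel (\<lambda>x. m x * f x)" "\<bar>\<integral>x. m x * f x \<partial>lborel\<bar> \<le> C * (\<integral>x. \<bar>m x\<bar> \<partial>lborel)"
proof -
  have m': "integrable lborel (\<lambda>x. C * \<bar>m x\<bar>)" using m by simp
  have [measurable]: "m \<in> borel_measurable lborel" using m by simp
  have le: "\<bar>m x * f x\<bar> \<le> C * \<bar>m x\<bar>" for x
    using b[of x] by (cases "m x = 0") (auto simp: abs_mult mult.commute mult_left_mono)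
  show i: "integrable lborel (\<lambda>x. m x * f x)"
    by (rule Bochner_Integration.integrable_bound[OF m']) (use le in \<open>auto intro: order_trans[OF _ abs_ge_self]\<close>)
  have "\<bar>\<integral>x. m x * f x \<partial>lborel\<bar> \<le> (\<integral>x. \<bar>m x * f x\<bar> \<partial>lborel)"
    by (rule integral_abs_bound)
  also have "\<dots> \<le> (\<integral>x. C * \<bar>m x\<bar> \<partial>lborel)"
    by (rule integral_mono[OF integrable_abs[OF i] m']) (rule le)
  finally show "\<bar>\<integral>x. m x * f x \<partial>lborel\<bar> \<le> C * (\<integral>x. \<bar>m x\<bar> \<partial>lborel)" by simp
qed

lemma conv_integrable:
  fixes m K :: "real^2 \<Rightarrow> real"
  assumes m: "integrable lborel m" and R: "\<And>x. R < norm x \<Longrightarrow> m x = 0" and K: "continuous_on UNIV K"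
  shows "integrable lborel (\<lambda>y. m y * K (x - y))"
proof -
  have c: "continuous_on UNIV (\<lambda>y. K (x - y))"
    by (rule continuous_on_compose2[OF K]) (auto intro!: continuous_intros)
  have "compact ((\<lambda>y. K (x - y)) ` cball 0 R)"
    by (intro compact_continuous_image continuous_on_subset[OF c]) auto
  then obtain C where C: "\<And>y. y \<in> (\<lambda>y. K (x - y)) ` cball 0 R \<Longrightarrow> norm y \<le> C"
    using bounded_pos compact_imp_bounded by metis
  show ?thesis
    by (rule integrable_mult_bounded(1)[OF m, where C = C])
       (use C R borel_measurable_continuous_onI[OF c] in \<open>force simp: not_less[symmetric]\<close>)+
qed

text \<open>The kernel K is smooth but in general neither bounded nor compactly supported (ramps
  occur below). Uniformity comes from the bounded support of m: only values of K on a fixed ball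
  enter, where its partial derivatives are uniformly continuous.\<close>

lemma conv_has_derivative:
  assumes m: "integrable lborel m" and R: "\<And>x. R < norm x \<Longrightarrow> m x = 0" and K: "smooth_on UNIV K"
  shows "(conv m K has_derivative
     (\<lambda>h. h $ 1 * conv m (partial_deriv 1 K) x + h $ 2 * conv m (partial_deriv 2 K) x)) (at x)"
  unfolding has_derivative_at_alt
proof (intro conjI allI impI)
  show "bounded_linear (\<lambda>h::real^2. h $ 1 * conv m (partial_deriv 1 K) x + h $ 2 * conv m (partial_deriv 2 K) x)"
    by (intro bounded_linear_add bounded_linear_mult_left[THEN bounded_linear_compose] bounded_linear_vec_nth)
  fix e :: real assume e: "0 < e"
  \<comment> \<open>Contains all x - u and y - u with u in the support of m and y within distance 1
    of x.\<close>
  define S where "S = cball (0::real^2) (R + norm x + 1)"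
  define M where "M = (\<integral>y. \<bar>m y\<bar> \<partial>lborel) + 1"
  have M: "0 < M" unfolding M_def by (simp add: add_nonneg_pos)
  define D where "D z h = h $ 1 *\<^sub>R partial_deriv 1 K z + h $ 2 *\<^sub>R partial_deriv 2 K z" for z h :: "real^2"
  have D: "(K has_derivative D z) (at z)" for z
    unfolding D_def[abs_def] by (rule has_derivative_partial_deriv[OF smooth_differentiable[OF K]])
  have cK: "continuous_on T (partial_deriv i K)" for T i using smooth_continuous[OF smooth_partial_deriv[OF K]] .
  have "uniformly_continuous_on S (partial_deriv i K)" for i
    by (rule compact_uniformly_continuous[OF cK]) (simp add: S_def)
  then have "\<exists>d>0. \<forall>z\<in>S. \<forall>w\<in>S. dist w z < d \<longrightarrow> dist (partial_deriv i K w) (partial_deriv i K z) < e / (2 * M)" for i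
    unfolding uniformly_continuous_on_def using e M by (metis divide_pos_pos mult_pos_pos zero_less_numeral)
  then obtain d where d: "\<And>i. 0 < d i"
    "\<And>i z w. z \<in> S \<Longrightarrow> w \<in> S \<Longrightarrow> dist w z < d i \<Longrightarrow> dist (partial_deriv i K w) (partial_deriv i K z) < e / (2 * M)"
    by metis
  define d0 where "d0 = min 1 (min (d 1) (d 2))"
  have d0: "0 < d0" "d0 \<le> 1" "d0 \<le> d 1" "d0 \<le> d 2" using d(1) by (auto simp: d0_def)
  show "\<exists>d>0. \<forall>y. norm (y - x) < d \<longrightarrow> norm (conv m K y - conv m K x -
      ((y - x) $ 1 * conv m (partial_deriv 1 K) x + (y - x) $ 2 * conv m (partial_deriv 2 K) x)) \<le> e * norm (y - x)"
  proof (intro exI[of _ d0] conjI allI impI)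
    show "0 < d0" by (rule d0)
    fix y assume y: "norm (y - x) < d0"
    define r where "r u = K (y - u) - K (x - u) - D (x - u) (y - x)" for u
    have r: "\<bar>r u\<bar> \<le> norm (y - x) * (e / M)" if u: "m u \<noteq> 0" for u
    proof -
      have nu: "norm u \<le> R" using u R[of u] by force
      let ?B = "cball (x - u) (norm (y - x))"
      have sub: "?B \<subseteq> S"
      proof
        fix z assume "z \<in> ?B"
        then have "norm ((x - u) - z) \<le> norm (y - x)" by (simp add: dist_norm)
        moreover have "norm z \<le> norm (x - u) + norm ((x - u) - z)" by (simp add: norm_triangle_sub norm_minus_commute[of "x - u"])
        moreover have "norm (x - u) \<le> norm x + norm u" by (rule norm_triangle_ineq4)
        ultimately show "z \<in> S" using nu y d0 by (simp add: S_def)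
      qed
      have "norm (K (y - u) - K (x - u) - D (x - u) ((y - u) - (x - u))) \<le> norm ((y - u) - (x - u)) * (e / M)"
      proof (rule differentiable_bound_linearization[where S = ?B and f' = D and ?x0.0 = "x - u"])
        show "(x - u) + t *\<^sub>R ((y - u) - (x - u)) \<in> ?B" if "t \<in> {0..1}" for t
          using that by (auto simp: dist_norm intro!: mult_left_le_one_le)
        show "(K has_derivative D z) (at z within ?B)" if "z \<in> ?B" for z
          using D has_derivative_at_withinI by blast
        show "x - u \<in> ?B" by simp
        fix z assume z: "z \<in> ?B"
        have dz: "\<bar>partial_deriv i K z - partial_deriv i K (x - u)\<bar> \<le> e / (2 * M)" for i
        proof -
          have "dist z (x - u) < d i"
            using z y d0 exhaust_2[of i] by (auto simp: dist_commute)
          moreover have "z \<in> S" "x - u \<in> S" using sub z by auto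
          ultimately show ?thesis using d(2)[of "x - u" z i] by (simp add: dist_real_def)
        qed
        show "onorm (D z - D (x - u)) \<le> e / M"
        proof (rule onorm_le)
          fix h
          have "norm ((D z - D (x - u)) h) = \<bar>h $ 1 * (partial_deriv 1 K z - partial_deriv 1 K (x - u)) +
              h $ 2 * (partial_deriv 2 K z - partial_deriv 2 K (x - u))\<bar>"
            by (simp add: D_def algebra_simps)
          also have "\<dots> \<le> \<bar>h $ 1\<bar> * \<bar>partial_deriv 1 K z - partial_deriv 1 K (x - u)\<bar> +
              \<bar>h $ 2\<bar> * \<bar>partial_deriv 2 K z - partial_deriv 2 K (x - u)\<bar>"
            by (rule order_trans[OF abs_triangle_ineq]) (simp add: abs_mult)
          also have "\<dots> \<le> norm h * (e / (2 * M)) + norm h * (e / (2 * M))"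
            by (intro add_mono mult_mono dz component_le_norm_cart) auto
          finally show "norm ((D z - D (x - u)) h) \<le> e / M * norm h" by (simp add: field_simps)
        qed
      qed
      then show ?thesis by (simp add: r_def)
    qed
    have I: "integrable lborel (\<lambda>u. m u * K (y - u))" "integrable lborel (\<lambda>u. m u * K (x - u))"
      "integrable lborel (\<lambda>u. m u * partial_deriv i K (x - u))" for i
      by (rule conv_integrable[OF m R]; simp add: cK smooth_continuous[OF K])+
    have mr: "m u * r u = m u * K (y - u) - m u * K (x - u) -
        ((y - x) $ 1 * (m u * partial_deriv 1 K (x - u)) + (y - x) $ 2 * (m u * partial_deriv 2 K (x - u)))" for u
      by (simp add: r_def D_def algebra_simps)
    have "conv m K y - conv m K x -
      ((y - x) $ 1 * conv m (partial_deriv 1 K) x + (y - x) $ 2 * conv m (partial_deriv 2 K) x) = (\<integral>u. m u * r u \<partial>lborel)"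
      unfolding conv_def mr using I by simp
    also have "\<bar>\<dots>\<bar> \<le> norm (y - x) * (e / M) * (\<integral>u. \<bar>m u\<bar> \<partial>lborel)"
    proof (rule integrable_mult_bounded(2)[OF m _ r])
      have "continuous_on UNIV (\<lambda>u. K (c - u))" "continuous_on UNIV (\<lambda>u. partial_deriv i K (c - u))" for c i
        using continuous_on_compose2[OF smooth_continuous[OF K, of UNIV], of UNIV "\<lambda>u. c - u"]
          continuous_on_compose2[OF cK[of UNIV i], of UNIV "\<lambda>u. c - u"]
        continuous_on_diff[OF continuous_on_const continuous_on_id, of UNIV c] by auto
      then have "continuous_on UNIV r" unfolding r_def D_def by (intro continuous_intros) auto
      then show "r \<in> borel_measurable borel" by (rule borel_measurable_continuous_onI)
    qed
    also have "\<dots> \<le> norm (y - x) * (e / M) * M"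
      using e M by (intro mult_left_mono) (auto simp: M_def)
    also have "\<dots> = e * norm (y - x)" using M by simp
    finally show "norm (conv m K y - conv m K x -
      ((y - x) $ 1 * conv m (partial_deriv 1 K) x + (y - x) $ 2 * conv m (partial_deriv 2 K) x)) \<le> e * norm (y - x)" by simp
  qed
qed

lemma partial_deriv_conv:
  assumes m: "integrable lborel m" and R: "\<And>x. R < norm x \<Longrightarrow> m x = 0" and K: "smooth_on UNIV K"
  shows "partial_deriv i (conv m K) = conv m (partial_deriv i K)"
  using partial_deriv_eq[OF conv_has_derivative[OF assms], where i = i] exhaust_2[of i]
  by (intro ext) (auto simp: axis_def)

lemma smooth_conv:
  assumes m: "integrable lborel m" and R: "\<And>x. R < norm x \<Longrightarrow> m x = 0" and K: "smooth_on UNIV K"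
  shows "smooth_on UNIV (conv m K)"
proof -
  have "n_smooth n (conv m K)" if "smooth_on UNIV K" for n K
    using that
  proof (induction n arbitrary: K)
    case 0
    show ?case using conv_has_derivative[OF m R 0] unfolding n_smooth.simps differentiable_def by blast
  next
    case (Suc n)
    have "conv m K differentiable (at x)" for x using conv_has_derivative[OF m R Suc.prems] unfolding differentiable_def by blast
    then show ?case using Suc.IH[OF smooth_partial_deriv[OF Suc.prems]] partial_deriv_conv[OF m R Suc.prems] by simp
  qed
  then show ?thesis using K by (simp add: smooth_iff_n_smooth)
qed

section \<open>Cauchy-Schwarz inequalities from the discriminant\<close>

lemma le_of_quadratic_nonneg:
  fixes a b c :: real
  assumes "\<And>t. 0 \<le> a + 2 * t * c + t\<^sup>2 * b"
  shows "c\<^sup>2 \<le> a * b"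
proof (cases "b = 0")
  case True
  have "c = 0"
  proof (rule ccontr)
    assume "c \<noteq> 0"
    then show False using assms[of "- (a + 1) / (2 * c)"] True by (simp add: field_simps)
  qed
  then show ?thesis using True by simp
next
  case False
  have "0 \<le> b"
  proof (rule ccontr)
    assume b: "\<not> 0 \<le> b"
    \<comment> \<open>Chosen so large that a negative quadratic term would outweigh the other
      two.\<close>
    define t where "t = (\<bar>a\<bar> + 2 * \<bar>c\<bar>) / (- b) + 1"
    have t: "1 \<le> t" using b by (auto simp: t_def divide_nonneg_neg intro: divide_nonneg_pos)
    have tb: "t * (- b) = \<bar>a\<bar> + 2 * \<bar>c\<bar> - b" using b by (simp add: t_def field_simps)
    have "a \<le> \<bar>a\<bar> * t" using t mult_left_mono[of 1 t "\<bar>a\<bar>"] by auto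
    moreover have "2 * t * c \<le> 2 * \<bar>c\<bar> * t" using t by (simp add: mult.commute mult_left_mono)
    moreover have "t\<^sup>2 * b = - (t * (\<bar>a\<bar> + 2 * \<bar>c\<bar> - b))"
      unfolding tb[symmetric] by (simp add: power2_eq_square)
    ultimately have "a + 2 * t * c + t\<^sup>2 * b \<le> t * b" by (simp add: algebra_simps)
    also have "\<dots> < 0" using t b by (simp add: mult_pos_neg)
    finally show False using assms[of t] by simp
  qed
  then have "0 < b" using False by simp
  then show ?thesis using assms[of "- c / b"] by (simp add: field_simps power2_eq_square)
qed

lemma Cauchy_Schwarz_integral:
  fixes f g :: "'a \<Rightarrow> real"
  assumes [measurable]: "f \<in> borel_measurable M" "g \<in> borel_measurable M"
    and f: "integrable M (\<lambda>x. (f x)\<^sup>2)" and g: "integrable M (\<lambda>x. (g x)\<^sup>2)"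
  shows "integrable M (\<lambda>x. f x * g x)"
    and "\<bar>\<integral>x. f x * g x \<partial>M\<bar> \<le> sqrt (\<integral>x. (f x)\<^sup>2 \<partial>M) * sqrt (\<integral>x. (g x)\<^sup>2 \<partial>M)"
proof -
  have le: "\<bar>f x * g x\<bar> \<le> (f x)\<^sup>2 + (g x)\<^sup>2" for x
  proof -
    have "2 * (\<bar>f x\<bar> * \<bar>g x\<bar>) \<le> (f x)\<^sup>2 + (g x)\<^sup>2"
      using sum_squares_bound[of "\<bar>f x\<bar>" "\<bar>g x\<bar>"] by simp
    moreover have "0 \<le> \<bar>f x\<bar> * \<bar>g x\<bar>" by simp
    ultimately show ?thesis unfolding abs_mult by linarith
  qed
  show i: "integrable M (\<lambda>x. f x * g x)"
    by (rule Bochner_Integration.integrable_bound[OF Bochner_Integration.integrable_add[OF f g]])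
       (use le in \<open>auto intro: order_trans[OF _ abs_ge_self]\<close>)
  have "0 \<le> (\<integral>x. (f x)\<^sup>2 \<partial>M) + 2 * t * (\<integral>x. f x * g x \<partial>M) + t\<^sup>2 * (\<integral>x. (g x)\<^sup>2 \<partial>M)" for t
  proof -
    have "(\<integral>x. (f x)\<^sup>2 \<partial>M) + 2 * t * (\<integral>x. f x * g x \<partial>M) + t\<^sup>2 * (\<integral>x. (g x)\<^sup>2 \<partial>M)
       = (\<integral>x. (f x)\<^sup>2 + 2 * t * (f x * g x) + t\<^sup>2 * (g x)\<^sup>2 \<partial>M)"
      using i f g by simp
    also have "\<dots> = (\<integral>x. (f x + t * g x)\<^sup>2 \<partial>M)" by (simp add: power2_eq_square algebra_simps)
    finally show ?thesis by simp
  qed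
  from le_of_quadratic_nonneg[OF this]
  have "(\<integral>x. f x * g x \<partial>M)\<^sup>2 \<le> (\<integral>x. (f x)\<^sup>2 \<partial>M) * (\<integral>x. (g x)\<^sup>2 \<partial>M)" .
  then show "\<bar>\<integral>x. f x * g x \<partial>M\<bar> \<le> sqrt (\<integral>x. (f x)\<^sup>2 \<partial>M) * sqrt (\<integral>x. (g x)\<^sup>2 \<partial>M)"
    using real_sqrt_le_mono by (fastforce simp: real_sqrt_mult)
qed

lemma Cauchy_Schwarz_integral_norm:
  fixes f :: "'a \<Rightarrow> 'b::euclidean_space" and g :: "'a \<Rightarrow> 'c::euclidean_space"
  assumes "f \<in> borel_measurable M" "g \<in> borel_measurable M"
    and "integrable M (\<lambda>x. (norm (f x))\<^sup>2)" and "integrable M (\<lambda>x. (norm (g x))\<^sup>2)"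
  shows "integrable M (\<lambda>x. norm (f x) * norm (g x))"
    and "(\<integral>x. norm (f x) * norm (g x) \<partial>M) \<le> sqrt (\<integral>x. (norm (f x))\<^sup>2 \<partial>M) * sqrt (\<integral>x. (norm (g x))\<^sup>2 \<partial>M)"
  using Cauchy_Schwarz_integral[of "\<lambda>x. norm (f x)" M "\<lambda>x. norm (g x)"] assms by (auto intro: order_trans[OF abs_ge_self])

lemma Cauchy_Schwarz_integral_inner:
  fixes f g :: "'a \<Rightarrow> 'b::euclidean_space"
  assumes [measurable]: "f \<in> borel_measurable M" "g \<in> borel_measurable M"
    and f: "integrable M (\<lambda>x. (norm (f x))\<^sup>2)" and g: "integrable M (\<lambda>x. (norm (g x))\<^sup>2)"
  shows "integrable M (\<lambda>x. f x \<bullet> g x)"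
    and "\<bar>\<integral>x. f x \<bullet> g x \<partial>M\<bar> \<le> sqrt (\<integral>x. (norm (f x))\<^sup>2 \<partial>M) * sqrt (\<integral>x. (norm (g x))\<^sup>2 \<partial>M)"
proof -
  note cs = Cauchy_Schwarz_integral_norm[OF assms]
  show i: "integrable M (\<lambda>x. f x \<bullet> g x)"
    by (rule Bochner_Integration.integrable_bound[OF cs(1)]) (auto simp: Cauchy_Schwarz_ineq2)
  have "\<bar>\<integral>x. f x \<bullet> g x \<partial>M\<bar> \<le> (\<integral>x. \<bar>f x \<bullet> g x\<bar> \<partial>M)" by (rule integral_abs_bound)
  also have "\<dots> \<le> (\<integral>x. norm (f x) * norm (g x) \<partial>M)"
    by (rule integral_mono[OF integrable_abs[OF i] cs(1)]) (rule Cauchy_Schwarz_ineq2)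
  finally show "\<bar>\<integral>x. f x \<bullet> g x \<partial>M\<bar> \<le> sqrt (\<integral>x. (norm (f x))\<^sup>2 \<partial>M) * sqrt (\<integral>x. (norm (g x))\<^sup>2 \<partial>M)"
    using cs(2) by linarith
qed

lemma AE_zero_imp_zero:
  fixes f :: "'a::euclidean_space \<Rightarrow> real"
  assumes U: "open U" and f: "continuous_on U f" and ae: "AE x in lebesgue. x \<in> U \<longrightarrow> f x = 0" and x: "x \<in> U"
  shows "f x = 0"
proof (rule ccontr)
  assume "f x \<noteq> 0"
  have o: "open (U \<inter> f -` (- {0}))" by (rule continuous_open_preimage[OF f U]) auto
  have "\<not> negligible (U \<inter> f -` (- {0}))"
    by (rule open_not_negligible[OF o]) (use x \<open>f x \<noteq> 0\<close> in auto)
  moreover have "negligible (U \<inter> f -` (- {0}))"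
  proof -
    have "U \<inter> f -` (- {0}) \<in> sets lebesgue" using o by simp
    moreover have "AE x in lebesgue. x \<notin> U \<inter> f -` (- {0})" using ae by eventually_elim auto
    ultimately show ?thesis unfolding negligible_iff_null_sets by (simp add: AE_iff_null_sets)
  qed
  ultimately show False by blast
qed

section \<open>Mollification\<close>

text \<open>The powers of e are those for which differentiation still leads from
  \<open>ramp_e\<close> to \<open>step_e\<close> to \<open>bump_e\<close>.\<close>

definition bump_e :: "real \<Rightarrow> real \<Rightarrow> real" where "bump_e e t = bump (t / e) / e"
definition step_e :: "real \<Rightarrow> real \<Rightarrow> real" where "step_e e t = step (t / e)"
definition ramp_e :: "real \<Rightarrow> real \<Rightarrow> real" where "ramp_e e t = e * ramp (t / e)"

lemma smooth_scaled:
  shows smooth_bump_e: "smooth1 (bump_e e)" and smooth_step_e: "smooth1 (step_e e)"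
    and smooth_ramp_e: "smooth1 (ramp_e e)"
proof -
  have "smooth1 (\<lambda>t. (1 / e) * bump (1 / e * t + 0))" "smooth1 (\<lambda>t. step (1 / e * t + 0))" "smooth1 (\<lambda>t. e * ramp (1 / e * t + 0))"
    by (intro smooth1_mult smooth1_const smooth1_affine smooth_bump smooth_step smooth_ramp)+
  then show "smooth1 (bump_e e)" "smooth1 (step_e e)" "smooth1 (ramp_e e)"
    by (simp_all add: bump_e_def[abs_def] step_e_def[abs_def] ramp_e_def[abs_def])
qed

lemma deriv_scaled:
  assumes "0 < e"
  shows deriv_ramp_e: "deriv (ramp_e e) = step_e e" and deriv_step_e: "deriv (step_e e) = bump_e e"
proof -
  have d: "((\<lambda>t. f (t / e)) has_real_derivative deriv f (t / e) / e) (at t)" if "smooth1 f" for f t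
    by (rule DERIV_cdivide[of "\<lambda>t. t" 1 t UNIV e, THEN DERIV_chain2[OF smooth1_DERIV[OF that]], simplified])
  show "deriv (ramp_e e) = step_e e"
    unfolding ramp_e_def[abs_def] step_e_def[abs_def] step_def
    by (rule deriv_eqI) (use DERIV_cmult[OF d[OF smooth_ramp], of e] assms in simp)
  show "deriv (step_e e) = bump_e e"
    unfolding step_e_def[abs_def] bump_e_def[abs_def] bump_def
    by (rule deriv_eqI) (rule d[OF smooth_step])
qed

lemma scaled_support:
  assumes "0 < e" "t \<le> - e"
  shows "bump_e e t = 0" "step_e e t = 0" "ramp_e e t = 0"
proof -
  have "t / e \<le> - 1" using assms by (simp add: divide_simps)
  then show "bump_e e t = 0" "step_e e t = 0" "ramp_e e t = 0"
    by (simp_all add: bump_e_def step_e_def ramp_e_def bump_lo step_0 ramp_0)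
qed

lemma bump_e_support:
  assumes "0 < e" "e \<le> \<bar>t\<bar>"
  shows "bump_e e t = 0"
proof -
  have "t / e \<le> - 1 \<or> 1 \<le> t / e" using assms by (auto simp: divide_simps abs_if split: if_splits)
  then show ?thesis by (auto simp: bump_e_def bump_lo bump_hi)
qed

definition kern :: "real \<Rightarrow> real^2 \<Rightarrow> real" where "kern e = tens (bump_e e) (bump_e e)"

text \<open>The mollifier is left unnormalized; its integral travels through all estimates as a
  positive factor and cancels at the end.\<close>

definition mass :: real where "mass = (\<integral>x. kern 1 x \<partial>lborel)"

lemma smooth_kern: "smooth_on UNIV (kern e)"
  unfolding kern_def by (intro smooth_tens smooth_bump_e)

lemma kern_borel [measurable]: "kern e \<in> borel_measurable borel"
  by (rule smooth_borel[OF smooth_kern])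

lemma kern_nonneg: "0 < e \<Longrightarrow> 0 \<le> kern e z"
  by (simp add: kern_def tens_def bump_e_def bump_nonneg)

lemma kern_support:
  assumes "0 < e" "kern e z \<noteq> 0" shows "norm z < 2 * e"
proof -
  have "\<bar>z $ 1\<bar> < e" "\<bar>z $ 2\<bar> < e"
    using bump_e_support[OF assms(1)] assms(2) by (auto simp: kern_def tens_def not_le[symmetric])
  moreover have "norm z \<le> \<bar>z $ 1\<bar> + \<bar>z $ 2\<bar>" using norm_le_l1_cart[of z] by (simp add: sum_2)
  ultimately show ?thesis by linarith
qed

lemma kern_integrable: "0 < e \<Longrightarrow> integrable lborel (kern e)"
  by (rule integrable_continuous_support[OF smooth_continuous[OF smooth_kern], of "2 * e"])
     (use kern_support in force)

lemma mass_pos: "0 < mass"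
proof -
  have "mass \<noteq> 0"
  proof
    assume "mass = 0"
    then have "AE x in lborel. kern 1 x = 0"
      unfolding mass_def by (subst (asm) integral_nonneg_eq_0_iff_AE) (auto simp: kern_integrable kern_nonneg)
    then have "AE x in lebesgue. x \<in> UNIV \<longrightarrow> kern 1 x = 0" by (auto intro: AE_completion)
    then have "kern 1 0 = 0" by (rule AE_zero_imp_zero[OF open_UNIV smooth_continuous[OF smooth_kern]]) simp
    then show False using bump_pos by (simp add: kern_def tens_def bump_e_def)
  qed
  moreover have "0 \<le> mass" unfolding mass_def by (simp add: kern_nonneg)
  ultimately show ?thesis by simp
qed

lemma integral_kern:
  assumes e: "0 < e" shows "(\<integral>x. kern e x \<partial>lborel) = mass"
proof -
  have *: "lborel = density (distr lborel borel (\<lambda>x::real^2. 0 + e *\<^sub>R x)) (\<lambda>_. ennreal (\<bar>e\<bar> ^ DIM(real^2)))"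
    by (rule lborel_affine) (use e in simp)
  have "(\<integral>x. kern e x \<partial>lborel) =
     (\<integral>x. kern e x \<partial>density (distr lborel borel (\<lambda>x::real^2. 0 + e *\<^sub>R x)) (\<lambda>_. ennreal (\<bar>e\<bar> ^ DIM(real^2))))"
    by (subst *) simp
  also have "\<dots> = (\<integral>x. e\<^sup>2 * kern e (e *\<^sub>R x) \<partial>lborel)"
    using e by (simp add: integral_density integral_distr)
  also have "(\<lambda>x. e\<^sup>2 * kern e (e *\<^sub>R x)) = kern 1"
    using e by (auto simp: kern_def tens_def bump_e_def power2_eq_square)
  finally show ?thesis by (simp add: mass_def)
qed

lemma kern_shift:
  assumes e: "0 < e"
  shows "integrable lborel (\<lambda>y. kern e (x - y))" "(\<integral>y. kern e (x - y) \<partial>lborel) = mass"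
    and "integrable lborel (\<lambda>x. kern e (x - y))" "(\<integral>x. kern e (x - y) \<partial>lborel) = mass"
  using lborel_integral_reflect[OF kern_borel, of e x] lborel_integral_translate[OF kern_borel, of e "- y"]
    kern_integrable[OF e] integral_kern[OF e] by (auto simp: add.commute)

text \<open>The weight k is kept abstract because \<open>kern e (x - y)\<close> is used both as a
  function of y and as a function of x.\<close>

lemma kern_average:
  assumes e: "0 < e" and f [measurable]: "f \<in> borel_measurable borel" and C: "\<And>x. \<bar>f x\<bar> \<le> C"
    and k: "integrable lborel k" "(\<integral>y. k y \<partial>lborel) = mass" "\<And>y. 0 \<le> k y"
    and d: "\<And>y. k y \<noteq> 0 \<Longrightarrow> \<bar>f y - f x\<bar> \<le> d"
  shows "\<bar>(\<integral>y. f y * k y \<partial>lborel) - mass * f x\<bar> \<le> d * mass" "integrable lborel (\<lambda>y. f y * k y)"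
proof -
  have "\<bar>\<integral>y. k y * (f y - f x) \<partial>lborel\<bar> \<le> d * (\<integral>y. \<bar>k y\<bar> \<partial>lborel)"
    by (rule integrable_mult_bounded(2)[OF k(1)]) (use d in auto)
  moreover have i: "integrable lborel (\<lambda>y. k y * f y)"
    by (rule integrable_mult_bounded(1)[OF k(1), where C = C]) (use C in auto)
  then have "(\<integral>y. k y * (f y - f x) \<partial>lborel) = (\<integral>y. f y * k y \<partial>lborel) - mass * f x"
    using k by (simp add: right_diff_distrib mult.commute)
  ultimately show "\<bar>(\<integral>y. f y * k y \<partial>lborel) - mass * f x\<bar> \<le> d * mass" using k by simp
  show "integrable lborel (\<lambda>y. f y * k y)" using i by (simp add: mult.commute)
qed

lemma conv_kern_approx:
  assumes e: "0 < e" and f: "f \<in> borel_measurable borel" and C: "\<And>x. \<bar>f x\<bar> \<le> C"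
    and d: "\<And>y. norm (y - x) < 2 * e \<Longrightarrow> \<bar>f y - f x\<bar> \<le> d"
  shows "\<bar>conv f (kern e) x - mass * f x\<bar> \<le> d * mass"
  unfolding conv_def
proof (rule kern_average(1)[OF e f C])
  show "\<bar>f y - f x\<bar> \<le> d" if "kern e (x - y) \<noteq> 0" for y
    using d[of y] kern_support[OF e that] by (simp add: norm_minus_commute)
qed (use kern_shift[OF e] kern_nonneg[OF e] in auto)

lemma conv_kern_support:
  assumes e: "0 < e" and x: "\<And>y. m y \<noteq> 0 \<Longrightarrow> 2 * e \<le> norm (x - y)"
  shows "conv m (kern e) x = 0"
proof -
  have "(\<lambda>y. m y * kern e (x - y)) = (\<lambda>_. 0)" using kern_support[OF e] x by force
  then show ?thesis unfolding conv_def by simp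
qed

text \<open>Fubini moves the mollifier from m onto f, where it costs only the oscillation of f at
  scale 2e. No regularity of m enters, which is what makes it fit for the residual field.\<close>

lemma conv_kern_pairing:
  assumes e: "0 < e" and m: "integrable lborel m" and f [measurable]: "f \<in> borel_measurable borel"
    and C: "\<And>x. \<bar>f x\<bar> \<le> C"
    and d: "\<And>x y. m y \<noteq> 0 \<Longrightarrow> norm (x - y) < 2 * e \<Longrightarrow> \<bar>f x - f y\<bar> \<le> d"
  shows "\<bar>(\<integral>x. f x * conv m (kern e) x \<partial>lborel) - mass * (\<integral>x. f x * m x \<partial>lborel)\<bar> \<le> d * mass * (\<integral>x. \<bar>m x\<bar> \<partial>lborel)"
proof -
  have m_borel [measurable]: "m \<in> borel_measurable borel" using m by simp
  have G: "integrable (lborel \<Otimes>\<^sub>M lborel) (\<lambda>(y, x). m y * kern e (x - y))"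
  proof (rule lborel_pair.Fubini_integrable)
    show "(\<lambda>(y, x). m y * kern e (x - y)) \<in> borel_measurable (lborel \<Otimes>\<^sub>M lborel)"
    proof -
      have "(\<lambda>(y, x). m y * kern e (x - y)) \<in> borel_measurable (borel \<Otimes>\<^sub>M borel)" by measurable
      then show ?thesis by (simp cong: measurable_cong_sets sets_pair_measure_cong)
    qed
    have "(\<integral>x. norm (case (y, x) of (y, x) \<Rightarrow> m y * kern e (x - y)) \<partial>lborel) = mass * \<bar>m y\<bar>" for y
      using kern_shift[OF e] kern_nonneg[OF e] by (simp add: abs_mult)
    then show "integrable lborel (\<lambda>y. \<integral>x. norm (case (y, x) of (y, x) \<Rightarrow> m y * kern e (x - y)) \<partial>lborel)"
      using m by simp
    show "AE y in lborel. integrable lborel (\<lambda>x. case (y, x) of (y, x) \<Rightarrow> m y * kern e (x - y))"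
      using kern_shift[OF e] by simp
  qed
  have F: "integrable (lborel \<Otimes>\<^sub>M lborel) (\<lambda>(y, x). f x * (m y * kern e (x - y)))"
  proof (rule Bochner_Integration.integrable_bound[OF integrable_mult_right[OF G, of C]])
    have "(\<lambda>(y, x). f x * (m y * kern e (x - y))) \<in> borel_measurable (borel \<Otimes>\<^sub>M borel)" by measurable
    then show "(\<lambda>(y, x). f x * (m y * kern e (x - y))) \<in> borel_measurable (lborel \<Otimes>\<^sub>M lborel)"
      by (simp cong: measurable_cong_sets sets_pair_measure_cong)
    show "AE z in lborel \<Otimes>\<^sub>M lborel. norm (case z of (y, x) \<Rightarrow> f x * (m y * kern e (x - y))) \<le> norm (C * (case z of (y, x) \<Rightarrow> m y * kern e (x - y)))"
      using C order_trans[OF abs_ge_zero C] by (intro AE_I2) (auto simp: abs_mult split: prod.split intro!: mult_right_mono)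
  qed
  define A where "A y = (\<integral>x. f x * kern e (x - y) \<partial>lborel)" for y
  have "(\<integral>x. f x * conv m (kern e) x \<partial>lborel) = (\<integral>x. \<integral>y. f x * (m y * kern e (x - y)) \<partial>lborel \<partial>lborel)"
    unfolding conv_def by simp
  also have "\<dots> = (\<integral>y. \<integral>x. f x * (m y * kern e (x - y)) \<partial>lborel \<partial>lborel)"
    using lborel_pair.Fubini_integral[OF F] by simp
  also have "\<dots> = (\<integral>y. m y * A y \<partial>lborel)"
    unfolding A_def integral_mult_right_zero[symmetric] by (simp add: mult.left_commute[of "f _"])
  finally have 1: "(\<integral>x. f x * conv m (kern e) x \<partial>lborel) = (\<integral>y. m y * A y \<partial>lborel)" .
  have A_borel [measurable]: "A \<in> borel_measurable borel"
    unfolding A_def by (rule lborel.borel_measurable_lebesgue_integral[of "\<lambda>y x. f x * kern e (x - y)" borel]) measurable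
  have A: "\<bar>A y - mass * f y\<bar> \<le> d * mass" if "m y \<noteq> 0" for y
    unfolding A_def
    by (rule kern_average(1)[OF e f C])
       (use kern_shift[OF e] kern_nonneg[OF e] d[OF that] kern_support[OF e] in auto)
  have "\<bar>\<integral>y. m y * (A y - mass * f y) \<partial>lborel\<bar> \<le> d * mass * (\<integral>x. \<bar>m x\<bar> \<partial>lborel)"
    by (rule integrable_mult_bounded(2)[OF m _ A]) auto
  moreover have i: "integrable lborel (\<lambda>y. m y * f y)"
    by (rule integrable_mult_bounded(1)[OF m, where C = C]) (use C in auto)
  moreover have "integrable lborel (\<lambda>y. m y * (A y - mass * f y))"
    by (rule integrable_mult_bounded(1)[OF m _ A]) auto
  then have "integrable lborel (\<lambda>y. m y * (A y - mass * f y) + mass * (m y * f y))" using i by simp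
  then have "integrable lborel (\<lambda>y. m y * A y)" by (simp add: algebra_simps)
  then have "(\<integral>y. m y * (A y - mass * f y) \<partial>lborel) = (\<integral>y. m y * A y \<partial>lborel) - mass * (\<integral>y. f y * m y \<partial>lborel)"
    using i by (simp add: right_diff_distrib mult.left_commute mult.commute[of "f _"])
  ultimately show ?thesis using 1 by simp
qed

text \<open>Young's inequality for an integrable kernel. Pointwise it is Jensen's inequality for the
  weight \<open>kern e (x - y)\<close>, obtained by expanding a nonnegative weighted
  variance.\<close>

lemma conv_kern_L2:
  assumes e: "0 < e" and m: "integrable lborel m" "integrable lborel (\<lambda>x. (m x)\<^sup>2)"
    and R: "\<And>x. R < norm x \<Longrightarrow> m x = 0"
  shows "(\<integral>x. (conv m (kern e) x)\<^sup>2 \<partial>lborel) \<le> mass\<^sup>2 * (\<integral>x. (m x)\<^sup>2 \<partial>lborel)"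
    and "integrable lborel (\<lambda>x. (conv m (kern e) x)\<^sup>2)"
proof -
  have R2: "(m x)\<^sup>2 = 0" if "R < norm x" for x using R that by simp
  have ck: "continuous_on UNIV (kern e)" by (rule smooth_continuous[OF smooth_kern])
  have J: "(conv m (kern e) x)\<^sup>2 \<le> mass * conv (\<lambda>y. (m y)\<^sup>2) (kern e) x" for x
  proof -
    \<comment> \<open>The weighted mean of m, for which the variance is smallest.\<close>
    define t where "t = conv m (kern e) x / mass"
    have i: "integrable lborel (\<lambda>y. m y * kern e (x - y))" "integrable lborel (\<lambda>y. (m y)\<^sup>2 * kern e (x - y))"
      by (rule conv_integrable[OF m(1) R ck] conv_integrable[OF m(2) R2 ck]; assumption)+
    have "0 \<le> (\<integral>y. (m y - t)\<^sup>2 * kern e (x - y) \<partial>lborel)" using kern_nonneg[OF e] by simp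
    also have "\<dots> = (\<integral>y. (m y)\<^sup>2 * kern e (x - y) - 2 * t * (m y * kern e (x - y)) + t\<^sup>2 * kern e (x - y) \<partial>lborel)"
      by (simp add: power2_eq_square algebra_simps)
    also have "\<dots> = conv (\<lambda>y. (m y)\<^sup>2) (kern e) x - 2 * t * conv m (kern e) x + t\<^sup>2 * mass"
      using i kern_shift[OF e] by (simp add: conv_def)
    finally have "0 \<le> conv (\<lambda>y. (m y)\<^sup>2) (kern e) x - (conv m (kern e) x)\<^sup>2 / mass"
      using mass_pos by (simp add: t_def power2_eq_square field_simps)
    then show ?thesis using mass_pos by (simp add: field_simps)
  qed
  have supp: "conv g (kern e) x = 0" if "\<And>x. R < norm x \<Longrightarrow> g x = 0" "R + 2 * e < norm x" for g x
  proof (rule conv_kern_support[OF e])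
    fix y assume "g y \<noteq> 0"
    then have "norm y \<le> R" using that(1) by force
    then show "2 * e \<le> norm (x - y)" using that(2) norm_triangle_ineq2[of x y] by linarith
  qed
  have i2: "integrable lborel (conv (\<lambda>y. (m y)\<^sup>2) (kern e))"
    by (rule integrable_continuous_support[OF smooth_continuous[OF smooth_conv[OF m(2) R2 smooth_kern]] supp[OF R2]])
  have c1: "continuous_on UNIV (conv m (kern e))" by (rule smooth_continuous[OF smooth_conv[OF m(1) R smooth_kern]])
  show i1: "integrable lborel (\<lambda>x. (conv m (kern e) x)\<^sup>2)"
    by (rule integrable_continuous_support[of _ "R + 2 * e"]) (auto intro!: continuous_intros c1 supp[OF R])
  have "(\<integral>x. (conv m (kern e) x)\<^sup>2 \<partial>lborel) \<le> (\<integral>x. mass * conv (\<lambda>y. (m y)\<^sup>2) (kern e) x \<partial>lborel)"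
    by (rule integral_mono[OF i1 _ J]) (use i2 in simp)
  also have "\<dots> = mass * (\<integral>x. conv (\<lambda>y. (m y)\<^sup>2) (kern e) x \<partial>lborel)" by simp
  \<comment> \<open>A constant function has no oscillation, so the pairing estimate holds with error
    0 and becomes an identity.\<close>
  also have "(\<integral>x. conv (\<lambda>y. (m y)\<^sup>2) (kern e) x \<partial>lborel) = mass * (\<integral>x. (m x)\<^sup>2 \<partial>lborel)"
    using conv_kern_pairing[OF e m(2), of "\<lambda>_. 1" 1 0] by simp
  finally show "(\<integral>x. (conv m (kern e) x)\<^sup>2 \<partial>lborel) \<le> mass\<^sup>2 * (\<integral>x. (m x)\<^sup>2 \<partial>lborel)"
    by (simp add: power2_eq_square mult.assoc)
qed

lemma conv_kern_limit:
  assumes f: "continuous_on UNIV f" and R: "\<And>x. R < norm x \<Longrightarrow> f x = 0" and d: "0 < d"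
  shows "\<exists>e>0. \<bar>conv f (kern e) x - mass * f x\<bar> \<le> d * mass"
proof -
  obtain s where s: "0 < s" "\<And>y. dist y x < s \<Longrightarrow> dist (f y) (f x) < d"
    using f d unfolding continuous_on_iff by (metis UNIV_I)
  obtain C where C: "\<And>x. \<bar>f x\<bar> \<le> C" using continuous_bounded_support[OF f R] by (metis real_norm_def)
  have "\<bar>conv f (kern (s / 2)) x - mass * f x\<bar> \<le> d * mass"
    by (rule conv_kern_approx[OF _ borel_measurable_continuous_onI[OF f] C])
       (use s in \<open>auto simp: dist_norm dist_real_def intro: less_imp_le\<close>)
  then show ?thesis using s(1) by (intro exI[of _ "s / 2"]) auto
qed

text \<open>The sign from integration by parts and the sign from the reflected argument of K
  cancel.\<close>

lemma conv_partial_deriv: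
  assumes f: "smooth_on UNIV f" and R: "\<And>x. R < norm x \<Longrightarrow> f x = 0" and K: "smooth_on UNIV K"
  shows "conv (partial_deriv i f) K x = conv f (partial_deriv i K) x"
proof -
  have "(\<integral>y. f y * partial_deriv i (\<lambda>y. K (x - y)) y \<partial>lborel) = - (\<integral>y. partial_deriv i f y * K (x - y) \<partial>lborel)"
    by (rule integration_by_parts'[OF f smooth_reflect[OF K], of R]) (use R in auto)
  then show ?thesis
    using partial_deriv_reflect[OF smooth_differentiable[OF K]] by (simp add: conv_def)
qed

text \<open>The commutator g of the two derivatives has convolution 0 with every mollifier, since
  both derivatives can be moved to the kernel and commute on tensor products. As the convolutions
  approximate a multiple of g, g vanishes.\<close>

lemma partial_deriv_commute_support:
  fixes f :: "real^2 \<Rightarrow> real"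
  assumes f: "smooth_on UNIV f" and R: "\<And>x. R < norm x \<Longrightarrow> f x = 0"
  shows "partial_deriv 2 (partial_deriv 1 f) x = partial_deriv 1 (partial_deriv 2 f) x"
proof (rule ccontr)
  define g where "g y = partial_deriv 2 (partial_deriv 1 f) y - partial_deriv 1 (partial_deriv 2 f) y" for y
  assume "partial_deriv 2 (partial_deriv 1 f) x \<noteq> partial_deriv 1 (partial_deriv 2 f) x"
  then have g0: "0 < \<bar>g x\<bar>" by (simp add: g_def)
  have s: "smooth_on UNIV (partial_deriv i (partial_deriv j f))" for i j by (intro smooth_partial_deriv f)
  have R1: "partial_deriv i f y = 0" if "R < norm y" for i y by (rule partial_deriv_support[OF R that])
  have R2: "partial_deriv i (partial_deriv j f) y = 0" if "R < norm y" for i j y by (rule partial_deriv_support[OF R1 that])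
  have sg: "smooth_on UNIV g" unfolding g_def[abs_def] by (intro smooth_diff s)
  obtain e where e: "0 < e" "\<bar>conv g (kern e) x - mass * g x\<bar> \<le> (\<bar>g x\<bar> / 2) * mass"
    using conv_kern_limit[OF smooth_continuous[OF sg], of R "\<bar>g x\<bar> / 2" x] R2 g0 by (auto simp: g_def)
  have c: "conv (partial_deriv i (partial_deriv j f)) (kern e) x = conv f (partial_deriv j (partial_deriv i (kern e))) x" for i j
    using conv_partial_deriv[OF smooth_partial_deriv[OF f] R1 smooth_kern[of e], where i = i and x = x]
      conv_partial_deriv[OF f R smooth_partial_deriv[OF smooth_kern[of e], of i], where i = j and x = x] by simp
  have ii: "integrable lborel (\<lambda>y. partial_deriv i (partial_deriv j f) y * kern e (x - y))" for i j
    by (rule conv_integrable[OF integrable_continuous_support[OF smooth_continuous[OF s] R2] R2 smooth_continuous[OF smooth_kern]])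
  have "conv g (kern e) x = conv (partial_deriv 2 (partial_deriv 1 f)) (kern e) x - conv (partial_deriv 1 (partial_deriv 2 f)) (kern e) x"
    unfolding conv_def g_def using ii by (simp add: left_diff_distrib)
  also have "\<dots> = 0"
    unfolding c unfolding kern_def by (simp add: smooth_tens_derivs smooth_bump_e smooth1_deriv)
  finally have "mass * \<bar>g x\<bar> \<le> (\<bar>g x\<bar> / 2) * mass" using e mass_pos by (simp add: abs_mult)
  then show False using g0 mass_pos by simp
qed

lemma partial_deriv_commute:
  fixes f :: "real^2 \<Rightarrow> real"
  assumes f: "smooth_on UNIV f" and R: "\<And>x. R < norm x \<Longrightarrow> f x = 0"
  shows "partial_deriv i (partial_deriv j f) = partial_deriv j (partial_deriv i f)"
  using partial_deriv_commute_support[OF f R] exhaust_2[of i] exhaust_2[of j] by (auto intro!: ext)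

text \<open>The embedding of \<open>W\<^sub>0\<^sup>2\<^sup>,\<^sup>2\<close> into the bounded functions rests on this: \<open>f\<close> is the integral of \<open>\<partial>\<^sub>1\<partial>\<^sub>2f\<close> over a quadrant.
  Convolving with a smoothed indicator of a quadrant avoids iterated integrals.\<close>

lemma sup_bound:
  fixes f :: "real^2 \<Rightarrow> real"
  assumes f: "smooth_on UNIV f" and R: "\<And>x. R < norm x \<Longrightarrow> f x = 0"
  shows "mass * \<bar>f x\<bar> \<le> (\<integral>y. \<bar>partial_deriv 1 (partial_deriv 2 f) y\<bar> \<partial>lborel)"
proof (rule ccontr)
  let ?I = "\<integral>y. \<bar>partial_deriv 1 (partial_deriv 2 f) y\<bar> \<partial>lborel"
  assume "\<not> mass * \<bar>f x\<bar> \<le> ?I"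
  then obtain d where d: "0 < d" "?I + d * mass < mass * \<bar>f x\<bar>"
    using mass_pos that[of "(mass * \<bar>f x\<bar> - ?I) / (2 * mass)"] by (auto simp: field_simps)
  obtain e where e: "0 < e" "\<bar>conv f (kern e) x - mass * f x\<bar> \<le> d * mass"
    using conv_kern_limit[OF smooth_continuous[OF f] R d(1)] by blast
  let ?K = "tens (step_e e) (step_e e)"
  have sK: "smooth_on UNIV ?K" by (intro smooth_tens smooth_step_e)
  have R1: "partial_deriv i f y = 0" if "R < norm y" for i y by (rule partial_deriv_support[OF R that])
  have R2: "partial_deriv i (partial_deriv j f) y = 0" if "R < norm y" for i j y by (rule partial_deriv_support[OF R1 that])
  have "kern e = partial_deriv 2 (partial_deriv 1 ?K)"
    unfolding kern_def using e(1) by (simp add: smooth_tens_derivs smooth_step_e smooth_bump_e deriv_step_e)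
  then have "conv f (kern e) x = conv (partial_deriv 1 (partial_deriv 2 f)) ?K x"
    using conv_partial_deriv[OF f R smooth_partial_deriv[OF sK, of 1], where i = 2 and x = x]
      conv_partial_deriv[OF smooth_partial_deriv[OF f] R1 sK, where i = 1 and x = x] by simp
  also have "\<bar>\<dots>\<bar> \<le> 1 * ?I"
    unfolding conv_def
  proof (rule integrable_mult_bounded(2))
    show "integrable lborel (partial_deriv 1 (partial_deriv 2 f))"
      by (rule integrable_continuous_support[OF smooth_continuous R2]) (intro smooth_partial_deriv f)
    show "(\<lambda>y. ?K (x - y)) \<in> borel_measurable borel"
      by (rule smooth_borel[OF smooth_reflect[OF sK]])
    show "\<bar>?K (x - y)\<bar> \<le> 1" for y
      unfolding tens_def step_e_def using step_bounds by (auto simp: abs_mult intro!: mult_le_one)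
  qed
  finally have "mass * \<bar>f x\<bar> \<le> ?I + d * mass" using e(2) mass_pos abs_mult[of mass "f x"] by linarith
  then show False using d by simp
qed

text \<open>Integrating the square of f by parts against the coordinate x1, whose derivative is 1,
  leaves the product of x1, 2f and the derivative of f. On the support x1 is at most R in modulus,
  and Cauchy-Schwarz finishes.\<close>

lemma Poincare:
  fixes f :: "real^2 \<Rightarrow> real"
  assumes f: "smooth_on UNIV f" and R: "\<And>x. R < norm x \<Longrightarrow> f x = 0" and R0: "0 \<le> R"
  shows "sqrt (\<integral>x. (f x)\<^sup>2 \<partial>lborel) \<le> 2 * R * sqrt (\<integral>x. (partial_deriv 1 f x)\<^sup>2 \<partial>lborel)"
proof -
  let ?A = "\<integral>x. (f x)\<^sup>2 \<partial>lborel" and ?B = "\<integral>x. (partial_deriv 1 f x)\<^sup>2 \<partial>lborel"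
  have R1: "partial_deriv 1 f y = 0" if "R < norm y" for y by (rule partial_deriv_support[OF R that])
  have X: "smooth_on UNIV (\<lambda>x::real^2. x $ 1)" "partial_deriv 1 (\<lambda>x::real^2. x $ 1) x = 1" for x
  proof -
    have "smooth1 (\<lambda>t. t)" using smooth1_iff_deriv[of "\<lambda>t. t" "\<lambda>_. 1"] smooth1_const by auto
    then show "smooth_on UNIV (\<lambda>x::real^2. x $ 1)"
      using smooth_tens[of "\<lambda>t. t" "\<lambda>_. 1"] smooth1_const by (simp add: tens_def[abs_def])
    show "partial_deriv 1 (\<lambda>x::real^2. x $ 1) x = 1"
      using partial_deriv_eq[OF bounded_linear.has_derivative[OF bounded_linear_vec_nth has_derivative_ident], of 1 1 x]
      by (simp add: axis_def)
  qed
  have ff: "smooth_on UNIV (\<lambda>x. f x * f x)" by (rule smooth_mult[OF f f])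
  have pff: "partial_deriv 1 (\<lambda>x. f x * f x) x = 2 * f x * partial_deriv 1 f x" for x
    using partial_deriv_mult[OF smooth_differentiable[OF f] smooth_differentiable[OF f]] by simp
  have cf: "continuous_on UNIV f" "continuous_on UNIV (partial_deriv 1 f)" by (intro smooth_continuous smooth_partial_deriv f)+
  have m: "f \<in> borel_measurable borel" "partial_deriv 1 f \<in> borel_measurable borel"
    using cf by (auto intro: borel_measurable_continuous_onI)
  have i: "integrable lborel (\<lambda>x. (f x)\<^sup>2)" "integrable lborel (\<lambda>x. (partial_deriv 1 f x)\<^sup>2)"
    by (rule integrable_continuous_support[of _ R]; auto intro!: continuous_intros cf simp: R R1)+
  have cs: "integrable lborel (\<lambda>x. \<bar>f x\<bar> * \<bar>partial_deriv 1 f x\<bar>)"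
      "(\<integral>x. \<bar>f x\<bar> * \<bar>partial_deriv 1 f x\<bar> \<partial>lborel) \<le> sqrt ?A * sqrt ?B"
    using Cauchy_Schwarz_integral_norm[of f lborel "partial_deriv 1 f"] i m by auto
  have "(\<integral>x. x $ 1 * partial_deriv 1 (\<lambda>x. f x * f x) x \<partial>lborel) =
      - (\<integral>x. partial_deriv 1 (\<lambda>x::real^2. x $ 1) x * (f x * f x) \<partial>lborel)"
    by (rule integration_by_parts'[OF X(1) ff, of R]) (use R in auto)
  then have "?A = - (\<integral>x. x $ 1 * (2 * f x * partial_deriv 1 f x) \<partial>lborel)"
    by (simp add: X(2) pff power2_eq_square)
  then have "?A \<le> (\<integral>x. \<bar>x $ 1 * (2 * f x * partial_deriv 1 f x)\<bar> \<partial>lborel)"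
    using integral_abs_bound[of lborel "\<lambda>x. x $ 1 * (2 * f x * partial_deriv 1 f x)"] by linarith
  also have "\<dots> \<le> (\<integral>x. 2 * R * (\<bar>f x\<bar> * \<bar>partial_deriv 1 f x\<bar>) \<partial>lborel)"
  proof (rule integral_mono')
    show "integrable lborel (\<lambda>x. 2 * R * (\<bar>f x\<bar> * \<bar>partial_deriv 1 f x\<bar>))" using cs(1) by simp
    show "\<bar>x $ 1 * (2 * f x * partial_deriv 1 f x)\<bar> \<le> 2 * R * (\<bar>f x\<bar> * \<bar>partial_deriv 1 f x\<bar>)" for x
    proof (cases "R < norm x")
      case False
      then have "\<bar>x $ 1\<bar> \<le> R" using component_le_norm_cart[of x 1] by linarith
      then have "\<bar>x $ 1\<bar> * (2 * (\<bar>f x\<bar> * \<bar>partial_deriv 1 f x\<bar>)) \<le> R * (2 * (\<bar>f x\<bar> * \<bar>partial_deriv 1 f x\<bar>))"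
        by (rule mult_right_mono) simp
      then show ?thesis by (simp add: abs_mult algebra_simps)
    qed (simp add: R)
    show "0 \<le> 2 * R * (\<bar>f x\<bar> * \<bar>partial_deriv 1 f x\<bar>)" for x using R0 by simp
  qed
  also have "\<dots> \<le> 2 * R * (sqrt ?A * sqrt ?B)" using cs(2) R0 by (simp add: mult_left_mono)
  finally have "sqrt ?A * sqrt ?A \<le> (2 * R * sqrt ?B) * sqrt ?A" by (simp add: algebra_simps)
  moreover have "0 \<le> sqrt ?A" "0 \<le> 2 * R * sqrt ?B" using R0 by simp_all
  ultimately show ?thesis by (metis mult_right_le_imp_le order_le_less)
qed

section \<open>Test functions\<close>

lemma test_functionsD:
  assumes "\<phi> \<in> test_functions \<omega>"
  shows test_smooth: "smooth_on UNIV \<phi>"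
    and test_compact: "compact (closure {x. \<phi> x \<noteq> 0})" "closure {x. \<phi> x \<noteq> 0} \<subseteq> \<omega>"
  using assms by (auto simp: test_functions_def)

lemma test_functionsI:
  assumes "smooth_on UNIV \<phi>" "compact K" "K \<subseteq> \<omega>" "\<And>x. x \<notin> K \<Longrightarrow> \<phi> x = 0"
  shows "\<phi> \<in> test_functions \<omega>"
proof -
  have "closure {x. \<phi> x \<noteq> 0} \<subseteq> K"
    using assms(4) by (intro closure_minimal) (auto intro: compact_imp_closed[OF assms(2)])
  moreover from this have "compact (closure {x. \<phi> x \<noteq> 0})"
    using assms(2) by (metis closed_closure compact_Int_closed inf.absorb2)
  ultimately show ?thesis using assms by (auto simp: test_functions_def)
qed

lemma test_zero: "\<phi> \<in> test_functions \<omega> \<Longrightarrow> x \<notin> \<omega> \<Longrightarrow> \<phi> x = 0"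
  using test_compact(2)[of \<phi> \<omega>] closure_subset[of "{x. \<phi> x \<noteq> 0}"] by blast

lemma test_bounded_support:
  assumes "\<phi> \<in> test_functions \<omega>"
  obtains R where "0 < R" "\<And>x. R < norm x \<Longrightarrow> \<phi> x = 0"
proof -
  obtain R where R: "0 < R" "\<forall>x\<in>closure {x. \<phi> x \<noteq> 0}. norm x \<le> R"
    using compact_imp_bounded[OF test_compact(1)[OF assms]] by (auto simp: bounded_pos)
  have "\<phi> x = 0" if "R < norm x" for x
    using R(2) that closure_subset[of "{x. \<phi> x \<noteq> 0}"] by force
  then show ?thesis by (rule that[OF R(1)])
qed

lemma test_partial_deriv:
  assumes "\<phi> \<in> test_functions \<omega>"
  shows "partial_deriv i \<phi> \<in> test_functions \<omega>"
proof (rule test_functionsI[OF smooth_partial_deriv[OF test_smooth[OF assms]] test_compact[OF assms]])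
  fix x assume "x \<notin> closure {x. \<phi> x \<noteq> 0}"
  then show "partial_deriv i \<phi> x = 0"
    using closure_subset[of "{x. \<phi> x \<noteq> 0}"] by (intro partial_deriv_0_open[of "- closure {x. \<phi> x \<noteq> 0}"]) blast+
qed

lemma test_partial_derivs: "\<phi> \<in> test_functions \<omega> \<Longrightarrow> partial_derivs is \<phi> \<in> test_functions \<omega>"
  by (induction "is") (auto intro: test_partial_deriv)

lemma test_bounded:
  assumes "\<phi> \<in> test_functions \<omega>"
  obtains C where "0 < C" "\<And>x. norm (\<phi> x) \<le> C"
proof -
  obtain R where "\<And>x. R < norm x \<Longrightarrow> \<phi> x = 0" by (rule test_bounded_support[OF assms]) auto
  then obtain C where "0 < C" "\<And>x. norm (\<phi> x) \<le> C"
    using continuous_bounded_support[OF smooth_continuous[OF test_smooth[OF assms]]] by metis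
  then show ?thesis by (rule that)
qed

lemma borel_imp_lebesgue: "f \<in> borel_measurable borel \<Longrightarrow> f \<in> borel_measurable lebesgue"
  by (rule measurable_completion) simp

lemma sigma_finite_lebesgue: "sigma_finite_measure (lebesgue :: 'a::euclidean_space measure)"
proof
  obtain A :: "'a set set" where "countable A" "A \<subseteq> sets lborel" "\<Union>A = space lborel" "\<forall>a\<in>A. emeasure lborel a \<noteq> \<infinity>"
    using lborel.sigma_finite_countable by auto
  then show "\<exists>A::'a set set. countable A \<and> A \<subseteq> sets lebesgue \<and> \<Union>A = space lebesgue \<and> (\<forall>a\<in>A. emeasure lebesgue a \<noteq> \<infinity>)"
    by (intro exI[of _ A]) (auto simp: emeasure_completion main_part_sets subset_eq)
qed

lemma indicator_scaleR_lebesgue: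
  fixes w :: "'a::euclidean_space \<Rightarrow> 'b::euclidean_space"
  assumes "A \<in> sets lebesgue" "w \<in> borel_measurable lebesgue"
  shows "(\<lambda>x. indicator A x *\<^sub>R w x) \<in> borel_measurable lebesgue"
  by (intro borel_measurable_scaleR borel_measurable_indicator assms)

lemma integrable_cutoff:
  fixes u :: "'a::euclidean_space \<Rightarrow> 'b::euclidean_space" and \<theta> :: "'a \<Rightarrow> real"
  assumes K: "integrable (lebesgue_on K) u" "K \<in> sets lebesgue" and [measurable]: "\<theta> \<in> borel_measurable borel"
    and C: "\<And>x. \<bar>\<theta> x\<bar> \<le> C"
  shows "integrable lebesgue (\<lambda>x. \<theta> x *\<^sub>R (indicator K x *\<^sub>R u x))"
proof -
  have i: "integrable lebesgue (\<lambda>x. indicator K x *\<^sub>R u x)"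
    using K by (simp add: integrable_restrict_space)
  have [measurable]: "\<theta> \<in> borel_measurable lebesgue" by (rule borel_imp_lebesgue) fact
  show ?thesis
  proof (rule Bochner_Integration.integrable_bound[OF integrable_scaleR_right[OF i, of C]])
    show "(\<lambda>x. \<theta> x *\<^sub>R (indicator K x *\<^sub>R u x)) \<in> borel_measurable lebesgue"
      by (intro borel_measurable_scaleR borel_measurable_integrable[OF i]) fact
    show "AE x in lebesgue. norm (\<theta> x *\<^sub>R (indicator K x *\<^sub>R u x)) \<le> norm (C *\<^sub>R (indicator K x *\<^sub>R u x))"
      using C by (intro AE_I2) (auto simp: abs_mult intro!: mult_right_mono order_trans[OF C abs_ge_self])
  qed
qed

definition locally_integrable :: "(real^2) set \<Rightarrow> (real^2 \<Rightarrow> 'b::euclidean_space) \<Rightarrow> bool" where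
  "locally_integrable \<omega> u \<longleftrightarrow> (\<forall>K. compact K \<and> K \<subseteq> \<omega> \<longrightarrow> integrable (lebesgue_on K) u)"

lemma test_mult_integrable:
  assumes \<omega>: "open \<omega>" and u: "locally_integrable \<omega> u" and \<phi>: "\<phi> \<in> test_functions \<omega>"
  shows "integrable (lebesgue_on \<omega>) (\<lambda>x. \<phi> x *\<^sub>R u x)"
proof -
  let ?K = "closure {x. \<phi> x \<noteq> 0}"
  obtain C where C: "\<And>x. \<bar>\<phi> x\<bar> \<le> C" using test_bounded[OF \<phi>] by (metis real_norm_def)
  have "integrable (lebesgue_on ?K) u" using u test_compact[OF \<phi>] by (auto simp: locally_integrable_def)
  then have "integrable lebesgue (\<lambda>x. \<phi> x *\<^sub>R (indicator ?K x *\<^sub>R u x))"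
    using \<phi> by (intro integrable_cutoff[OF _ _ smooth_borel[OF test_smooth[OF \<phi>]] C]) auto
  also have "(\<lambda>x. \<phi> x *\<^sub>R (indicator ?K x *\<^sub>R u x)) = (\<lambda>x. indicator \<omega> x *\<^sub>R (\<phi> x *\<^sub>R u x))"
    using test_zero[OF \<phi>] closure_subset[of "{x. \<phi> x \<noteq> 0}"] by (fastforce simp: indicator_def)
  finally show ?thesis using \<omega> by (simp add: integrable_restrict_space)
qed

section \<open>Fundamental lemma of the calculus of variations\<close>

definition box_cutoff :: "nat \<Rightarrow> real \<Rightarrow> real \<Rightarrow> real \<Rightarrow> real" where
  "box_cutoff n c d t = step (real n * t + (- real n * c - 1)) * step (- real n * t + (real n * d - 1))"

lemma smooth_box_cutoff: "smooth1 (box_cutoff n c d)"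
  unfolding box_cutoff_def[abs_def] by (intro smooth1_mult smooth1_affine smooth_step)

lemma box_cutoff_bounds: "0 \<le> box_cutoff n c d t" "box_cutoff n c d t \<le> 1"
  unfolding box_cutoff_def using step_bounds by (auto intro!: mult_le_one)

lemma box_cutoff_0: "t \<le> c \<or> d \<le> t \<Longrightarrow> box_cutoff n c d t = 0"
proof -
  assume *: "t \<le> c \<or> d \<le> t"
  have "real n * t + (- real n * c - 1) \<le> -1 \<or> - real n * t + (real n * d - 1) \<le> -1"
    using * mult_left_mono[of t c "real n"] mult_left_mono[of d t "real n"] by auto
  then show ?thesis unfolding box_cutoff_def using step_0 by auto
qed

lemma box_cutoff_1:
  assumes "c < t" "t < d"
  shows "\<forall>\<^sub>F n in sequentially. box_cutoff n c d t = 1"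
proof -
  obtain n1 where n1: "2 < real n1 * (t - c)" using ex_less_of_nat_mult[of "t - c" 2] assms by auto
  obtain n2 where n2: "2 < real n2 * (d - t)" using ex_less_of_nat_mult[of "d - t" 2] assms by auto
  have "box_cutoff n c d t = 1" if "max n1 n2 \<le> n" for n
  proof -
    have "real n1 * (t - c) \<le> real n * (t - c)" "real n2 * (d - t) \<le> real n * (d - t)"
      using that assms by (auto intro!: mult_right_mono)
    then have "2 \<le> real n * (t - c)" "2 \<le> real n * (d - t)" using n1 n2 by linarith+
    then show ?thesis unfolding box_cutoff_def by (simp add: step_1 algebra_simps)
  qed
  then show ?thesis unfolding eventually_sequentially by blast
qed

text \<open>A cutoff \<open>box_cutoff n\<close> vanishes outside its interval and equals 1 at
  distance at least 2/n from the end points. The products are therefore test functions that converge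
  pointwise to the indicator of the open box, dominated by u on the closed box.\<close>

lemma integral_box_eq_0:
  fixes u :: "real^2 \<Rightarrow> 'b::euclidean_space"
  assumes \<omega>: "open \<omega>" and u: "locally_integrable \<omega> u"
    and z: "\<And>\<phi>::real^2 \<Rightarrow> real. \<phi> \<in> test_functions \<omega> \<Longrightarrow> (\<integral>x. \<phi> x *\<^sub>R u x \<partial>lebesgue_on \<omega>) = 0"
    and Q: "cbox a b \<subseteq> \<omega>" and sub: "box c d \<subseteq> cbox a b"
  shows "(\<integral>x. indicator (box c d) x *\<^sub>R (indicator (cbox a b) x *\<^sub>R u x) \<partial>lebesgue) = 0"
proof -
  let ?w = "\<lambda>x. indicator (cbox a b) x *\<^sub>R u x"
  have w: "integrable lebesgue ?w"
    using u Q by (simp add: locally_integrable_def integrable_restrict_space[symmetric])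
  define \<theta> where "\<theta> n = tens (box_cutoff n (c $ 1) (d $ 1)) (box_cutoff n (c $ 2) (d $ 2))" for n
  have \<theta>0: "\<theta> n x = 0" if "x \<notin> box c d" for n x
  proof -
    have "x $ 1 \<le> c $ 1 \<or> d $ 1 \<le> x $ 1 \<or> x $ 2 \<le> c $ 2 \<or> d $ 2 \<le> x $ 2"
      using that by (auto simp: mem_box_cart forall_2 not_less)
    then show ?thesis unfolding \<theta>_def tens_def using box_cutoff_0 by (metis mult_zero_left mult_zero_right)
  qed
  have \<theta>1: "\<bar>\<theta> n x\<bar> \<le> 1" for n x
    unfolding \<theta>_def tens_def using box_cutoff_bounds by (auto simp: abs_mult intro!: mult_le_one)
  have \<theta>s: "smooth_on UNIV (\<theta> n)" for n unfolding \<theta>_def by (intro smooth_tens smooth_box_cutoff)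
  have \<theta>t: "\<theta> n \<in> test_functions \<omega>" for n
    by (rule test_functionsI[OF \<theta>s compact_cbox Q]) (use \<theta>0 sub in auto)
  have lim: "(\<lambda>n. \<theta> n x) \<longlonglongrightarrow> indicator (box c d) x" for x
  proof (cases "x \<in> box c d")
    case True
    then have "\<forall>\<^sub>F n in sequentially. box_cutoff n (c $ 1) (d $ 1) (x $ 1) = 1"
      "\<forall>\<^sub>F n in sequentially. box_cutoff n (c $ 2) (d $ 2) (x $ 2) = 1"
      by (auto intro!: box_cutoff_1 simp: mem_box_cart)
    then have "\<forall>\<^sub>F n in sequentially. \<theta> n x = 1" by eventually_elim (simp add: \<theta>_def tens_def)
    then show ?thesis using True by (simp add: tendsto_eventually)
  qed (simp add: \<theta>0)
  have z\<theta>: "(\<integral>x. \<theta> n x *\<^sub>R ?w x \<partial>lebesgue) = 0" for n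
  proof -
    have "(\<lambda>x. indicator \<omega> x *\<^sub>R (\<theta> n x *\<^sub>R u x)) = (\<lambda>x. \<theta> n x *\<^sub>R ?w x)"
      using \<theta>0 sub Q by (fastforce simp: indicator_def)
    then show ?thesis using z[OF \<theta>t[of n]] \<omega> by (simp add: integral_restrict_space)
  qed
  have "(\<lambda>n. \<integral>x. \<theta> n x *\<^sub>R ?w x \<partial>lebesgue) \<longlonglongrightarrow> (\<integral>x. indicator (box c d) x *\<^sub>R ?w x \<partial>lebesgue)"
  proof (rule integral_dominated_convergence[OF _ _ integrable_norm[OF w]])
    show "(\<lambda>x. indicator (box c d) x *\<^sub>R ?w x) \<in> borel_measurable lebesgue"
      by (intro indicator_scaleR_lebesgue borel_measurable_integrable[OF w]) auto
    have "\<theta> n \<in> borel_measurable lebesgue" for n by (rule borel_imp_lebesgue[OF smooth_borel[OF \<theta>s]])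
    then show "(\<lambda>x. \<theta> n x *\<^sub>R ?w x) \<in> borel_measurable lebesgue" for n
      by (intro borel_measurable_scaleR borel_measurable_integrable[OF w])
    show "AE x in lebesgue. (\<lambda>n. \<theta> n x *\<^sub>R ?w x) \<longlonglongrightarrow> indicator (box c d) x *\<^sub>R ?w x"
      using lim by (intro AE_I2 tendsto_intros)
    show "AE x in lebesgue. norm (\<theta> n x *\<^sub>R ?w x) \<le> norm (?w x)" for n
      using \<theta>1 by (intro AE_I2) (auto simp: indicator_def intro: mult_left_le_one_le)
  qed
  then show ?thesis by (simp only: z\<theta> LIMSEQ_const_iff)
qed

text \<open>Dynkin's argument: open boxes are stable under intersection and generate the Borel sets.
  The hypothesis on the total integral serves the complements.\<close>

lemma set_integral_zero_of_boxes:
  fixes w :: "'a::euclidean_space \<Rightarrow> 'b::euclidean_space"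
  assumes w: "integrable lebesgue w" and box: "\<And>c d. set_lebesgue_integral lebesgue (box c d) w = 0"
    and total: "(\<integral>x. w x \<partial>lebesgue) = 0" and A: "A \<in> sets borel"
  shows "set_lebesgue_integral lebesgue A w = 0"
proof -
  let ?G = "range (\<lambda>(a, b). box a b :: 'a set)"
  have sets: "sigma_sets UNIV ?G = sets borel" by (simp add: borel_eq_box)
  have si: "set_integrable lebesgue A w" if "A \<in> sets borel" for A
    unfolding set_integrable_def by (rule integrable_mult_indicator[OF _ w]) (use that in auto)
  have "Int_stable ?G" by (auto simp: Int_stable_def box_Int_box)
  moreover have "?G \<subseteq> Pow UNIV" by simp
  moreover have "A \<in> sigma_sets UNIV ?G" using A sets by simp
  ultimately show ?thesis
  proof (induction rule: sigma_sets_induct_disjoint)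
    case (basic A)
    then show ?case using box by auto
  next
    case empty
    show ?case by (simp add: set_lebesgue_integral_def)
  next
    case (compl A)
    then have A: "A \<in> sets borel" using sets by simp
    have "set_lebesgue_integral lebesgue (UNIV - A) w = (\<integral>x. w x - indicator A x *\<^sub>R w x \<partial>lebesgue)"
      unfolding set_lebesgue_integral_def by (rule Bochner_Integration.integral_cong) (auto simp: indicator_def)
    also have "\<dots> = (\<integral>x. w x \<partial>lebesgue) - set_lebesgue_integral lebesgue A w"
      unfolding set_lebesgue_integral_def
      by (rule Bochner_Integration.integral_diff[OF w si[OF A, unfolded set_integrable_def]])
    finally show ?case using total compl by simp
  next
    case (union A)
    then have A: "A i \<in> sets borel" for i using sets by auto
    have "set_lebesgue_integral lebesgue (\<Union>i. A i) w = (\<Sum>i. set_lebesgue_integral lebesgue (A i) w)"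
    proof (rule lebesgue_integral_countable_add)
      show "A i \<inter> A j = {}" if "i \<noteq> j" for i j
        using union(1) that by (auto simp: disjoint_family_on_def)
      show "set_integrable lebesgue (\<Union>i. A i) w" by (rule si) (use A in auto)
    qed (use A in auto)
    then show ?case using union by simp
  qed
qed

text \<open>On a closed box inside \<omega> the function is integrable, and its integral over every
  measurable set vanishes, first for boxes, then Borel sets, then Lebesgue sets. Countably many such
  boxes exhaust \<omega>.\<close>

lemma fundamental_lemma:
  fixes u :: "real^2 \<Rightarrow> 'b::euclidean_space"
  assumes \<omega>: "open \<omega>" and u: "locally_integrable \<omega> u"
    and z: "\<And>\<phi>::real^2 \<Rightarrow> real. \<phi> \<in> test_functions \<omega> \<Longrightarrow> (\<integral>x. \<phi> x *\<^sub>R u x \<partial>lebesgue_on \<omega>) = 0"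
  shows "AE x in lebesgue. x \<in> \<omega> \<longrightarrow> u x = 0"
proof -
  have box: "AE x in lebesgue. x \<in> cbox a b \<longrightarrow> u x = 0" if Q: "cbox a b \<subseteq> \<omega>" for a b
  proof -
    define w where "w x = indicator (cbox a b) x *\<^sub>R u x" for x
    have w: "integrable lebesgue w"
      using u Q by (simp add: w_def[abs_def] locally_integrable_def integrable_restrict_space[symmetric])
    \<comment> \<open>The approximation result concerns open boxes; the boundary of the closed box
      is negligible.\<close>
    have null: "AE x in lebesgue. x \<notin> cbox a b - box a b"
      by (rule AE_not_in) (simp add: negligible_frontier_interval negligible_iff_null_sets[symmetric])
    have basic: "set_lebesgue_integral lebesgue (box c d) w = 0" for c d
    proof -
      obtain e f where ef: "box c d \<inter> box a b = box e f"
        using box_Int_box[of c d a b] by blast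
      have "set_lebesgue_integral lebesgue (box c d) w = set_lebesgue_integral lebesgue (box e f) w"
        unfolding set_lebesgue_integral_def
      proof (rule integral_cong_AE)
        show "AE x in lebesgue. indicator (box c d) x *\<^sub>R w x = indicator (box e f) x *\<^sub>R w x"
          using null by eventually_elim (auto simp: ef[symmetric] w_def indicator_def)
      qed (use w in \<open>auto intro!: indicator_scaleR_lebesgue\<close>)
      also have "\<dots> = 0"
        unfolding set_lebesgue_integral_def w_def
        by (rule integral_box_eq_0[OF \<omega> u z Q]) (use ef box_subset_cbox in blast)+
      finally show ?thesis .
    qed
    have total: "(\<integral>x. w x \<partial>lebesgue) = 0"
    proof -
      have "(\<integral>x. w x \<partial>lebesgue) = set_lebesgue_integral lebesgue (box a b) w"
        unfolding set_lebesgue_integral_def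
      proof (rule integral_cong_AE)
        show "AE x in lebesgue. w x = indicator (box a b) x *\<^sub>R w x"
          using null by eventually_elim (auto simp: w_def indicator_def)
      qed (use w in \<open>auto intro!: indicator_scaleR_lebesgue\<close>)
      then show ?thesis using basic by simp
    qed
    have borel: "set_lebesgue_integral lebesgue A w = 0" if "A \<in> sets borel" for A
      by (rule set_integral_zero_of_boxes[OF w basic total that])
    have "AE x in lebesgue. w x = 0"
    proof (rule sigma_finite_measure.density_zero[OF sigma_finite_lebesgue w])
      fix A assume "A \<in> sets (lebesgue :: (real^2) measure)"
      \<comment> \<open>A Lebesgue set differs from a Borel set by a null set.\<close>
      then obtain S N N' where A: "A = S \<union> N" "N \<subseteq> N'" "N' \<in> null_sets lborel" "S \<in> sets lborel"
        by (rule sets_completionE)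
      have AN: "AE x in lebesgue. x \<notin> N'" by (rule AE_completion[OF AE_not_in[OF A(3)]])
      have "set_lebesgue_integral lebesgue A w = set_lebesgue_integral lebesgue S w"
        unfolding set_lebesgue_integral_def
      proof (rule integral_cong_AE)
        show "AE x in lebesgue. indicator A x *\<^sub>R w x = indicator S x *\<^sub>R w x"
          using AN by eventually_elim (use A in \<open>auto simp: indicator_def\<close>)
      qed (use w \<open>A \<in> sets lebesgue\<close> A(4) in \<open>auto intro!: indicator_scaleR_lebesgue\<close>)
      then show "set_lebesgue_integral lebesgue A w = 0" using borel A(4) by simp
    qed
    then show ?thesis by eventually_elim (auto simp: w_def)
  qed
  obtain D where D: "countable D" "D \<subseteq> Pow \<omega>" "\<And>X. X \<in> D \<Longrightarrow> \<exists>a b. X = cbox a b" "\<Union>D = \<omega>"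
    by (rule open_countable_Union_open_cbox[OF \<omega>]) blast
  have "AE x in lebesgue. x \<in> X \<longrightarrow> u x = 0" if "X \<in> D" for X
  proof -
    obtain a b where "X = cbox a b" using D(3) \<open>X \<in> D\<close> by blast
    then show ?thesis using box[of a b] D(2) \<open>X \<in> D\<close> by auto
  qed
  then have "AE x in lebesgue. \<forall>X\<in>D. x \<in> X \<longrightarrow> u x = 0"
    unfolding AE_ball_countable[OF D(1)] by blast
  then show ?thesis using D(4) by (auto elim: eventually_mono)
qed

lemma partial_derivs_linear:
  assumes L: "bounded_linear L" and f: "smooth_on UNIV f"
  shows "partial_derivs is (\<lambda>x. L (f x)) = (\<lambda>x. L (partial_derivs is f x))"
proof (induction "is")
  case (Cons i "is")
  then show ?case
    using partial_deriv_linear[OF L smooth_differentiable[OF smooth_partial_derivs[OF f]]] by (auto intro!: ext)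
qed simp

section \<open>Sobolev spaces\<close>

text \<open>Nothing is said about the boundary, so that the L2 theory can also be instantiated with
  large balls containing the supports of potentials and their translates.\<close>

locale planar_domain =
  fixes \<omega> :: "(real^2) set"
  assumes open_\<omega>: "open \<omega>" and bounded_\<omega>: "bounded \<omega>"
begin

abbreviation \<mu> :: "(real^2) measure" where "\<mu> \<equiv> lebesgue_on \<omega>"

lemma \<omega>_sets [simp]: "\<omega> \<in> sets borel" "\<omega> \<in> sets lebesgue" using open_\<omega> by auto

lemma AE_\<mu>: "(AE x in \<mu>. P x) \<longleftrightarrow> (AE x in lebesgue. x \<in> \<omega> \<longrightarrow> P x)"
  by (rule AE_restrict_space_iff) simp

lemma measurable_\<mu>:
  fixes f :: "real^2 \<Rightarrow> 'b::euclidean_space"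
  shows "f \<in> borel_measurable \<mu> \<longleftrightarrow> (\<lambda>x. indicator \<omega> x *\<^sub>R f x) \<in> borel_measurable lebesgue"
  by (rule borel_measurable_restrict_space_iff) simp

lemma borel_imp_\<mu>: "f \<in> borel_measurable borel \<Longrightarrow> f \<in> borel_measurable \<mu>"
  by (intro measurable_restrict_space1 borel_imp_lebesgue)

lemma measurable_\<mu>_AE:
  fixes f g :: "real^2 \<Rightarrow> 'b::euclidean_space"
  assumes "f \<in> borel_measurable \<mu>" "AE x in \<mu>. f x = g x"
  shows "g \<in> borel_measurable \<mu>"
  unfolding measurable_\<mu>
  by (rule borel_measurable_AE[OF assms(1)[unfolded measurable_\<mu>]])
     (use assms(2) in \<open>auto simp: AE_\<mu> indicator_def elim: eventually_mono\<close>)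

lemma finite_measure_\<mu>: "finite_measure \<mu>"
proof
  have "emeasure lebesgue \<omega> < \<infinity>"
    using emeasure_bounded_finite[OF bounded_\<omega>] by (simp add: emeasure_completion)
  then show "emeasure \<mu> (space \<mu>) \<noteq> \<infinity>" by (simp add: emeasure_restrict_space space_restrict_space)
qed

lemma integrable_const_\<mu> [simp]: "integrable \<mu> (\<lambda>x. c :: real)"
  using finite_measure.integrable_const[OF finite_measure_\<mu>] .

lemma integrable_bounded_\<mu>:
  fixes f :: "real^2 \<Rightarrow> 'b::euclidean_space"
  assumes "f \<in> borel_measurable \<mu>" "AE x in \<mu>. norm (f x) \<le> C"
  shows "integrable \<mu> f"
  by (rule Bochner_Integration.integrable_bound[OF integrable_const_\<mu>[of C] assms(1)])
     (use assms(2) in \<open>auto elim!: eventually_mono\<close>)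

section \<open>Square integrable functions on the domain\<close>

lemma L2D:
  assumes "f \<in> L2 \<omega>"
  shows L2_measurable: "f \<in> borel_measurable \<mu>" and L2_integrable2: "integrable \<mu> (\<lambda>x. (norm (f x))\<^sup>2)"
  using assms by (auto simp: L2_def)

lemma L2_norm_nonneg [simp]: "0 \<le> L2_norm \<omega> f"
  by (simp add: L2_norm_def)

lemma L2_norm_square: "(L2_norm \<omega> f)\<^sup>2 = (\<integral>x. (norm (f x))\<^sup>2 \<partial>\<mu>)"
  by (simp add: L2_norm_def)

lemma L2_norm_cong_AE:
  fixes f g :: "real^2 \<Rightarrow> 'b::euclidean_space"
  assumes "f \<in> borel_measurable \<mu>" "AE x in \<mu>. f x = g x"
  shows "L2_norm \<omega> f = L2_norm \<omega> g"
proof -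
  have "g \<in> borel_measurable \<mu>" by (rule measurable_\<mu>_AE[OF assms])
  then show ?thesis unfolding L2_norm_def using assms
    by (intro arg_cong[of _ _ sqrt] integral_cong_AE) (auto elim: eventually_mono)
qed

lemma L2_AE:
  fixes f g :: "real^2 \<Rightarrow> 'b::euclidean_space"
  assumes f: "f \<in> L2 \<omega>" and ae: "AE x in \<mu>. f x = g x"
  shows "g \<in> L2 \<omega>"
proof -
  have g: "g \<in> borel_measurable \<mu>" by (rule measurable_\<mu>_AE[OF L2_measurable[OF f] ae])
  moreover have "integrable \<mu> (\<lambda>x. (norm (g x))\<^sup>2)"
    using L2_integrable2[OF f]
    by (rule integrable_cong_AE_imp) (use g ae in \<open>auto elim: eventually_mono\<close>)
  ultimately show ?thesis by (simp add: L2_def)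
qed

lemma L2_bounded:
  fixes f :: "real^2 \<Rightarrow> 'b::euclidean_space"
  assumes "f \<in> borel_measurable \<mu>" "\<And>x. x \<in> \<omega> \<Longrightarrow> norm (f x) \<le> C"
  shows "f \<in> L2 \<omega>"
proof -
  have "integrable \<mu> (\<lambda>x. (norm (f x))\<^sup>2)"
  proof (rule integrable_bounded_\<mu>[of _ "C\<^sup>2"])
    show "AE x in \<mu>. norm ((norm (f x))\<^sup>2) \<le> C\<^sup>2"
      unfolding AE_\<mu> using assms(2) by (intro AE_I2) (auto intro!: power_mono)
  qed (use assms in auto)
  then show ?thesis using assms by (simp add: L2_def)
qed

lemma L2_Cauchy_Schwarz:
  assumes "f \<in> L2 \<omega>" "g \<in> L2 \<omega>"
  shows "integrable \<mu> (\<lambda>x. f x \<bullet> g x)" "\<bar>\<integral>x. f x \<bullet> g x \<partial>\<mu>\<bar> \<le> L2_norm \<omega> f * L2_norm \<omega> g"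
  using Cauchy_Schwarz_integral_inner[of f \<mu> g] assms by (auto simp: L2D L2_norm_def)

lemma L2_norm_Cauchy_Schwarz:
  assumes "f \<in> L2 \<omega>" "g \<in> L2 \<omega>"
  shows "integrable \<mu> (\<lambda>x. norm (f x) * norm (g x))"
    and "(\<integral>x. norm (f x) * norm (g x) \<partial>\<mu>) \<le> L2_norm \<omega> f * L2_norm \<omega> g"
  using Cauchy_Schwarz_integral_norm[of f \<mu> g] assms by (auto simp: L2D L2_norm_def)

lemma L2_add:
  assumes f: "f \<in> L2 \<omega>" and g: "g \<in> L2 \<omega>"
  shows "(\<lambda>x. f x + g x) \<in> L2 \<omega>" "L2_norm \<omega> (\<lambda>x. f x + g x) \<le> L2_norm \<omega> f + L2_norm \<omega> g"
proof -
  have eq: "(norm (f x + g x))\<^sup>2 = (norm (f x))\<^sup>2 + 2 * (f x \<bullet> g x) + (norm (g x))\<^sup>2" for x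
    unfolding power2_norm_eq_inner by (simp add: inner_add_left inner_add_right inner_commute)
  have i: "integrable \<mu> (\<lambda>x. (norm (f x))\<^sup>2)" "integrable \<mu> (\<lambda>x. (norm (g x))\<^sup>2)" "integrable \<mu> (\<lambda>x. f x \<bullet> g x)"
    using L2_Cauchy_Schwarz(1)[OF f g] f g by (auto simp: L2D)
  then have "integrable \<mu> (\<lambda>x. (norm (f x + g x))\<^sup>2)" unfolding eq by auto
  then show "(\<lambda>x. f x + g x) \<in> L2 \<omega>" using f g by (auto simp: L2_def)
  have "(L2_norm \<omega> (\<lambda>x. f x + g x))\<^sup>2 = (L2_norm \<omega> f)\<^sup>2 + 2 * (\<integral>x. f x \<bullet> g x \<partial>\<mu>) + (L2_norm \<omega> g)\<^sup>2"
    unfolding L2_norm_square eq using i by simp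
  also have "\<dots> \<le> (L2_norm \<omega> f)\<^sup>2 + 2 * (L2_norm \<omega> f * L2_norm \<omega> g) + (L2_norm \<omega> g)\<^sup>2"
    using L2_Cauchy_Schwarz(2)[OF f g] by simp
  also have "\<dots> = (L2_norm \<omega> f + L2_norm \<omega> g)\<^sup>2" by (simp add: power2_sum)
  finally show "L2_norm \<omega> (\<lambda>x. f x + g x) \<le> L2_norm \<omega> f + L2_norm \<omega> g"
    by (rule power2_le_imp_le) simp
qed

lemma L2_scaleR:
  assumes f: "f \<in> L2 \<omega>"
  shows "(\<lambda>x. c *\<^sub>R f x) \<in> L2 \<omega>" "L2_norm \<omega> (\<lambda>x. c *\<^sub>R f x) = \<bar>c\<bar> * L2_norm \<omega> f"
  using f by (auto simp: L2_def L2_norm_def power_mult_distrib real_sqrt_mult)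

lemma L2_diff:
  assumes f: "f \<in> L2 \<omega>" and g: "g \<in> L2 \<omega>"
  shows "(\<lambda>x. f x - g x) \<in> L2 \<omega>" "L2_norm \<omega> (\<lambda>x. f x - g x) \<le> L2_norm \<omega> f + L2_norm \<omega> g"
  using L2_add[OF f L2_scaleR(1)[OF g, of "-1"]] L2_scaleR(2)[OF g, of "-1"] by auto

lemma L2_integrable: "f \<in> L2 \<omega> \<Longrightarrow> integrable \<mu> f"
proof -
  assume f: "f \<in> L2 \<omega>"
  have "(\<lambda>x. 1::real) \<in> L2 \<omega>" by (rule L2_bounded[of _ 1]) auto
  from L2_norm_Cauchy_Schwarz(1)[OF f this] show ?thesis
    using L2_measurable[OF f] by (simp add: integrable_norm_iff)
qed

lemma L2_locally_integrable:
  assumes "f \<in> L2 \<omega>" shows "locally_integrable \<omega> f"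
  unfolding locally_integrable_def
proof (intro allI impI)
  fix K assume K: "compact K \<and> K \<subseteq> \<omega>"
  have "integrable lebesgue (\<lambda>x. indicator \<omega> x *\<^sub>R f x)"
    using L2_integrable[OF assms] by (simp add: integrable_restrict_space)
  from integrable_mult_indicator[OF _ this, of K]
  have "integrable lebesgue (\<lambda>x. indicator K x *\<^sub>R (indicator \<omega> x *\<^sub>R f x))"
    using K lmeasurable_compact fmeasurableD by blast
  moreover have "(\<lambda>x. indicator K x *\<^sub>R (indicator \<omega> x *\<^sub>R f x)) = (\<lambda>x. indicator K x *\<^sub>R f x)"
    by (intro ext) (use K in \<open>auto simp: indicator_def of_bool_def\<close>)
  moreover have "K \<in> sets lebesgue" using K lmeasurable_compact fmeasurableD by blast
  ultimately show "integrable (lebesgue_on K) f" by (simp add: integrable_restrict_space)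
qed

lemma locally_integrable_diff:
  "locally_integrable \<omega> f \<Longrightarrow> locally_integrable \<omega> g \<Longrightarrow> locally_integrable \<omega> (\<lambda>x. f x - g x)"
  by (auto simp: locally_integrable_def)

lemma smooth_L2:
  assumes "smooth_on UNIV f" shows "f \<in> L2 \<omega>"
proof -
  have "compact (f ` closure \<omega>)"
    using bounded_\<omega> by (intro compact_continuous_image smooth_continuous assms) auto
  then obtain C where "\<forall>y\<in>f ` closure \<omega>. norm y \<le> C" by (auto dest!: compact_imp_bounded simp: bounded_iff)
  then have "norm (f x) \<le> C" if "x \<in> \<omega>" for x using that closure_subset[of \<omega>] by auto
  then show ?thesis by (rule L2_bounded[OF borel_imp_\<mu>[OF smooth_borel[OF assms]]])
qed

lemma test_integral:
  fixes f :: "real^2 \<Rightarrow> 'b::euclidean_space"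
  assumes "f \<in> borel_measurable borel" "\<And>x. x \<notin> \<omega> \<Longrightarrow> f x = 0"
  shows "integral\<^sup>L \<mu> f = (\<integral>x. f x \<partial>lborel)" "integrable \<mu> f \<longleftrightarrow> integrable lborel f"
proof -
  have "(\<lambda>x. indicator \<omega> x *\<^sub>R f x) = f" using assms(2) by (auto simp: indicator_def)
  then show "integral\<^sup>L \<mu> f = (\<integral>x. f x \<partial>lborel)" "integrable \<mu> f \<longleftrightarrow> integrable lborel f"
    using integral_lebesgue_on[of \<omega> f] assms(1) by auto
qed

section \<open>Weak derivatives\<close>

lemma is_weak_deriv_iff:
  "is_weak_deriv \<omega> is u g \<longleftrightarrow> locally_integrable \<omega> u \<and> locally_integrable \<omega> g \<and>
     (\<forall>\<phi> :: real^2 \<Rightarrow> real. \<phi> \<in> test_functions \<omega> \<longrightarrow>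
        (\<integral>x. partial_derivs is \<phi> x *\<^sub>R u x \<partial>\<mu>) = (- 1) ^ length is *\<^sub>R (\<integral>x. \<phi> x *\<^sub>R g x \<partial>\<mu>))"
  unfolding is_weak_deriv_def locally_integrable_def by blast

lemma is_weak_deriv_diff:
  assumes u: "is_weak_deriv \<omega> is u g" and v: "is_weak_deriv \<omega> is v h"
  shows "is_weak_deriv \<omega> is (\<lambda>x. u x - v x) (\<lambda>x. g x - h x)"
  unfolding is_weak_deriv_iff
proof (intro conjI allI impI)
  have li: "locally_integrable \<omega> u" "locally_integrable \<omega> g" "locally_integrable \<omega> v" "locally_integrable \<omega> h"
    using u v by (auto simp: is_weak_deriv_iff)
  then show "locally_integrable \<omega> (\<lambda>x. u x - v x)" "locally_integrable \<omega> (\<lambda>x. g x - h x)"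
    by (auto intro: locally_integrable_diff)
  fix \<phi> :: "real^2 \<Rightarrow> real" assume \<phi>: "\<phi> \<in> test_functions \<omega>"
  note t = test_mult_integrable[OF open_\<omega> li(2) \<phi>] test_mult_integrable[OF open_\<omega> li(4) \<phi>]
    test_mult_integrable[OF open_\<omega> li(1) test_partial_derivs[OF \<phi>, of "is"]]
    test_mult_integrable[OF open_\<omega> li(3) test_partial_derivs[OF \<phi>, of "is"]]
  show "(\<integral>x. partial_derivs is \<phi> x *\<^sub>R (u x - v x) \<partial>\<mu>) =
      (- 1) ^ length is *\<^sub>R (\<integral>x. \<phi> x *\<^sub>R (g x - h x) \<partial>\<mu>)"
    using u v \<phi> t by (simp add: scaleR_diff_right is_weak_deriv_iff)
qed

text \<open>\<open>weak_deriv\<close> is an arbitrary choice; this lemma allows replacing it by any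
  concrete weak derivative, up to null sets.\<close>

lemma is_weak_deriv_unique:
  assumes g: "is_weak_deriv \<omega> is u g" and h: "is_weak_deriv \<omega> is u h"
  shows "AE x in \<mu>. g x = h x"
proof -
  have li: "locally_integrable \<omega> g" "locally_integrable \<omega> h" using g h by (auto simp: is_weak_deriv_iff)
  have "(\<integral>x. \<phi> x *\<^sub>R (g x - h x) \<partial>\<mu>) = 0" if \<phi>: "\<phi> \<in> test_functions \<omega>" for \<phi> :: "real^2 \<Rightarrow> real"
  proof -
    have "(- 1) ^ length is *\<^sub>R (\<integral>x. \<phi> x *\<^sub>R g x \<partial>\<mu>) = (- 1) ^ length is *\<^sub>R (\<integral>x. \<phi> x *\<^sub>R h x \<partial>\<mu>)"
      using g h \<phi> by (simp add: is_weak_deriv_iff)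
    then show ?thesis
      using test_mult_integrable[OF open_\<omega> li(1) \<phi>] test_mult_integrable[OF open_\<omega> li(2) \<phi>] by (simp add: scaleR_diff_right)
  qed
  from fundamental_lemma[OF open_\<omega> locally_integrable_diff[OF li] this]
  show ?thesis unfolding AE_\<mu> by (auto elim: eventually_mono)
qed

lemma test_integration_by_parts:
  fixes u :: "real^2 \<Rightarrow> 'b::euclidean_space"
  assumes \<psi>: "\<psi> \<in> test_functions \<omega>" and u: "smooth_on UNIV u"
  shows "(\<integral>x. partial_deriv i \<psi> x *\<^sub>R u x \<partial>\<mu>) = - (\<integral>x. \<psi> x *\<^sub>R partial_deriv i u x \<partial>\<mu>)"
proof (rule euclidean_eqI)
  fix b :: 'b assume b: "b \<in> Basis"
  have su: "smooth_on UNIV (\<lambda>x. u x \<bullet> b)" by (rule smooth_linear[OF bounded_linear_inner_left u])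
  have pu: "partial_deriv i (\<lambda>x. u x \<bullet> b) x = partial_deriv i u x \<bullet> b" for x
    by (rule partial_deriv_linear[OF bounded_linear_inner_left smooth_differentiable[OF u]])
  have t: "integrable \<mu> (\<lambda>x. partial_deriv i \<psi> x *\<^sub>R u x)" "integrable \<mu> (\<lambda>x. \<psi> x *\<^sub>R partial_deriv i u x)"
    using test_mult_integrable[OF open_\<omega> L2_locally_integrable[OF smooth_L2]] \<psi> u test_partial_deriv[OF \<psi>] smooth_partial_deriv[OF u]
    by auto
  obtain R where R: "\<And>x. R < norm x \<Longrightarrow> \<psi> x = 0" by (rule test_bounded_support[OF \<psi>]) auto
  have m: "(\<lambda>x. partial_deriv i \<psi> x * (u x \<bullet> b)) \<in> borel_measurable borel" "(\<lambda>x. \<psi> x * (partial_deriv i u x \<bullet> b)) \<in> borel_measurable borel"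
    by (intro borel_measurable_times smooth_borel smooth_partial_deriv test_smooth[OF \<psi>] su borel_measurable_inner u borel_measurable_const)+
  have "(\<integral>x. \<psi> x * partial_deriv i (\<lambda>x. u x \<bullet> b) x \<partial>lborel) = - (\<integral>x. partial_deriv i \<psi> x * (u x \<bullet> b) \<partial>lborel)"
    by (rule integration_by_parts'[OF test_smooth[OF \<psi>] su, of R]) (use R in auto)
  then have "(\<integral>x. partial_deriv i \<psi> x * (u x \<bullet> b) \<partial>\<mu>) = - (\<integral>x. \<psi> x * (partial_deriv i u x \<bullet> b) \<partial>\<mu>)"
    using test_integral(1)[OF m(1)] test_integral(1)[OF m(2)] test_zero[OF \<psi>] test_zero[OF test_partial_deriv[OF \<psi>]]
    by (simp add: pu)
  then show "(\<integral>x. partial_deriv i \<psi> x *\<^sub>R u x \<partial>\<mu>) \<bullet> b = - (\<integral>x. \<psi> x *\<^sub>R partial_deriv i u x \<partial>\<mu>) \<bullet> b"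
    using t by (simp add: integral_inner_left[symmetric])
qed

text \<open>Integration by parts removes the outermost derivative of the test function first, and it
  becomes the innermost derivative on u. This is the origin of \<open>rev\<close>.\<close>

lemma is_weak_deriv_smooth:
  fixes u :: "real^2 \<Rightarrow> 'b::euclidean_space"
  assumes u: "smooth_on UNIV u"
  shows "is_weak_deriv \<omega> is u (partial_derivs (rev is) u)"
proof -
  have "(\<integral>x. partial_derivs is \<phi> x *\<^sub>R u x \<partial>\<mu>) = (- 1) ^ length is *\<^sub>R (\<integral>x. \<phi> x *\<^sub>R partial_derivs (rev is) u x \<partial>\<mu>)"
    if \<phi>: "\<phi> \<in> test_functions \<omega>" for \<phi> :: "real^2 \<Rightarrow> real"
    using u
  proof (induction "is" arbitrary: u)
    case (Cons i "is")
    show ?case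
      using test_integration_by_parts[OF test_partial_derivs[OF \<phi>] Cons.prems, of i "is"]
        Cons.IH[OF smooth_partial_deriv[OF Cons.prems, of i]] by (simp add: partial_derivs_snoc)
  qed simp
  then show ?thesis
    using L2_locally_integrable[OF smooth_L2[OF u]] L2_locally_integrable[OF smooth_L2[OF smooth_partial_derivs[OF u]]]
    by (auto simp: is_weak_deriv_iff)
qed

lemma smooth_W2:
  assumes u: "smooth_on UNIV u" shows "u \<in> W2 k \<omega>"
  unfolding W2_def using is_weak_deriv_smooth[OF u] smooth_L2[OF smooth_partial_derivs[OF u]] by blast

lemma W2_weak_deriv:
  assumes u: "u \<in> W2 k \<omega>" and l: "length is \<le> k"
  shows weak_deriv_is: "is_weak_deriv \<omega> is u (weak_deriv \<omega> is u)" and weak_deriv_L2: "weak_deriv \<omega> is u \<in> L2 \<omega>"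
proof -
  obtain g where g: "g \<in> L2 \<omega>" "is_weak_deriv \<omega> is u g" using u l by (auto simp: W2_def)
  show w: "is_weak_deriv \<omega> is u (weak_deriv \<omega> is u)"
    unfolding weak_deriv_def by (rule someI[of _ g]) (rule g)
  show "weak_deriv \<omega> is u \<in> L2 \<omega>"
    by (rule L2_AE[OF g(1) is_weak_deriv_unique[OF g(2) w]])
qed

lemma weak_deriv_smooth:
  assumes u: "smooth_on UNIV u"
  shows "AE x in \<mu>. weak_deriv \<omega> is u x = partial_derivs (rev is) u x"
    and "L2_norm \<omega> (weak_deriv \<omega> is u) = L2_norm \<omega> (partial_derivs (rev is) u)"
proof -
  have w: "u \<in> W2 (length is) \<omega>" by (rule smooth_W2[OF u])
  show ae: "AE x in \<mu>. weak_deriv \<omega> is u x = partial_derivs (rev is) u x"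
    by (rule is_weak_deriv_unique[OF weak_deriv_is[OF w order_refl] is_weak_deriv_smooth[OF u]])
  show "L2_norm \<omega> (weak_deriv \<omega> is u) = L2_norm \<omega> (partial_derivs (rev is) u)"
    by (rule L2_norm_cong_AE[OF L2_measurable[OF weak_deriv_L2[OF w order_refl]] ae])
qed

lemma W2_L2:
  assumes u: "u \<in> W2 k \<omega>"
  shows "u \<in> L2 \<omega>" "AE x in \<mu>. weak_deriv \<omega> [] u x = u x"
proof -
  have w: "is_weak_deriv \<omega> [] u (weak_deriv \<omega> [] u)" "weak_deriv \<omega> [] u \<in> L2 \<omega>"
    using W2_weak_deriv[OF u, of "[]"] by auto
  then have "is_weak_deriv \<omega> [] u u" by (simp add: is_weak_deriv_iff)
  from is_weak_deriv_unique[OF w(1) this] show ae: "AE x in \<mu>. weak_deriv \<omega> [] u x = u x" .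
  show "u \<in> L2 \<omega>" by (rule L2_AE[OF w(2) ae])
qed

lemma W2_diff:
  assumes u: "u \<in> W2 k \<omega>" and v: "v \<in> W2 k \<omega>"
  shows "(\<lambda>x. u x - v x) \<in> W2 k \<omega>"
    and "length is \<le> k \<Longrightarrow> AE x in \<mu>. weak_deriv \<omega> is (\<lambda>x. u x - v x) x = weak_deriv \<omega> is u x - weak_deriv \<omega> is v x"
proof -
  have d: "is_weak_deriv \<omega> is (\<lambda>x. u x - v x) (\<lambda>x. weak_deriv \<omega> is u x - weak_deriv \<omega> is v x)"
      "(\<lambda>x. weak_deriv \<omega> is u x - weak_deriv \<omega> is v x) \<in> L2 \<omega>"
    if "length is \<le> k" for "is"
    using W2_weak_deriv[OF u that] W2_weak_deriv[OF v that] by (auto intro: is_weak_deriv_diff L2_diff)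
  show w: "(\<lambda>x. u x - v x) \<in> W2 k \<omega>" unfolding W2_def using d by blast
  show "length is \<le> k \<Longrightarrow> AE x in \<mu>. weak_deriv \<omega> is (\<lambda>x. u x - v x) x = weak_deriv \<omega> is u x - weak_deriv \<omega> is v x"
    by (rule is_weak_deriv_unique[OF weak_deriv_is[OF w] d(1)])
qed

lemma finite_multi: "finite {is :: 2 list. length is \<le> k}"
  using finite_lists_length_le[of "UNIV :: 2 set" k] by simp

lemma weak_deriv_le_W2_norm: "length is \<le> k \<Longrightarrow> L2_norm \<omega> (weak_deriv \<omega> is u) \<le> W2_norm k \<omega> u"
  unfolding W2_norm_def
  by (rule real_le_rsqrt) (rule member_le_sum[of "is"], auto simp: finite_multi)

lemma W2_norm_le_sum: "W2_norm k \<omega> u \<le> (\<Sum>is\<in>{is. length is \<le> k}. L2_norm \<omega> (weak_deriv \<omega> is u))"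
  using L2_set_le_sum[of "{is. length is \<le> k}" "\<lambda>is. L2_norm \<omega> (weak_deriv \<omega> is u)"]
  by (simp add: W2_norm_def L2_set_def)

lemma multi_1: "{is :: 2 list. length is \<le> 1} = {[], [1], [2]}"
proof -
  have "is \<in> {[], [1], [2]}" if "length is \<le> 1" for "is" :: "2 list"
    using that exhaust_2 by (cases "is") auto
  then show ?thesis by auto
qed

lemma W2_norm_1_smooth:
  assumes "smooth_on UNIV u"
  shows "W2_norm 1 \<omega> u \<le> L2_norm \<omega> u + L2_norm \<omega> (partial_deriv 1 u) + L2_norm \<omega> (partial_deriv 2 u)"
  using W2_norm_le_sum[of 1 u] unfolding multi_1 by (simp add: weak_deriv_smooth(2)[OF assms])

lemma W2_norm_scaleR_smooth:
  assumes "smooth_on UNIV u"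
  shows "W2_norm k \<omega> (\<lambda>x. c *\<^sub>R u x) = \<bar>c\<bar> * W2_norm k \<omega> u"
proof -
  have s: "smooth_on UNIV (\<lambda>x. c *\<^sub>R u x)" by (rule smooth_linear[OF bounded_linear_scaleR_right assms])
  have "L2_norm \<omega> (weak_deriv \<omega> is (\<lambda>x. c *\<^sub>R u x)) = \<bar>c\<bar> * L2_norm \<omega> (weak_deriv \<omega> is u)" for "is"
    unfolding weak_deriv_smooth(2)[OF s] weak_deriv_smooth(2)[OF assms]
      partial_derivs_linear[OF bounded_linear_scaleR_right assms]
    by (rule L2_scaleR(2)[OF smooth_L2[OF smooth_partial_derivs[OF assms]]])
  then show ?thesis unfolding W2_norm_def
    by (simp add: power_mult_distrib sum_distrib_left[symmetric] real_sqrt_mult)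
qed

lemma test_W2_0:
  assumes "\<phi> \<in> test_functions \<omega>" shows "\<phi> \<in> W2_0 k \<omega>"
proof -
  have "partial_derivs is (\<lambda>x::real^2. 0 :: 'a) = (\<lambda>x. 0)" for "is"
    by (induction "is") auto
  then have "W2_norm k \<omega> (\<lambda>x. 0 :: 'a) = 0"
    unfolding W2_norm_def weak_deriv_smooth(2)[OF smooth_const] by (simp add: L2_norm_def)
  then show ?thesis
    using assms smooth_W2[OF test_smooth[OF assms]] unfolding W2_0_def by (auto intro!: exI[of _ "\<lambda>_. \<phi>"])
qed

section \<open>Negative Sobolev norms and the sup bound\<close>

lemma H_minus_ge:
  "\<phi> \<in> W2_0 k \<omega> \<Longrightarrow> W2_norm k \<omega> \<phi> \<le> 1 \<Longrightarrow> ennreal \<bar>\<integral>x. f x \<bullet> \<phi> x \<partial>\<mu>\<bar> \<le> H_minus_norm k \<omega> f"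
  unfolding H_minus_norm_def by (rule SUP_upper) simp

text \<open>Homogeneity, by rescaling the test function to norm at most 1. Since N may be 0, the
  division is made with a slightly larger positive bound; the excess e/(h + 1) costs at most e, also
  for h = 0.\<close>

lemma H_minus_test:
  assumes H: "H_minus_norm k \<omega> f = ennreal h" "0 \<le> h" and \<phi>: "\<phi> \<in> test_functions \<omega>"
    and N: "W2_norm k \<omega> \<phi> \<le> N"
  shows "\<bar>\<integral>x. f x \<bullet> \<phi> x \<partial>\<mu>\<bar> \<le> h * N"
proof -
  have *: "\<bar>\<integral>x. f x \<bullet> \<phi> x \<partial>\<mu>\<bar> \<le> h * n" if n: "0 < n" "W2_norm k \<omega> \<phi> \<le> n" for n
  proof -
    have "(\<lambda>x. (1 / n) *\<^sub>R \<phi> x) \<in> test_functions \<omega>"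
      by (rule test_functionsI[OF smooth_linear[OF bounded_linear_scaleR_right test_smooth[OF \<phi>]] test_compact[OF \<phi>]])
         (use closure_subset[of "{x. \<phi> x \<noteq> 0}"] in auto)
    moreover have "W2_norm k \<omega> (\<lambda>x. (1 / n) *\<^sub>R \<phi> x) \<le> 1"
      using n by (simp add: W2_norm_scaleR_smooth[OF test_smooth[OF \<phi>]] divide_simps)
    ultimately have "ennreal \<bar>\<integral>x. f x \<bullet> ((1 / n) *\<^sub>R \<phi> x) \<partial>\<mu>\<bar> \<le> ennreal h"
      unfolding H(1)[symmetric] by (intro H_minus_ge test_W2_0)
    then have "\<bar>\<integral>x. f x \<bullet> ((1 / n) *\<^sub>R \<phi> x) \<partial>\<mu>\<bar> \<le> h" using H(2) by (simp add: ennreal_le_iff)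
    then show ?thesis using n by (simp add: abs_mult divide_simps)
  qed
  have N0: "0 \<le> N" using order_trans[OF _ N] by (simp add: W2_norm_def sum_nonneg)
  show ?thesis
  proof (rule field_le_epsilon)
    fix e :: real assume e: "0 < e"
    have "\<bar>\<integral>x. f x \<bullet> \<phi> x \<partial>\<mu>\<bar> \<le> h * (N + e / (h + 1))"
      by (rule *) (use e N N0 H(2) in \<open>auto intro: add_nonneg_pos add_increasing2\<close>)
    also have "\<dots> \<le> h * N + e" using e H(2) by (simp add: algebra_simps divide_simps)
    finally show "\<bar>\<integral>x. f x \<bullet> \<phi> x \<partial>\<mu>\<bar> \<le> h * N + e" .
  qed
qed

lemma W2_0_approx:
  assumes "\<phi> \<in> W2_0 k \<omega>"
  obtains \<psi> \<epsilon> where "\<And>n. \<psi> n \<in> test_functions \<omega>" "\<epsilon> \<longlonglongrightarrow> 0" "\<And>n. 0 \<le> \<epsilon> n"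
    "\<And>n. L2_norm \<omega> (\<lambda>x. \<phi> x - \<psi> n x) \<le> \<epsilon> n"
    "\<And>n is. length is \<le> k \<Longrightarrow> L2_norm \<omega> (partial_derivs (rev is) (\<psi> n)) \<le> W2_norm k \<omega> \<phi> + \<epsilon> n"
proof -
  obtain \<psi> where \<phi>: "\<phi> \<in> W2 k \<omega>" and \<psi>: "\<And>n. \<psi> n \<in> test_functions \<omega>"
    and lim: "(\<lambda>n. W2_norm k \<omega> (\<lambda>x. \<phi> x - \<psi> n x)) \<longlonglongrightarrow> 0"
    using assms by (auto simp: W2_0_def)
  define \<epsilon> where "\<epsilon> n = W2_norm k \<omega> (\<lambda>x. \<phi> x - \<psi> n x)" for n
  have W: "\<psi> n \<in> W2 k \<omega>" for n by (rule smooth_W2[OF test_smooth[OF \<psi>]])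
  have D: "(\<lambda>x. \<phi> x - \<psi> n x) \<in> W2 k \<omega>" for n by (rule W2_diff[OF \<phi> W])
  show ?thesis
  proof
    show "\<psi> n \<in> test_functions \<omega>" for n by (rule \<psi>)
    show "\<epsilon> \<longlonglongrightarrow> 0" using lim by (simp add: \<epsilon>_def[abs_def])
    show "0 \<le> \<epsilon> n" for n by (simp add: \<epsilon>_def W2_norm_def sum_nonneg)
    show "L2_norm \<omega> (\<lambda>x. \<phi> x - \<psi> n x) \<le> \<epsilon> n" for n
      using L2_norm_cong_AE[OF L2_measurable[OF weak_deriv_L2[OF D, of "[]" n]] W2_L2(2)[OF D]]
        weak_deriv_le_W2_norm[of "[]" k "\<lambda>x. \<phi> x - \<psi> n x"] by (simp add: \<epsilon>_def)
    fix n and "is" :: "2 list" assume l: "length is \<le> k"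
    let ?a = "weak_deriv \<omega> is \<phi>" and ?b = "weak_deriv \<omega> is (\<lambda>x. \<phi> x - \<psi> n x)"
    have L: "?a \<in> L2 \<omega>" "?b \<in> L2 \<omega>" using weak_deriv_L2[OF \<phi> l] weak_deriv_L2[OF D l] by auto
    have "AE x in \<mu>. ?a x - ?b x = partial_derivs (rev is) (\<psi> n) x"
      using W2_diff(2)[OF \<phi> W l, of n] weak_deriv_smooth(1)[OF test_smooth[OF \<psi>[of n]], of "is"]
      by eventually_elim simp
    from L2_norm_cong_AE[OF L2_measurable[OF L2_diff(1)[OF L]] this]
    have "L2_norm \<omega> (partial_derivs (rev is) (\<psi> n)) \<le> L2_norm \<omega> ?a + L2_norm \<omega> ?b"
      using L2_diff(2)[OF L] by simp
    then show "L2_norm \<omega> (partial_derivs (rev is) (\<psi> n)) \<le> W2_norm k \<omega> \<phi> + \<epsilon> n"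
      using weak_deriv_le_W2_norm[OF l, of \<phi>] weak_deriv_le_W2_norm[OF l, of "\<lambda>x. \<phi> x - \<psi> n x"]
      unfolding \<epsilon>_def by linarith
  qed
qed

lemma W2_0_L2: "\<phi> \<in> W2_0 k \<omega> \<Longrightarrow> \<phi> \<in> L2 \<omega>"
  using W2_L2(1) by (auto simp: W2_0_def)

text \<open>By density it suffices to estimate the pairing with test functions. The factor 2 counts
  the two first derivatives, each of norm at most 1 in the limit.\<close>

lemma H_minus_1_upper:
  assumes f: "f \<in> L2 \<omega>" and K: "0 \<le> K"
    and t: "\<And>\<phi>. \<phi> \<in> test_functions \<omega> \<Longrightarrow>
       \<bar>\<integral>x. f x \<bullet> \<phi> x \<partial>\<mu>\<bar> \<le> K * (L2_norm \<omega> (partial_deriv 1 \<phi>) + L2_norm \<omega> (partial_deriv 2 \<phi>))"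
  shows "H_minus_norm 1 \<omega> f \<le> ennreal (2 * K)"
  unfolding H_minus_norm_def
proof (rule SUP_least)
  fix \<phi> :: "real^2 \<Rightarrow> 'a" assume "\<phi> \<in> {\<phi> \<in> W2_0 1 \<omega>. W2_norm 1 \<omega> \<phi> \<le> 1}"
  then have \<phi>: "\<phi> \<in> W2_0 1 \<omega>" and \<phi>1: "W2_norm 1 \<omega> \<phi> \<le> 1" by auto
  obtain \<psi> \<epsilon> where \<psi>: "\<And>n. \<psi> n \<in> test_functions \<omega>" and \<epsilon>: "\<epsilon> \<longlonglongrightarrow> 0" "\<And>n. 0 \<le> \<epsilon> n"
    and d: "\<And>n. L2_norm \<omega> (\<lambda>x. \<phi> x - \<psi> n x) \<le> \<epsilon> n"
    and p: "\<And>n is. length is \<le> 1 \<Longrightarrow> L2_norm \<omega> (partial_derivs (rev is) (\<psi> n)) \<le> W2_norm 1 \<omega> \<phi> + \<epsilon> n"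
    by (rule W2_0_approx[OF \<phi>]) blast
  have "\<bar>\<integral>x. f x \<bullet> \<phi> x \<partial>\<mu>\<bar> \<le> K * (2 + 2 * \<epsilon> n) + L2_norm \<omega> f * \<epsilon> n" for n
  proof -
    have \<psi>L: "\<psi> n \<in> L2 \<omega>" by (rule smooth_L2[OF test_smooth[OF \<psi>]])
    have \<phi>L: "\<phi> \<in> L2 \<omega>" by (rule W2_0_L2[OF \<phi>])
    have "(\<integral>x. f x \<bullet> \<phi> x \<partial>\<mu>) = (\<integral>x. f x \<bullet> \<psi> n x \<partial>\<mu>) + (\<integral>x. f x \<bullet> (\<phi> x - \<psi> n x) \<partial>\<mu>)"
      using L2_Cauchy_Schwarz(1)[OF f \<psi>L] L2_Cauchy_Schwarz(1)[OF f \<phi>L] by (simp add: inner_diff_right)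
    moreover have "\<bar>\<integral>x. f x \<bullet> (\<phi> x - \<psi> n x) \<partial>\<mu>\<bar> \<le> L2_norm \<omega> f * \<epsilon> n"
      using L2_Cauchy_Schwarz(2)[OF f L2_diff(1)[OF \<phi>L \<psi>L]] mult_left_mono[OF d L2_norm_nonneg[of f], of n] by linarith
    moreover have "\<bar>\<integral>x. f x \<bullet> \<psi> n x \<partial>\<mu>\<bar> \<le> K * (2 + 2 * \<epsilon> n)"
    proof -
      have "L2_norm \<omega> (partial_deriv i (\<psi> n)) \<le> 1 + \<epsilon> n" for i
        using p[of "[i]" n] \<phi>1 by simp
      then have "K * (L2_norm \<omega> (partial_deriv 1 (\<psi> n)) + L2_norm \<omega> (partial_deriv 2 (\<psi> n))) \<le> K * (2 + 2 * \<epsilon> n)"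
        using K by (intro mult_left_mono) (smt (verit))+
      then show ?thesis using t[OF \<psi>[of n]] by linarith
    qed
    ultimately show ?thesis by linarith
  qed
  moreover have "(\<lambda>n. K * (2 + 2 * \<epsilon> n) + L2_norm \<omega> f * \<epsilon> n) \<longlonglongrightarrow> K * (2 + 2 * 0) + L2_norm \<omega> f * 0"
    by (intro tendsto_intros \<epsilon>)
  ultimately have "\<bar>\<integral>x. f x \<bullet> \<phi> x \<partial>\<mu>\<bar> \<le> K * (2 + 2 * 0) + L2_norm \<omega> f * 0"
    by (meson LIMSEQ_le_const)
  then show "ennreal \<bar>\<integral>x. f x \<bullet> \<phi> x \<partial>\<mu>\<bar> \<le> ennreal (2 * K)" by (simp add: ennreal_leI)
qed

text \<open>The 2 leaves room for approximation: test functions that approximate an element of norm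
  at most 1 are only known to have norm at most 2 from some index on. The norm of 1 comes from
  passing from the L1 to the L2 norm of the mixed derivative in \<open>sup_bound\<close>.\<close>

definition sup_const :: real where
  "sup_const = 2 * L2_norm \<omega> (\<lambda>_. 1 :: real) / mass"

lemma sup_const_nonneg: "0 \<le> sup_const"
  using mass_pos by (simp add: sup_const_def)

lemma test_sup_bound:
  fixes \<psi> :: "real^2 \<Rightarrow> real"
  assumes \<psi>: "\<psi> \<in> test_functions \<omega>"
  shows "mass * \<bar>\<psi> x\<bar> \<le> L2_norm \<omega> (partial_derivs [1, 2] \<psi>) * L2_norm \<omega> (\<lambda>_. 1 :: real)"
proof -
  let ?p = "partial_derivs [1, 2] \<psi>"
  obtain R where R: "\<And>x. R < norm x \<Longrightarrow> \<psi> x = 0" by (rule test_bounded_support[OF \<psi>]) auto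
  have p: "?p \<in> test_functions \<omega>" by (rule test_partial_derivs[OF \<psi>])
  have "mass * \<bar>\<psi> x\<bar> \<le> (\<integral>y. \<bar>?p y\<bar> \<partial>lborel)"
    using sup_bound[OF test_smooth[OF \<psi>] R] by simp
  also have "\<dots> = (\<integral>y. norm (?p y) * norm (1::real) \<partial>\<mu>)"
    by (subst test_integral(1)) (use smooth_borel[OF test_smooth[OF p]] test_zero[OF p] in auto)
  also have "\<dots> \<le> L2_norm \<omega> ?p * L2_norm \<omega> (\<lambda>_. 1 :: real)"
    by (rule L2_norm_Cauchy_Schwarz(2)[OF smooth_L2[OF test_smooth[OF p]] smooth_L2[OF smooth_const]])
  finally show ?thesis .
qed

text \<open>Approximating test functions stay below the bound everywhere, so the excess of the
  modulus of \<phi> over the bound is at most the distance to them. Its L2 norm is thus zero, and no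
  pointwise convergent subsequence has to be extracted.\<close>

lemma W2_0_bounded:
  fixes \<phi> :: "real^2 \<Rightarrow> real"
  assumes \<phi>: "\<phi> \<in> W2_0 2 \<omega>" and \<phi>1: "W2_norm 2 \<omega> \<phi> \<le> 1"
  shows "AE x in \<mu>. \<bar>\<phi> x\<bar> \<le> sup_const"
proof -
  obtain \<psi> \<epsilon> where \<psi>: "\<And>n. \<psi> n \<in> test_functions \<omega>" and \<epsilon>: "\<epsilon> \<longlonglongrightarrow> 0" "\<And>n. 0 \<le> \<epsilon> n"
    and d: "\<And>n. L2_norm \<omega> (\<lambda>x. \<phi> x - \<psi> n x) \<le> \<epsilon> n"
    and p: "\<And>n is. length is \<le> 2 \<Longrightarrow> L2_norm \<omega> (partial_derivs (rev is) (\<psi> n)) \<le> W2_norm 2 \<omega> \<phi> + \<epsilon> n"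
    by (rule W2_0_approx[OF \<phi>]) blast
  have \<phi>L: "\<phi> \<in> L2 \<omega>" by (rule W2_0_L2[OF \<phi>])
  define g where "g x = max (\<bar>\<phi> x\<bar> - sup_const) 0" for x
  have \<phi>m [measurable]: "\<phi> \<in> borel_measurable \<mu>" by (rule L2_measurable[OF \<phi>L])
  have gm [measurable]: "g \<in> borel_measurable \<mu>" unfolding g_def[abs_def] by measurable
  have gle: "\<bar>g x\<bar> \<le> \<bar>\<phi> x\<bar>" for x using sup_const_nonneg by (auto simp: g_def)
  have ig: "integrable \<mu> (\<lambda>x. (g x)\<^sup>2)"
    by (rule Bochner_Integration.integrable_bound[OF L2_integrable2[OF \<phi>L]])
       (use gle in \<open>auto simp: abs_le_square_iff\<close>)
  have ev: "\<forall>\<^sub>F n in sequentially. \<epsilon> n < 1" using \<epsilon>(1) by (rule order_tendstoD) simp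
  have le: "\<forall>\<^sub>F n in sequentially. (\<integral>x. (g x)\<^sup>2 \<partial>\<mu>) \<le> (\<epsilon> n)\<^sup>2"
    using ev
  proof eventually_elim
    case (elim n)
    have \<psi>L: "\<psi> n \<in> L2 \<omega>" by (rule smooth_L2[OF test_smooth[OF \<psi>]])
    have "L2_norm \<omega> (partial_derivs [1, 2] (\<psi> n)) \<le> 2" using p[of "[2, 1]" n] \<phi>1 elim by simp
    then have "mass * \<bar>\<psi> n x\<bar> \<le> 2 * L2_norm \<omega> (\<lambda>_. 1 :: real)" for x
      using test_sup_bound[OF \<psi>, of n x] mult_right_mono[OF _ L2_norm_nonneg[of "\<lambda>_. 1 :: real"]] by (meson order_trans)
    then have \<psi>b: "\<bar>\<psi> n x\<bar> \<le> sup_const" for x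
      using mass_pos by (simp add: sup_const_def field_simps)
    have "(\<integral>x. (g x)\<^sup>2 \<partial>\<mu>) \<le> (\<integral>x. (norm (\<phi> x - \<psi> n x))\<^sup>2 \<partial>\<mu>)"
    proof (rule integral_mono[OF ig L2_integrable2[OF L2_diff(1)[OF \<phi>L \<psi>L]]])
      fix x
      have "\<bar>g x\<bar> \<le> \<bar>\<phi> x - \<psi> n x\<bar>" using \<psi>b[of x] by (auto simp: g_def)
      then show "(g x)\<^sup>2 \<le> (norm (\<phi> x - \<psi> n x))\<^sup>2" by (simp add: abs_le_square_iff)
    qed
    also have "\<dots> \<le> (\<epsilon> n)\<^sup>2" unfolding L2_norm_square[symmetric] by (rule power_mono[OF d]) simp
    finally show ?case .
  qed
  have "(\<lambda>n. (\<epsilon> n)\<^sup>2) \<longlonglongrightarrow> 0" using tendsto_power[OF \<epsilon>(1), of 2] by simp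
  then have "(\<integral>x. (g x)\<^sup>2 \<partial>\<mu>) \<le> 0" using le by (rule tendsto_lowerbound) simp
  then have "(\<integral>x. (g x)\<^sup>2 \<partial>\<mu>) = 0" by (simp add: order_antisym)
  then have "AE x in \<mu>. (g x)\<^sup>2 = 0" using integral_nonneg_eq_0_iff_AE[OF ig] by simp
  then show ?thesis by eventually_elim (auto simp: g_def max_def split: if_splits)
qed

section \<open>Fields smooth up to the boundary\<close>

lemma continuous_measurable_\<mu>:
  fixes f :: "real^2 \<Rightarrow> 'b::euclidean_space"
  shows "continuous_on \<omega> f \<Longrightarrow> f \<in> borel_measurable \<mu>"
  by (rule continuous_imp_measurable_on_sets_lebesgue) auto

lemma smooth_on_closure_derivs:
  fixes F :: "real^2 \<Rightarrow> 'b::euclidean_space"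
  assumes F: "smooth_on_closure \<omega> F"
  shows "continuous_on \<omega> (partial_derivs is F)" "\<exists>C. \<forall>x\<in>\<omega>. norm (partial_derivs is F x) \<le> C"
    and "x \<in> \<omega> \<Longrightarrow> partial_derivs is F differentiable (at x)"
proof -
  obtain g where g: "continuous_on (closure \<omega>) g" "\<And>x. x \<in> \<omega> \<Longrightarrow> g x = partial_derivs is F x"
    using F unfolding smooth_on_closure_def by blast
  have "continuous_on \<omega> g" by (rule continuous_on_subset[OF g(1) closure_subset])
  then show "continuous_on \<omega> (partial_derivs is F)" using g(2) by (simp cong: continuous_on_cong)
  have "compact (g ` closure \<omega>)" using bounded_\<omega> by (intro compact_continuous_image g) auto
  then obtain C where C: "\<forall>y\<in>g ` closure \<omega>. norm y \<le> C" by (auto dest!: compact_imp_bounded simp: bounded_iff)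
  then have "\<forall>x\<in>\<omega>. norm (partial_derivs is F x) \<le> C"
    using g(2) closure_subset[of \<omega>] by (metis image_eqI subsetD)
  then show "\<exists>C. \<forall>x\<in>\<omega>. norm (partial_derivs is F x) \<le> C" ..
  show "x \<in> \<omega> \<Longrightarrow> partial_derivs is F differentiable (at x)"
    using F open_\<omega> unfolding smooth_on_closure_def smooth_on_def
    by (metis at_within_open differentiable_on_def)
qed

lemma partial_derivs_component:
  fixes F :: "real^2 \<Rightarrow> real^2^2"
  assumes F: "smooth_on_closure \<omega> F" and x: "x \<in> \<omega>"
  shows "partial_derivs is (\<lambda>y. F y $ k $ j) x = partial_derivs is F x $ k $ j"
  using x
proof (induction "is" arbitrary: x)
  case (Cons i "is")
  have L: "bounded_linear (\<lambda>A :: real^2^2. A $ k $ j)"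
    by (rule bounded_linear_compose[OF bounded_linear_vec_nth bounded_linear_vec_nth])
  have "partial_deriv i (partial_derivs is (\<lambda>y. F y $ k $ j)) x = partial_deriv i (\<lambda>y. partial_derivs is F y $ k $ j) x"
    by (rule partial_deriv_cong[OF open_\<omega> Cons.prems Cons.IH])
  also have "\<dots> = partial_deriv i (partial_derivs is F) x $ k $ j"
    by (rule partial_deriv_linear[OF L smooth_on_closure_derivs(3)[OF F Cons.prems]])
  finally show ?case by simp
qed simp

section \<open>Curl and determinant of a perturbed Hessian\<close>

text \<open>The regularity retained for the entries of B, for which no smooth extension to the plane
  is at hand: enough for one integration by parts against a test function.\<close>

definition C1_bounded :: "(real^2 \<Rightarrow> real) \<Rightarrow> bool" where
  "C1_bounded b \<longleftrightarrow> (\<forall>x\<in>\<omega>. b differentiable (at x)) \<and> (\<forall>i. continuous_on \<omega> (partial_deriv i b)) \<and>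
     (\<exists>C. \<forall>x\<in>\<omega>. \<bar>b x\<bar> \<le> C \<and> (\<forall>i. \<bar>partial_deriv i b x\<bar> \<le> C))"

lemma C1_bounded_component:
  fixes F :: "real^2 \<Rightarrow> real^2^2"
  assumes F: "smooth_on_closure \<omega> F"
  shows "C1_bounded (\<lambda>y. F y $ k $ j)"
  unfolding C1_bounded_def
proof (intro conjI ballI allI)
  have L: "bounded_linear (\<lambda>A :: real^2^2. A $ k $ j)"
    by (rule bounded_linear_compose[OF bounded_linear_vec_nth bounded_linear_vec_nth])
  show "(\<lambda>y. F y $ k $ j) differentiable (at x)" if "x \<in> \<omega>" for x
    using smooth_on_closure_derivs(3)[OF F that, of "[]"] bounded_linear_imp_differentiable[OF L]
    by (auto intro: differentiable_compose[of "\<lambda>A. A $ k $ j"])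
  have p: "partial_deriv i (\<lambda>y. F y $ k $ j) x = partial_deriv i F x $ k $ j" if "x \<in> \<omega>" for i x
    using partial_derivs_component[OF F that, of "[i]"] by simp
  have "continuous_on \<omega> (\<lambda>x. partial_deriv i F x $ k $ j)" for i
    using smooth_on_closure_derivs(1)[OF F, of "[i]"] by (auto intro!: continuous_intros)
  then show "continuous_on \<omega> (partial_deriv i (\<lambda>y. F y $ k $ j))" for i using p by (simp cong: continuous_on_cong)
  have comp: "\<bar>A $ k $ j\<bar> \<le> norm A" for A :: "real^2^2"
    using component_le_norm_cart[of "A $ k" j] component_le_norm_cart order_trans Finite_Cartesian_Product.norm_nth_le by blast
  obtain C0 C1 C2 where C: "\<forall>x\<in>\<omega>. norm (partial_derivs [] F x) \<le> C0" "\<forall>x\<in>\<omega>. norm (partial_derivs [1] F x) \<le> C1" "\<forall>x\<in>\<omega>. norm (partial_derivs [2] F x) \<le> C2"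
    using smooth_on_closure_derivs(2)[OF F] by metis
  show "\<exists>C. \<forall>x\<in>\<omega>. \<bar>F x $ k $ j\<bar> \<le> C \<and> (\<forall>i. \<bar>partial_deriv i (\<lambda>y. F y $ k $ j) x\<bar> \<le> C)"
  proof (intro exI[of _ "max C0 (max C1 C2)"] ballI)
    fix x assume x: "x \<in> \<omega>"
    show "\<bar>F x $ k $ j\<bar> \<le> max C0 (max C1 C2) \<and> (\<forall>i. \<bar>partial_deriv i (\<lambda>y. F y $ k $ j) x\<bar> \<le> max C0 (max C1 C2))"
      using C x comp[of "F x"] comp[of "partial_deriv 1 F x"] comp[of "partial_deriv 2 F x"]
      by (auto simp: forall_2 p intro: order_trans)
  qed
qed

lemma C1_boundedD:
  assumes "C1_bounded b"
  shows "b \<in> borel_measurable \<mu>" "partial_deriv i b \<in> borel_measurable \<mu>"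
    "\<exists>C. (\<forall>x\<in>\<omega>. \<bar>b x\<bar> \<le> C) \<and> (\<forall>i. \<forall>x\<in>\<omega>. \<bar>partial_deriv i b x\<bar> \<le> C)"
proof -
  have "continuous_on \<omega> b"
    using assms open_\<omega> unfolding C1_bounded_def
    by (meson continuous_at_imp_continuous_on differentiable_imp_continuous_within)
  then show "b \<in> borel_measurable \<mu>" by (rule continuous_measurable_\<mu>)
  show "partial_deriv i b \<in> borel_measurable \<mu>"
    using assms unfolding C1_bounded_def by (intro continuous_measurable_\<mu>) blast
  show "\<exists>C. (\<forall>x\<in>\<omega>. \<bar>b x\<bar> \<le> C) \<and> (\<forall>i. \<forall>x\<in>\<omega>. \<bar>partial_deriv i b x\<bar> \<le> C)"
    using assms unfolding C1_bounded_def by blast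
qed

lemma bounded_mult_test_integrable:
  fixes b \<phi> :: "real^2 \<Rightarrow> real"
  assumes "b \<in> borel_measurable \<mu>" "\<And>x. x \<in> \<omega> \<Longrightarrow> \<bar>b x\<bar> \<le> C" "\<phi> \<in> test_functions \<omega>"
  shows "integrable \<mu> (\<lambda>x. b x * \<phi> x)"
  using L2_Cauchy_Schwarz(1)[OF L2_bounded[of b C] smooth_L2[OF test_smooth[OF assms(3)]]] assms by simp

text \<open>The product with a test function is differentiable in the whole plane, since it vanishes
  near every point outside \<omega>. Its partial derivative is bounded, so its integral
  vanishes.\<close>

lemma C1_bounded_parts:
  fixes b \<phi> :: "real^2 \<Rightarrow> real"
  assumes b: "C1_bounded b" and \<phi>: "\<phi> \<in> test_functions \<omega>"
  shows "(\<integral>x. partial_deriv i b x * \<phi> x \<partial>\<mu>) = - (\<integral>x. b x * partial_deriv i \<phi> x \<partial>\<mu>)"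
proof -
  define h where "h x = b x * \<phi> x" for x
  note \<phi>d = smooth_differentiable[OF test_smooth[OF \<phi>]]
  have bd: "b differentiable (at x)" if "x \<in> \<omega>" for x using b that by (simp add: C1_bounded_def)
  have h0: "h y = 0" if "y \<in> - closure {x. \<phi> x \<noteq> 0}" for y
    using that closure_subset[of "{x. \<phi> x \<noteq> 0}"] by (auto simp: h_def)
  have out: "x \<in> - closure {x. \<phi> x \<noteq> 0}" if "x \<notin> \<omega>" for x using test_compact(2)[OF \<phi>] that by blast
  have o: "open (- closure {x. \<phi> x \<noteq> 0})" by auto
  have hd: "h differentiable (at x)" for x
  proof (cases "x \<in> \<omega>")
    case True
    then show ?thesis unfolding h_def[abs_def] using bd \<phi>d by (auto intro: differentiable_mult)
  next
    case False
    have "((\<lambda>_. 0) has_derivative (\<lambda>_. 0)) (at x)" by simp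
    then have "(h has_derivative (\<lambda>_. 0)) (at x)"
      using has_derivative_transform_within_open[OF _ o out[OF False], of "\<lambda>_. 0" "\<lambda>_. 0" UNIV h] h0 by simp
    then show ?thesis by (auto simp: differentiable_def)
  qed
  have ph: "partial_deriv i h x = b x * partial_deriv i \<phi> x + partial_deriv i b x * \<phi> x" if "x \<in> \<omega>" for x
    unfolding h_def[abs_def] by (rule partial_deriv_mult[OF bd[OF that] \<phi>d])
  have ph0: "partial_deriv i h x = 0" if "x \<notin> \<omega>" for x
    by (rule partial_deriv_0_open[OF o out[OF that] h0])
  obtain C where C: "\<And>x. x \<in> \<omega> \<Longrightarrow> \<bar>b x\<bar> \<le> C" "\<And>x i. x \<in> \<omega> \<Longrightarrow> \<bar>partial_deriv i b x\<bar> \<le> C"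
    using C1_boundedD(3)[OF b] by blast
  obtain D where D: "0 < D" "\<And>x. \<bar>\<phi> x\<bar> \<le> D" using test_bounded[OF \<phi>] by (metis real_norm_def)
  obtain D' where D': "0 < D'" "\<And>x. \<bar>partial_deriv i \<phi> x\<bar> \<le> D'" using test_bounded[OF test_partial_deriv[OF \<phi>]] by (metis real_norm_def)
  have bnd: "\<bar>partial_deriv i h x\<bar> \<le> \<bar>C\<bar> * D' + \<bar>C\<bar> * D" for x
  proof (cases "x \<in> \<omega>")
    case True
    have "\<bar>partial_deriv i h x\<bar> \<le> \<bar>b x\<bar> * \<bar>partial_deriv i \<phi> x\<bar> + \<bar>partial_deriv i b x\<bar> * \<bar>\<phi> x\<bar>"
      unfolding ph[OF True] by (rule order_trans[OF abs_triangle_ineq]) (simp add: abs_mult)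
    also have "\<dots> \<le> \<bar>C\<bar> * D' + \<bar>C\<bar> * D"
      using C(1)[OF True] C(2)[OF True, of i] D(2)[of x] D'(2)[of x] by (intro add_mono mult_mono) auto
    finally show ?thesis .
  qed (use ph0 D D' in auto)
  obtain R where R: "\<And>x. R < norm x \<Longrightarrow> \<phi> x = 0" by (rule test_bounded_support[OF \<phi>]) auto
  then have R': "h x = 0" if "R < norm x" for x using that by (simp add: h_def)
  note z = integral_partial_deriv_eq_0[of h i, OF hd bnd R']
  have "(\<integral>x. partial_deriv i h x \<partial>\<mu>) = 0"
    using test_integral(1)[of "partial_deriv i h"] ph0 z borel_measurable_integrable[OF z(1)] by simp
  moreover have "(\<integral>x. partial_deriv i h x \<partial>\<mu>) = (\<integral>x. b x * partial_deriv i \<phi> x + partial_deriv i b x * \<phi> x \<partial>\<mu>)"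
    by (rule Bochner_Integration.integral_cong) (auto simp: space_restrict_space ph)
  moreover have "integrable \<mu> (\<lambda>x. b x * partial_deriv i \<phi> x)" "integrable \<mu> (\<lambda>x. partial_deriv i b x * \<phi> x)"
    using bounded_mult_test_integrable[OF C1_boundedD(1)[OF b] C(1) test_partial_deriv[OF \<phi>]]
      bounded_mult_test_integrable[OF C1_boundedD(2)[OF b] C(2) \<phi>] by auto
  ultimately show ?thesis by simp
qed

lemma test_component: "\<phi> \<in> test_functions \<omega> \<Longrightarrow> (\<lambda>x. \<phi> x $ k) \<in> test_functions \<omega>"
  for \<phi> :: "real^2 \<Rightarrow> real^2"
proof (rule test_functionsI[OF smooth_linear[OF bounded_linear_vec_nth test_smooth] test_compact])
  fix x assume "x \<notin> closure {x. \<phi> x \<noteq> 0}"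
  then have "\<phi> x = 0" using closure_subset[of "{x. \<phi> x \<noteq> 0}"] by blast
  then show "\<phi> x $ k = 0" by simp
qed

lemma curl_rows_nth:
  "curl_rows B x $ k = partial_deriv 1 (\<lambda>y. B y $ k $ 2) x - partial_deriv 2 (\<lambda>y. B y $ k $ 1) x"
  by (simp add: curl_rows_def curl_def)

lemma curl_rows_L2:
  fixes B :: "real^2 \<Rightarrow> real^2^2"
  assumes B: "smooth_on_closure \<omega> B"
  shows "curl_rows B \<in> L2 \<omega>"
proof -
  note c = C1_bounded_component[OF B]
  have eq: "curl_rows B = (\<lambda>x. \<chi> k. partial_deriv 1 (\<lambda>y. B y $ k $ 2) x - partial_deriv 2 (\<lambda>y. B y $ k $ 1) x)"
    by (auto simp: vec_eq_iff curl_rows_nth)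
  have cont: "continuous_on \<omega> (curl_rows B)"
    unfolding eq using c by (intro continuous_intros) (auto simp: C1_bounded_def)
  have "\<exists>C. \<forall>x\<in>\<omega>. \<bar>partial_deriv i (\<lambda>y. B y $ k $ j) x\<bar> \<le> C" for i k j
    using c[of k j] unfolding C1_bounded_def by blast
  then obtain C where C: "\<And>i k j x. x \<in> \<omega> \<Longrightarrow> \<bar>partial_deriv i (\<lambda>y. B y $ k $ j) x\<bar> \<le> C i k j" by metis
  have "norm (curl_rows B x) \<le> C 1 1 2 + C 2 1 1 + (C 1 2 2 + C 2 2 1)" if "x \<in> \<omega>" for x
  proof -
    have "norm (curl_rows B x) \<le> \<bar>curl_rows B x $ 1\<bar> + \<bar>curl_rows B x $ 2\<bar>"
      using norm_le_l1_cart[of "curl_rows B x"] by (simp add: sum_2)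
    also have "\<dots> \<le> C 1 1 2 + C 2 1 1 + (C 1 2 2 + C 2 2 1)"
      unfolding curl_rows_nth using C[OF that] by (intro add_mono order_trans[OF abs_triangle_ineq4]) auto
    finally show ?thesis .
  qed
  then show ?thesis by (rule L2_bounded[OF continuous_measurable_\<mu>[OF cont]])
qed

text \<open>The integrand of the weak row-wise curl of A, with p and q in the roles of the first and
  second partial derivative of the test field; the signs already include the integration by
  parts.\<close>

definition curl_form :: "real^2^2 \<Rightarrow> real^2 \<Rightarrow> real^2 \<Rightarrow> real" where
  "curl_form A p q = (A $ 1 $ 1 * q $ 1 - A $ 1 $ 2 * p $ 1) + (A $ 2 $ 1 * q $ 2 - A $ 2 $ 2 * p $ 2)"

lemma curl_form_le: "\<bar>curl_form A p q\<bar> \<le> 2 * (norm A * norm p + norm A * norm q)"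
proof -
  have c: "\<bar>A $ k $ j\<bar> \<le> norm A" for k j
    using component_le_norm_cart[of "A $ k" j] component_le_norm_cart order_trans Finite_Cartesian_Product.norm_nth_le by blast
  have "\<bar>A $ k $ j * r $ l\<bar> \<le> norm A * norm r" for k j l :: 2 and r :: "real^2"
    unfolding abs_mult by (intro mult_mono c component_le_norm_cart) auto
  note m = this[of 1 1 q 1] this[of 1 2 p 1] this[of 2 1 q 2] this[of 2 2 p 2]
  show ?thesis unfolding curl_form_def
  proof (rule abs_leI)
    show "A $ 1 $ 1 * q $ 1 - A $ 1 $ 2 * p $ 1 + (A $ 2 $ 1 * q $ 2 - A $ 2 $ 2 * p $ 2) \<le> 2 * (norm A * norm p + norm A * norm q)"
      using m unfolding abs_le_iff distrib_left by linarith
    show "- (A $ 1 $ 1 * q $ 1 - A $ 1 $ 2 * p $ 1 + (A $ 2 $ 1 * q $ 2 - A $ 2 $ 2 * p $ 2)) \<le> 2 * (norm A * norm p + norm A * norm q)"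
      using m unfolding abs_le_iff distrib_left by linarith
  qed
qed

lemma curl_form_add: "curl_form (A + B) p q = curl_form A p q + curl_form B p q"
  by (simp add: curl_form_def algebra_simps)

lemma L2_component:
  fixes E :: "real^2 \<Rightarrow> real^2^2"
  assumes "E \<in> L2 \<omega>" shows "(\<lambda>x. E x $ k $ j) \<in> L2 \<omega>"
proof -
  have c: "\<bar>A $ k $ j\<bar> \<le> norm A" for A :: "real^2^2"
    using component_le_norm_cart[of "A $ k" j] component_le_norm_cart order_trans Finite_Cartesian_Product.norm_nth_le by blast
  have m: "(\<lambda>x. E x $ k $ j) \<in> borel_measurable \<mu>"
    by (rule borel_measurable_continuous_on[OF _ L2_measurable[OF assms]]) (intro continuous_intros)
  have "integrable \<mu> (\<lambda>x. (E x $ k $ j)\<^sup>2)"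
    by (rule Bochner_Integration.integrable_bound[OF L2_integrable2[OF assms]])
       (use m c in \<open>auto simp: abs_le_square_iff[symmetric]\<close>)
  then show ?thesis using m by (simp add: L2_def)
qed

lemma L2_mult_integrable: "f \<in> L2 \<omega> \<Longrightarrow> g \<in> L2 \<omega> \<Longrightarrow> integrable \<mu> (\<lambda>x. f x * g x :: real)"
  using L2_Cauchy_Schwarz(1)[of f g] by simp

lemma smooth_closure_L2:
  fixes B :: "real^2 \<Rightarrow> real^2^2"
  assumes "smooth_on_closure \<omega> B" shows "B \<in> L2 \<omega>"
  using smooth_on_closure_derivs(1,2)[OF assms, of "[]"] L2_bounded[of B] continuous_measurable_\<mu>[of B] by auto

lemma curl_rows_pairing:
  fixes B :: "real^2 \<Rightarrow> real^2^2" and \<phi> :: "real^2 \<Rightarrow> real^2"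
  assumes B: "smooth_on_closure \<omega> B" and \<phi>: "\<phi> \<in> test_functions \<omega>"
  shows "(\<integral>x. curl_rows B x \<bullet> \<phi> x \<partial>\<mu>) = (\<integral>x. curl_form (B x) (partial_deriv 1 \<phi> x) (partial_deriv 2 \<phi> x) \<partial>\<mu>)"
proof -
  note c = C1_bounded_component[OF B] and t = test_component[OF \<phi>]
  have p: "partial_deriv i (\<lambda>x. \<phi> x $ k) x = partial_deriv i \<phi> x $ k" for i k x
    by (rule partial_deriv_nth[OF smooth_differentiable[OF test_smooth[OF \<phi>]]])
  have "\<exists>C. \<forall>x\<in>\<omega>. \<bar>B x $ k $ j\<bar> \<le> C" "\<exists>C. \<forall>x\<in>\<omega>. \<bar>partial_deriv i (\<lambda>y. B y $ k $ j) x\<bar> \<le> C" for i k j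
    using c[of k j] unfolding C1_bounded_def by blast+
  then obtain C C' where C: "\<And>k j x. x \<in> \<omega> \<Longrightarrow> \<bar>B x $ k $ j\<bar> \<le> C k j"
    "\<And>i k j x. x \<in> \<omega> \<Longrightarrow> \<bar>partial_deriv i (\<lambda>y. B y $ k $ j) x\<bar> \<le> C' i k j" by metis
  have i1: "integrable \<mu> (\<lambda>x. partial_deriv i (\<lambda>y. B y $ k $ j) x * \<phi> x $ l)" for i k j l
    by (rule bounded_mult_test_integrable[OF C1_boundedD(2)[OF c] C(2) t])
  have i2: "integrable \<mu> (\<lambda>x. B x $ k $ j * partial_deriv i \<phi> x $ l)" for i k j l
    using bounded_mult_test_integrable[OF C1_boundedD(1)[OF c] C(1) test_partial_deriv[OF t], of k j i l] by (simp add: p)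
  have parts: "(\<integral>x. partial_deriv i (\<lambda>y. B y $ k $ j) x * \<phi> x $ l \<partial>\<mu>) = - (\<integral>x. B x $ k $ j * partial_deriv i \<phi> x $ l \<partial>\<mu>)" for i k j l
    using C1_bounded_parts[OF c t, of i k j l] by (simp add: p)
  have "(\<integral>x. curl_rows B x \<bullet> \<phi> x \<partial>\<mu>) = (\<integral>x. (partial_deriv 1 (\<lambda>y. B y $ 1 $ 2) x * \<phi> x $ 1 - partial_deriv 2 (\<lambda>y. B y $ 1 $ 1) x * \<phi> x $ 1)
     + (partial_deriv 1 (\<lambda>y. B y $ 2 $ 2) x * \<phi> x $ 2 - partial_deriv 2 (\<lambda>y. B y $ 2 $ 1) x * \<phi> x $ 2) \<partial>\<mu>)"
    by (simp add: inner_vec_def sum_2 curl_rows_nth left_diff_distrib)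
  also have "\<dots> = (\<integral>x. curl_form (B x) (partial_deriv 1 \<phi> x) (partial_deriv 2 \<phi> x) \<partial>\<mu>)"
    unfolding curl_form_def using i1 i2 by (simp add: parts)
  finally show ?thesis .
qed

lemma hessian_L2:
  assumes v: "v \<in> W2 2 \<omega>" shows "hessian \<omega> v \<in> L2 \<omega>"
proof -
  have w: "weak_deriv \<omega> [i, j] v \<in> L2 \<omega>" for i j by (rule weak_deriv_L2[OF v]) simp
  have m: "hessian \<omega> v \<in> borel_measurable \<mu>"
    using L2_measurable[OF w] by (subst borel_measurable_euclidean_space) (auto simp: Basis_vec_def inner_axis hessian_def)
  have "(norm (hessian \<omega> v x))\<^sup>2 = ((weak_deriv \<omega> [1, 1] v x)\<^sup>2 + (weak_deriv \<omega> [1, 2] v x)\<^sup>2)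
      + ((weak_deriv \<omega> [2, 1] v x)\<^sup>2 + (weak_deriv \<omega> [2, 2] v x)\<^sup>2)" for x
    by (simp add: hessian_def norm_vec_def L2_set_def sum_2)
  moreover have "integrable \<mu> (\<lambda>x. (weak_deriv \<omega> [i, j] v x)\<^sup>2)" for i j
    using L2_integrable2[OF w[of i j]] by simp
  ultimately have "integrable \<mu> (\<lambda>x. (norm (hessian \<omega> v x))\<^sup>2)" by simp
  then show ?thesis using m by (simp add: L2_def)
qed

text \<open>Row k of the weak Hessian is tested with the two first derivatives of the k-th component
  of \<phi>. Moving the weak derivatives back to the test function gives v against third derivatives
  of that component, and these agree because mixed derivatives commute.\<close>

lemma hessian_curl_free:
  fixes \<phi> :: "real^2 \<Rightarrow> real^2"
  assumes v: "v \<in> W2 2 \<omega>" and \<phi>: "\<phi> \<in> test_functions \<omega>"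
  shows "(\<integral>x. curl_form (hessian \<omega> v x) (partial_deriv 1 \<phi> x) (partial_deriv 2 \<phi> x) \<partial>\<mu>) = 0"
proof -
  have w: "weak_deriv \<omega> [i, j] v \<in> L2 \<omega>" "is_weak_deriv \<omega> [i, j] v (weak_deriv \<omega> [i, j] v)" for i j
    using weak_deriv_L2[OF v, of "[i, j]"] weak_deriv_is[OF v, of "[i, j]"] by auto
  have p: "partial_deriv i (\<lambda>x. \<phi> x $ k) = (\<lambda>x. partial_deriv i \<phi> x $ k)" for i k
    using partial_deriv_nth[OF smooth_differentiable[OF test_smooth[OF \<phi>]]] by auto
  have t: "(\<lambda>x. partial_deriv i \<phi> x $ k) \<in> test_functions \<omega>" for i k
    by (rule test_component[OF test_partial_deriv[OF \<phi>]])
  have s: "(\<integral>x. partial_derivs [k, j] (\<lambda>x. partial_deriv i \<phi> x $ k) x * v x \<partial>\<mu>) = (\<integral>x. weak_deriv \<omega> [k, j] v x * partial_deriv i \<phi> x $ k \<partial>\<mu>)" for i j k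
    using w(2)[of k j] t[of i k] unfolding is_weak_deriv_iff by (simp add: mult.commute)
  obtain R where R: "\<And>x. R < norm x \<Longrightarrow> \<phi> x = 0" by (rule test_bounded_support[OF \<phi>]) auto
  have "partial_deriv 1 (partial_deriv 2 (\<lambda>x. \<phi> x $ k)) = partial_deriv 2 (partial_deriv 1 (\<lambda>x. \<phi> x $ k))" for k
    by (rule partial_deriv_commute[OF test_smooth[OF test_component[OF \<phi>]], of R]) (use R in auto)
  then have eq: "partial_derivs [k, 1] (\<lambda>x. partial_deriv 2 \<phi> x $ k) = partial_derivs [k, 2] (\<lambda>x. partial_deriv 1 \<phi> x $ k)" for k
    by (simp add: p)
  have "(\<integral>x. weak_deriv \<omega> [k, 1] v x * partial_deriv 2 \<phi> x $ k \<partial>\<mu>) = (\<integral>x. weak_deriv \<omega> [k, 2] v x * partial_deriv 1 \<phi> x $ k \<partial>\<mu>)" for k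
    unfolding s[symmetric] eq ..
  moreover have "integrable \<mu> (\<lambda>x. weak_deriv \<omega> [k, j] v x * partial_deriv i \<phi> x $ l)" for i j k l
    by (rule L2_mult_integrable[OF w(1) smooth_L2[OF test_smooth[OF t]]])
  ultimately show ?thesis
    unfolding curl_form_def hessian_def by simp
qed

lemma curl_form_integrable:
  assumes "E \<in> L2 \<omega>" "p \<in> L2 \<omega>" "q \<in> L2 \<omega>"
  shows "integrable \<mu> (\<lambda>x. curl_form (E x) (p x) (q x))"
    and "\<bar>\<integral>x. curl_form (E x) (p x) (q x) \<partial>\<mu>\<bar> \<le> 2 * L2_norm \<omega> E * (L2_norm \<omega> p + L2_norm \<omega> q)"
proof -
  have nth: "(\<lambda>x. r x $ k) \<in> L2 \<omega>" if "r \<in> L2 \<omega>" for r :: "real^2 \<Rightarrow> real^2" and k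
  proof -
    have m: "(\<lambda>x. r x $ k) \<in> borel_measurable \<mu>"
      by (rule borel_measurable_continuous_on[OF _ L2_measurable[OF that]]) (intro continuous_intros)
    have "integrable \<mu> (\<lambda>x. (r x $ k)\<^sup>2)"
      by (rule Bochner_Integration.integrable_bound[OF L2_integrable2[OF that]])
         (use m in \<open>auto simp: abs_le_square_iff[symmetric] component_le_norm_cart\<close>)
    then show ?thesis using m by (simp add: L2_def)
  qed
  show i: "integrable \<mu> (\<lambda>x. curl_form (E x) (p x) (q x))"
    unfolding curl_form_def
    by (intro Bochner_Integration.integrable_add Bochner_Integration.integrable_diff L2_mult_integrable L2_component nth assms)
  note c1 = L2_norm_Cauchy_Schwarz[OF assms(1,2)] and c2 = L2_norm_Cauchy_Schwarz[OF assms(1,3)]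
  have "\<bar>\<integral>x. curl_form (E x) (p x) (q x) \<partial>\<mu>\<bar> \<le> (\<integral>x. \<bar>curl_form (E x) (p x) (q x)\<bar> \<partial>\<mu>)"
    by (rule integral_abs_bound)
  also have "\<dots> \<le> (\<integral>x. 2 * (norm (E x) * norm (p x) + norm (E x) * norm (q x)) \<partial>\<mu>)"
    by (rule integral_mono[OF integrable_abs[OF i] _ curl_form_le]) (use c1(1) c2(1) in simp)
  also have "\<dots> = 2 * ((\<integral>x. norm (E x) * norm (p x) \<partial>\<mu>) + (\<integral>x. norm (E x) * norm (q x) \<partial>\<mu>))"
    using c1(1) c2(1) by simp
  also have "\<dots> \<le> 2 * (L2_norm \<omega> E * L2_norm \<omega> p + L2_norm \<omega> E * L2_norm \<omega> q)"
    using c1(2) c2(2) by simp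
  finally show "\<bar>\<integral>x. curl_form (E x) (p x) (q x) \<partial>\<mu>\<bar> \<le> 2 * L2_norm \<omega> E * (L2_norm \<omega> p + L2_norm \<omega> q)"
    by (simp add: algebra_simps)
qed

text \<open>Adding the Hessian does not change the pairing of the curl with test fields. The 4 is
  the 2 of the bound on \<open>curl_form\<close> times the 2 of
  \<open>H_minus_1_upper\<close>.\<close>

lemma curl_lower_bound:
  assumes v: "v \<in> W2 2 \<omega>" and B: "smooth_on_closure \<omega> B"
  shows "H_minus_norm 1 \<omega> (curl_rows B) \<le> ennreal (4 * L2_norm \<omega> (\<lambda>x. hessian \<omega> v x + B x))"
proof -
  let ?E = "\<lambda>x. hessian \<omega> v x + B x"
  have E: "?E \<in> L2 \<omega>" by (rule L2_add(1)[OF hessian_L2[OF v] smooth_closure_L2[OF B]])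
  have "H_minus_norm 1 \<omega> (curl_rows B) \<le> ennreal (2 * (2 * L2_norm \<omega> ?E))"
  proof (rule H_minus_1_upper[OF curl_rows_L2[OF B]])
    fix \<phi> :: "real^2 \<Rightarrow> real^2" assume \<phi>: "\<phi> \<in> test_functions \<omega>"
    let ?p = "partial_deriv 1 \<phi>" and ?q = "partial_deriv 2 \<phi>"
    have pq: "?p \<in> L2 \<omega>" "?q \<in> L2 \<omega>" using smooth_L2[OF smooth_partial_deriv[OF test_smooth[OF \<phi>]]] by auto
    have "(\<integral>x. curl_rows B x \<bullet> \<phi> x \<partial>\<mu>) = (\<integral>x. curl_form (B x) (?p x) (?q x) \<partial>\<mu>) + (\<integral>x. curl_form (hessian \<omega> v x) (?p x) (?q x) \<partial>\<mu>)"
      unfolding curl_rows_pairing[OF B \<phi>] hessian_curl_free[OF v \<phi>] by simp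
    also have "\<dots> = (\<integral>x. curl_form (?E x) (?p x) (?q x) \<partial>\<mu>)"
      using curl_form_integrable(1)[OF hessian_L2[OF v] pq] curl_form_integrable(1)[OF smooth_closure_L2[OF B] pq]
      by (simp add: curl_form_add add.commute)
    finally show "\<bar>\<integral>x. curl_rows B x \<bullet> \<phi> x \<partial>\<mu>\<bar> \<le> 2 * L2_norm \<omega> ?E * (L2_norm \<omega> ?p + L2_norm \<omega> ?q)"
      using curl_form_integrable(2)[OF E pq] by simp
  qed simp
  then show ?thesis by simp
qed

text \<open>Since admissible \<phi> are essentially bounded by \<open>sup_const\<close>, an
  integrable perturbation is controlled by its L1 norm. This is how a quadratic expression in L2
  functions becomes admissible in the dual norm.\<close>

lemma H_minus_2_perturb:
  fixes f g :: "real^2 \<Rightarrow> real"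
  assumes f: "integrable \<mu> f" and g: "integrable \<mu> g"
  shows "H_minus_norm 2 \<omega> (\<lambda>x. f x + g x) \<le> H_minus_norm 2 \<omega> f + ennreal (sup_const * (\<integral>x. \<bar>g x\<bar> \<partial>\<mu>))"
  unfolding H_minus_norm_def[of 2 \<omega> "\<lambda>x. f x + g x"]
proof (rule SUP_least)
  fix \<phi> :: "real^2 \<Rightarrow> real" assume "\<phi> \<in> {\<phi> \<in> W2_0 2 \<omega>. W2_norm 2 \<omega> \<phi> \<le> 1}"
  then have \<phi>: "\<phi> \<in> W2_0 2 \<omega>" and \<phi>1: "W2_norm 2 \<omega> \<phi> \<le> 1" by auto
  have \<phi>m [measurable]: "\<phi> \<in> borel_measurable \<mu>" by (rule L2_measurable[OF W2_0_L2[OF \<phi>]])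
  have ae: "AE x in \<mu>. \<bar>\<phi> x\<bar> \<le> sup_const" by (rule W2_0_bounded[OF \<phi> \<phi>1])
  have i: "integrable \<mu> (\<lambda>x. h x * \<phi> x)" if h: "integrable \<mu> h" for h
  proof (rule Bochner_Integration.integrable_bound[OF integrable_mult_right[OF integrable_abs[OF h], of sup_const]])
    show "(\<lambda>x. h x * \<phi> x) \<in> borel_measurable \<mu>" using h by measurable
    show "AE x in \<mu>. norm (h x * \<phi> x) \<le> norm (sup_const * \<bar>h x\<bar>)"
      using ae by eventually_elim (use sup_const_nonneg in \<open>auto simp: abs_mult mult.commute intro: mult_right_mono\<close>)
  qed
  have "\<bar>\<integral>x. g x * \<phi> x \<partial>\<mu>\<bar> \<le> (\<integral>x. \<bar>g x * \<phi> x\<bar> \<partial>\<mu>)" by (rule integral_abs_bound)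
  also have "\<dots> \<le> (\<integral>x. sup_const * \<bar>g x\<bar> \<partial>\<mu>)"
  proof (rule integral_mono_AE)
    show "AE x in \<mu>. \<bar>g x * \<phi> x\<bar> \<le> sup_const * \<bar>g x\<bar>"
      using ae by eventually_elim (auto simp: abs_mult mult.commute intro: mult_right_mono)
  qed (use i[OF g] g in auto)
  finally have gb: "\<bar>\<integral>x. g x * \<phi> x \<partial>\<mu>\<bar> \<le> sup_const * (\<integral>x. \<bar>g x\<bar> \<partial>\<mu>)" by simp
  have "(\<integral>x. (f x + g x) \<bullet> \<phi> x \<partial>\<mu>) = (\<integral>x. f x * \<phi> x \<partial>\<mu>) + (\<integral>x. g x * \<phi> x \<partial>\<mu>)"
    using i[OF f] i[OF g] by (simp add: distrib_right)
  then have "\<bar>\<integral>x. (f x + g x) \<bullet> \<phi> x \<partial>\<mu>\<bar> \<le> \<bar>\<integral>x. f x * \<phi> x \<partial>\<mu>\<bar> + sup_const * (\<integral>x. \<bar>g x\<bar> \<partial>\<mu>)"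
    using gb by linarith
  then have "ennreal \<bar>\<integral>x. (f x + g x) \<bullet> \<phi> x \<partial>\<mu>\<bar> \<le> ennreal \<bar>\<integral>x. f x * \<phi> x \<partial>\<mu>\<bar> + ennreal (sup_const * (\<integral>x. \<bar>g x\<bar> \<partial>\<mu>))"
    using sup_const_nonneg by (simp add: ennreal_leI flip: ennreal_plus)
  also have "\<dots> \<le> H_minus_norm 2 \<omega> f + ennreal (sup_const * (\<integral>x. \<bar>g x\<bar> \<partial>\<mu>))"
    using H_minus_ge[OF \<phi> \<phi>1, of f] by (intro add_right_mono) simp
  finally show "ennreal \<bar>\<integral>x. (f x + g x) \<bullet> \<phi> x \<partial>\<mu>\<bar> \<le> H_minus_norm 2 \<omega> f + ennreal (sup_const * (\<integral>x. \<bar>g x\<bar> \<partial>\<mu>))" .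
qed

text \<open>The difference is det E, two products of entries of E, minus the bilinear polarization
  of the determinant at E and B, four mixed products.\<close>

lemma det_perturb:
  fixes E B :: "real^2^2"
  shows "\<bar>det (E - B) - det B\<bar> \<le> 2 * (norm E)\<^sup>2 + 4 * (norm E * norm B)"
proof -
  have c: "\<bar>A $ k $ j\<bar> \<le> norm A" for k j and A :: "real^2^2"
    using component_le_norm_cart[of "A $ k" j] component_le_norm_cart order_trans Finite_Cartesian_Product.norm_nth_le by blast
  have m: "\<bar>A $ k $ j * B $ l $ m\<bar> \<le> norm A * norm B" for k j l m and A B :: "real^2^2"
    unfolding abs_mult by (intro mult_mono c) auto
  have "det (E - B) - det B = (E $ 1 $ 1 * E $ 2 $ 2 - E $ 1 $ 2 * E $ 2 $ 1) -
     (E $ 1 $ 1 * B $ 2 $ 2 + E $ 2 $ 2 * B $ 1 $ 1 - E $ 1 $ 2 * B $ 2 $ 1 - E $ 2 $ 1 * B $ 1 $ 2)"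
    by (simp add: det_2 algebra_simps)
  also have "\<bar>\<dots>\<bar> \<le> 2 * (norm E * norm E) + 4 * (norm E * norm B)"
    using m[of E 1 1 E 2 2] m[of E 1 2 E 2 1] m[of E 1 1 B 2 2] m[of E 2 2 B 1 1] m[of E 1 2 B 2 1] m[of E 2 1 B 1 2]
    by linarith
  finally show ?thesis by (simp add: power2_eq_square)
qed

lemma Linf_norm_finite:
  fixes B :: "real^2 \<Rightarrow> real^2^2"
  assumes B: "smooth_on_closure \<omega> B"
  obtains \<beta> where "0 \<le> \<beta>" "Linf_norm \<omega> B = ennreal \<beta>" "AE x in \<mu>. norm (B x) \<le> \<beta>"
proof -
  have m [measurable]: "B \<in> borel_measurable \<mu>" by (rule L2_measurable[OF smooth_closure_L2[OF B]])
  obtain C where C: "\<And>x. x \<in> \<omega> \<Longrightarrow> norm (B x) \<le> C" using smooth_on_closure_derivs(2)[OF B, of "[]"] by auto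
  have "Linf_norm \<omega> B \<le> ennreal C"
    unfolding Linf_norm_def by (rule esssup_I) (use C in \<open>auto simp: AE_\<mu> ennreal_leI\<close>)
  then obtain \<beta> where \<beta>: "0 \<le> \<beta>" "Linf_norm \<omega> B = ennreal \<beta>"
    by (cases "Linf_norm \<omega> B") (auto simp: top_unique)
  have "AE x in \<mu>. ennreal (norm (B x)) \<le> Linf_norm \<omega> B"
    unfolding Linf_norm_def by (rule esssup_AE)
  then have "AE x in \<mu>. norm (B x) \<le> \<beta>" unfolding \<beta>(2) by eventually_elim (use \<beta> in \<open>simp add: ennreal_le_iff\<close>)
  then show ?thesis using that \<beta> by blast
qed

text \<open>The square root of the area of \<omega>: the constant between L1 and L2 norms.\<close>

definition one_norm :: real where "one_norm = L2_norm \<omega> (\<lambda>_. 1 :: real)"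

text \<open>Integrating \<open>det_perturb\<close> bounds the L1 norm of the difference of the
  determinants. The perturbation lemma is then applied to this difference and to its negative, which
  gives both directions.\<close>

lemma det_H_minus_compare:
  assumes v: "v \<in> W2 2 \<omega>" and B: "smooth_on_closure \<omega> B" and S: "smooth_on_closure \<omega> S"
    and \<beta>: "0 \<le> \<beta>" "AE x in \<mu>. norm (B x) \<le> \<beta>"
  defines "E \<equiv> L2_norm \<omega> (\<lambda>x. hessian \<omega> v x + B x)"
  defines "D \<equiv> sup_const * (2 * E\<^sup>2 + 4 * (\<beta> * (E * one_norm)))"
  shows "H_minus_norm 2 \<omega> (\<lambda>x. det (hessian \<omega> v x) + curlT_curl S x) \<le>
      H_minus_norm 2 \<omega> (\<lambda>x. det (B x) + curlT_curl S x) + ennreal D"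
    and "H_minus_norm 2 \<omega> (\<lambda>x. det (B x) + curlT_curl S x) \<le>
      H_minus_norm 2 \<omega> (\<lambda>x. det (hessian \<omega> v x) + curlT_curl S x) + ennreal D"
proof -
  define e where "e x = hessian \<omega> v x + B x" for x
  define g where "g x = det (hessian \<omega> v x) - det (B x)" for x
  define s where "s x = curlT_curl S x" for x
  have hL: "hessian \<omega> v \<in> L2 \<omega>" and BL: "B \<in> L2 \<omega>" by (rule hessian_L2[OF v]) (rule smooth_closure_L2[OF B])
  have eL: "e \<in> L2 \<omega>" unfolding e_def by (rule L2_add(1)[OF hL BL])
  have det_i: "integrable \<mu> (\<lambda>x. det (F x))" if "F \<in> L2 \<omega>" for F :: "real^2 \<Rightarrow> real^2^2"
    unfolding det_2 by (intro Bochner_Integration.integrable_diff L2_mult_integrable L2_component that)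
  have s_i: "integrable \<mu> s"
  proof -
    have c: "integrable \<mu> (\<lambda>x. partial_derivs is (\<lambda>y. S y $ k $ j) x)" for "is" k j
    proof -
      have "partial_derivs is S \<in> L2 \<omega>"
        using smooth_on_closure_derivs(1,2)[OF S, of "is"] L2_bounded continuous_measurable_\<mu> by blast
      from L2_integrable[OF L2_component[OF this]]
      have "integrable \<mu> (\<lambda>x. partial_derivs is S x $ k $ j)" .
      then show ?thesis
        by (rule Bochner_Integration.integrable_cong[THEN iffD1, rotated 2])
           (auto simp: space_restrict_space partial_derivs_component[OF S])
    qed
    show ?thesis unfolding s_def[abs_def] curlT_curl_def[abs_def]
      by (intro Bochner_Integration.integrable_add Bochner_Integration.integrable_diff integrable_mult_right c)
  qed
  have g_i: "integrable \<mu> g" unfolding g_def[abs_def] by (intro Bochner_Integration.integrable_diff det_i hL BL)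
  have e1: "integrable \<mu> (\<lambda>x. norm (e x))" "(\<integral>x. norm (e x) \<partial>\<mu>) \<le> E * one_norm"
    using L2_norm_Cauchy_Schwarz[OF eL smooth_L2[OF smooth_const[of "1::real"]]]
    by (simp_all add: E_def e_def[abs_def] one_norm_def)
  have "(\<integral>x. \<bar>g x\<bar> \<partial>\<mu>) \<le> (\<integral>x. 2 * (norm (e x))\<^sup>2 + 4 * (\<beta> * norm (e x)) \<partial>\<mu>)"
  proof (rule integral_mono_AE)
    show "AE x in \<mu>. \<bar>g x\<bar> \<le> 2 * (norm (e x))\<^sup>2 + 4 * (\<beta> * norm (e x))"
      using \<beta>(2)
    proof eventually_elim
      case (elim x)
      have "\<bar>g x\<bar> \<le> 2 * (norm (e x))\<^sup>2 + 4 * (norm (e x) * norm (B x))"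
        using det_perturb[of "e x" "B x"] by (simp add: g_def e_def)
      moreover have "norm (e x) * norm (B x) \<le> \<beta> * norm (e x)" using elim by (simp add: mult.commute mult_right_mono)
      ultimately show ?case by linarith
    qed
  qed (use g_i e1 L2_integrable2[OF eL] in auto)
  also have "\<dots> = 2 * E\<^sup>2 + 4 * (\<beta> * (\<integral>x. norm (e x) \<partial>\<mu>))"
    using e1(1) L2_integrable2[OF eL] by (simp add: E_def L2_norm_square e_def)
  also have "\<dots> \<le> 2 * E\<^sup>2 + 4 * (\<beta> * (E * one_norm))"
    using e1(2) \<beta>(1) by (simp add: mult_left_mono)
  finally have D: "sup_const * (\<integral>x. \<bar>g x\<bar> \<partial>\<mu>) \<le> D"
    unfolding D_def by (rule mult_left_mono[OF _ sup_const_nonneg])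
  have f_i: "integrable \<mu> (\<lambda>x. det (hessian \<omega> v x) + s x)" "integrable \<mu> (\<lambda>x. det (B x) + s x)"
    using det_i[OF hL] det_i[OF BL] s_i by auto
  have "H_minus_norm 2 \<omega> (\<lambda>x. det (hessian \<omega> v x) + s x) \<le>
      H_minus_norm 2 \<omega> (\<lambda>x. det (B x) + s x) + ennreal (sup_const * (\<integral>x. \<bar>g x\<bar> \<partial>\<mu>))"
    using H_minus_2_perturb[OF f_i(2) g_i] by (simp add: g_def algebra_simps)
  then show "H_minus_norm 2 \<omega> (\<lambda>x. det (hessian \<omega> v x) + curlT_curl S x) \<le>
      H_minus_norm 2 \<omega> (\<lambda>x. det (B x) + curlT_curl S x) + ennreal D"
    unfolding s_def using ennreal_leI[OF D] by (meson add_left_mono order_trans)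
  have "integrable \<mu> (\<lambda>x. - g x)" using g_i by simp
  from H_minus_2_perturb[OF f_i(1) this]
  have "H_minus_norm 2 \<omega> (\<lambda>x. det (B x) + s x) \<le>
      H_minus_norm 2 \<omega> (\<lambda>x. det (hessian \<omega> v x) + s x) + ennreal (sup_const * (\<integral>x. \<bar>g x\<bar> \<partial>\<mu>))"
    by (simp add: g_def algebra_simps abs_minus_commute[of "det (B _)"])
  then show "H_minus_norm 2 \<omega> (\<lambda>x. det (B x) + curlT_curl S x) \<le>
      H_minus_norm 2 \<omega> (\<lambda>x. det (hessian \<omega> v x) + curlT_curl S x) + ennreal D"
    unfolding s_def using ennreal_leI[OF D] by (meson add_left_mono order_trans)
qed

section \<open>The orthogonal complement of the Hessians\<close>

text \<open>On a bounded domain the sequence is also Cauchy in L1, which yields a subsequence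
  converging almost everywhere; its pointwise limit is the candidate.\<close>

lemma Riesz_Fischer:
  fixes f :: "nat \<Rightarrow> real^2 \<Rightarrow> 'b::euclidean_space"
  assumes f: "\<And>n. f n \<in> L2 \<omega>"
    and C: "\<And>e. 0 < e \<Longrightarrow> \<exists>N. \<forall>m\<ge>N. \<forall>n\<ge>N. L2_norm \<omega> (\<lambda>x. f m x - f n x) < e"
  obtains g where "g \<in> L2 \<omega>" "(\<lambda>n. L2_norm \<omega> (\<lambda>x. f n x - g x)) \<longlonglongrightarrow> 0"
proof -
  have m [measurable]: "f n \<in> borel_measurable \<mu>" for n by (rule L2_measurable[OF f])
  have L1: "(\<integral>x. norm (h x) \<partial>\<mu>) \<le> L2_norm \<omega> h * one_norm" if "h \<in> L2 \<omega>" for h :: "real^2 \<Rightarrow> 'b"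
    using L2_norm_Cauchy_Schwarz(2)[OF that smooth_L2[OF smooth_const[of "1::real"]]] by (simp add: one_norm_def)
  have one0: "0 \<le> one_norm" by (simp add: one_norm_def)
  have C1: "\<exists>N. \<forall>i\<ge>N. \<forall>j\<ge>N. (\<integral>x. norm (f i x - f j x) \<partial>\<mu>) < e" if e: "0 < e" for e
  proof -
    obtain N where N: "\<forall>m\<ge>N. \<forall>n\<ge>N. L2_norm \<omega> (\<lambda>x. f m x - f n x) < e / (one_norm + 1)"
      using C[of "e / (one_norm + 1)"] e one0 by auto
    have "(\<integral>x. norm (f i x - f j x) \<partial>\<mu>) < e" if "N \<le> i" "N \<le> j" for i j
    proof -
      have "(\<integral>x. norm (f i x - f j x) \<partial>\<mu>) \<le> L2_norm \<omega> (\<lambda>x. f i x - f j x) * one_norm"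
        by (rule L1[OF L2_diff(1)[OF f f]])
      also have "\<dots> \<le> e / (one_norm + 1) * one_norm" using N that one0 by (intro mult_right_mono) (auto intro: less_imp_le)
      also have "\<dots> < e" using e one0 by (simp add: field_simps)
      finally show ?thesis .
    qed
    then show ?thesis by blast
  qed
  obtain r where r: "strict_mono r" "AE x in \<mu>. Cauchy (\<lambda>i. f (r i) x)"
    by (rule cauchy_L1_AE_cauchy_subseq[of \<mu> f, OF L2_integrable[OF f] C1])
  define g where "g x = lim (\<lambda>i. f (r i) x)" for x
  have gm [measurable]: "g \<in> borel_measurable \<mu>" unfolding g_def by measurable
  have lim: "AE x in \<mu>. (\<lambda>i. f (r i) x) \<longlonglongrightarrow> g x"
    using r(2) by eventually_elim (simp add: g_def Cauchy_convergent_iff convergent_LIMSEQ_iff)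
  \<comment> \<open>Fatou's lemma along the subsequence turns the Cauchy bound into a bound for the
    distance to the limit.\<close>
  have main: "(\<lambda>x. f n x - g x) \<in> L2 \<omega> \<and> L2_norm \<omega> (\<lambda>x. f n x - g x) \<le> e"
    if e: "0 < e" and N: "\<And>i. N \<le> i \<Longrightarrow> L2_norm \<omega> (\<lambda>x. f n x - f i x) < e" for n N e
  proof -
    have "(\<integral>\<^sup>+x. ennreal ((norm (f n x - g x))\<^sup>2) \<partial>\<mu>) = (\<integral>\<^sup>+x. liminf (\<lambda>i. ennreal ((norm (f n x - f (r i) x))\<^sup>2)) \<partial>\<mu>)"
    proof (rule nn_integral_cong_AE)
      show "AE x in \<mu>. ennreal ((norm (f n x - g x))\<^sup>2) = liminf (\<lambda>i. ennreal ((norm (f n x - f (r i) x))\<^sup>2))"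
        using lim
      proof eventually_elim
        case (elim x)
        have "(\<lambda>i. ennreal ((norm (f n x - f (r i) x))\<^sup>2)) \<longlonglongrightarrow> ennreal ((norm (f n x - g x))\<^sup>2)"
          by (intro tendsto_ennrealI tendsto_intros elim)
        then show ?case by (rule lim_imp_Liminf[OF trivial_limit_sequentially, symmetric])
      qed
    qed
    also have "\<dots> \<le> liminf (\<lambda>i. \<integral>\<^sup>+x. ennreal ((norm (f n x - f (r i) x))\<^sup>2) \<partial>\<mu>)"
      by (rule nn_integral_liminf) measurable
    also have "\<dots> \<le> ennreal (e\<^sup>2)"
    proof (rule Liminf_le)
      have "(\<integral>\<^sup>+x. ennreal ((norm (f n x - f (r i) x))\<^sup>2) \<partial>\<mu>) \<le> ennreal (e\<^sup>2)" if "N \<le> i" for i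
      proof -
        have "(\<integral>\<^sup>+x. ennreal ((norm (f n x - f (r i) x))\<^sup>2) \<partial>\<mu>) = ennreal ((L2_norm \<omega> (\<lambda>x. f n x - f (r i) x))\<^sup>2)"
          unfolding L2_norm_square by (rule nn_integral_eq_integral[OF L2_integrable2[OF L2_diff(1)[OF f f]]]) simp
        also have "\<dots> \<le> ennreal (e\<^sup>2)"
          using N[of "r i"] seq_suble[OF r(1), of i] that by (intro ennreal_leI power_mono) auto
        finally show ?thesis .
      qed
      then show "\<forall>\<^sub>F i in sequentially. (\<integral>\<^sup>+x. ennreal ((norm (f n x - f (r i) x))\<^sup>2) \<partial>\<mu>) \<le> ennreal (e\<^sup>2)"
        unfolding eventually_sequentially by blast
    qed simp
    finally have le: "(\<integral>\<^sup>+x. ennreal ((norm (f n x - g x))\<^sup>2) \<partial>\<mu>) \<le> ennreal (e\<^sup>2)" .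
    have i: "integrable \<mu> (\<lambda>x. (norm (f n x - g x))\<^sup>2)"
      unfolding integrable_iff_bounded using le by (auto simp: order_le_less_trans[OF _ ennreal_less_top])
    have "ennreal ((L2_norm \<omega> (\<lambda>x. f n x - g x))\<^sup>2) \<le> ennreal (e\<^sup>2)"
      unfolding L2_norm_square using le by (subst nn_integral_eq_integral[OF i, symmetric]) auto
    then have "(L2_norm \<omega> (\<lambda>x. f n x - g x))\<^sup>2 \<le> e\<^sup>2" by (simp add: ennreal_le_iff)
    then show ?thesis using i e by (auto simp: L2_def intro: power2_le_imp_le)
  qed
  obtain N1 where "\<forall>m\<ge>N1. \<forall>n\<ge>N1. L2_norm \<omega> (\<lambda>x. f m x - f n x) < 1" using C[of 1] by auto
  then have "(\<lambda>x. f N1 x - g x) \<in> L2 \<omega>" using main[of 1 N1 N1] by auto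
  from L2_diff(1)[OF f this, of N1] have gL: "g \<in> L2 \<omega>" by simp
  have "(\<lambda>n. L2_norm \<omega> (\<lambda>x. f n x - g x)) \<longlonglongrightarrow> 0"
  proof (rule LIMSEQ_I)
    fix e :: real assume e: "0 < e"
    obtain N where N: "\<forall>m\<ge>N. \<forall>n\<ge>N. L2_norm \<omega> (\<lambda>x. f m x - f n x) < e / 2" using C[of "e / 2"] e by auto
    have "L2_norm \<omega> (\<lambda>x. f n x - g x) \<le> e / 2" if "N \<le> n" for n
      using main[of "e / 2" N n] N that e by auto
    then have "\<forall>n\<ge>N. norm (L2_norm \<omega> (\<lambda>x. f n x - g x) - 0) < e"
      using e by (auto intro: order_le_less_trans[of _ "e / 2"])
    then show "\<exists>N. \<forall>n\<ge>N. norm (L2_norm \<omega> (\<lambda>x. f n x - g x) - 0) < e" by blast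
  qed
  then show ?thesis using that gL by blast
qed

section \<open>Projection onto the Hessians\<close>

definition inner_L2 :: "(real^2 \<Rightarrow> 'b::euclidean_space) \<Rightarrow> (real^2 \<Rightarrow> 'b) \<Rightarrow> real" where
  "inner_L2 f g = (\<integral>x. f x \<bullet> g x \<partial>\<mu>)"

lemma inner_L2_self: "inner_L2 f f = (L2_norm \<omega> f)\<^sup>2"
  by (simp add: inner_L2_def L2_norm_square power2_norm_eq_inner)

lemma inner_L2_commute: "inner_L2 f g = inner_L2 g f"
  by (simp add: inner_L2_def inner_commute)

lemma inner_L2_le: "f \<in> L2 \<omega> \<Longrightarrow> g \<in> L2 \<omega> \<Longrightarrow> \<bar>inner_L2 f g\<bar> \<le> L2_norm \<omega> f * L2_norm \<omega> g"
  unfolding inner_L2_def by (rule L2_Cauchy_Schwarz(2))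

lemma inner_L2_add_right:
  "f \<in> L2 \<omega> \<Longrightarrow> g \<in> L2 \<omega> \<Longrightarrow> h \<in> L2 \<omega> \<Longrightarrow> inner_L2 f (\<lambda>x. g x + h x) = inner_L2 f g + inner_L2 f h"
  unfolding inner_L2_def using L2_Cauchy_Schwarz(1)[of f g] L2_Cauchy_Schwarz(1)[of f h] by (simp add: inner_add_right)

lemma inner_L2_diff_right:
  "f \<in> L2 \<omega> \<Longrightarrow> g \<in> L2 \<omega> \<Longrightarrow> h \<in> L2 \<omega> \<Longrightarrow> inner_L2 f (\<lambda>x. g x - h x) = inner_L2 f g - inner_L2 f h"
  unfolding inner_L2_def using L2_Cauchy_Schwarz(1)[of f g] L2_Cauchy_Schwarz(1)[of f h] by (simp add: inner_diff_right)

lemma inner_L2_tendsto: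
  assumes f: "\<And>n. f n \<in> L2 \<omega>" and g: "g \<in> L2 \<omega>" and h: "h \<in> L2 \<omega>"
    and lim: "(\<lambda>n. L2_norm \<omega> (\<lambda>x. f n x - g x)) \<longlonglongrightarrow> 0"
  shows "(\<lambda>n. inner_L2 h (f n)) \<longlonglongrightarrow> inner_L2 h g"
proof -
  have "\<forall>\<^sub>F n in sequentially. norm (inner_L2 h (f n) - inner_L2 h g) \<le> L2_norm \<omega> h * L2_norm \<omega> (\<lambda>x. f n x - g x)"
    using inner_L2_le[OF h L2_diff(1)[OF f g]] inner_L2_diff_right[OF h f g] by (intro always_eventually) auto
  from Lim_null_comparison[OF this tendsto_mult_right_zero[OF lim]]
  have "(\<lambda>n. inner_L2 h (f n) - inner_L2 h g) \<longlonglongrightarrow> 0" .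
  then show ?thesis by (rule LIM_zero_cancel)
qed

lemma L2_norm_combination:
  assumes f: "f \<in> L2 \<omega>" and g: "g \<in> L2 \<omega>"
  shows "(L2_norm \<omega> (\<lambda>x. f x + t *\<^sub>R g x))\<^sup>2 = (L2_norm \<omega> f)\<^sup>2 + 2 * t * inner_L2 f g + t\<^sup>2 * (L2_norm \<omega> g)\<^sup>2"
proof -
  have "(norm (f x + t *\<^sub>R g x))\<^sup>2 = (norm (f x))\<^sup>2 + 2 * t * (f x \<bullet> g x) + t\<^sup>2 * (norm (g x))\<^sup>2" for x
    unfolding power2_norm_eq_inner by (simp add: inner_add_left inner_add_right inner_commute power2_eq_square)
  then show ?thesis unfolding L2_norm_square inner_L2_def
    using L2_Cauchy_Schwarz(1)[OF f g] L2_integrable2[OF f] L2_integrable2[OF g] by simp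
qed

text \<open>The indices appear as [j, i] because weak derivatives of smooth functions come with the
  reversed list; entry by entry this matches \<open>hessian\<close>.\<close>

definition classical_hessian :: "(real^2 \<Rightarrow> real) \<Rightarrow> real^2 \<Rightarrow> real^2^2" where
  "classical_hessian v x = (\<chi> i j. partial_derivs [j, i] v x)"

lemma classical_hessian_L2:
  assumes v: "smooth_on UNIV v"
  shows "classical_hessian v \<in> L2 \<omega>" "AE x in \<mu>. hessian \<omega> v x = classical_hessian v x"
proof -
  have h: "AE x in \<mu>. weak_deriv \<omega> [i, j] v x = partial_derivs [j, i] v x" for i j
    using weak_deriv_smooth(1)[OF v, of "[i, j]"] by simp
  show ae: "AE x in \<mu>. hessian \<omega> v x = classical_hessian v x"
    using h[of 1 1] h[of 1 2] h[of 2 1] h[of 2 2]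
    by eventually_elim (simp add: hessian_def classical_hessian_def vec_eq_iff forall_2)
  show "classical_hessian v \<in> L2 \<omega>" by (rule L2_AE[OF hessian_L2[OF smooth_W2[OF v]] ae])
qed

lemma classical_hessian_combination:
  assumes v: "smooth_on UNIV v" and w: "smooth_on UNIV w"
  shows "classical_hessian (\<lambda>x. a * v x + t * w x) x = a *\<^sub>R classical_hessian v x + t *\<^sub>R classical_hessian w x"
proof -
  have "partial_deriv i (\<lambda>x. a * f x + t * g x) = (\<lambda>x. a * partial_deriv i f x + t * partial_deriv i g x)"
    if f: "smooth_on UNIV f" and g: "smooth_on UNIV g" for f g i
  proof (rule ext)
    fix x
    have "partial_deriv i (\<lambda>x. a * f x + t * g x) x = partial_deriv i (\<lambda>x. a * f x) x + partial_deriv i (\<lambda>x. t * g x) x"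
      by (intro partial_deriv_add smooth_differentiable smooth_cmult f g)
    then show "partial_deriv i (\<lambda>x. a * f x + t * g x) x = a * partial_deriv i f x + t * partial_deriv i g x"
      by (simp add: partial_deriv_cmult smooth_differentiable f g)
  qed
  note comb = this
  show ?thesis
    by (simp add: classical_hessian_def vec_eq_iff comb[OF v w] comb[OF smooth_partial_deriv[OF v] smooth_partial_deriv[OF w]])
qed

text \<open>Hilbert space projection onto the closure of a linear space: a minimizing sequence is
  Cauchy by the parallelogram identity, and the limit M of the residuals is orthogonal to the space.
  As each residual differs from B by a Hessian, pairing with M gives the same number for B, for the
  residuals and for M itself. The infimum need not be attained, hence the e in the last
  claim.\<close>

lemma hessian_projection:
  assumes B: "B \<in> L2 \<omega>"
  obtains M where "M \<in> L2 \<omega>" "\<And>w. smooth_on UNIV w \<Longrightarrow> inner_L2 M (classical_hessian w) = 0"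
    "(L2_norm \<omega> M)\<^sup>2 = inner_L2 M B"
    "\<And>e. 0 < e \<Longrightarrow> \<exists>v\<in>W2 2 \<omega>. L2_norm \<omega> (\<lambda>x. hessian \<omega> v x + B x) \<le> L2_norm \<omega> M + e"
proof -
  define E where "E v x = classical_hessian v x + B x" for v x
  define J where "J v = (L2_norm \<omega> (E v))\<^sup>2" for v
  define V where "V = {v :: real^2 \<Rightarrow> real. smooth_on UNIV v}"
  define d where "d = Inf (J ` V)"
  have EL: "E v \<in> L2 \<omega>" if "v \<in> V" for v
    unfolding E_def using that classical_hessian_L2(1) B by (auto simp: V_def intro: L2_add(1))
  have HL: "classical_hessian v \<in> L2 \<omega>" if "v \<in> V" for v using that classical_hessian_L2(1) by (auto simp: V_def)
  have Vc: "(\<lambda>x. a * v x + t * w x) \<in> V" if "v \<in> V" "w \<in> V" for v w a t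
    using that unfolding V_def by (auto intro: smooth_add smooth_cmult)
  have bdd: "bdd_below (J ` V)" by (rule bdd_belowI[of _ 0]) (auto simp: J_def)
  have ne: "V \<noteq> {}" using smooth_const[of "0::real"] by (auto simp: V_def)
  have d_le: "d \<le> J v" if "v \<in> V" for v unfolding d_def using bdd that by (auto intro: cInf_lower)
  have "\<exists>v\<in>V. J v < d + e" if "0 < e" for e
    using cInf_lessD[of "J ` V" "d + e"] ne that by (auto simp: d_def)
  then have "\<forall>n. \<exists>v\<in>V. J v < d + 1 / real (Suc n)" by simp
  then obtain v where v: "\<And>n. v n \<in> V" "\<And>n. J (v n) < d + 1 / real (Suc n)" by metis
  have diff_bound: "(L2_norm \<omega> (\<lambda>x. E (v m) x - E (v n) x))\<^sup>2 \<le> 2 * (1 / real (Suc m)) + 2 * (1 / real (Suc n))" for m n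
  proof -
    \<comment> \<open>The midpoint: its residual is the mean of the two residuals and has square
      norm at least d.\<close>
    define u where "u x = 1/2 * v m x + 1/2 * v n x" for x
    have u: "u \<in> V" unfolding u_def[abs_def] by (rule Vc[OF v(1) v(1)])
    have "(norm (E (v m) x - E (v n) x))\<^sup>2 = 2 * (norm (E (v m) x))\<^sup>2 + 2 * (norm (E (v n) x))\<^sup>2 - 4 * (norm (E u x))\<^sup>2" for x
    proof -
      have Bx: "B x = (1/2) *\<^sub>R B x + (1/2) *\<^sub>R B x" by (simp flip: scaleR_left_distrib)
      have "classical_hessian u x = (1/2) *\<^sub>R classical_hessian (v m) x + (1/2) *\<^sub>R classical_hessian (v n) x"
        unfolding u_def[abs_def] using v(1) unfolding V_def by (intro classical_hessian_combination) auto
      then have "E u x = (1/2) *\<^sub>R (E (v m) x + E (v n) x)"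
        unfolding E_def by (subst Bx) (simp only: scaleR_add_right ac_simps)
      then show ?thesis unfolding power2_norm_eq_inner
        by (simp add: inner_add_left inner_add_right inner_diff_left inner_diff_right inner_commute field_simps)
    qed
    then have "(L2_norm \<omega> (\<lambda>x. E (v m) x - E (v n) x))\<^sup>2 = 2 * J (v m) + 2 * J (v n) - 4 * J u"
      unfolding J_def L2_norm_square using L2_integrable2[OF EL[OF v(1)]] L2_integrable2[OF EL[OF u]] by simp
    then show ?thesis using v(2)[of m] v(2)[of n] d_le[OF u] by linarith
  qed
  have C: "\<exists>N. \<forall>m\<ge>N. \<forall>n\<ge>N. L2_norm \<omega> (\<lambda>x. E (v m) x - E (v n) x) < e" if e: "0 < e" for e
  proof -
    obtain N where N: "4 / e\<^sup>2 < real N" using reals_Archimedean2 by blast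
    have "L2_norm \<omega> (\<lambda>x. E (v m) x - E (v n) x) < e" if "N \<le> m" "N \<le> n" for m n
    proof -
      have s: "2 * (1 / real (Suc k)) < e\<^sup>2 / 2" if "N \<le> k" for k
      proof -
        have "4 / e\<^sup>2 < real (Suc k)" using N that by linarith
        then show ?thesis using e by (simp add: field_simps)
      qed
      have "(L2_norm \<omega> (\<lambda>x. E (v m) x - E (v n) x))\<^sup>2 < e\<^sup>2"
        using diff_bound[of m n] s[OF that(1)] s[OF that(2)] by linarith
      then show ?thesis using e by (intro power2_less_imp_less[of _ e]) auto
    qed
    then show ?thesis by blast
  qed
  obtain M where M: "M \<in> L2 \<omega>" "(\<lambda>n. L2_norm \<omega> (\<lambda>x. E (v n) x - M x)) \<longlonglongrightarrow> 0"
    by (rule Riesz_Fischer[of "\<lambda>n. E (v n)", OF EL[OF v(1)] C])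
  have inv: "(\<lambda>n. 1 / real (Suc n)) \<longlonglongrightarrow> 0" by (rule LIMSEQ_Suc[OF lim_1_over_n])
  have orth: "inner_L2 M (classical_hessian w) = 0" if "smooth_on UNIV w" for w
  proof -
    let ?H = "classical_hessian w"
    have w: "w \<in> V" using that by (simp add: V_def)
    \<comment> \<open>Moving in the direction w can lower the functional by at most the gap 1/(n +
      1) to the infimum; the discriminant then bounds the inner product.\<close>
    have bound: "(inner_L2 ?H (E (v n)))\<^sup>2 \<le> 1 / real (Suc n) * (L2_norm \<omega> ?H)\<^sup>2" for n
    proof (rule le_of_quadratic_nonneg)
      fix t
      have "E (\<lambda>x. 1 * v n x + t * w x) = (\<lambda>x. E (v n) x + t *\<^sub>R ?H x)"
        unfolding E_def using classical_hessian_combination[of "v n" w 1 t] v(1)[of n] w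
        by (auto simp: V_def)
      then have "J (\<lambda>x. 1 * v n x + t * w x) = J (v n) + 2 * t * inner_L2 (E (v n)) ?H + t\<^sup>2 * (L2_norm \<omega> ?H)\<^sup>2"
        unfolding J_def using L2_norm_combination[OF EL[OF v(1)] HL[OF w]] by simp
      then show "0 \<le> 1 / real (Suc n) + 2 * t * inner_L2 ?H (E (v n)) + t\<^sup>2 * (L2_norm \<omega> ?H)\<^sup>2"
        using d_le[OF Vc[OF v(1) w, of 1 n t]] v(2)[of n] by (simp add: inner_L2_commute[of ?H])
    qed
    have "(\<lambda>n. (inner_L2 ?H (E (v n)))\<^sup>2) \<longlonglongrightarrow> (inner_L2 ?H M)\<^sup>2"
      by (intro tendsto_intros inner_L2_tendsto EL v M HL w)
    moreover have "(\<lambda>n. 1 / real (Suc n) * (L2_norm \<omega> ?H)\<^sup>2) \<longlonglongrightarrow> 0 * (L2_norm \<omega> ?H)\<^sup>2"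
      by (intro tendsto_intros inv)
    ultimately have "(inner_L2 ?H M)\<^sup>2 \<le> 0 * (L2_norm \<omega> ?H)\<^sup>2"
      by (rule LIMSEQ_le) (use bound in blast)
    then show ?thesis by (simp add: inner_L2_commute)
  qed
  have ME: "inner_L2 M (E (v n)) = inner_L2 M B" for n
    unfolding E_def using inner_L2_add_right[OF M(1) HL[OF v(1)] B, of n] orth[of "v n"] v(1)[of n] by (simp add: V_def)
  have "(\<lambda>n. inner_L2 M (E (v n))) \<longlonglongrightarrow> inner_L2 M M"
    by (intro inner_L2_tendsto EL v M)
  then have MB: "(L2_norm \<omega> M)\<^sup>2 = inner_L2 M B" by (simp add: ME LIMSEQ_const_iff inner_L2_self)
  have near: "\<exists>v\<in>W2 2 \<omega>. L2_norm \<omega> (\<lambda>x. hessian \<omega> v x + B x) \<le> L2_norm \<omega> M + e" if e: "0 < e" for e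
  proof -
    obtain n where n: "L2_norm \<omega> (\<lambda>x. E (v n) x - M x) < e"
      using order_tendstoD(2)[OF M(2) e] by (auto dest: eventually_happens)
    have sv: "smooth_on UNIV (v n)" using v(1) by (simp add: V_def)
    have "AE x in \<mu>. E (v n) x = hessian \<omega> (v n) x + B x"
      using classical_hessian_L2(2)[OF sv] by eventually_elim (simp add: E_def)
    from L2_norm_cong_AE[OF L2_measurable[OF EL[OF v(1)]] this]
    have "L2_norm \<omega> (\<lambda>x. hessian \<omega> (v n) x + B x) = L2_norm \<omega> (\<lambda>x. (E (v n) x - M x) + M x)" by simp
    also have "\<dots> \<le> L2_norm \<omega> (\<lambda>x. E (v n) x - M x) + L2_norm \<omega> M"
      by (rule L2_add(2)[OF L2_diff(1)[OF EL[OF v(1)] M(1)] M(1)])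
    finally show ?thesis using n smooth_W2[OF sv, of 2] by (intro bexI[of _ "v n"]) auto
  qed
  show ?thesis by (rule that[OF M(1) orth MB near])
qed

end

section \<open>Geometry of Lipschitz domains\<close>

text \<open>Transfer to the complex plane by a linear isomorphism, where a bounded open set is
  simply connected only if it and its complement are connected.\<close>

lemma simply_connected_imp_connected_Compl:
  fixes \<omega> :: "(real^2) set"
  assumes "open \<omega>" "bounded \<omega>" "simply_connected \<omega>"
  shows "connected (- \<omega>)"
proof -
  define h where "h = (\<lambda>x::real^2. Complex (x $ 1) (x $ 2))"
  have lin: "linear h" unfolding h_def by (rule linearI) (auto simp: complex_eq_iff)
  have inj: "inj h" unfolding h_def by (rule injI) (auto simp: vec_eq_iff forall_2)
  have surj: "surj h"
  proof (rule surjI)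
    show "h (vector [Re z, Im z]) = z" for z by (simp add: h_def)
  qed
  obtain g where g: "homeomorphism (h ` \<omega>) \<omega> g h" by (rule linear_homeomorphism_image[OF lin inj])
  have "h ` \<omega> homeomorphic \<omega>" using g homeomorphic_def by blast
  then have sc: "simply_connected (h ` \<omega>)" using assms(3) homeomorphic_simply_connected_eq by blast
  have op: "open (h ` \<omega>)" by (rule open_surjective_linear_image[OF assms(1) lin surj])
  have bd: "bounded (h ` \<omega>)" by (rule bounded_linear_image[OF assms(2)]) (rule linear_conv_bounded_linear[THEN iffD1, OF lin])
  have con: "connected (- h ` \<omega>)" using simply_connected_iff_simple[OF op bd] sc by blast
  obtain g' where g': "homeomorphism (h ` (- \<omega>)) (- \<omega>) g' h" by (rule linear_homeomorphism_image[OF lin inj])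
  have "h ` (- \<omega>) = - h ` \<omega>" by (rule bij_image_Compl_eq) (simp add: bij_def inj surj)
  then have "connected (g' ` (h ` (- \<omega>)))"
    using con homeomorphism_cont1[OF g'] connected_continuous_image by metis
  then show ?thesis using homeomorphism_image1[OF g'] by simp
qed

lemma orthogonal_components_le:
  fixes T :: "real^2 \<Rightarrow> real^2"
  assumes T: "orthogonal_transformation T"
  shows "\<bar>T x $ i - T y $ i\<bar> \<le> dist x y"
proof -
  have "\<bar>(T x - T y) $ i\<bar> \<le> norm (T x - T y)" by (rule component_le_norm_cart)
  also have "\<dots> = norm (x - y)"
    using T by (metis linear_diff orthogonal_transformation orthogonal_transformation_linear)
  finally show ?thesis by (simp add: dist_norm)
qed

text \<open>The exterior of \<open>\<omega>\<close> is connected near a boundary point, hence a separation of the complement of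
  \<open>closure \<omega>\<close> would separate the complement of \<open>\<omega>\<close>.\<close>

lemma lipschitz_boundary_outside:
  fixes \<omega> :: "(real^2) set"
  assumes op: "open \<omega>" and lip: "lipschitz_boundary \<omega>" and p: "p \<in> frontier \<omega>"
  shows "p \<in> closure (- closure \<omega>)"
    and "\<exists>s>0. \<exists>Z. connected Z \<and> (- closure \<omega>) \<inter> ball p s \<subseteq> Z \<and> Z \<subseteq> - closure \<omega>"
proof -
  obtain r and T :: "real^2 \<Rightarrow> real^2" and \<gamma> :: "real \<Rightarrow> real" and L :: real where r: "0 < r" and T: "orthogonal_transformation T" and \<gamma>: "L-lipschitz_on UNIV \<gamma>"
    and eq: "\<omega> \<inter> ball p r = {x \<in> ball p r. \<gamma> (T x $ 1) < T x $ 2}"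
    using lip p unfolding lipschitz_boundary_def by blast
  have L: "0 \<le> L" using \<gamma> by (rule lipschitz_on_nonneg)
  have linT: "linear T" by (rule orthogonal_transformation_linear[OF T])
  have comp: "\<bar>T x $ i - T y $ i\<bar> \<le> dist x y" for x y i by (rule orthogonal_components_le[OF T])
  have \<gamma>L: "\<bar>\<gamma> a - \<gamma> b\<bar> \<le> L * \<bar>a - b\<bar>" for a b using lipschitz_onD[OF \<gamma>, of a b] by (simp add: dist_real_def)
  have contT: "continuous_on S T" for S by (rule linear_continuous_on[OF linT[unfolded linear_conv_bounded_linear]])
  have cont\<gamma>: "continuous_on S \<gamma>" for S using lipschitz_on_continuous_on[OF \<gamma>] continuous_on_subset by blast
  \<comment> \<open>Signed height above the graph: near p the set \<omega> is where \<open>F\<close>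
    is positive.\<close>
  define F where "F x = T x $ 2 - \<gamma> (T x $ 1)" for x
  have contF: "continuous_on S F" for S
    unfolding F_def by (intro continuous_intros contT continuous_on_compose2[OF cont\<gamma>[of UNIV]]) auto
  have in\<omega>: "x \<in> \<omega> \<longleftrightarrow> 0 < F x" if "x \<in> ball p r" for x
  proof -
    have "x \<in> \<omega> \<inter> ball p r \<longleftrightarrow> x \<in> {x \<in> ball p r. \<gamma> (T x $ 1) < T x $ 2}" by (simp only: eq)
    then show ?thesis using that by (simp add: F_def)
  qed
  have out: "x \<in> - closure \<omega>" if "x \<in> ball p r" "F x < 0" for x
  proof -
    have "open (ball p r \<inter> F -` {..<0})" by (rule continuous_open_preimage[OF contF]) auto
    moreover have "(ball p r \<inter> F -` {..<0}) \<inter> \<omega> = {}" by (auto simp: in\<omega>)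
    ultimately have "(ball p r \<inter> F -` {..<0}) \<inter> closure \<omega> = {}" by (simp add: open_Int_closure_eq_empty)
    then show ?thesis using that by auto
  qed
  \<comment> \<open>A point on the graph is a limit of points of \<omega>: moving along u raises
    \<open>F\<close> by exactly the distance covered.\<close>
  have out': "F x < 0" if "x \<in> ball p r" "x \<in> - closure \<omega>" for x
  proof -
    have "F x \<le> 0" using in\<omega>[OF that(1)] that(2) closure_subset[of \<omega>] by force
    moreover have "F x \<noteq> 0"
    proof
      assume F0: "F x = 0"
      obtain u where u: "T u = axis 2 1" using orthogonal_transformation_surj[OF T] by (metis surjD)
      have nu: "norm u = 1" using u T by (metis norm_axis_1 orthogonal_transformation)
      have Fu: "F (x + t *\<^sub>R u) = F x + t" for t
        using linT by (simp add: F_def linear_add linear_scale u axis_def)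
      have "x \<in> closure \<omega>"
        unfolding closure_approachable
      proof (intro allI impI)
        fix e :: real assume e: "0 < e"
        define t where "t = min (e / 2) ((r - dist p x) / 2)"
        have t: "0 < t" "t < e" "t < r - dist p x" using e that(1) by (auto simp: t_def min_def field_simps)
        have "x + t *\<^sub>R u \<in> ball p r"
          using t nu dist_triangle[of p "x + t *\<^sub>R u" x] by (simp add: dist_norm)
        then have "x + t *\<^sub>R u \<in> \<omega>" using in\<omega> Fu F0 t by simp
        moreover have "dist (x + t *\<^sub>R u) x < e" using t nu by (simp add: dist_norm)
        ultimately show "\<exists>y\<in>\<omega>. dist y x < e" by blast
      qed
      then show False using that(2) by simp
    qed
    ultimately show ?thesis by simp
  qed
  obtain u where u: "T u = axis 2 1" using orthogonal_transformation_surj[OF T] by (metis surjD)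
  have nu: "norm u = 1" using u T by (metis norm_axis_1 orthogonal_transformation)
  obtain w where w: "T w = axis 1 1" using orthogonal_transformation_surj[OF T] by (metis surjD)
  have nw: "norm w = 1" using w T by (metis norm_axis_1 orthogonal_transformation)
  have Tuw: "T (p + a *\<^sub>R w + b *\<^sub>R u) $ 1 = T p $ 1 + a" "T (p + a *\<^sub>R w + b *\<^sub>R u) $ 2 = T p $ 2 + b" for a b
    using linT by (simp_all add: linear_add linear_scale u w axis_def)
  have Fp: "F p = 0"
  proof -
    have "p \<in> ball p r" using r by simp
    moreover have "p \<notin> \<omega>" "p \<in> closure \<omega>" using p op by (auto simp: frontier_def interior_open)
    ultimately have "\<not> 0 < F p" "\<not> F p < 0" using in\<omega>[of p] out[of p] by blast+
    then show ?thesis by simp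
  qed
  have F_low: "F (p + a *\<^sub>R w + b *\<^sub>R u) \<le> b + L * \<bar>a\<bar>" for a b
    using \<gamma>L[of "T p $ 1 + a" "T p $ 1"] Fp unfolding F_def Tuw by simp
  show "p \<in> closure (- closure \<omega>)"
    unfolding closure_approachable
  proof (intro allI impI)
    fix e :: real assume e: "0 < e"
    define t where "t = min (e / 2) (r / 2)"
    have t: "0 < t" "t < e" "t < r" using e r by (auto simp: t_def min_def)
    have "p + 0 *\<^sub>R w + (- t) *\<^sub>R u \<in> - closure \<omega>"
      by (rule out) (use t nu F_low[of 0 "- t"] in \<open>auto simp: dist_norm\<close>)
    moreover have "dist (p + 0 *\<^sub>R w + (- t) *\<^sub>R u) p < e" using t nu by (simp add: dist_norm)
    ultimately show "\<exists>y\<in>- closure \<omega>. dist y p < e" by blast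
  qed
  \<comment> \<open>Small enough for the box of half width s and half height (L + 2) s around p to
    lie in the ball of radius r.\<close>
  define s where "s = r / (L + 4)"
  have s0: "0 < s" using r L by (simp add: s_def)
  have "(L + 4) * s = r" using L by (simp add: s_def)
  then have "s + (L + 2) * s < r" using s0 by (simp add: algebra_simps)
  note s = s0 this
  define P where "P a b = p + a *\<^sub>R w + b *\<^sub>R u" for a b
  have Pball: "P a b \<in> ball p r" if "\<bar>a\<bar> < s" "\<bar>b\<bar> \<le> (L + 2) * s" for a b
  proof -
    have "dist p (P a b) \<le> \<bar>a\<bar> + \<bar>b\<bar>"
    proof -
      have "dist p (P a b) = norm (- (a *\<^sub>R w + b *\<^sub>R u))" by (simp add: dist_norm P_def)
      then show ?thesis using norm_triangle_ineq[of "a *\<^sub>R w" "b *\<^sub>R u"] nu nw unfolding norm_minus_cancel by simp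
    qed
    then show ?thesis using that s by simp
  qed
  \<comment> \<open>A comb. \<open>H\<close> is a horizontal segment at depth (L + 1) s, which the
    Lipschitz bound keeps below the graph; each \<open>V a\<close> is the vertical segment under the
    graph at abscissa a and meets \<open>H\<close>. Their union \<open>Z\<close> contains all
    exterior points within distance s of p.\<close>
  define H where "H = (\<lambda>a. P a (- (L + 1) * s)) ` {-s<..<s}"
  define V where "V a = (\<lambda>b. P a b) ` {b. - (L + 2) * s < b \<and> F (P a b) < 0 \<and> b < (L + 2) * s}" for a
  define Z where "Z = (\<Union>a\<in>{-s<..<s}. V a \<union> H)"
  have FP: "F (P a b) = b + F (P a 0)" for a b unfolding P_def F_def Tuw by simp
  have contP: "continuous_on UNIV (\<lambda>a. P a b)" "continuous_on UNIV (\<lambda>b. P a b)" for a b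
    unfolding P_def by (intro continuous_intros)+
  have mem: "P a (- (L + 1) * s) \<in> V a" if "\<bar>a\<bar> < s" for a
  proof -
    have "L * \<bar>a\<bar> \<le> L * s" using L that by (intro mult_left_mono) auto
    then have "F (P a (- (L + 1) * s)) < 0"
      using F_low[of a "- (L + 1) * s"] s unfolding P_def by (simp add: algebra_simps)
    moreover have "0 \<le> L * s" using L s by simp
    ultimately show ?thesis unfolding V_def using s by (intro imageI) (auto simp: algebra_simps)
  qed
  have "connected Z"
    unfolding Z_def
  proof (rule connected_Union)
    fix X assume "X \<in> (\<lambda>a. V a \<union> H) ` {-s<..<s}"
    then obtain a where a: "X = V a \<union> H" "a \<in> {-s<..<s}" by blast
    have "connected H" unfolding H_def
      by (rule connected_continuous_image[OF continuous_on_subset[OF contP(1)]]) auto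
    moreover have "connected (V a)"
    proof -
      define c where "c = - F (P a 0)"
      have c: "F (P a b) < 0 \<longleftrightarrow> b < c" for b using FP[of a b] unfolding c_def by linarith
      have eqI: "{b. - (L + 2) * s < b \<and> F (P a b) < 0 \<and> b < (L + 2) * s} = {- (L + 2) * s <..< min c ((L + 2) * s)}"
        unfolding c by auto
      show ?thesis unfolding V_def eqI
        by (rule connected_continuous_image[OF continuous_on_subset[OF contP(2) subset_UNIV]]) simp
    qed
    moreover have "P a (- (L + 1) * s) \<in> V a \<inter> H" using mem[of a] a(2) unfolding H_def by auto
    ultimately show "connected X" unfolding a(1) by (intro connected_Un) auto
  next
    have "P 0 (- (L + 1) * s) \<in> H" unfolding H_def using s by auto
    then show "\<Inter> ((\<lambda>a. V a \<union> H) ` {-s<..<s}) \<noteq> {}" by auto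
  qed
  moreover have "(- closure \<omega>) \<inter> ball p s \<subseteq> Z"
  proof
    fix x assume x: "x \<in> (- closure \<omega>) \<inter> ball p s"
    define a b where "a = T x $ 1 - T p $ 1" and "b = T x $ 2 - T p $ 2"
    have ab: "\<bar>a\<bar> < s" "\<bar>b\<bar> < s" using comp[of x _ p] x unfolding a_def b_def
      by (auto simp: dist_commute intro: order_le_less_trans)
    have "T (P a b) = T x" unfolding P_def by (simp add: vec_eq_iff forall_2 Tuw a_def b_def)
    then have xP: "x = P a b" using orthogonal_transformation_inj[OF T] by (metis injD)
    have "s \<le> (L + 2) * s" using L s(1) by simp
    moreover have "s \<le> r" using s L by (smt (verit) mult_nonneg_nonneg)
    then have "F x < 0" using x by (intro out') auto
    ultimately have "- (L + 2) * s < b" "b < (L + 2) * s" "F (P a b) < 0"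
      using ab(2) unfolding mult_minus_left xP[symmetric] by linarith+
    then have "x \<in> V a" unfolding V_def xP by blast
    then show "x \<in> Z" unfolding Z_def using ab(1) by (intro UN_I[of a]) auto
  qed
  moreover have "Z \<subseteq> - closure \<omega>"
  proof -
    have V: "V a \<subseteq> - closure \<omega>" if "\<bar>a\<bar> < s" for a
    proof
      fix x assume "x \<in> V a"
      then obtain b where b: "x = P a b" "- (L + 2) * s < b" "F (P a b) < 0" "b < (L + 2) * s" by (auto simp: V_def)
      then have "\<bar>b\<bar> \<le> (L + 2) * s" by (simp add: abs_le_iff algebra_simps)
      then show "x \<in> - closure \<omega>" using out[OF Pball[OF that]] b by simp
    qed
    show ?thesis
    proof
      fix x assume "x \<in> Z"
      then obtain a where a: "a \<in> {-s<..<s}" "x \<in> V a \<or> x \<in> H" unfolding Z_def by blast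
      from a(2) show "x \<in> - closure \<omega>"
      proof
        assume "x \<in> V a"
        moreover have "\<bar>a\<bar> < s" using a(1) by (auto simp: abs_less_iff)
        ultimately show ?thesis using V[of a] by blast
      next
        assume "x \<in> H"
        then obtain a' where a': "a' \<in> {-s<..<s}" "x = P a' (- (L + 1) * s)" unfolding H_def by blast
        moreover from a'(1) have "\<bar>a'\<bar> < s" by (auto simp: abs_less_iff)
        ultimately show ?thesis using V[of a'] mem[of a'] by blast
      qed
    qed
  qed
  ultimately show "\<exists>s>0. \<exists>Z. connected Z \<and> (- closure \<omega>) \<inter> ball p s \<subseteq> Z \<and> Z \<subseteq> - closure \<omega>"
    using s(1) by blast
qed

text \<open>The closures of two separating pieces cover the complement of \<omega>, because boundary
  points are limits of exterior points. That complement is connected, so the closures share a point,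
  necessarily a boundary point p. The connected set near p then meets both pieces, a
  contradiction.\<close>

lemma connected_Compl_closure:
  fixes \<omega> :: "(real^2) set"
  assumes op: "open \<omega>" and bd: "bounded \<omega>" and sc: "simply_connected \<omega>" and lip: "lipschitz_boundary \<omega>"
  shows "connected (- closure \<omega>)"
proof (rule ccontr)
  let ?W = "- closure \<omega>"
  assume "\<not> connected ?W"
  then obtain A B where AB: "open A" "open B" "A \<inter> ?W \<noteq> {}" "B \<inter> ?W \<noteq> {}" "A \<inter> B \<inter> ?W = {}" "?W \<subseteq> A \<union> B"
    unfolding connected_def by blast
  define A' B' where "A' = A \<inter> ?W" and "B' = B \<inter> ?W"
  have o: "open A'" "open B'" using AB by (auto simp: A'_def B'_def intro!: open_Int)
  have W: "?W = A' \<union> B'" "A' \<inter> B' = {}" "A' \<noteq> {}" "B' \<noteq> {}" using AB by (auto simp: A'_def B'_def)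
  have sub: "- \<omega> \<subseteq> closure A' \<union> closure B'"
  proof
    fix x assume x: "x \<in> - \<omega>"
    have "x \<in> closure ?W"
    proof (cases "x \<in> closure \<omega>")
      case True
      then have "x \<in> frontier \<omega>" using x op by (simp add: frontier_def interior_open)
      then show ?thesis by (rule lipschitz_boundary_outside(1)[OF op lip])
    next
      case False
      then show ?thesis using closure_subset by blast
    qed
    then show "x \<in> closure A' \<union> closure B'" unfolding W(1) by (simp add: closure_Un)
  qed
  have "A' \<subseteq> - \<omega>" "B' \<subseteq> - \<omega>" using closure_subset[of \<omega>] by (auto simp: A'_def B'_def)
  then have "closure A' \<inter> - \<omega> \<noteq> {}" "closure B' \<inter> - \<omega> \<noteq> {}" using W(3,4) closure_subset[of A'] closure_subset[of B'] by auto
  then have "closure A' \<inter> closure B' \<inter> - \<omega> \<noteq> {}"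
    using simply_connected_imp_connected_Compl[OF op bd sc] sub unfolding connected_closed by blast
  then obtain p where p: "p \<in> closure A'" "p \<in> closure B'" "p \<notin> \<omega>" by blast
  have "p \<notin> A'" using p(2) o(1) W(2) open_Int_closure_eq_empty by blast
  moreover have "p \<notin> B'" using p(1) o(2) W(2) open_Int_closure_eq_empty[of B' A'] by blast
  ultimately have "p \<in> frontier \<omega>" using W(1) p(3) op by (auto simp: frontier_def interior_open)
  then obtain s Z where Z: "0 < s" "connected Z" "?W \<inter> ball p s \<subseteq> Z" "Z \<subseteq> ?W"
    using lipschitz_boundary_outside(2)[OF op lip] by metis
  have "A' \<inter> ball p s \<noteq> {}" "B' \<inter> ball p s \<noteq> {}"
    using p(1,2) Z(1) open_Int_closure_eq_empty[OF open_ball, of p s] centre_in_ball[of p s] by blast+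
  then have "A' \<inter> Z \<noteq> {}" "B' \<inter> Z \<noteq> {}" using Z(3) W(1) by auto
  then show False using Z(2,4) W(1,2) o unfolding connected_def by blast
qed

section \<open>Inward translations and a partition of unity\<close>

lemma inward_direction:
  fixes \<omega> :: "(real^2) set"
  assumes op: "open \<omega>" and lip: "lipschitz_boundary \<omega>" and p: "p \<in> closure \<omega>"
  shows "\<exists>r>0. \<exists>e. \<forall>x\<in>closure \<omega> \<inter> ball p r. \<forall>\<delta>. 0 < \<delta> \<and> \<delta> < r \<longrightarrow> x + \<delta> *\<^sub>R e \<in> \<omega>"
proof (cases "p \<in> \<omega>")
  case True
  then obtain r where "0 < r" "ball p r \<subseteq> \<omega>" using op open_contains_ball by blast
  then show ?thesis by (intro exI[of _ r] conjI exI[of _ 0]) auto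
next
  case False
  then have "p \<in> frontier \<omega>" using p op by (simp add: frontier_def interior_open)
  then obtain r and T :: "real^2 \<Rightarrow> real^2" and \<gamma> :: "real \<Rightarrow> real" and L :: real where r: "0 < r" and T: "orthogonal_transformation T" and \<gamma>: "L-lipschitz_on UNIV \<gamma>"
    and eq: "\<omega> \<inter> ball p r = {x \<in> ball p r. \<gamma> (T x $ 1) < T x $ 2}"
    using lip unfolding lipschitz_boundary_def by blast
  have linT: "linear T" by (rule orthogonal_transformation_linear[OF T])
  have contT: "continuous_on S T" for S by (rule linear_continuous_on[OF linT[unfolded linear_conv_bounded_linear]])
  have cont\<gamma>: "continuous_on S \<gamma>" for S using lipschitz_on_continuous_on[OF \<gamma>] continuous_on_subset by blast
  define F where "F x = T x $ 2 - \<gamma> (T x $ 1)" for x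
  have contF: "continuous_on S F" for S
    unfolding F_def by (intro continuous_intros contT continuous_on_compose2[OF cont\<gamma>[of UNIV]]) auto
  \<comment> \<open>The vertical direction of the local graph. \<open>F\<close> is nonnegative on
    \<open>closure \<omega>\<close> near p and grows strictly along u. Halving the radius keeps the
    shifted points inside the ball where the graph description is valid.\<close>
  obtain u where u: "T u = axis 2 1" using orthogonal_transformation_surj[OF T] by (metis surjD)
  have nu: "norm u = 1" using u T by (metis norm_axis_1 orthogonal_transformation)
  have Fu: "F (x + t *\<^sub>R u) = F x + t" for x t
    using linT by (simp add: F_def linear_add linear_scale u axis_def)
  have in\<omega>: "x \<in> \<omega> \<longleftrightarrow> 0 < F x" if "x \<in> ball p r" for x
  proof -
    have "x \<in> \<omega> \<inter> ball p r \<longleftrightarrow> x \<in> {x \<in> ball p r. \<gamma> (T x $ 1) < T x $ 2}" by (simp only: eq)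
    then show ?thesis using that by (simp add: F_def)
  qed
  have "x + \<delta> *\<^sub>R u \<in> \<omega>" if x: "x \<in> closure \<omega>" "x \<in> ball p (r / 2)" and \<delta>: "0 < \<delta>" "\<delta> < r / 2" for x \<delta>
  proof -
    have "open (ball p r \<inter> F -` {..<0})" by (rule continuous_open_preimage[OF contF]) auto
    moreover have "(ball p r \<inter> F -` {..<0}) \<inter> \<omega> = {}" by (auto simp: in\<omega>)
    ultimately have "(ball p r \<inter> F -` {..<0}) \<inter> closure \<omega> = {}" by (simp add: open_Int_closure_eq_empty)
    moreover have "x \<in> ball p r" using x(2) r by auto
    ultimately have "0 \<le> F x" using x(1) by (fastforce simp: set_eq_iff not_less)
    then have "0 < F (x + \<delta> *\<^sub>R u)" using Fu \<delta> by simp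
    moreover have "x + \<delta> *\<^sub>R u \<in> ball p r"
      using \<delta> nu x(2) dist_triangle[of p "x + \<delta> *\<^sub>R u" x] by (simp add: dist_norm)
    ultimately show ?thesis by (simp add: in\<omega>)
  qed
  then show ?thesis using r by (intro exI[of _ "r / 2"] conjI exI[of _ u]) auto
qed

text \<open>In each coordinate a plateau: 1 up to distance s/2 from p, 0 from distance s on. For the
  Euclidean distance this gives 1 up to s/2 and 0 from 2s on.\<close>

definition cutoff :: "real \<Rightarrow> real^2 \<Rightarrow> real^2 \<Rightarrow> real" where
  "cutoff s p = tens (\<lambda>t. step (4 / s * t + (3 - 4 / s * p $ 1)) * step (- 4 / s * t + (3 + 4 / s * p $ 1)))
                     (\<lambda>t. step (4 / s * t + (3 - 4 / s * p $ 2)) * step (- 4 / s * t + (3 + 4 / s * p $ 2)))"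

lemma smooth_cutoff: "smooth_on UNIV (cutoff s p)"
  unfolding cutoff_def by (intro smooth_tens smooth1_mult smooth1_affine smooth_step)

lemma cutoff_1:
  assumes s: "0 < s" and x: "dist p x \<le> s / 2"
  shows "cutoff s p x = 1"
proof -
  have "\<bar>(x - p) $ i\<bar> \<le> s / 2" for i
    using component_le_norm_cart[of "x - p" i] x by (simp add: dist_norm norm_minus_commute)
  then have c: "\<bar>x $ i - p $ i\<bar> \<le> s / 2" for i by simp
  have "4 / s * (s / 2) = 2" using s by simp
  have neg: "- 4 / s * x $ i = - (4 / s * x $ i)" for i by simp
  then have "\<bar>4 / s * (x $ i - p $ i)\<bar> \<le> 2" for i
    using mult_left_mono[OF c[of i], of "4 / s"] s unfolding abs_mult by simp
  then have "\<bar>4 / s * x $ i - 4 / s * p $ i\<bar> \<le> 2" for i by (simp add: right_diff_distrib)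
  then have "1 \<le> 4 / s * x $ i + (3 - 4 / s * p $ i)" "1 \<le> - 4 / s * x $ i + (3 + 4 / s * p $ i)" for i
    unfolding neg[of i] abs_le_iff by (smt (verit))+
  then show ?thesis by (simp add: cutoff_def tens_def step_1)
qed

lemma cutoff_0:
  assumes s: "0 < s" and x: "2 * s \<le> dist p x"
  shows "cutoff s p x = 0"
proof -
  have "norm (x - p) \<le> \<bar>(x - p) $ 1\<bar> + \<bar>(x - p) $ 2\<bar>" using norm_le_l1_cart[of "x - p"] by (simp add: sum_2)
  then have "2 * s \<le> \<bar>x $ 1 - p $ 1\<bar> + \<bar>x $ 2 - p $ 2\<bar>" using x by (simp add: dist_norm norm_minus_commute)
  then obtain i where i: "s \<le> \<bar>x $ i - p $ i\<bar>" by (metis add_mono_thms_linordered_field(5) linorder_not_le mult_2)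
  have neg: "- 4 / s * x $ i = - (4 / s * x $ i)" by simp
  have "4 \<le> \<bar>4 / s * (x $ i - p $ i)\<bar>"
    using mult_left_mono[OF i, of "4 / s"] s unfolding abs_mult by simp
  then have "4 / s * x $ i + (3 - 4 / s * p $ i) \<le> -1 \<or> - 4 / s * x $ i + (3 + 4 / s * p $ i) \<le> -1"
    using neg unfolding right_diff_distrib by linarith
  then have "step (4 / s * x $ i + (3 - 4 / s * p $ i)) * step (- 4 / s * x $ i + (3 + 4 / s * p $ i)) = 0"
    using step_0 by auto
  then show ?thesis using exhaust_2[of i] by (auto simp: cutoff_def tens_def)
qed

lemma smooth_prod_compl:
  fixes b :: "nat \<Rightarrow> real^2 \<Rightarrow> real"
  assumes "\<And>j. smooth_on UNIV (b j)"
  shows "smooth_on UNIV (\<lambda>x. \<Prod>j<k. 1 - b j x)"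
  by (induction k) (auto intro!: smooth_const smooth_mult smooth_diff assms)

text \<open>Wherever one of the b equals 1 the product vanishes and the sum is 1. The partition of
  unity thus arises without division.\<close>

lemma partition_telescope:
  fixes b :: "nat \<Rightarrow> real"
  shows "(\<Sum>k<n. b k * (\<Prod>j<k. 1 - b j)) = 1 - (\<Prod>j<n. 1 - b j)"
  by (induction n) (auto simp: algebra_simps)

text \<open>The functions \<theta> and the directions depend on \<omega> only; the shift length
  \<delta> is free below a threshold, and just the width \<eta> of the neighbourhood depends on it.
  This order keeps the bounds on the cut and shifted potentials uniform.\<close>

lemma shift_partition:
  fixes \<omega> :: "(real^2) set"
  assumes op: "open \<omega>" and bd: "bounded \<omega>" and lip: "lipschitz_boundary \<omega>"
  obtains n :: nat and \<theta> :: "nat \<Rightarrow> real^2 \<Rightarrow> real" and e :: "nat \<Rightarrow> real^2" and \<delta>0 :: real and R :: real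
  where "0 < \<delta>0" "\<And>k. smooth_on UNIV (\<theta> k)" "\<And>k x. k < n \<Longrightarrow> R < norm x \<Longrightarrow> \<theta> k x = 0"
    "\<And>\<delta>. 0 < \<delta> \<Longrightarrow> \<delta> < \<delta>0 \<Longrightarrow> \<exists>\<eta>>0. \<forall>a\<in>closure \<omega>. \<forall>x. dist a x < \<eta> \<longrightarrow>
        (\<Sum>k<n. \<theta> k x) = 1 \<and> (\<forall>k<n. x \<in> closure {y. \<theta> k y \<noteq> 0} \<longrightarrow> x + \<delta> *\<^sub>R e k \<in> \<omega>)"
proof -
  have K: "compact (closure \<omega>)" using bd by simp
  have "\<forall>p\<in>closure \<omega>. \<exists>r e. 0 < r \<and> (\<forall>x\<in>closure \<omega> \<inter> ball p r. \<forall>\<delta>. 0 < \<delta> \<and> \<delta> < r \<longrightarrow> x + \<delta> *\<^sub>R e \<in> \<omega>)"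
    using inward_direction[OF op lip] by blast
  from bchoice[OF this] obtain r where "\<forall>p\<in>closure \<omega>. \<exists>e. 0 < r p \<and> (\<forall>x\<in>closure \<omega> \<inter> ball p (r p). \<forall>\<delta>. 0 < \<delta> \<and> \<delta> < r p \<longrightarrow> x + \<delta> *\<^sub>R e \<in> \<omega>)" ..
  from bchoice[OF this] obtain d where d: "\<forall>p\<in>closure \<omega>. 0 < r p \<and> (\<forall>x\<in>closure \<omega> \<inter> ball p (r p). \<forall>\<delta>. 0 < \<delta> \<and> \<delta> < r p \<longrightarrow> x + \<delta> *\<^sub>R d p \<in> \<omega>)" ..
  have rd: "\<And>p. p \<in> closure \<omega> \<Longrightarrow> 0 < r p"
    "\<And>p x \<delta>. p \<in> closure \<omega> \<Longrightarrow> x \<in> closure \<omega> \<Longrightarrow> x \<in> ball p (r p) \<Longrightarrow> 0 < \<delta> \<Longrightarrow> \<delta> < r p \<Longrightarrow> x + \<delta> *\<^sub>R d p \<in> \<omega>"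
    using d by blast+
  have cov: "closure \<omega> \<subseteq> (\<Union>p\<in>closure \<omega>. ball p (r p / 6))"
  proof
    fix x assume "x \<in> closure \<omega>"
    then show "x \<in> (\<Union>p\<in>closure \<omega>. ball p (r p / 6))" using rd(1)[of x] by (intro UN_I[of x]) auto
  qed
  have "\<exists>C\<subseteq>closure \<omega>. finite C \<and> closure \<omega> \<subseteq> (\<Union>p\<in>C. ball p (r p / 6))"
    by (rule compactE_image[OF K _ cov]) (simp, blast)
  then obtain C where C: "C \<subseteq> closure \<omega>" "finite C" "closure \<omega> \<subseteq> (\<Union>p\<in>C. ball p (r p / 6))"
    by blast
  obtain n :: nat and q where "C = q ` {i. i < n}" using finite_imp_nat_seg_image_inj_on[OF C(2)] by blast
  then have q: "q ` {..<n} = C" by (simp add: lessThan_def)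
  \<comment> \<open>With parameter r/3 the cutoff is 1 within r/6, the radius of the covering balls,
    and 0 beyond 2r/3, safely inside the ball of radius r where the inward direction works.\<close>
  define b where "b k = cutoff (r (q k) / 3) (q k)" for k :: nat
  define \<theta> where "\<theta> k x = b k x * (\<Prod>j<k. 1 - b j x)" for k x
  \<comment> \<open>The inserted 1 covers an empty index set.\<close>
  define \<delta>0 where "\<delta>0 = Min (insert 1 (r ` C))"
  have qC: "q k \<in> closure \<omega>" if "k < n" for k using q C(1) that by blast
  have r0: "0 < r (q k)" if "k < n" for k using rd(1) qC[OF that] by blast
  have \<delta>0: "0 < \<delta>0" unfolding \<delta>0_def using C rd(1) by (subst Min_gr_iff) auto
  have \<delta>0_le: "\<delta>0 \<le> r (q k)" if "k < n" for k unfolding \<delta>0_def using C(2) q that by (intro Min_le) auto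
  have bs: "smooth_on UNIV (b k)" for k unfolding b_def by (rule smooth_cutoff)
  have \<theta>s: "smooth_on UNIV (\<theta> k)" for k unfolding \<theta>_def[abs_def] by (intro smooth_mult bs smooth_prod_compl)
  have \<theta>0: "dist (q k) x \<le> 2 * (r (q k) / 3)" if "\<theta> k x \<noteq> 0" "k < n" for k x
  proof (rule ccontr)
    assume "\<not> ?thesis"
    then have "b k x = 0" unfolding b_def using r0[OF that(2)] by (intro cutoff_0) auto
    then show False using that by (simp add: \<theta>_def)
  qed
  obtain R0 where R0: "\<And>x. x \<in> closure \<omega> \<Longrightarrow> norm x \<le> R0" using compact_imp_bounded[OF K] by (auto simp: bounded_iff)
  define R where "R = R0 + (\<Sum>p\<in>C. r p)"
  have far: "\<theta> k x = 0" if "k < n" "R < norm x" for k x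
  proof (rule ccontr)
    assume "\<theta> k x \<noteq> 0"
    then have "dist (q k) x \<le> r (q k)" using \<theta>0[OF _ that(1)] r0[OF that(1)] by force
    moreover have "r (q k) \<le> (\<Sum>p\<in>C. r p)" using C rd(1) q that(1) by (intro member_le_sum) (auto simp: less_imp_le subset_iff)
    moreover have "norm x \<le> norm (q k) + dist (q k) x" by (metis dist_commute dist_norm norm_triangle_sub)
    ultimately show False using that(2) R0[OF qC[OF that(1)]] by (simp add: R_def)
  qed
  have main: "\<exists>\<eta>>0. \<forall>a\<in>closure \<omega>. \<forall>x. dist a x < \<eta> \<longrightarrow>
        (\<Sum>k<n. \<theta> k x) = 1 \<and> (\<forall>k<n. x \<in> closure {y. \<theta> k y \<noteq> 0} \<longrightarrow> x + \<delta> *\<^sub>R d (q k) \<in> \<omega>)"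
    if \<delta>: "0 < \<delta>" "\<delta> < \<delta>0" for \<delta>
  proof -
    \<comment> \<open>Open, and contains \<open>closure \<omega>\<close>. Both required properties
      hold on it, so compactness supplies the uniform width \<eta>.\<close>
    define G where "G = (\<Union>p\<in>C. ball p (r p / 6)) \<inter>
       (\<Inter>k\<in>{..<n}. - closure {y. \<theta> k y \<noteq> 0} \<union> (\<lambda>x. x + \<delta> *\<^sub>R d (q k)) -` \<omega>)"
    have oG: "open G"
      unfolding G_def using op by (intro open_Int open_UN ballI open_ball open_INT finite_lessThan open_Un open_Compl closed_closure open_vimage) (auto intro!: continuous_intros)
    have sub: "closure \<omega> \<subseteq> G"
    proof
      fix x assume x: "x \<in> closure \<omega>"
      have "x + \<delta> *\<^sub>R d (q k) \<in> \<omega>" if "k < n" "x \<in> closure {y. \<theta> k y \<noteq> 0}" for k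
      proof -
        have "closure {y. \<theta> k y \<noteq> 0} \<subseteq> cball (q k) (2 * (r (q k) / 3))"
          using \<theta>0[OF _ that(1)] by (intro closure_minimal) auto
        then have "x \<in> ball (q k) (r (q k))" using that r0[OF that(1)] by force
        then show ?thesis using rd(2)[OF qC[OF that(1)] x] \<delta> \<delta>0_le[OF that(1)] by auto
      qed
      moreover have "x \<in> (\<Union>p\<in>C. ball p (r p / 6))" using C(3) x by blast
      ultimately show "x \<in> G" unfolding G_def by blast
    qed
    obtain \<eta> where \<eta>: "0 < \<eta>" "(\<Union>a\<in>closure \<omega>. ball a \<eta>) \<subseteq> G"
      by (rule compact_subset_open_imp_ball_epsilon_subset[OF K oG sub])
    have "(\<Sum>k<n. \<theta> k x) = 1" if xG: "x \<in> G" for x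
    proof -
      have "x \<in> (\<Union>p\<in>C. ball p (r p / 6))" using xG unfolding G_def by blast
      then obtain p where p: "p \<in> C" "dist p x < r p / 6" by (auto simp del: UN_simps)
      then obtain k where k: "k < n" "p = q k" using q by auto
      have "b k x = 1" unfolding b_def using p k r0[OF k(1)] by (intro cutoff_1) auto
      then have "(\<Prod>j<n. 1 - b j x) = 0" using k(1) by (intro prod_zero) auto
      then show ?thesis unfolding \<theta>_def partition_telescope by simp
    qed
    moreover have "x + \<delta> *\<^sub>R d (q k) \<in> \<omega>" if "x \<in> G" "k < n" "x \<in> closure {y. \<theta> k y \<noteq> 0}" for x k
      using that unfolding G_def by auto
    ultimately show ?thesis using \<eta> by (intro exI[of _ \<eta>]) (auto simp: subset_iff)
  qed
  show ?thesis by (rule that[OF \<delta>0 \<theta>s far main])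
qed

text \<open>A neighbourhood of \<open>K\<close> may have holes, which shrink to nothing as the neighbourhood does.\<close>

lemma component_exhaustion:
  fixes K :: "(real^2) set"
  assumes K: "compact K" "K \<noteq> {}" and W: "connected (- K)" and R: "\<And>x. x \<in> K \<Longrightarrow> norm x \<le> R"
    and q: "R + 2 < norm q" and \<eta>: "0 < \<eta>"
  shows "\<exists>t>0. t \<le> 1 \<and> (\<forall>x. \<eta> \<le> infdist x K \<longrightarrow> x \<in> connected_component_set {x. t < infdist x K} q)"
proof -
  define V where "V t = {x. t < infdist x K}" for t :: real
  have oV: "open (V t)" for t unfolding V_def by (rule open_Collect_less) (auto intro!: continuous_intros)
  have mono: "V t \<subseteq> V s" if "s \<le> t" for s t using that by (auto simp: V_def)
  define D where "D n = connected_component_set (V (1 / real (Suc n))) q" for n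
  have oD: "open (D n)" for n unfolding D_def by (rule open_connected_component[OF oV])
  have Dmono: "D m \<subseteq> D n" if "m \<le> n" for m n
    unfolding D_def using that by (intro connected_component_mono mono) (simp add: frac_le)
  have far: "x \<in> V 1" if "R + 2 < norm x" for x
  proof -
    have "2 \<le> infdist x K"
    proof (rule ccontr)
      assume "\<not> 2 \<le> infdist x K"
      moreover obtain a where "a \<in> K" "infdist x K = dist x a" using infdist_attains_inf[OF compact_imp_closed[OF K(1)] K(2)] by blast
      ultimately show False using R[of a] that norm_triangle_ineq2[of x a] by (simp add: dist_norm)
    qed
    then show ?thesis by (simp add: V_def)
  qed
  have farD: "x \<in> D n" if "R + 2 < norm x" for x n
  proof -
    have c: "connected (- cball (0::real^2) (R + 2))" by (rule connected_complement_bounded_convex) auto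
    have "- cball (0::real^2) (R + 2) \<subseteq> V (1 / real (Suc n))" using far mono[of "1 / real (Suc n)" 1] by auto
    then show ?thesis unfolding D_def mem_Collect_eq using c that q
      by (intro connected_componentI[of "- cball 0 (R + 2)"]) auto
  qed
  have "- K \<subseteq> (\<Union>n. D n)"
  proof
    fix x assume x: "x \<in> - K"
    have oK: "open (- K)" using compact_imp_closed[OF K(1)] by auto
    have "q \<in> - K" using R[of q] q by force
    then obtain g where g: "path g" "path_image g \<subseteq> - K" "pathstart g = q" "pathfinish g = x"
      using connected_open_path_connected[OF oK W] x unfolding path_connected_def by blast
    have cp: "compact (path_image g)" "path_image g \<noteq> {}" using g(1) by (auto simp: compact_path_image)
    \<comment> \<open>The point of the path closest to K; its positive distance tells which
      \<open>D n\<close> contains the whole path.\<close>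
    obtain y where y: "y \<in> path_image g" "\<And>z. z \<in> path_image g \<Longrightarrow> infdist y K \<le> infdist z K"
      using continuous_attains_inf[OF cp, of "\<lambda>z. infdist z K", OF continuous_on_infdist[OF continuous_on_id]] by blast
    have "y \<notin> K" using y(1) g(2) by auto
    then have "infdist y K \<noteq> 0" using in_closed_iff_infdist_zero[OF compact_imp_closed[OF K(1)] K(2)] by blast
    then have "0 < infdist y K" using infdist_nonneg[of y K] by simp
    then obtain n where n: "1 / real (Suc n) < infdist y K" using nat_approx_posE by metis
    have "path_image g \<subseteq> V (1 / real (Suc n))" using n y(2) unfolding V_def by fastforce
    then have "x \<in> D n" unfolding D_def mem_Collect_eq
      using connected_path_image[OF g(1)] pathstart_in_path_image[of g] pathfinish_in_path_image[of g] g(3,4)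
      by (intro connected_componentI[of "path_image g"]) auto
    then show "x \<in> (\<Union>n. D n)" by blast
  qed
  \<comment> \<open>Points of norm larger than R + 2 have distance at least 2 from K and can be
    joined to q out there, so only this compact set needs a finite subcover of the increasing sets
    \<open>D n\<close>.\<close>
  moreover define Q where "Q = {x. \<eta> \<le> infdist x K} \<inter> cball 0 (R + 2)"
  have "closed {x. \<eta> \<le> infdist x K}" by (rule closed_Collect_le) (auto intro!: continuous_intros)
  then have cQ: "compact Q" unfolding Q_def by (metis compact_cball compact_Int_closed inf_commute)
  have "Q \<subseteq> - K" using \<eta> by (auto simp: Q_def)
  ultimately have covQ: "Q \<subseteq> (\<Union>n\<in>UNIV. D n)" by blast
  have "\<exists>I. finite I \<and> Q \<subseteq> (\<Union>n\<in>I. D n)"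
    by (rule compactE_image[OF cQ _ covQ]) (rule oD, blast)
  then obtain I where I: "finite I" "Q \<subseteq> (\<Union>n\<in>I. D n)" by blast
  obtain N where N: "\<And>n. n \<in> I \<Longrightarrow> n \<le> N" using finite_nat_set_iff_bounded_le[of I] I(1) by blast
  have "x \<in> D N" if "\<eta> \<le> infdist x K" for x
  proof (cases "R + 2 < norm x")
    case False
    then have "x \<in> Q" using that by (simp add: Q_def)
    then show ?thesis using I(2) N Dmono by blast
  qed (rule farD)
  then show ?thesis unfolding D_def V_def by (intro exI[of _ "1 / real (Suc N)"]) auto
qed

lemma uniformly_continuous_bounded_support:
  fixes f :: "real^2 \<Rightarrow> real"
  assumes f: "continuous_on UNIV f" and R: "\<And>x. R < norm x \<Longrightarrow> f x = 0" and d: "0 < d"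
  shows "\<exists>r>0. \<forall>x y. dist x y < r \<longrightarrow> \<bar>f x - f y\<bar> \<le> d"
proof -
  have "uniformly_continuous_on (cball 0 (R + 1)) f"
    by (rule compact_uniformly_continuous[OF continuous_on_subset[OF f subset_UNIV]]) simp
  then obtain r where r: "0 < r" "\<And>x y. x \<in> cball 0 (R + 1) \<Longrightarrow> y \<in> cball 0 (R + 1) \<Longrightarrow> dist y x < r \<Longrightarrow> dist (f y) (f x) < d"
    using d unfolding uniformly_continuous_on_def by blast
  have "\<bar>f x - f y\<bar> \<le> d" if "dist x y < min r 1" for x y
  proof (cases "norm x \<le> R \<or> norm y \<le> R")
    case True
    have "norm x \<le> norm y + dist x y" "norm y \<le> norm x + dist x y"
      by (metis dist_norm norm_triangle_sub) (metis dist_commute dist_norm norm_triangle_sub)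
    then have "x \<in> cball 0 (R + 1)" "y \<in> cball 0 (R + 1)" using True that by auto
    then show ?thesis using r(2)[of y x] that by (simp add: dist_real_def)
  next
    case False
    then show ?thesis using R[of x] R[of y] d by simp
  qed
  then show ?thesis using r(1) by (intro exI[of _ "min r 1"]) auto
qed

lemma zero_on_component:
  fixes f :: "real^2 \<Rightarrow> real"
  assumes f: "smooth_on UNIV f" and D: "open D" "connected D" and z: "\<And>x i. x \<in> D \<Longrightarrow> partial_deriv i f x = 0"
    and q: "q \<in> D" "f q = 0" and x: "x \<in> D"
  shows "f x = 0"
proof -
  have "(f has_derivative (\<lambda>_. 0)) (at y)" if "y \<in> D" for y
    using has_derivative_partial_deriv[OF smooth_differentiable[OF f], of y] z[OF that] by simp
  from has_derivative_zero_unique_connected[OF D this x q(1)] show ?thesis using q(2) by simp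
qed

section \<open>Potentials of the mollified field\<close>

text \<open>With \<open>m1 = M\<^sub>1\<^sub>1\<close>, \<open>m2 = M\<^sub>1\<^sub>2 + M\<^sub>2\<^sub>1\<close>, \<open>m3 = M\<^sub>2\<^sub>2\<close>, all integrals run upwards from \<open>-\<infinity>\<close>: \<open>pot1\<close> is the
  vertical primitive of the mollified \<open>m1\<close>, \<open>potb\<close> its horizontal derivative, and \<open>pot2\<close> the vertical
  primitive of the mollified \<open>m2\<close> plus \<open>potb\<close>. The hypothesis \<open>orth\<close> in the lemmas below is orthogonality of \<open>M\<close> to the Hessian of
  \<open>tens (bump_e e) (ramp_e e)\<close>, reflected and translated.\<close>

definition pot1 :: "real \<Rightarrow> (real^2 \<Rightarrow> real) \<Rightarrow> real^2 \<Rightarrow> real" where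
  "pot1 e m1 = conv m1 (tens (bump_e e) (step_e e))"

definition potb :: "real \<Rightarrow> (real^2 \<Rightarrow> real) \<Rightarrow> real^2 \<Rightarrow> real" where
  "potb e m1 = conv m1 (tens (deriv (bump_e e)) (step_e e))"

definition pot2 :: "real \<Rightarrow> (real^2 \<Rightarrow> real) \<Rightarrow> (real^2 \<Rightarrow> real) \<Rightarrow> real^2 \<Rightarrow> real" where
  "pot2 e m1 m2 x = conv m2 (tens (bump_e e) (step_e e)) x + conv m1 (tens (deriv (bump_e e)) (ramp_e e)) x"

text \<open>All identities differentiate the kernels. Orthogonality enters for the first derivative
  of \<open>pot2\<close>. Differentiating that identity vertically yields the first derivative of
  \<open>potb\<close>; so the gradient of \<open>potb\<close> is expressed through derivatives of
  the mollified components and vanishes wherever these vanish on an open set.\<close>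

lemma potentials:
  assumes e: "0 < e"
    and m: "integrable lborel m1" "integrable lborel m2" "integrable lborel m3"
    and R: "\<And>x. R < norm x \<Longrightarrow> m1 x = 0" "\<And>x. R < norm x \<Longrightarrow> m2 x = 0" "\<And>x. R < norm x \<Longrightarrow> m3 x = 0"
    and orth: "\<And>x. conv m1 (tens (deriv (deriv (bump_e e))) (ramp_e e)) x
        + conv m2 (tens (deriv (bump_e e)) (step_e e)) x + conv m3 (kern e) x = 0"
  shows "smooth_on UNIV (pot1 e m1)" "smooth_on UNIV (pot2 e m1 m2)" "smooth_on UNIV (potb e m1)"
    "partial_deriv 1 (pot1 e m1) x = potb e m1 x" "partial_deriv 2 (pot1 e m1) x = conv m1 (kern e) x"
    "partial_deriv 1 (pot2 e m1 m2) x = - conv m3 (kern e) x"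
    "partial_deriv 2 (pot2 e m1 m2) x = conv m2 (kern e) x + potb e m1 x"
    "partial_deriv 1 (potb e m1) x = - partial_deriv 2 (conv m3 (kern e)) x - partial_deriv 1 (conv m2 (kern e)) x"
    "partial_deriv 2 (potb e m1) x = partial_deriv 1 (conv m1 (kern e)) x"
proof -
  note s = smooth_bump_e[of e] smooth_step_e[of e] smooth_ramp_e[of e]
    smooth1_deriv[OF smooth_bump_e[of e]] smooth1_deriv[OF smooth1_deriv[OF smooth_bump_e[of e]]]
  have c1: "\<And>K. smooth_on UNIV K \<Longrightarrow> smooth_on UNIV (conv m1 K)"
    "\<And>i K. smooth_on UNIV K \<Longrightarrow> partial_deriv i (conv m1 K) = conv m1 (partial_deriv i K)"
    by (rule smooth_conv[OF m(1) R(1)]; assumption) (rule partial_deriv_conv[OF m(1) R(1)]; assumption)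
  have c2: "\<And>K. smooth_on UNIV K \<Longrightarrow> smooth_on UNIV (conv m2 K)"
    "\<And>i K. smooth_on UNIV K \<Longrightarrow> partial_deriv i (conv m2 K) = conv m2 (partial_deriv i K)"
    by (rule smooth_conv[OF m(2) R(2)]; assumption) (rule partial_deriv_conv[OF m(2) R(2)]; assumption)
  have c3: "\<And>K. smooth_on UNIV K \<Longrightarrow> smooth_on UNIV (conv m3 K)"
    "\<And>i K. smooth_on UNIV K \<Longrightarrow> partial_deriv i (conv m3 K) = conv m3 (partial_deriv i K)"
    by (rule smooth_conv[OF m(3) R(3)]; assumption) (rule partial_deriv_conv[OF m(3) R(3)]; assumption)
  note t = smooth_tens_derivs deriv_ramp_e[OF e] deriv_step_e[OF e]
  have sm: "smooth_on UNIV (tens (bump_e e) (step_e e))" "smooth_on UNIV (tens (deriv (bump_e e)) (ramp_e e))"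
    "smooth_on UNIV (tens (deriv (bump_e e)) (step_e e))" "smooth_on UNIV (kern e)"
    unfolding kern_def by (intro smooth_tens s)+
  show p1: "smooth_on UNIV (pot1 e m1)" unfolding pot1_def by (intro c1 sm)
  show pb: "smooth_on UNIV (potb e m1)" unfolding potb_def by (intro c1 sm)
  have a: "smooth_on UNIV (conv m2 (tens (bump_e e) (step_e e)))" "smooth_on UNIV (conv m1 (tens (deriv (bump_e e)) (ramp_e e)))"
    using c2(1)[OF sm(1)] c1(1)[OF sm(2)] by auto
  show p2: "smooth_on UNIV (pot2 e m1 m2)" unfolding pot2_def[abs_def] by (intro smooth_add a)
  show "partial_deriv 1 (pot1 e m1) x = potb e m1 x" "partial_deriv 2 (pot1 e m1) x = conv m1 (kern e) x"
    unfolding pot1_def potb_def kern_def by (simp_all add: c1(2)[OF sm(1)] t s)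
  have p2d: "partial_deriv i (pot2 e m1 m2) x = conv m2 (partial_deriv i (tens (bump_e e) (step_e e))) x
      + conv m1 (partial_deriv i (tens (deriv (bump_e e)) (ramp_e e))) x" for i x
    unfolding pot2_def[abs_def] using partial_deriv_add[OF smooth_differentiable[OF a(1)] smooth_differentiable[OF a(2)]]
    by (simp add: c1(2)[OF sm(2)] c2(2)[OF sm(1)])
  show p21: "partial_deriv 1 (pot2 e m1 m2) x = - conv m3 (kern e) x" for x
    using orth[of x] unfolding p2d by (simp add: t s)
  show p22: "partial_deriv 2 (pot2 e m1 m2) x = conv m2 (kern e) x + potb e m1 x"
    unfolding p2d potb_def kern_def by (simp add: t s)
  show "partial_deriv 2 (potb e m1) x = partial_deriv 1 (conv m1 (kern e)) x"
    unfolding potb_def c1(2)[OF sm(3)] c1(2)[OF sm(4)] by (simp add: t s kern_def)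
  have "conv m1 (tens (deriv (deriv (bump_e e))) (step_e e)) x + conv m2 (tens (deriv (bump_e e)) (bump_e e)) x
      = partial_deriv 2 (partial_deriv 1 (pot2 e m1 m2)) x"
  proof -
    have s2: "smooth_on UNIV (tens (deriv (bump_e e)) (step_e e))" "smooth_on UNIV (tens (deriv (deriv (bump_e e))) (ramp_e e))"
      by (intro smooth_tens s)+
    have b: "smooth_on UNIV (conv m2 (tens (deriv (bump_e e)) (step_e e)))" "smooth_on UNIV (conv m1 (tens (deriv (deriv (bump_e e))) (ramp_e e)))"
      using c2(1)[OF s2(1)] c1(1)[OF s2(2)] by auto
    have "partial_deriv 1 (pot2 e m1 m2) = (\<lambda>x. conv m2 (tens (deriv (bump_e e)) (step_e e)) x + conv m1 (tens (deriv (deriv (bump_e e))) (ramp_e e)) x)"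
      by (rule ext) (simp add: p2d t s)
    then have "partial_deriv 2 (partial_deriv 1 (pot2 e m1 m2)) x = partial_deriv 2 (conv m2 (tens (deriv (bump_e e)) (step_e e))) x
       + partial_deriv 2 (conv m1 (tens (deriv (deriv (bump_e e))) (ramp_e e))) x"
      using partial_deriv_add[OF smooth_differentiable[OF b(1)] smooth_differentiable[OF b(2)]] by simp
    then show ?thesis by (simp add: c1(2)[OF s2(2)] c2(2)[OF s2(1)] t s)
  qed
  moreover have "partial_deriv 2 (partial_deriv 1 (pot2 e m1 m2)) x = - partial_deriv 2 (conv m3 (kern e)) x"
  proof -
    have "partial_deriv 1 (pot2 e m1 m2) = (\<lambda>x. - conv m3 (kern e) x)" by (rule ext) (rule p21)
    then show ?thesis using partial_deriv_uminus[OF smooth_differentiable[OF c3(1)[OF sm(4)]]] by simp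
  qed
  moreover have "partial_deriv 1 (potb e m1) x = conv m1 (tens (deriv (deriv (bump_e e))) (step_e e)) x"
    unfolding potb_def c1(2)[OF sm(3)] by (simp add: t s)
  moreover have "partial_deriv 1 (conv m2 (kern e)) x = conv m2 (tens (deriv (bump_e e)) (bump_e e)) x"
    unfolding c2(2)[OF sm(4)] by (simp add: t s kern_def)
  ultimately show "partial_deriv 1 (potb e m1) x = - partial_deriv 2 (conv m3 (kern e)) x - partial_deriv 1 (conv m2 (kern e)) x"
    by simp
qed

text \<open>The point q lies below the reach of m, so the vertical factor is evaluated only where it
  vanishes. This gives the value 0 from which the potentials are propagated.\<close>

lemma conv_tens_low:
  assumes v: "\<And>t. t \<le> - e \<Longrightarrow> v t = 0" and m: "\<And>y. m y \<noteq> 0 \<Longrightarrow> norm y \<le> R" and q: "q $ 2 \<le> - R - e"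
  shows "conv m (tens u v) q = 0"
proof -
  have z: "m y * tens u v (q - y) = 0" for y
  proof (cases "m y = 0")
    case False
    then have "\<bar>y $ 2\<bar> \<le> R" using m[OF False] component_le_norm_cart[of y 2] by linarith
    then have "v (q $ 2 - y $ 2) = 0" using q by (intro v) linarith
    then show ?thesis by (simp add: tens_def)
  qed simp
  show ?thesis unfolding conv_def z by simp
qed

text \<open>On the component the mollified components are zero, so \<open>potb\<close> is constant
  there, and it is 0 at q. Only after that do the gradients of \<open>pot1\<close> and
  \<open>pot2\<close> vanish, and the same argument applies to them.\<close>

lemma potentials_support:
  fixes K :: "(real^2) set"
  assumes e: "0 < e" "2 * e \<le> t" "t \<le> 1"
    and m: "integrable lborel m1" "integrable lborel m2" "integrable lborel m3"
    and K: "\<And>x. m1 x \<noteq> 0 \<or> m2 x \<noteq> 0 \<or> m3 x \<noteq> 0 \<Longrightarrow> x \<in> K" and R: "\<And>x. x \<in> K \<Longrightarrow> norm x \<le> R"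
    and orth: "\<And>x. conv m1 (tens (deriv (deriv (bump_e e))) (ramp_e e)) x
        + conv m2 (tens (deriv (bump_e e)) (step_e e)) x + conv m3 (kern e) x = 0"
    and q: "q $ 2 \<le> - R - 1"
    and x: "x \<in> connected_component_set {x. t < infdist x K} q"
  shows "pot1 e m1 x = 0" "pot2 e m1 m2 x = 0"
proof -
  define V where "V = {x. t < infdist x K}"
  define D where "D = connected_component_set V q"
  have oV: "open V" unfolding V_def by (rule open_Collect_less) (auto intro!: continuous_intros)
  have oD: "open D" "connected D" "D \<subseteq> V"
    unfolding D_def using connected_component_subset[of V q] by (auto intro: open_connected_component[OF oV])
  have xD: "x \<in> D" using x by (simp add: D_def V_def)
  then have "connected_component V q x" by (simp add: D_def)
  then have "q \<in> V" by (rule connected_component_in[THEN conjunct1])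
  then have qD: "q \<in> D" unfolding D_def by (simp add: connected_component_refl)
  have R': "m1 x = 0" "m2 x = 0" "m3 x = 0" if "R < norm x" for x
    using K[of x] R[of x] that by force+
  have ker0: "conv m (kern e) x = 0" if "x \<in> V" "\<And>y. m y \<noteq> 0 \<Longrightarrow> y \<in> K" for m x
  proof (rule conv_kern_support[OF e(1)])
    fix y assume "m y \<noteq> 0"
    then have "infdist x K \<le> dist x y" using that(2) by (intro infdist_le) auto
    then show "2 * e \<le> norm (x - y)" using that(1) e by (simp add: V_def dist_norm)
  qed
  have k: "conv m1 (kern e) x = 0" "conv m2 (kern e) x = 0" "conv m3 (kern e) x = 0" if "x \<in> V" for x
    using ker0[OF that] K by blast+
  have dk: "partial_deriv i (conv m1 (kern e)) x = 0" "partial_deriv i (conv m2 (kern e)) x = 0" "partial_deriv i (conv m3 (kern e)) x = 0"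
    if "x \<in> V" for i x
    using k by (auto intro: partial_deriv_0_open[OF oV that])
  note p = potentials[OF e(1) m R' orth, of R]
  have mR: "norm y \<le> R" if "m1 y \<noteq> 0 \<or> m2 y \<noteq> 0" for y using K[of y] R that by blast
  have qe: "q $ 2 \<le> - R - e" using q e by linarith
  have low: "conv m1 (tens u v) q = 0" "conv m2 (tens u v) q = 0" if "\<And>t. t \<le> - e \<Longrightarrow> v t = 0" for u v
    using mR by (auto intro: conv_tens_low[OF that _ qe])
  have b: "potb e m1 y = 0" if "y \<in> D" for y
  proof (rule zero_on_component[OF p(3) oD(1,2) _ qD _ that])
    show "partial_deriv i (potb e m1) x = 0" if "x \<in> D" for x i
      using exhaust_2[of i] p(8,9)[of x] dk[of x] oD(3) that by auto
    show "potb e m1 q = 0" unfolding potb_def by (rule low) (rule scaled_support[OF e(1)])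
  qed
  show "pot1 e m1 x = 0"
  proof (rule zero_on_component[OF p(1) oD(1,2) _ qD _ xD])
    show "partial_deriv i (pot1 e m1) x = 0" if "x \<in> D" for x i
      using exhaust_2[of i] p(4,5)[of x] k[of x] b oD(3) that by auto
    show "pot1 e m1 q = 0" unfolding pot1_def by (rule low) (rule scaled_support[OF e(1)])
  qed
  show "pot2 e m1 m2 x = 0"
  proof (rule zero_on_component[OF p(2) oD(1,2) _ qD _ xD])
    show "partial_deriv i (pot2 e m1 m2) x = 0" if "x \<in> D" for x i
      using exhaust_2[of i] p(6,7)[of x] k[of x] b oD(3) that by auto
    show "pot2 e m1 m2 q = 0" unfolding pot2_def
      using low[OF scaled_support(2)[OF e(1)]] low[OF scaled_support(3)[OF e(1)]] by simp
  qed
qed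

text \<open>Here \<open>a\<close>, \<open>s\<close>, \<open>c\<close> are the given components and \<open>b\<close> the missing one. Integrating \<open>\<partial>\<^sub>1f1 \<partial>\<^sub>2f2 - \<partial>\<^sub>2f1 \<partial>\<^sub>1f2\<close>, whose
  integral vanishes, gives \<open>\<integral> (b\<^sup>2 + b s + a c) = 0\<close>.\<close>

lemma Korn:
  fixes f1 f2 :: "real^2 \<Rightarrow> real"
  assumes f: "smooth_on UNIV f1" "smooth_on UNIV f2"
    and R: "\<And>x. R < norm x \<Longrightarrow> f1 x = 0" "\<And>x. R < norm x \<Longrightarrow> f2 x = 0"
    and p: "\<And>x. partial_deriv 1 f1 x = b x" "\<And>x. partial_deriv 2 f1 x = a x"
      "\<And>x. partial_deriv 1 f2 x = - c x" "\<And>x. partial_deriv 2 f2 x = s x + b x"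
  shows "(\<integral>x. (b x)\<^sup>2 \<partial>lborel) \<le> (\<integral>x. (a x)\<^sup>2 \<partial>lborel) + (\<integral>x. (s x)\<^sup>2 \<partial>lborel) + (\<integral>x. (c x)\<^sup>2 \<partial>lborel)"
proof -
  note sp = smooth_partial_deriv
  have cont: "continuous_on UNIV a" "continuous_on UNIV b" "continuous_on UNIV c" "continuous_on UNIV s"
  proof -
    have eq: "b = partial_deriv 1 f1" "a = partial_deriv 2 f1" "c = (\<lambda>x. - partial_deriv 1 f2 x)"
      "s = (\<lambda>x. partial_deriv 2 f2 x - partial_deriv 1 f1 x)" by (auto simp: p)
    show "continuous_on UNIV a" "continuous_on UNIV b" "continuous_on UNIV c" "continuous_on UNIV s"
      unfolding eq by (intro continuous_intros smooth_continuous sp f)+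
  qed
  have z: "a x = 0" "b x = 0" "c x = 0" "s x = 0" if "R < norm x" for x
  proof -
    have "partial_deriv i f1 x = 0" "partial_deriv i f2 x = 0" for i
      using partial_deriv_support[OF R(1) that] partial_deriv_support[OF R(2) that] by auto
    then show "a x = 0" "b x = 0" "c x = 0" "s x = 0" using p[of x] by (auto simp: p(1)[symmetric])
  qed
  have int: "integrable lborel (\<lambda>x. g x * h x)" if "continuous_on UNIV g" "continuous_on UNIV h" "\<And>x. R < norm x \<Longrightarrow> g x = 0" for g h :: "real^2 \<Rightarrow> real"
    by (rule integrable_continuous_support[of _ R]) (use that in \<open>auto intro!: continuous_intros\<close>)
  have e1: "(\<integral>x. f1 x * partial_deriv 1 (partial_deriv 2 f2) x \<partial>lborel) = - (\<integral>x. partial_deriv 1 f1 x * partial_deriv 2 f2 x \<partial>lborel)"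
    by (rule integration_by_parts'[OF f(1) sp[OF f(2)], of R]) (use R in auto)
  have e2: "(\<integral>x. f1 x * partial_deriv 2 (partial_deriv 1 f2) x \<partial>lborel) = - (\<integral>x. partial_deriv 2 f1 x * partial_deriv 1 f2 x \<partial>lborel)"
    by (rule integration_by_parts'[OF f(1) sp[OF f(2)], of R]) (use R in auto)
  have "(\<integral>x. b x * (s x + b x) \<partial>lborel) = (\<integral>x. a x * (- c x) \<partial>lborel)"
    using e1 e2 partial_deriv_commute[OF f(2) R(2), of R 1 2] by (simp only: p minus_equation_iff neg_equal_iff_equal)
  then have "(\<integral>x. b x * s x \<partial>lborel) + (\<integral>x. b x * b x \<partial>lborel) = - (\<integral>x. a x * c x \<partial>lborel)"
    using int[OF cont(2) cont(4) z(2)] int[OF cont(2) cont(2) z(2)] by (simp add: distrib_left)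
  \<comment> \<open>Young's inequality for both mixed terms; half of the integral of the square of b
    is absorbed on the left.\<close>
  moreover have "- (\<integral>x. a x * c x \<partial>lborel) \<le> (\<integral>x. 1/2 * (a x * a x) + 1/2 * (c x * c x) \<partial>lborel)"
  proof -
    have "(\<integral>x. - (a x * c x) \<partial>lborel) \<le> (\<integral>x. 1/2 * (a x * a x) + 1/2 * (c x * c x) \<partial>lborel)"
    proof (rule integral_mono)
      fix x show "- (a x * c x) \<le> 1/2 * (a x * a x) + 1/2 * (c x * c x)"
        using zero_le_square[of "a x + c x"] by (simp add: algebra_simps)
    qed (use int[OF cont(1,3) z(1)] int[OF cont(1,1) z(1)] int[OF cont(3,3) z(3)] in auto)
    then show ?thesis by simp
  qed
  moreover have "- (\<integral>x. b x * s x \<partial>lborel) \<le> (\<integral>x. 1/2 * (b x * b x) + 1/2 * (s x * s x) \<partial>lborel)"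
  proof -
    have "(\<integral>x. - (b x * s x) \<partial>lborel) \<le> (\<integral>x. 1/2 * (b x * b x) + 1/2 * (s x * s x) \<partial>lborel)"
    proof (rule integral_mono)
      fix x show "- (b x * s x) \<le> 1/2 * (b x * b x) + 1/2 * (s x * s x)"
        using zero_le_square[of "b x + s x"] by (simp add: algebra_simps)
    qed (use int[OF cont(2,4) z(2)] int[OF cont(2,2) z(2)] int[OF cont(4,4) z(4)] in auto)
    then show ?thesis by simp
  qed
  moreover have "(\<integral>x. 1/2 * (b x * b x) + 1/2 * (s x * s x) \<partial>lborel) = 1/2 * (\<integral>x. b x * b x \<partial>lborel) + 1/2 * (\<integral>x. s x * s x \<partial>lborel)"
    "(\<integral>x. 1/2 * (a x * a x) + 1/2 * (c x * c x) \<partial>lborel) = 1/2 * (\<integral>x. a x * a x \<partial>lborel) + 1/2 * (\<integral>x. c x * c x \<partial>lborel)"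
    using int[OF cont(1,1) z(1)] int[OF cont(3,3) z(3)] int[OF cont(2,2) z(2)] int[OF cont(4,4) z(4)] by auto
  ultimately show ?thesis by (simp add: power2_eq_square)
qed

section \<open>From fields on the domain to densities on the plane\<close>

context planar_domain
begin

text \<open>Elements of \<open>L2\<close> are only Lebesgue measurable and arbitrary outside
  \<omega>, while convolution and Fubini are set up for Borel functions on \<open>lborel\<close>.
  The representative vanishes at every point outside \<omega>, not just almost everywhere.\<close>

lemma borel_version:
  fixes h :: "real^2 \<Rightarrow> real"
  assumes h: "h \<in> L2 \<omega>"
  obtains m where "integrable lborel m" "integrable lborel (\<lambda>x. (m x)\<^sup>2)" "(\<integral>x. (m x)\<^sup>2 \<partial>lborel) = (L2_norm \<omega> h)\<^sup>2"
    "\<And>x. m x \<noteq> 0 \<Longrightarrow> x \<in> \<omega>" "\<And>f. f \<in> borel_measurable borel \<Longrightarrow> (\<integral>x. h x * f x \<partial>\<mu>) = (\<integral>x. m x * f x \<partial>lborel)"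
proof -
  have "(\<lambda>x. indicator \<omega> x *\<^sub>R h x) \<in> borel_measurable (completion lborel)"
    using L2_measurable[OF h] unfolding measurable_\<mu> .
  from completion_ex_borel_measurable_real[OF this]
  obtain g where g: "g \<in> borel_measurable lborel" "AE x in lborel. indicator \<omega> x *\<^sub>R h x = g x" by blast
  define m where "m x = indicator \<omega> x * g x" for x
  have mb [measurable]: "m \<in> borel_measurable borel" unfolding m_def[abs_def]
    by (intro borel_measurable_times borel_measurable_indicator) (use g(1) in auto)
  have m0: "m x = 0" if "x \<notin> \<omega>" for x using that by (simp add: m_def)
  have ae: "AE x in \<mu>. h x = m x"
    unfolding AE_\<mu> using AE_completion[OF g(2)] by eventually_elim (auto simp: m_def)
  have mL: "m \<in> L2 \<omega>" by (rule L2_AE[OF h ae])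
  show ?thesis
  proof (rule that)
    show "integrable lborel m" using test_integral(2)[OF mb m0] L2_integrable[OF mL] by simp
    have sq: "(\<lambda>x. (m x)\<^sup>2) \<in> borel_measurable borel" by measurable
    show "integrable lborel (\<lambda>x. (m x)\<^sup>2)" using test_integral(2)[OF sq] m0 L2_integrable2[OF mL] by simp
    show "(\<integral>x. (m x)\<^sup>2 \<partial>lborel) = (L2_norm \<omega> h)\<^sup>2"
      using test_integral(1)[OF sq] m0 L2_norm_cong_AE[OF L2_measurable[OF h] ae] by (simp add: L2_norm_square)
    show "m x \<noteq> 0 \<Longrightarrow> x \<in> \<omega>" for x using m0 by blast
    fix f :: "real^2 \<Rightarrow> real" assume f [measurable]: "f \<in> borel_measurable borel"
    have "(\<integral>x. h x * f x \<partial>\<mu>) = (\<integral>x. m x * f x \<partial>\<mu>)"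
      by (rule integral_cong_AE) (use ae L2_measurable[OF h] L2_measurable[OF mL] borel_imp_\<mu>[OF f] in \<open>auto elim: eventually_mono\<close>)
    also have "\<dots> = (\<integral>x. m x * f x \<partial>lborel)" by (rule test_integral(1)) (auto simp: m0)
    finally show "(\<integral>x. h x * f x \<partial>\<mu>) = (\<integral>x. m x * f x \<partial>lborel)" .
  qed
qed

lemma L2_norm_lborel:
  fixes f :: "real^2 \<Rightarrow> real"
  assumes "smooth_on UNIV f" "\<And>x. x \<notin> \<omega> \<Longrightarrow> f x = 0"
  shows "L2_norm \<omega> f = sqrt (\<integral>x. (f x)\<^sup>2 \<partial>lborel)"
  unfolding L2_norm_def using test_integral(1)[of "\<lambda>x. (f x)\<^sup>2"] smooth_borel[OF assms(1)] assms(2) by simp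

lemma L2_norm_mult_le:
  fixes f g :: "real^2 \<Rightarrow> real"
  assumes "smooth_on UNIV f" "smooth_on UNIV g" "\<And>x. \<bar>f x\<bar> \<le> C" "0 \<le> C"
  shows "L2_norm \<omega> (\<lambda>x. f x * g x) \<le> C * L2_norm \<omega> g"
proof -
  have "(L2_norm \<omega> (\<lambda>x. f x * g x))\<^sup>2 \<le> (\<integral>x. C\<^sup>2 * (norm (g x))\<^sup>2 \<partial>\<mu>)"
    unfolding L2_norm_square
  proof (rule integral_mono)
    show "integrable \<mu> (\<lambda>x. (norm (f x * g x))\<^sup>2)" by (rule L2_integrable2[OF smooth_L2[OF smooth_mult[OF assms(1,2)]]])
    show "integrable \<mu> (\<lambda>x. C\<^sup>2 * (norm (g x))\<^sup>2)" using L2_integrable2[OF smooth_L2[OF assms(2)]] by simp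
    show "(norm (f x * g x))\<^sup>2 \<le> C\<^sup>2 * (norm (g x))\<^sup>2" for x
      unfolding norm_mult power_mult_distrib using assms(3)[of x] by (intro mult_right_mono power_mono) auto
  qed
  also have "\<dots> = (C * L2_norm \<omega> g)\<^sup>2" by (simp add: power_mult_distrib L2_norm_square)
  finally show ?thesis by (rule power2_le_imp_le) (use assms(4) in simp)
qed

lemma L2_norm_sum_le:
  assumes "\<And>k. k < n \<Longrightarrow> smooth_on UNIV (f k)"
  shows "L2_norm \<omega> (\<lambda>x. \<Sum>k<(n::nat). f k x) \<le> (\<Sum>k<n. L2_norm \<omega> (f k))"
  using assms
proof (induction n)
  case 0
  then show ?case by (simp add: L2_norm_def)
next
  case (Suc n)
  have "L2_norm \<omega> (\<lambda>x. (\<Sum>k<n. f k x) + f n x) \<le> L2_norm \<omega> (\<lambda>x. \<Sum>k<n. f k x) + L2_norm \<omega> (f n)"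
    by (rule L2_add(2)) (intro smooth_L2 smooth_sum Suc.prems; simp)+
  then show ?case using Suc by simp
qed

lemma L2_norm_vec2_le:
  fixes f :: "real^2 \<Rightarrow> real^2"
  assumes "smooth_on UNIV f"
  shows "L2_norm \<omega> f \<le> L2_norm \<omega> (\<lambda>x. f x $ 1) + L2_norm \<omega> (\<lambda>x. f x $ 2)"
proof -
  have c: "smooth_on UNIV (\<lambda>x. f x $ j)" for j by (rule smooth_linear[OF bounded_linear_vec_nth assms])
  have i: "integrable \<mu> (\<lambda>x. (f x $ j)\<^sup>2)" for j using L2_integrable2[OF smooth_L2[OF c[of j]]] by simp
  have "(norm (f x))\<^sup>2 = (f x $ 1)\<^sup>2 + (f x $ 2)\<^sup>2" for x
    by (simp add: norm_vec_def L2_set_def sum_2)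
  then have "(L2_norm \<omega> f)\<^sup>2 = (L2_norm \<omega> (\<lambda>x. f x $ 1))\<^sup>2 + (L2_norm \<omega> (\<lambda>x. f x $ 2))\<^sup>2"
    unfolding L2_norm_square using i by simp
  also have "\<dots> \<le> (L2_norm \<omega> (\<lambda>x. f x $ 1) + L2_norm \<omega> (\<lambda>x. f x $ 2))\<^sup>2"
    by (simp add: power2_sum)
  finally show ?thesis by (rule power2_le_imp_le) simp
qed

end

text \<open>The substitution puts the translation on \<beta>, where it costs only oscillation; the
  derivative of f is merely needed in L1.\<close>

lemma shift_pairing:
  fixes f \<beta> :: "real^2 \<Rightarrow> real"
  assumes f: "smooth_on UNIV f" and R: "\<And>x. R < norm x \<Longrightarrow> f x = 0"
    and \<beta>: "continuous_on UNIV \<beta>" "\<And>x. \<bar>\<beta> x\<bar> \<le> C" and d: "\<And>x. \<bar>\<beta> (v + x) - \<beta> x\<bar> \<le> d"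
  shows "\<bar>(\<integral>x. \<beta> x * partial_deriv i (\<lambda>x. f (x - v)) x \<partial>lborel) - (\<integral>x. \<beta> x * partial_deriv i f x \<partial>lborel)\<bar>
     \<le> d * (\<integral>x. \<bar>partial_deriv i f x\<bar> \<partial>lborel)"
proof -
  let ?p = "partial_deriv i f"
  have sp: "smooth_on UNIV ?p" by (rule smooth_partial_deriv[OF f])
  have p0: "?p x = 0" if "R < norm x" for x by (rule partial_deriv_support[OF R that])
  have ip: "integrable lborel ?p" by (rule integrable_continuous_support[OF smooth_continuous[OF sp] p0])
  have b [measurable]: "\<beta> \<in> borel_measurable borel" "?p \<in> borel_measurable borel"
    by (rule borel_measurable_continuous_onI[OF \<beta>(1)]) (rule smooth_borel[OF sp])
  have "(\<integral>x. \<beta> x * partial_deriv i (\<lambda>x. f (x - v)) x \<partial>lborel) = (\<integral>x. \<beta> x * ?p (x - v) \<partial>lborel)"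
    by (simp add: partial_deriv_translate[OF smooth_differentiable[OF f]])
  also have "\<dots> = (\<integral>x. \<beta> (v + x) * ?p (v + x - v) \<partial>lborel)"
    by (rule lborel_integral_translate(1)[symmetric]) measurable
  finally have 1: "(\<integral>x. \<beta> x * partial_deriv i (\<lambda>x. f (x - v)) x \<partial>lborel) = (\<integral>x. ?p x * \<beta> (v + x) \<partial>lborel)"
    by (simp add: mult.commute)
  have i: "integrable lborel (\<lambda>x. ?p x * \<beta> (v + x))" "integrable lborel (\<lambda>x. ?p x * \<beta> x)"
    by (rule integrable_mult_bounded(1)[OF ip, where C = C]; (use \<beta>(2) in simp | measurable))+
  have "\<bar>\<integral>x. ?p x * (\<beta> (v + x) - \<beta> x) \<partial>lborel\<bar> \<le> d * (\<integral>x. \<bar>?p x\<bar> \<partial>lborel)"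
    by (rule integrable_mult_bounded(2)[OF ip]) (use d in auto)
  moreover have "(\<integral>x. ?p x * (\<beta> (v + x) - \<beta> x) \<partial>lborel) = (\<integral>x. ?p x * \<beta> (v + x) \<partial>lborel) - (\<integral>x. \<beta> x * ?p x \<partial>lborel)"
    using i by (simp add: right_diff_distrib mult.commute[of "\<beta> _"])
  ultimately show ?thesis unfolding 1 by simp
qed

context planar_domain
begin

lemma L2_component_le:
  fixes E :: "real^2 \<Rightarrow> real^2^2"
  assumes "E \<in> L2 \<omega>" shows "L2_norm \<omega> (\<lambda>x. E x $ k $ j) \<le> L2_norm \<omega> E"
proof -
  have c: "\<bar>A $ k $ j\<bar> \<le> norm A" for A :: "real^2^2"
    using component_le_norm_cart[of "A $ k" j] component_le_norm_cart order_trans Finite_Cartesian_Product.norm_nth_le by blast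
  have "(L2_norm \<omega> (\<lambda>x. E x $ k $ j))\<^sup>2 \<le> (L2_norm \<omega> E)\<^sup>2"
    unfolding L2_norm_square
    by (rule integral_mono[OF L2_integrable2[OF L2_component[OF assms]] L2_integrable2[OF assms]])
       (use c in \<open>auto simp: abs_le_square_iff[symmetric]\<close>)
  then show ?thesis by (rule power2_le_imp_le) simp
qed

lemma classical_hessian_reflect:
  assumes K: "smooth_on UNIV K"
  shows "classical_hessian (\<lambda>y. K (x - y)) y $ i $ j = partial_derivs [j, i] K (x - y)"
proof -
  have p: "partial_deriv i (\<lambda>y. K (x - y)) = (\<lambda>y. - partial_deriv i K (x - y))" if "smooth_on UNIV K" for K :: "real^2 \<Rightarrow> real" and i
    by (rule ext) (rule partial_deriv_reflect[OF smooth_differentiable[OF that]])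
  have s: "smooth_on UNIV (\<lambda>y. partial_deriv i K (x - y))" by (rule smooth_reflect[OF smooth_partial_deriv[OF K]])
  show ?thesis
    unfolding classical_hessian_def
    by (simp add: p[OF K] p[OF smooth_partial_deriv[OF K]] partial_deriv_uminus[OF smooth_differentiable[OF s]])
qed

text \<open>Only the sum of the off-diagonal entries of M is seen by symmetric fields, so three
  scalars suffice; that sum is the source of the factor 4. The convolution identity is the
  distributional equation for the extension by zero, in mollified and integrated form.\<close>

lemma borel_stress:
  assumes M: "M \<in> L2 \<omega>" and orth: "\<And>w. smooth_on UNIV w \<Longrightarrow> inner_L2 M (classical_hessian w) = 0"
  obtains m1 m2 m3 where "integrable lborel m1" "integrable lborel m2" "integrable lborel m3"
    "integrable lborel (\<lambda>x. (m1 x)\<^sup>2)" "integrable lborel (\<lambda>x. (m2 x)\<^sup>2)" "integrable lborel (\<lambda>x. (m3 x)\<^sup>2)"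
    "(\<integral>x. (m1 x)\<^sup>2 \<partial>lborel) \<le> (L2_norm \<omega> M)\<^sup>2" "(\<integral>x. (m2 x)\<^sup>2 \<partial>lborel) \<le> 4 * (L2_norm \<omega> M)\<^sup>2"
    "(\<integral>x. (m3 x)\<^sup>2 \<partial>lborel) \<le> (L2_norm \<omega> M)\<^sup>2"
    "\<And>x. m1 x \<noteq> 0 \<or> m2 x \<noteq> 0 \<or> m3 x \<noteq> 0 \<Longrightarrow> x \<in> \<omega>"
    "\<And>e x. 0 < e \<Longrightarrow> conv m1 (tens (deriv (deriv (bump_e e))) (ramp_e e)) x
        + conv m2 (tens (deriv (bump_e e)) (step_e e)) x + conv m3 (kern e) x = 0"
    "\<And>F b1 b2 b3. F \<in> L2 \<omega> \<Longrightarrow> b1 \<in> borel_measurable borel \<Longrightarrow> b2 \<in> borel_measurable borel \<Longrightarrow> b3 \<in> borel_measurable borel \<Longrightarrow>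
       (\<And>x. x \<in> \<omega> \<Longrightarrow> F x $ 1 $ 1 = b1 x \<and> F x $ 1 $ 2 = b2 x \<and> F x $ 2 $ 1 = b2 x \<and> F x $ 2 $ 2 = b3 x) \<Longrightarrow>
       inner_L2 M F = (\<integral>x. m1 x * b1 x \<partial>lborel) + (\<integral>x. m2 x * b2 x \<partial>lborel) + (\<integral>x. m3 x * b3 x \<partial>lborel)"
proof -
  define h2 where "h2 x = M x $ 1 $ 2 + M x $ 2 $ 1" for x
  have hL: "(\<lambda>x. M x $ 1 $ 1) \<in> L2 \<omega>" "h2 \<in> L2 \<omega>" "(\<lambda>x. M x $ 2 $ 2) \<in> L2 \<omega>"
    unfolding h2_def by (intro L2_add(1) L2_component M)+
  have h2n: "L2_norm \<omega> h2 \<le> 2 * L2_norm \<omega> M"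
    using L2_add(2)[OF L2_component[OF M, of 1 2] L2_component[OF M, of 2 1]] L2_component_le[OF M, of 1 2] L2_component_le[OF M, of 2 1]
    unfolding h2_def by linarith
  obtain m1 where m1: "integrable lborel m1" "integrable lborel (\<lambda>x. (m1 x)\<^sup>2)" "(\<integral>x. (m1 x)\<^sup>2 \<partial>lborel) = (L2_norm \<omega> (\<lambda>x. M x $ 1 $ 1))\<^sup>2"
    "\<And>x. m1 x \<noteq> 0 \<Longrightarrow> x \<in> \<omega>" "\<And>f. f \<in> borel_measurable borel \<Longrightarrow> (\<integral>x. M x $ 1 $ 1 * f x \<partial>\<mu>) = (\<integral>x. m1 x * f x \<partial>lborel)"
    by (rule borel_version[OF hL(1)]) blast
  obtain m2 where m2: "integrable lborel m2" "integrable lborel (\<lambda>x. (m2 x)\<^sup>2)" "(\<integral>x. (m2 x)\<^sup>2 \<partial>lborel) = (L2_norm \<omega> h2)\<^sup>2"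
    "\<And>x. m2 x \<noteq> 0 \<Longrightarrow> x \<in> \<omega>" "\<And>f. f \<in> borel_measurable borel \<Longrightarrow> (\<integral>x. h2 x * f x \<partial>\<mu>) = (\<integral>x. m2 x * f x \<partial>lborel)"
    by (rule borel_version[OF hL(2)]) blast
  obtain m3 where m3: "integrable lborel m3" "integrable lborel (\<lambda>x. (m3 x)\<^sup>2)" "(\<integral>x. (m3 x)\<^sup>2 \<partial>lborel) = (L2_norm \<omega> (\<lambda>x. M x $ 2 $ 2))\<^sup>2"
    "\<And>x. m3 x \<noteq> 0 \<Longrightarrow> x \<in> \<omega>" "\<And>f. f \<in> borel_measurable borel \<Longrightarrow> (\<integral>x. M x $ 2 $ 2 * f x \<partial>\<mu>) = (\<integral>x. m3 x * f x \<partial>lborel)"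
    by (rule borel_version[OF hL(3)]) blast
  have inner: "inner_L2 M F = (\<integral>x. m1 x * b1 x \<partial>lborel) + (\<integral>x. m2 x * b2 x \<partial>lborel) + (\<integral>x. m3 x * b3 x \<partial>lborel)"
    if F: "F \<in> L2 \<omega>" and b: "b1 \<in> borel_measurable borel" "b2 \<in> borel_measurable borel" "b3 \<in> borel_measurable borel"
      and eq: "\<And>x. x \<in> \<omega> \<Longrightarrow> F x $ 1 $ 1 = b1 x \<and> F x $ 1 $ 2 = b2 x \<and> F x $ 2 $ 1 = b2 x \<and> F x $ 2 $ 2 = b3 x" for F b1 b2 b3
  proof -
    have bL: "b1 \<in> L2 \<omega>" "b2 \<in> L2 \<omega>" "b3 \<in> L2 \<omega>"
      by (rule L2_AE[OF L2_component[OF F, of 1 1]] L2_AE[OF L2_component[OF F, of 1 2]] L2_AE[OF L2_component[OF F, of 2 2]],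
          (use eq in \<open>auto simp: AE_\<mu>\<close>)[1])+
    have "inner_L2 M F = (\<integral>x. M x $ 1 $ 1 * b1 x + h2 x * b2 x + M x $ 2 $ 2 * b3 x \<partial>\<mu>)"
      unfolding inner_L2_def
    proof (rule Bochner_Integration.integral_cong[OF refl])
      fix x assume "x \<in> space \<mu>"
      then have "x \<in> \<omega>" by (simp add: space_restrict_space)
      from eq[OF this] show "M x \<bullet> F x = M x $ 1 $ 1 * b1 x + h2 x * b2 x + M x $ 2 $ 2 * b3 x"
        by (simp add: inner_vec_def sum_2 h2_def algebra_simps)
    qed
    also have "\<dots> = (\<integral>x. M x $ 1 $ 1 * b1 x \<partial>\<mu>) + (\<integral>x. h2 x * b2 x \<partial>\<mu>) + (\<integral>x. M x $ 2 $ 2 * b3 x \<partial>\<mu>)"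
      using L2_mult_integrable[OF hL(1) bL(1)] L2_mult_integrable[OF hL(2) bL(2)] L2_mult_integrable[OF hL(3) bL(3)] by simp
    finally show ?thesis using m1(5)[OF b(1)] m2(5)[OF b(2)] m3(5)[OF b(3)] by simp
  qed
  show ?thesis
  proof (rule that[OF m1(1) m2(1) m3(1) m1(2) m2(2) m3(2)])
    show "(\<integral>x. (m1 x)\<^sup>2 \<partial>lborel) \<le> (L2_norm \<omega> M)\<^sup>2" "(\<integral>x. (m3 x)\<^sup>2 \<partial>lborel) \<le> (L2_norm \<omega> M)\<^sup>2"
      unfolding m1(3) m3(3) by (intro power_mono L2_component_le M L2_norm_nonneg)+
    show "(\<integral>x. (m2 x)\<^sup>2 \<partial>lborel) \<le> 4 * (L2_norm \<omega> M)\<^sup>2"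
      using power_mono[OF h2n L2_norm_nonneg, of 2] unfolding m2(3) by (simp add: power_mult_distrib)
    show "m1 x \<noteq> 0 \<or> m2 x \<noteq> 0 \<or> m3 x \<noteq> 0 \<Longrightarrow> x \<in> \<omega>" for x using m1(4) m2(4) m3(4) by blast
    show "conv m1 (tens (deriv (deriv (bump_e e))) (ramp_e e)) x
        + conv m2 (tens (deriv (bump_e e)) (step_e e)) x + conv m3 (kern e) x = 0" if e: "0 < e" for e x
    proof -
      \<comment> \<open>Its second derivatives are exactly the three kernels of the claim; the two
        signs of the reflection cancel.\<close>
      let ?K = "tens (bump_e e) (ramp_e e)"
      note s = smooth_bump_e[of e] smooth_step_e[of e] smooth_ramp_e[of e]
        smooth1_deriv[OF smooth_bump_e[of e]] smooth1_deriv[OF smooth1_deriv[OF smooth_bump_e[of e]]]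
      have sK: "smooth_on UNIV ?K" by (intro smooth_tens s)
      have sw: "smooth_on UNIV (\<lambda>y. ?K (x - y))" by (rule smooth_reflect[OF sK])
      have sm: "(\<lambda>y. tens u v (x - y)) \<in> borel_measurable borel" if "smooth1 u" "smooth1 v" for u v
        by (rule smooth_borel[OF smooth_reflect[OF smooth_tens[OF that]]])
      have "inner_L2 M (classical_hessian (\<lambda>y. ?K (x - y))) = (\<integral>y. m1 y * tens (deriv (deriv (bump_e e))) (ramp_e e) (x - y) \<partial>lborel)
         + (\<integral>y. m2 y * tens (deriv (bump_e e)) (step_e e) (x - y) \<partial>lborel) + (\<integral>y. m3 y * tens (bump_e e) (bump_e e) (x - y) \<partial>lborel)"
        by (rule inner[OF classical_hessian_L2(1)[OF sw]])
           (use s in \<open>auto intro!: sm simp: classical_hessian_reflect[OF sK] smooth_tens_derivs deriv_ramp_e[OF e] deriv_step_e[OF e]\<close>)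
      then show ?thesis using orth[OF sw] by (simp add: conv_def kern_def)
    qed
  qed (use inner in blast)
qed

end

text \<open>The error is bounded by the oscillation of \<open>\<beta>\<close> at the scale of the shifts.\<close>

lemma cut_shift:
  fixes \<phi> :: "real^2 \<Rightarrow> real" and \<theta> :: "nat \<Rightarrow> real^2 \<Rightarrow> real" and v :: "nat \<Rightarrow> real^2" and n :: nat
  defines "\<psi> \<equiv> \<lambda>x. \<Sum>k<n. \<theta> k (x - v k) * \<phi> (x - v k)"
  assumes \<phi>: "smooth_on UNIV \<phi>" and R: "\<And>x. R < norm x \<Longrightarrow> \<phi> x = 0" "0 \<le> R"
    and \<theta>: "\<And>k. smooth_on UNIV (\<theta> k)" and C: "0 \<le> C" "\<And>k x. k < n \<Longrightarrow> \<bar>\<theta> k x\<bar> \<le> C" "\<And>k i x. k < n \<Longrightarrow> \<bar>partial_deriv i (\<theta> k) x\<bar> \<le> C"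
    and v: "\<And>k. k < n \<Longrightarrow> norm (v k) \<le> 1" and one: "\<And>x. \<phi> x \<noteq> 0 \<Longrightarrow> (\<Sum>k<n. \<theta> k x) = 1"
    and P: "\<And>i. L2_norm (ball 0 (R + 2)) (partial_deriv i \<phi>) \<le> P"
  shows "smooth_on UNIV \<psi>"
    and "L2_norm (ball 0 (R + 2)) \<psi> \<le> real n * (C * (1 + 2 * R) * P)"
    and "L2_norm (ball 0 (R + 2)) (partial_deriv i \<psi>) \<le> real n * (C * (1 + 2 * R) * P)"
    and "continuous_on UNIV \<beta> \<Longrightarrow> (\<And>x. \<bar>\<beta> x\<bar> \<le> D) \<Longrightarrow> (\<And>k x. k < n \<Longrightarrow> \<bar>\<beta> (v k + x) - \<beta> x\<bar> \<le> d) \<Longrightarrow> 0 \<le> d \<Longrightarrow>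
      \<bar>(\<integral>x. \<beta> x * partial_deriv i \<psi> x \<partial>lborel) - (\<integral>x. \<beta> x * partial_deriv i \<phi> x \<partial>lborel)\<bar>
        \<le> d * (real n * (C * (1 + 2 * R) * P) * L2_norm (ball 0 (R + 2)) (\<lambda>_. 1 :: real))"
proof -
  let ?N = "L2_norm (ball (0::real^2) (R + 2))"
  \<comment> \<open>The supports of \<phi> and of its translates by vectors of length at most 1 lie
    in this ball, so norms over it are norms over the plane and invariant under these
    translations.\<close>
  interpret \<Omega>: planar_domain "ball 0 (R + 2)" by unfold_locales auto
  define f where "f k x = \<theta> k x * \<phi> x" for k x
  define g where "g k x = f k (x - v k)" for k x
  have sf: "smooth_on UNIV (f k)" for k unfolding f_def[abs_def] by (rule smooth_mult[OF \<theta> \<phi>])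
  have sg: "smooth_on UNIV (g k)" for k unfolding g_def[abs_def] by (rule smooth_translate[OF sf])
  have \<psi>g: "\<psi> = (\<lambda>x. \<Sum>k<n. g k x)" by (simp add: \<psi>_def g_def f_def)
  show s\<psi>: "smooth_on UNIV \<psi>" unfolding \<psi>g by (intro smooth_sum sg)
  have f0: "f k x = 0" if "R < norm x" for k x using R(1)[OF that] by (simp add: f_def)
  have pf0: "partial_deriv i (f k) x = 0" if "R < norm x" for i k x by (rule partial_deriv_support[OF f0 that])
  have far: "R < norm (x - v k)" if "k < n" "x \<notin> ball 0 (R + 2)" for x k
    using v[OF that(1)] that(2) norm_triangle_ineq2[of x "v k"] by auto
  have L: "?N h = sqrt (\<integral>x. (h x)\<^sup>2 \<partial>lborel)" if "smooth_on UNIV h" "\<And>x. x \<notin> ball 0 (R + 2) \<Longrightarrow> h x = 0" for h :: "real^2 \<Rightarrow> real"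
    by (rule \<Omega>.L2_norm_lborel[OF that])
  have tr: "?N (\<lambda>x. h (x - v k)) = ?N h" if h: "smooth_on UNIV h" "\<And>x. R < norm x \<Longrightarrow> h x = 0" and k: "k < n" for h :: "real^2 \<Rightarrow> real" and k
  proof -
    have "?N (\<lambda>x. h (x - v k)) = sqrt (\<integral>x. (h (x - v k))\<^sup>2 \<partial>lborel)"
      by (rule L[OF smooth_translate[OF h(1)]]) (use h(2) far[OF k] in auto)
    also have "(\<integral>x. (h (x - v k))\<^sup>2 \<partial>lborel) = (\<integral>x. (h x)\<^sup>2 \<partial>lborel)"
      using lborel_integral_translate(1)[of "\<lambda>x. (h x)\<^sup>2" "- v k"] smooth_borel[OF h(1)] by simp
    also have "sqrt \<dots> = ?N h" by (rule L[OF h(1), symmetric]) (use h(2) in auto)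
    finally show ?thesis .
  qed
  have P0: "0 \<le> P" using P[of 1] \<Omega>.L2_norm_nonneg[of "partial_deriv 1 \<phi>"] by linarith
  have N\<phi>: "?N \<phi> \<le> 2 * R * P"
  proof -
    have "?N \<phi> = sqrt (\<integral>x. (\<phi> x)\<^sup>2 \<partial>lborel)" by (rule L[OF \<phi>]) (use R(1) in auto)
    also have "\<dots> \<le> 2 * R * sqrt (\<integral>x. (partial_deriv 1 \<phi> x)\<^sup>2 \<partial>lborel)" by (rule Poincare[OF \<phi> R])
    also have "sqrt (\<integral>x. (partial_deriv 1 \<phi> x)\<^sup>2 \<partial>lborel) = ?N (partial_deriv 1 \<phi>)"
      by (rule L[OF smooth_partial_deriv[OF \<phi>], symmetric]) (use partial_deriv_support[OF R(1)] in auto)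
    finally show ?thesis using mult_left_mono[OF P[of 1], of "2 * R"] R(2) by linarith
  qed
  \<comment> \<open>C P arises when the derivative falls on \<phi>; C times 2 R P arises from
    Poincare's inequality when it falls on \<theta>.\<close>
  define F where "F = C * (1 + 2 * R) * P"
  have Nf: "?N (f k) \<le> F" if k: "k < n" for k
  proof -
    have "?N (f k) \<le> C * ?N \<phi>" unfolding f_def by (rule \<Omega>.L2_norm_mult_le[OF \<theta> \<phi> C(2)[OF k] C(1)])
    also have "\<dots> \<le> C * (2 * R * P)" by (rule mult_left_mono[OF N\<phi> C(1)])
    also have "\<dots> \<le> F" using mult_nonneg_nonneg[OF C(1) P0] by (simp add: F_def algebra_simps)
    finally show ?thesis .
  qed
  have Npf: "?N (partial_deriv i (f k)) \<le> F" if k: "k < n" for k i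
  proof -
    have "partial_deriv i (f k) = (\<lambda>x. \<theta> k x * partial_deriv i \<phi> x + partial_deriv i (\<theta> k) x * \<phi> x)"
      unfolding f_def[abs_def] by (rule ext) (rule partial_deriv_mult[OF smooth_differentiable[OF \<theta>] smooth_differentiable[OF \<phi>]])
    then have "?N (partial_deriv i (f k)) \<le> ?N (\<lambda>x. \<theta> k x * partial_deriv i \<phi> x) + ?N (\<lambda>x. partial_deriv i (\<theta> k) x * \<phi> x)"
      using \<Omega>.L2_add(2)[OF \<Omega>.smooth_L2[OF smooth_mult[OF \<theta>[of k] smooth_partial_deriv[OF \<phi>, of i]]]
        \<Omega>.smooth_L2[OF smooth_mult[OF smooth_partial_deriv[OF \<theta>[of k], of i] \<phi>]]] by simp
    also have "\<dots> \<le> C * ?N (partial_deriv i \<phi>) + C * ?N \<phi>"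
      by (intro add_mono \<Omega>.L2_norm_mult_le smooth_partial_deriv \<theta> \<phi> C k)
    also have "\<dots> \<le> C * P + C * (2 * R * P)"
      by (intro add_mono mult_left_mono P N\<phi> C(1))
    also have "\<dots> = F" by (simp add: F_def algebra_simps)
    finally show ?thesis .
  qed
  have pg: "partial_deriv i (g k) = (\<lambda>x. partial_deriv i (f k) (x - v k))" for i k
    unfolding g_def[abs_def] by (rule ext) (rule partial_deriv_translate[OF smooth_differentiable[OF sf]])
  have p\<psi>: "partial_deriv i \<psi> = (\<lambda>x. \<Sum>k<n. partial_deriv i (g k) x)" for i
    unfolding \<psi>g by (rule ext) (rule partial_deriv_sum; simp add: smooth_differentiable[OF sg])
  have "?N \<psi> \<le> (\<Sum>k<n. ?N (g k))" unfolding \<psi>g by (rule \<Omega>.L2_norm_sum_le[OF sg])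
  also have "\<dots> \<le> (\<Sum>k<n. F)"
    by (rule sum_mono) (use tr[OF sf f0] Nf in \<open>auto simp: g_def[abs_def]\<close>)
  finally show "?N \<psi> \<le> real n * (C * (1 + 2 * R) * P)" by (simp add: F_def)
  have "?N (partial_deriv i \<psi>) \<le> (\<Sum>k<n. ?N (partial_deriv i (g k)))"
    unfolding p\<psi> by (rule \<Omega>.L2_norm_sum_le[OF smooth_partial_deriv[OF sg]])
  also have "\<dots> \<le> (\<Sum>k<n. F)"
    by (rule sum_mono) (use tr[OF smooth_partial_deriv[OF sf] pf0] Npf in \<open>auto simp: pg\<close>)
  finally show "?N (partial_deriv i \<psi>) \<le> real n * (C * (1 + 2 * R) * P)" by (simp add: F_def)
  assume \<beta>: "continuous_on UNIV \<beta>" "\<And>x. \<bar>\<beta> x\<bar> \<le> D" "\<And>k x. k < n \<Longrightarrow> \<bar>\<beta> (v k + x) - \<beta> x\<bar> \<le> d" "0 \<le> d"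
  \<comment> \<open>The partition sums to 1 wherever \<phi> is nonzero, so the unshifted pieces add
    up to \<phi> everywhere and only the shifts have to be accounted for.\<close>
  have \<phi>f: "\<phi> = (\<lambda>x. \<Sum>k<n. f k x)"
  proof
    fix x show "\<phi> x = (\<Sum>k<n. f k x)"
      using one[of x] by (cases "\<phi> x = 0") (auto simp: f_def sum_distrib_right[symmetric])
  qed
  have p\<phi>: "partial_deriv i \<phi> = (\<lambda>x. \<Sum>k<n. partial_deriv i (f k) x)"
    by (subst \<phi>f, rule ext, rule partial_deriv_sum; simp add: smooth_differentiable[OF sf])
  have g0: "g k x = 0" if "k < n" "R + 2 < norm x" for k x
    unfolding g_def by (rule f0) (use far[OF that(1), of x] that(2) in auto)
  have int: "integrable lborel (\<lambda>x. \<beta> x * partial_deriv i h x)" if h: "smooth_on UNIV h" and h0: "\<And>x. R + 2 < norm x \<Longrightarrow> h x = 0" for h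
  proof (rule integrable_continuous_support[of _ "R + 2"])
    show "continuous_on UNIV (\<lambda>x. \<beta> x * partial_deriv i h x)"
      by (intro continuous_on_mult \<beta>(1) smooth_continuous[OF smooth_partial_deriv[OF h]])
    show "\<beta> x * partial_deriv i h x = 0" if "R + 2 < norm x" for x
      using partial_deriv_support[OF h0 that] by simp
  qed
  have "(\<integral>x. \<beta> x * partial_deriv i \<psi> x \<partial>lborel) = (\<Sum>k<n. \<integral>x. \<beta> x * partial_deriv i (g k) x \<partial>lborel)"
    unfolding p\<psi> sum_distrib_left by (rule Bochner_Integration.integral_sum) (use int[OF sg g0] in auto)
  moreover have "(\<integral>x. \<beta> x * partial_deriv i \<phi> x \<partial>lborel) = (\<Sum>k<n. \<integral>x. \<beta> x * partial_deriv i (f k) x \<partial>lborel)"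
    unfolding p\<phi> sum_distrib_left by (rule Bochner_Integration.integral_sum) (use int[OF sf f0] in auto)
  ultimately have "\<bar>(\<integral>x. \<beta> x * partial_deriv i \<psi> x \<partial>lborel) - (\<integral>x. \<beta> x * partial_deriv i \<phi> x \<partial>lborel)\<bar>
     = \<bar>\<Sum>k<n. (\<integral>x. \<beta> x * partial_deriv i (g k) x \<partial>lborel) - (\<integral>x. \<beta> x * partial_deriv i (f k) x \<partial>lborel)\<bar>"
    by (simp add: sum_subtractf)
  also have "\<dots> \<le> (\<Sum>k<n. \<bar>(\<integral>x. \<beta> x * partial_deriv i (g k) x \<partial>lborel) - (\<integral>x. \<beta> x * partial_deriv i (f k) x \<partial>lborel)\<bar>)"
    by (rule sum_abs)
  also have "\<dots> \<le> (\<Sum>k<n. d * (F * ?N (\<lambda>_. 1 :: real)))"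
  proof (rule sum_mono)
    fix k assume "k \<in> {..<n}"
    then have k: "k < n" by simp
    have "\<bar>(\<integral>x. \<beta> x * partial_deriv i (g k) x \<partial>lborel) - (\<integral>x. \<beta> x * partial_deriv i (f k) x \<partial>lborel)\<bar> \<le> d * (\<integral>x. \<bar>partial_deriv i (f k) x\<bar> \<partial>lborel)"
      unfolding g_def[abs_def] by (rule shift_pairing[OF sf f0 \<beta>(1,2) \<beta>(3)[OF k]])
    also have "(\<integral>x. \<bar>partial_deriv i (f k) x\<bar> \<partial>lborel) = (\<integral>x. norm (partial_deriv i (f k) x) * norm (1::real) \<partial>\<Omega>.\<mu>)"
      by (subst \<Omega>.test_integral(1)) (use pf0 smooth_borel[OF smooth_partial_deriv[OF sf]] in auto)
    also have "\<dots> \<le> ?N (partial_deriv i (f k)) * ?N (\<lambda>_. 1 :: real)"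
      by (rule \<Omega>.L2_norm_Cauchy_Schwarz(2)[OF \<Omega>.smooth_L2[OF smooth_partial_deriv[OF sf]] \<Omega>.smooth_L2[OF smooth_const]])
    also have "\<dots> \<le> F * ?N (\<lambda>_. 1 :: real)" by (rule mult_right_mono[OF Npf[OF k]]) simp
    finally show "\<bar>(\<integral>x. \<beta> x * partial_deriv i (g k) x \<partial>lborel) - (\<integral>x. \<beta> x * partial_deriv i (f k) x \<partial>lborel)\<bar> \<le> d * (F * ?N (\<lambda>_. 1 :: real))"
      using \<beta>(4) by (simp add: mult_left_mono)
  qed
  finally show "\<bar>(\<integral>x. \<beta> x * partial_deriv i \<psi> x \<partial>lborel) - (\<integral>x. \<beta> x * partial_deriv i \<phi> x \<partial>lborel)\<bar>
        \<le> d * (real n * (C * (1 + 2 * R) * P) * ?N (\<lambda>_. 1 :: real))"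
    by (simp add: F_def algebra_simps)
qed

text \<open>In units of \<open>mass * A\<close> the mollified components have norms at most 1, 2 and
  1. Korn's inequality then gives 3 for the missing component, and 2 + 3 = 5 for the sum that is the
  vertical derivative of \<open>pot2\<close>.\<close>

lemma potential_bounds:
  assumes e: "0 < e"
    and m: "integrable lborel m1" "integrable lborel m2" "integrable lborel m3"
    and msq: "integrable lborel (\<lambda>x. (m1 x)\<^sup>2)" "integrable lborel (\<lambda>x. (m2 x)\<^sup>2)" "integrable lborel (\<lambda>x. (m3 x)\<^sup>2)"
    and A: "(\<integral>x. (m1 x)\<^sup>2 \<partial>lborel) \<le> A\<^sup>2" "(\<integral>x. (m2 x)\<^sup>2 \<partial>lborel) \<le> 4 * A\<^sup>2" "(\<integral>x. (m3 x)\<^sup>2 \<partial>lborel) \<le> A\<^sup>2" "0 \<le> A"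
    and R: "\<And>x. R < norm x \<Longrightarrow> m1 x = 0" "\<And>x. R < norm x \<Longrightarrow> m2 x = 0" "\<And>x. R < norm x \<Longrightarrow> m3 x = 0"
    and orth: "\<And>x. conv m1 (tens (deriv (deriv (bump_e e))) (ramp_e e)) x
        + conv m2 (tens (deriv (bump_e e)) (step_e e)) x + conv m3 (kern e) x = 0"
    and z: "\<And>x. R < norm x \<Longrightarrow> pot1 e m1 x = 0" "\<And>x. R < norm x \<Longrightarrow> pot2 e m1 m2 x = 0"
  shows "L2_norm (ball 0 (R + 2)) (partial_deriv i (pot1 e m1)) \<le> 5 * mass * A"
    and "L2_norm (ball 0 (R + 2)) (partial_deriv i (pot2 e m1 m2)) \<le> 5 * mass * A"
proof -
  let ?N = "L2_norm (ball (0::real^2) (R + 2))"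
  interpret \<Omega>: planar_domain "ball 0 (R + 2)" by unfold_locales auto
  note p = potentials[OF e m R orth]
  define a s c b where "a = conv m1 (kern e)" and "s = conv m2 (kern e)" and "c = conv m3 (kern e)" and "b = potb e m1"
  have sm: "smooth_on UNIV a" "smooth_on UNIV s" "smooth_on UNIV c" "smooth_on UNIV b"
    unfolding a_def s_def c_def b_def
    by (rule smooth_conv[OF m(1) R(1) smooth_kern], assumption, rule smooth_conv[OF m(2) R(2) smooth_kern], assumption,
        rule smooth_conv[OF m(3) R(3) smooth_kern], assumption, rule p(3), assumption)
  have q: "partial_deriv 1 (pot1 e m1) = b" "partial_deriv 2 (pot1 e m1) = a"
    "partial_deriv 1 (pot2 e m1 m2) = (\<lambda>x. - c x)" "partial_deriv 2 (pot2 e m1 m2) = (\<lambda>x. s x + b x)"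
    unfolding a_def s_def c_def b_def using p(4-7) by auto
  have out: "partial_deriv i (pot1 e m1) x = 0" "partial_deriv i (pot2 e m1 m2) x = 0" if "x \<notin> ball 0 (R + 2)" for i x
    using partial_deriv_support[OF z(1), where x = x and i = i] partial_deriv_support[OF z(2), where x = x and i = i] that by auto
  have out': "a x = 0" "b x = 0" "c x = 0" "s x = 0" if "x \<notin> ball 0 (R + 2)" for x
    using out(1)[OF that, of 1] out(1)[OF that, of 2] out(2)[OF that, of 1] out(2)[OF that, of 2] unfolding q by auto
  have L: "(\<integral>x. (a x)\<^sup>2 \<partial>lborel) \<le> mass\<^sup>2 * A\<^sup>2" "(\<integral>x. (s x)\<^sup>2 \<partial>lborel) \<le> mass\<^sup>2 * (4 * A\<^sup>2)" "(\<integral>x. (c x)\<^sup>2 \<partial>lborel) \<le> mass\<^sup>2 * A\<^sup>2"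
    unfolding a_def s_def c_def
    using conv_kern_L2(1)[OF e m(1) msq(1) R(1)] conv_kern_L2(1)[OF e m(2) msq(2) R(2)] conv_kern_L2(1)[OF e m(3) msq(3) R(3)]
      A(1-3) by (meson mult_left_mono order_trans zero_le_power2)+
  have sp: "smooth_on UNIV (pot1 e m1)" "smooth_on UNIV (pot2 e m1 m2)" by ((rule p(1); assumption), (rule p(2); assumption))
  have K: "(\<integral>x. (b x)\<^sup>2 \<partial>lborel) \<le> (\<integral>x. (a x)\<^sup>2 \<partial>lborel) + (\<integral>x. (s x)\<^sup>2 \<partial>lborel) + (\<integral>x. (c x)\<^sup>2 \<partial>lborel)"
    by (rule Korn[OF sp z]) (simp_all add: q)
  have Nb: "?N f \<le> r * (mass * A)" if f: "smooth_on UNIV f" "\<And>x. x \<notin> ball 0 (R + 2) \<Longrightarrow> f x = 0" and le: "(\<integral>x. (f x)\<^sup>2 \<partial>lborel) \<le> (r * (mass * A))\<^sup>2" and r: "0 \<le> r" for f :: "real^2 \<Rightarrow> real" and r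
  proof -
    have "?N f = sqrt (\<integral>x. (f x)\<^sup>2 \<partial>lborel)" by (rule \<Omega>.L2_norm_lborel[OF f])
    also have "\<dots> \<le> r * (mass * A)" using le r mass_pos A(4) by (intro real_le_lsqrt) auto
    finally show ?thesis .
  qed
  have mA: "0 \<le> mass * A" using mass_pos A(4) by simp
  have Na: "?N a \<le> 1 * (mass * A)" by (rule Nb[OF sm(1) out'(1)]) (use L(1) in \<open>auto simp: power_mult_distrib\<close>)
  have Ns: "?N s \<le> 2 * (mass * A)" by (rule Nb[OF sm(2) out'(4)]) (use L(2) in \<open>auto simp: power_mult_distrib\<close>)
  have Nc: "?N c \<le> 1 * (mass * A)" by (rule Nb[OF sm(3) out'(3)]) (use L(3) in \<open>auto simp: power_mult_distrib\<close>)
  \<comment> \<open>Korn gives 1 + 4 + 1 = 6 for the square, rounded up to 9.\<close>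
  have NB: "?N b \<le> 3 * (mass * A)"
  proof (rule Nb[OF sm(4) out'(2)])
    have "0 \<le> mass\<^sup>2 * A\<^sup>2" by simp
    moreover have "(3 * (mass * A))\<^sup>2 = 9 * (mass\<^sup>2 * A\<^sup>2)" by (simp add: power_mult_distrib)
    ultimately show "(\<integral>x. (b x)\<^sup>2 \<partial>lborel) \<le> (3 * (mass * A))\<^sup>2" using K L by linarith
  qed auto
  have Nsb: "?N (\<lambda>x. s x + b x) \<le> 5 * (mass * A)"
    using \<Omega>.L2_add(2)[OF \<Omega>.smooth_L2[OF sm(2)] \<Omega>.smooth_L2[OF sm(4)]] Ns NB by linarith
  have Nmc: "?N (\<lambda>x. - c x) = ?N c" by (simp add: L2_norm_def)
  show "?N (partial_deriv i (pot1 e m1)) \<le> 5 * mass * A"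
    using exhaust_2[of i] NB Na mA by (auto simp: q)
  show "?N (partial_deriv i (pot2 e m1 m2)) \<le> 5 * mass * A"
    using exhaust_2[of i] Nc Nsb mA by (auto simp: q Nmc)
qed

text \<open>The potentials reach slightly beyond \<open>closure \<omega>\<close>, so the entries of
  B need values there. Tietze's extension multiplied by a cutoff has compact support and is
  therefore uniformly continuous.\<close>

lemma continuous_extension_compact:
  fixes f :: "real^2 \<Rightarrow> real"
  assumes K: "compact K" and f: "continuous_on K f"
  obtains \<beta> R where "continuous_on UNIV \<beta>" "\<And>x. R < norm x \<Longrightarrow> \<beta> x = 0" "\<And>x. x \<in> K \<Longrightarrow> \<beta> x = f x"
proof -
  obtain g where g: "continuous_on UNIV g" "\<And>x. x \<in> K \<Longrightarrow> g x = f x"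
    by (rule Tietze_unbounded[OF f, of UNIV]) (use compact_imp_closed[OF K] in auto)
  obtain r where r: "0 < r" "\<And>x. x \<in> K \<Longrightarrow> norm x \<le> r" using compact_imp_bounded[OF K] by (auto simp: bounded_pos)
  show ?thesis
  proof (rule that[of "\<lambda>x. cutoff (2 * r) 0 x * g x" "4 * r"])
    show "continuous_on UNIV (\<lambda>x. cutoff (2 * r) 0 x * g x)" by (intro continuous_on_mult g smooth_continuous smooth_cutoff)
    show "4 * r < norm x \<Longrightarrow> cutoff (2 * r) 0 x * g x = 0" for x using cutoff_0[of "2 * r" 0 x] r(1) by simp
    show "x \<in> K \<Longrightarrow> cutoff (2 * r) 0 x * g x = f x" for x using cutoff_1[of "2 * r" 0 x] r g(2) by simp
  qed
qed

section \<open>The residual is controlled by the curl\<close>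

context planar_domain
begin

text \<open>The 6 comes from the three terms of the first-order norm, each at most 2F because the
  test field has two components.\<close>

lemma curl_pairing_bound:
  assumes B: "smooth_on_closure \<omega> B" and H: "H_minus_norm 1 \<omega> (curl_rows B) = ennreal h" "0 \<le> h"
    and \<psi>: "smooth_on UNIV \<psi>1" "smooth_on UNIV \<psi>2" and Q: "compact Q" "Q \<subseteq> \<omega>" "\<And>x. x \<notin> Q \<Longrightarrow> \<psi>1 x = 0 \<and> \<psi>2 x = 0"
    and \<beta>: "continuous_on UNIV \<beta>1" "continuous_on UNIV \<beta>2" "continuous_on UNIV \<beta>3"
    and eq: "\<And>x. x \<in> \<omega> \<Longrightarrow> B x $ 1 $ 1 = \<beta>1 x \<and> B x $ 1 $ 2 = \<beta>2 x \<and> B x $ 2 $ 1 = \<beta>2 x \<and> B x $ 2 $ 2 = \<beta>3 x"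
    and F: "L2_norm \<omega> \<psi>1 \<le> F" "L2_norm \<omega> \<psi>2 \<le> F" "\<And>i. L2_norm \<omega> (partial_deriv i \<psi>1) \<le> F" "\<And>i. L2_norm \<omega> (partial_deriv i \<psi>2) \<le> F"
  shows "\<bar>((\<integral>x. \<beta>1 x * partial_deriv 2 \<psi>1 x \<partial>lborel) - (\<integral>x. \<beta>2 x * partial_deriv 1 \<psi>1 x \<partial>lborel))
     + ((\<integral>x. \<beta>2 x * partial_deriv 2 \<psi>2 x \<partial>lborel) - (\<integral>x. \<beta>3 x * partial_deriv 1 \<psi>2 x \<partial>lborel))\<bar> \<le> h * (6 * F)"
proof -
  define \<psi> where "\<psi> x = (vector [\<psi>1 x, \<psi>2 x] :: real^2)" for x
  have c: "(\<lambda>x. \<psi> x $ 1) = \<psi>1" "(\<lambda>x. \<psi> x $ 2) = \<psi>2" by (auto simp: \<psi>_def)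
  have s: "smooth_on UNIV \<psi>" unfolding smooth_vec2_iff forall_2 using \<psi> c by simp
  have t: "\<psi> \<in> test_functions \<omega>"
    by (rule test_functionsI[OF s Q(1,2)]) (use Q(3) in \<open>auto simp: \<psi>_def vec_eq_iff forall_2\<close>)
  have t1: "\<psi>1 \<in> test_functions \<omega>" "\<psi>2 \<in> test_functions \<omega>" using test_component[OF t, of 1] test_component[OF t, of 2] c by auto
  have p: "partial_deriv i \<psi> x $ 1 = partial_deriv i \<psi>1 x" "partial_deriv i \<psi> x $ 2 = partial_deriv i \<psi>2 x" for i x
    using partial_deriv_nth[OF smooth_differentiable[OF s], of i 1 x] partial_deriv_nth[OF smooth_differentiable[OF s], of i 2 x] c by auto
  have v: "L2_norm \<omega> \<psi> \<le> 2 * F" using L2_norm_vec2_le[OF s] F(1,2) c by simp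
  have "L2_norm \<omega> (partial_deriv i \<psi>) \<le> 2 * F" for i
    using L2_norm_vec2_le[OF smooth_partial_deriv[OF s], of i] F(3,4)[of i] by (simp add: p)
  then have W: "W2_norm 1 \<omega> \<psi> \<le> 6 * F" using W2_norm_1_smooth[OF s] v by (smt (verit))
  have b: "\<bar>\<integral>x. curl_rows B x \<bullet> \<psi> x \<partial>\<mu>\<bar> \<le> h * (6 * F)" by (rule H_minus_test[OF H t W])
  have int: "integrable lborel (\<lambda>x. \<beta> x * partial_deriv i g x)" "(\<integral>x. \<beta> x * partial_deriv i g x \<partial>\<mu>) = (\<integral>x. \<beta> x * partial_deriv i g x \<partial>lborel)"
    "integrable \<mu> (\<lambda>x. \<beta> x * partial_deriv i g x)"
    if "continuous_on UNIV \<beta>" "g \<in> test_functions \<omega>" for \<beta> g :: "real^2 \<Rightarrow> real" and i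
  proof -
    have pg: "partial_deriv i g \<in> test_functions \<omega>" by (rule test_partial_deriv[OF that(2)])
    obtain r where r: "\<And>x. r < norm x \<Longrightarrow> partial_deriv i g x = 0" by (rule test_bounded_support[OF pg]) auto
    have cont: "continuous_on UNIV (\<lambda>x. \<beta> x * partial_deriv i g x)"
      by (intro continuous_on_mult that(1) smooth_continuous[OF test_smooth[OF pg]])
    show 1: "integrable lborel (\<lambda>x. \<beta> x * partial_deriv i g x)"
      by (rule integrable_continuous_support[OF cont, of r]) (simp add: r)
    show "(\<integral>x. \<beta> x * partial_deriv i g x \<partial>\<mu>) = (\<integral>x. \<beta> x * partial_deriv i g x \<partial>lborel)" "integrable \<mu> (\<lambda>x. \<beta> x * partial_deriv i g x)"
      using test_integral[of "\<lambda>x. \<beta> x * partial_deriv i g x", OF borel_measurable_continuous_onI[OF cont]] test_zero[OF pg] 1 by auto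
  qed
  have "(\<integral>x. curl_rows B x \<bullet> \<psi> x \<partial>\<mu>) = (\<integral>x. curl_form (B x) (partial_deriv 1 \<psi> x) (partial_deriv 2 \<psi> x) \<partial>\<mu>)"
    by (rule curl_rows_pairing[OF B t])
  also have "\<dots> = (\<integral>x. (\<beta>1 x * partial_deriv 2 \<psi>1 x - \<beta>2 x * partial_deriv 1 \<psi>1 x) + (\<beta>2 x * partial_deriv 2 \<psi>2 x - \<beta>3 x * partial_deriv 1 \<psi>2 x) \<partial>\<mu>)"
    by (rule Bochner_Integration.integral_cong) (auto simp: space_restrict_space curl_form_def p dest: eq)
  also have "\<dots> = ((\<integral>x. \<beta>1 x * partial_deriv 2 \<psi>1 x \<partial>lborel) - (\<integral>x. \<beta>2 x * partial_deriv 1 \<psi>1 x \<partial>lborel))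
     + ((\<integral>x. \<beta>2 x * partial_deriv 2 \<psi>2 x \<partial>lborel) - (\<integral>x. \<beta>3 x * partial_deriv 1 \<psi>2 x \<partial>lborel))"
    using int(3)[OF \<beta>(1) t1(1), of 2] int(3)[OF \<beta>(2) t1(1), of 1] int(3)[OF \<beta>(2) t1(2), of 2] int(3)[OF \<beta>(3) t1(2), of 1]
      int(2)[OF \<beta>(1) t1(1), of 2] int(2)[OF \<beta>(2) t1(1), of 1] int(2)[OF \<beta>(2) t1(2), of 2] int(2)[OF \<beta>(3) t1(2), of 1]
    by simp
  finally show ?thesis using b by simp
qed

text \<open>The partition and its bounds are fixed before B and M are introduced, so the constant
  depends on \<omega> only. For M as in \<open>hessian_projection\<close>, the left side is the
  square of its norm.\<close>

lemma key_inequality: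
  assumes sc: "simply_connected \<omega>" and lip: "lipschitz_boundary \<omega>" and ne: "\<omega> \<noteq> {}"
  shows "\<exists>C\<ge>0. \<forall>B h M. smooth_sym_field \<omega> B \<longrightarrow> H_minus_norm 1 \<omega> (curl_rows B) = ennreal h \<longrightarrow> 0 \<le> h \<longrightarrow> M \<in> L2 \<omega> \<longrightarrow>
     (\<forall>w. smooth_on UNIV w \<longrightarrow> inner_L2 M (classical_hessian w) = 0) \<longrightarrow> inner_L2 M B \<le> C * h * L2_norm \<omega> M"
proof -
  let ?K = "closure \<omega>"
  have K: "compact ?K" "?K \<noteq> {}" using bounded_\<omega> ne by auto
  have conn: "connected (- ?K)" by (rule connected_Compl_closure[OF open_\<omega> bounded_\<omega> sc lip])
  obtain R0 where R0: "0 < R0" "\<And>x. x \<in> ?K \<Longrightarrow> norm x \<le> R0" using compact_imp_bounded[OF K(1)] by (auto simp: bounded_pos)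
  define R where "R = R0 + 1"
  have R: "0 \<le> R" using R0 by (simp add: R_def)
  have \<omega>K: "\<omega> \<subseteq> ?K" by (rule closure_subset)
  obtain n :: nat and \<theta> :: "nat \<Rightarrow> real^2 \<Rightarrow> real" and e0 :: "nat \<Rightarrow> real^2" and \<delta>0 R\<theta> :: real where part: "0 < \<delta>0" "\<And>k. smooth_on UNIV (\<theta> k)" "\<And>k x. k < n \<Longrightarrow> R\<theta> < norm x \<Longrightarrow> \<theta> k x = 0"
    "\<And>\<delta>. 0 < \<delta> \<Longrightarrow> \<delta> < \<delta>0 \<Longrightarrow> \<exists>\<eta>>0. \<forall>a\<in>?K. \<forall>x. dist a x < \<eta> \<longrightarrow>
        (\<Sum>k<n. \<theta> k x) = 1 \<and> (\<forall>k<n. x \<in> closure {y. \<theta> k y \<noteq> 0} \<longrightarrow> x + \<delta> *\<^sub>R e0 k \<in> \<omega>)"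
    by (rule shift_partition[OF open_\<omega> bounded_\<omega> lip]) blast
  have "\<exists>C\<ge>0. \<forall>x. \<bar>\<theta> k x\<bar> \<le> C \<and> \<bar>partial_deriv 1 (\<theta> k) x\<bar> \<le> C \<and> \<bar>partial_deriv 2 (\<theta> k) x\<bar> \<le> C" if k: "k < n" for k
  proof -
    have b: "\<exists>C>0. \<forall>x. \<bar>g x\<bar> \<le> C" if "smooth_on UNIV g" "\<And>x. R\<theta> < norm x \<Longrightarrow> g x = 0" for g :: "real^2 \<Rightarrow> real"
      using continuous_bounded_support[OF smooth_continuous[OF that(1)] that(2)] by (metis real_norm_def)
    obtain c0 where c0: "0 < c0" "\<forall>x. \<bar>\<theta> k x\<bar> \<le> c0" using b[OF part(2) part(3)[OF k]] by blast
    have "\<exists>C>0. \<forall>x. \<bar>partial_deriv i (\<theta> k) x\<bar> \<le> C" for i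
      by (rule b[OF smooth_partial_deriv[OF part(2)]]) (rule partial_deriv_support[OF part(3)[OF k]])
    then obtain c1 c2 where c: "0 < c1" "\<forall>x. \<bar>partial_deriv 1 (\<theta> k) x\<bar> \<le> c1" "0 < c2" "\<forall>x. \<bar>partial_deriv 2 (\<theta> k) x\<bar> \<le> c2" by metis
    have "c0 \<le> c0 + c1 + c2" "c1 \<le> c0 + c1 + c2" "c2 \<le> c0 + c1 + c2" "0 \<le> c0 + c1 + c2" using c0(1) c(1,3) by auto
    then show ?thesis using c0(2) c(2,4) by (intro exI[of _ "c0 + c1 + c2"]) (meson order_trans)
  qed
  then obtain ck where ck: "\<And>k. k < n \<Longrightarrow> 0 \<le> ck k"
    "\<And>k x. k < n \<Longrightarrow> \<bar>\<theta> k x\<bar> \<le> ck k \<and> \<bar>partial_deriv 1 (\<theta> k) x\<bar> \<le> ck k \<and> \<bar>partial_deriv 2 (\<theta> k) x\<bar> \<le> ck k" by metis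
  define C\<theta> where "C\<theta> = (\<Sum>k<n. ck k)"
  have ck_le: "ck k \<le> C\<theta>" if "k < n" for k unfolding C\<theta>_def using ck(1) that by (intro member_le_sum) auto
  have C\<theta>: "0 \<le> C\<theta>" "\<And>k x. k < n \<Longrightarrow> \<bar>\<theta> k x\<bar> \<le> C\<theta>" "\<And>k i x. k < n \<Longrightarrow> \<bar>partial_deriv i (\<theta> k) x\<bar> \<le> C\<theta>"
  proof -
    show "0 \<le> C\<theta>" unfolding C\<theta>_def using ck(1) by (intro sum_nonneg) auto
    show "\<bar>\<theta> k x\<bar> \<le> C\<theta>" if "k < n" for k x using ck(2)[OF that, of x] ck_le[OF that] by linarith
    show "\<bar>partial_deriv i (\<theta> k) x\<bar> \<le> C\<theta>" if "k < n" for k i x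
      using ck(2)[OF that, of x] ck_le[OF that] exhaust_2[of i] by (elim disjE) auto
  qed
  define E0 where "E0 = (\<Sum>k<n. norm (e0 k)) + 1"
  have E0: "1 \<le> E0" "\<And>k. k < n \<Longrightarrow> norm (e0 k) \<le> E0"
  proof -
    show "1 \<le> E0" by (simp add: E0_def sum_nonneg)
    show "norm (e0 k) \<le> E0" if "k < n" for k
      using member_le_sum[of k "{..<n}" "\<lambda>k. norm (e0 k)"] that unfolding E0_def by auto
  qed
  define N1 where "N1 = L2_norm (ball 0 (R + 2)) (\<lambda>_::real^2. 1 :: real)"
  have N1: "0 \<le> N1" by (simp add: N1_def L2_norm_def)
  \<comment> \<open>30 = 6 times 5: the factor of the curl pairing and that of the potential
    bounds.\<close>
  define C0 where "C0 = 30 * (real n * (C\<theta> * (1 + 2 * R)))"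
  have C0: "0 \<le> C0" using C\<theta>(1) R by (simp add: C0_def)
  have main: "inner_L2 M B \<le> C0 * h * L2_norm \<omega> M"
    if BS: "smooth_sym_field \<omega> B" and H: "H_minus_norm 1 \<omega> (curl_rows B) = ennreal h" "0 \<le> h" and M: "M \<in> L2 \<omega>"
      and orth: "\<And>w. smooth_on UNIV w \<Longrightarrow> inner_L2 M (classical_hessian w) = 0" for B h M
  proof -
    have B: "smooth_on_closure \<omega> B" and sym: "\<And>x. x \<in> ?K \<Longrightarrow> transpose (B x) = B x" using BS by (auto simp: smooth_sym_field_def)
    have Bc: "continuous_on ?K (\<lambda>x. B x $ i $ j)" for i j using B by (auto simp: smooth_on_closure_def intro!: continuous_intros)
    obtain \<beta>1 r1 where \<beta>1: "continuous_on UNIV \<beta>1" "\<And>x. r1 < norm x \<Longrightarrow> \<beta>1 x = 0" "\<And>x. x \<in> ?K \<Longrightarrow> \<beta>1 x = B x $ 1 $ 1"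
      by (rule continuous_extension_compact[OF K(1) Bc[of 1 1]]) blast
    obtain \<beta>2 r2 where \<beta>2: "continuous_on UNIV \<beta>2" "\<And>x. r2 < norm x \<Longrightarrow> \<beta>2 x = 0" "\<And>x. x \<in> ?K \<Longrightarrow> \<beta>2 x = B x $ 1 $ 2"
      by (rule continuous_extension_compact[OF K(1) Bc[of 1 2]]) blast
    obtain \<beta>3 r3 where \<beta>3: "continuous_on UNIV \<beta>3" "\<And>x. r3 < norm x \<Longrightarrow> \<beta>3 x = 0" "\<And>x. x \<in> ?K \<Longrightarrow> \<beta>3 x = B x $ 2 $ 2"
      by (rule continuous_extension_compact[OF K(1) Bc[of 2 2]]) blast
    have eq: "B x $ 1 $ 1 = \<beta>1 x \<and> B x $ 1 $ 2 = \<beta>2 x \<and> B x $ 2 $ 1 = \<beta>2 x \<and> B x $ 2 $ 2 = \<beta>3 x" if "x \<in> \<omega>" for x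
    proof -
      have x: "x \<in> ?K" using that \<omega>K by blast
      have "transpose (B x) $ 2 $ 1 = B x $ 1 $ 2" by (simp add: transpose_def)
      then show ?thesis using \<beta>1(3)[OF x] \<beta>2(3)[OF x] \<beta>3(3)[OF x] sym[OF x] by simp
    qed
    obtain D1 where D1: "\<And>x. \<bar>\<beta>1 x\<bar> \<le> D1" using continuous_bounded_support[OF \<beta>1(1,2)] by (metis real_norm_def)
    obtain D2 where D2: "\<And>x. \<bar>\<beta>2 x\<bar> \<le> D2" using continuous_bounded_support[OF \<beta>2(1,2)] by (metis real_norm_def)
    obtain D3 where D3: "\<And>x. \<bar>\<beta>3 x\<bar> \<le> D3" using continuous_bounded_support[OF \<beta>3(1,2)] by (metis real_norm_def)
    have \<beta>b: "\<beta>1 \<in> borel_measurable borel" "\<beta>2 \<in> borel_measurable borel" "\<beta>3 \<in> borel_measurable borel"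
      by (intro borel_measurable_continuous_onI \<beta>1 \<beta>2 \<beta>3)+
    define A where "A = L2_norm \<omega> M"
    have A: "0 \<le> A" by (simp add: A_def)
    obtain m1 m2 m3 where m: "integrable lborel m1" "integrable lborel m2" "integrable lborel m3"
      and msq: "integrable lborel (\<lambda>x. (m1 x)\<^sup>2)" "integrable lborel (\<lambda>x. (m2 x)\<^sup>2)" "integrable lborel (\<lambda>x. (m3 x)\<^sup>2)"
      and mA: "(\<integral>x. (m1 x)\<^sup>2 \<partial>lborel) \<le> (L2_norm \<omega> M)\<^sup>2" "(\<integral>x. (m2 x)\<^sup>2 \<partial>lborel) \<le> 4 * (L2_norm \<omega> M)\<^sup>2" "(\<integral>x. (m3 x)\<^sup>2 \<partial>lborel) \<le> (L2_norm \<omega> M)\<^sup>2"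
      and m\<omega>: "\<And>x. m1 x \<noteq> 0 \<or> m2 x \<noteq> 0 \<or> m3 x \<noteq> 0 \<Longrightarrow> x \<in> \<omega>"
      and orthK: "\<And>e x. 0 < e \<Longrightarrow> conv m1 (tens (deriv (deriv (bump_e e))) (ramp_e e)) x
        + conv m2 (tens (deriv (bump_e e)) (step_e e)) x + conv m3 (kern e) x = 0"
      and inner: "\<And>F b1 b2 b3. F \<in> L2 \<omega> \<Longrightarrow> b1 \<in> borel_measurable borel \<Longrightarrow> b2 \<in> borel_measurable borel \<Longrightarrow> b3 \<in> borel_measurable borel \<Longrightarrow>
       (\<And>x. x \<in> \<omega> \<Longrightarrow> F x $ 1 $ 1 = b1 x \<and> F x $ 1 $ 2 = b2 x \<and> F x $ 2 $ 1 = b2 x \<and> F x $ 2 $ 2 = b3 x) \<Longrightarrow>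
       inner_L2 M F = (\<integral>x. m1 x * b1 x \<partial>lborel) + (\<integral>x. m2 x * b2 x \<partial>lborel) + (\<integral>x. m3 x * b3 x \<partial>lborel)"
    proof (rule borel_stress[OF M orth], goal_cases)
      case (2 m1 m2 m3)
      show ?case by (rule 2(1)[of m1 m2 m3]; fact 2)
    qed
    note mA = mA[folded A_def]
    have innerB: "inner_L2 M B = (\<integral>x. \<beta>1 x * m1 x \<partial>lborel) + (\<integral>x. \<beta>2 x * m2 x \<partial>lborel) + (\<integral>x. \<beta>3 x * m3 x \<partial>lborel)"
      using inner[OF smooth_closure_L2[OF B] \<beta>b eq] by (simp add: mult.commute)
    have mK: "m1 x \<noteq> 0 \<or> m2 x \<noteq> 0 \<or> m3 x \<noteq> 0 \<Longrightarrow> x \<in> ?K" for x using m\<omega> \<omega>K by blast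
    have mR: "m1 x = 0" "m2 x = 0" "m3 x = 0" if "R < norm x" for x
      using mK[of x] R0(2)[of x] that by (auto simp: R_def)
    define I where "I = (\<integral>x. \<bar>m1 x\<bar> \<partial>lborel) + (\<integral>x. \<bar>m2 x\<bar> \<partial>lborel) + (\<integral>x. \<bar>m3 x\<bar> \<partial>lborel)"
    define P where "P = 5 * mass * A"
    define F where "F = real n * (C\<theta> * (1 + 2 * R) * P)"
    define Z where "Z = mass * I + 4 * (F * N1)"
    have P: "0 \<le> P" using mass_pos A by (simp add: P_def)
    have F0: "0 \<le> F" using P C\<theta>(1) R by (simp add: F_def)
    have I0: "0 \<le> I" by (simp add: I_def)
    have Z0: "0 \<le> Z" unfolding Z_def using mass_pos I0 F0 N1 by simp
    \<comment> \<open>The parameters are chosen in the order: tolerance d, radius r of uniform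
      continuity, shift length \<delta>, width \<eta> of the neighbourhood in which the shifts enter
      \<omega>, level t beyond which the exterior component is reached, mollification radius e. F
      and Z do not depend on any of them.\<close>
    have step: "mass * inner_L2 M B \<le> h * (6 * F) + d * Z" if d: "0 < d" for d
    proof -
      obtain r1 where r1: "0 < r1" "\<And>x y. dist x y < r1 \<Longrightarrow> \<bar>\<beta>1 x - \<beta>1 y\<bar> \<le> d"
        using uniformly_continuous_bounded_support[OF \<beta>1(1,2) d] by blast
      obtain r2 where r2: "0 < r2" "\<And>x y. dist x y < r2 \<Longrightarrow> \<bar>\<beta>2 x - \<beta>2 y\<bar> \<le> d"
        using uniformly_continuous_bounded_support[OF \<beta>2(1,2) d] by blast
      obtain r3 where r3: "0 < r3" "\<And>x y. dist x y < r3 \<Longrightarrow> \<bar>\<beta>3 x - \<beta>3 y\<bar> \<le> d"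
        using uniformly_continuous_bounded_support[OF \<beta>3(1,2) d] by blast
      define r where "r = min 1 (min r1 (min r2 r3))"
      have r: "0 < r" "r \<le> 1" "r \<le> r1" "r \<le> r2" "r \<le> r3" using r1 r2 r3 by (auto simp: r_def)
      have near: "\<bar>\<beta>1 x - \<beta>1 y\<bar> \<le> d" "\<bar>\<beta>2 x - \<beta>2 y\<bar> \<le> d" "\<bar>\<beta>3 x - \<beta>3 y\<bar> \<le> d" if "dist x y < r" for x y
        using that r r1(2) r2(2) r3(2) by auto
      define \<delta> where "\<delta> = min (\<delta>0 / 2) (r / (2 * E0))"
      have \<delta>: "0 < \<delta>" "\<delta> < \<delta>0" "\<delta> \<le> r / (2 * E0)" using part(1) r E0(1) by (auto simp: \<delta>_def min_def)
      define v where "v k = \<delta> *\<^sub>R e0 k" for k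
      have v: "norm (v k) < r" if k: "k < n" for k
      proof -
        have "norm (v k) \<le> \<delta> * E0" using \<delta> E0(2)[OF k] by (simp add: v_def mult_left_mono)
        also have "\<dots> \<le> r / (2 * E0) * E0" using \<delta>(3) E0(1) by (intro mult_right_mono) auto
        also have "\<dots> < r" using r(1) E0(1) by simp
        finally show ?thesis .
      qed
      obtain \<eta> where \<eta>: "0 < \<eta>" "\<And>a x. a \<in> ?K \<Longrightarrow> dist a x < \<eta> \<Longrightarrow>
          (\<Sum>k<n. \<theta> k x) = 1 \<and> (\<forall>k<n. x \<in> closure {y. \<theta> k y \<noteq> 0} \<longrightarrow> x + v k \<in> \<omega>)"
        using part(4)[OF \<delta>(1,2)] unfolding v_def by blast
      define \<eta>' where "\<eta>' = min (\<eta> / 2) 1"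
      have \<eta>': "0 < \<eta>'" "\<eta>' < \<eta>" "\<eta>' \<le> 1" using \<eta>(1) by (auto simp: \<eta>'_def min_def)
      have inK: "\<exists>a\<in>?K. infdist x ?K = dist x a" for x
        using infdist_attains_inf[OF closed_closure K(2)] by blast
      have close: "(\<Sum>k<n. \<theta> k x) = 1 \<and> (\<forall>k<n. x \<in> closure {y. \<theta> k y \<noteq> 0} \<longrightarrow> x + v k \<in> \<omega>)" if "infdist x ?K \<le> \<eta>'" for x
      proof -
        obtain a where "a \<in> ?K" "infdist x ?K = dist x a" using inK by blast
        then show ?thesis using \<eta>(2)[of a x] that \<eta>'(2) by (simp add: dist_commute)
      qed
      \<comment> \<open>Below the support of M, so that the potentials start with value 0, and far
        enough out for \<open>component_exhaustion\<close>.\<close>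
      define q where "q = (vector [0, - (R0 + 3)] :: real^2)"
      have q2: "q $ 2 = - (R0 + 3)" by (simp add: q_def)
      have "\<bar>q $ 2\<bar> \<le> norm q" by (rule component_le_norm_cart)
      then have nq: "R0 + 2 < norm q" using q2 R0(1) by simp
      obtain t where t: "0 < t" "t \<le> 1" "\<And>x. \<eta>' \<le> infdist x ?K \<Longrightarrow> x \<in> connected_component_set {x. t < infdist x ?K} q"
        using component_exhaustion[OF K conn R0(2) nq \<eta>'(1)] by blast
      \<comment> \<open>The kernel has radius below 2e, which must not exceed the distance t
        (vanishing on the component) nor r (oscillation of the \<beta>).\<close>
      define e where "e = min (t / 2) (r / 2)"
      have e: "0 < e" "2 * e \<le> t" "2 * e \<le> r" using t r by (auto simp: e_def)
      note orthe = orthK[OF e(1)]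
      note pot = potentials[OF e(1) m mR orthe]
      define \<phi>1 \<phi>2 where "\<phi>1 = pot1 e m1" and "\<phi>2 = pot2 e m1 m2"
      have s: "smooth_on UNIV \<phi>1" "smooth_on UNIV \<phi>2"
        unfolding \<phi>1_def \<phi>2_def by ((rule pot(1); assumption), (rule pot(2); assumption))
      have van: "\<phi>1 x = 0" "\<phi>2 x = 0" if "\<eta>' \<le> infdist x ?K" for x
        unfolding \<phi>1_def \<phi>2_def
        using potentials_support[OF e(1,2) t(2) m mK R0(2) orthe _ t(3)[OF that]] q2 by auto
      have far: "\<eta>' \<le> infdist x ?K" if "R < norm x" for x
      proof -
        obtain a where a: "a \<in> ?K" "infdist x ?K = dist x a" using inK by blast
        have "norm x - norm a \<le> dist x a" unfolding dist_norm by (rule norm_triangle_ineq2)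
        then show ?thesis using a R0(2)[OF a(1)] that \<eta>'(3) by (simp add: R_def)
      qed
      have \<phi>R: "\<phi>1 x = 0" "\<phi>2 x = 0" if "R < norm x" for x using van[OF far[OF that]] by auto
      have NP: "L2_norm (ball 0 (R + 2)) (partial_deriv i \<phi>1) \<le> P" "L2_norm (ball 0 (R + 2)) (partial_deriv i \<phi>2) \<le> P" for i
        unfolding P_def \<phi>1_def \<phi>2_def
        using potential_bounds[OF e(1) m msq mA A mR orthe \<phi>R[unfolded \<phi>1_def \<phi>2_def]] by auto
      have one: "(\<Sum>k<n. \<theta> k x) = 1" if "\<phi>1 x \<noteq> 0 \<or> \<phi>2 x \<noteq> 0" for x
        using close[of x] van[of x] that by (cases "\<eta>' \<le> infdist x ?K") auto
      define \<psi>1 where "\<psi>1 x = (\<Sum>k<n. \<theta> k (x - v k) * \<phi>1 (x - v k))" for x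
      define \<psi>2 where "\<psi>2 x = (\<Sum>k<n. \<theta> k (x - v k) * \<phi>2 (x - v k))" for x
      have v1: "norm (v k) \<le> 1" if "k < n" for k using v[OF that] r(2) by simp
      note cut1 = cut_shift[where \<phi> = \<phi>1 and \<theta> = \<theta> and v = v and n = n and C = C\<theta> and R = R and P = P, folded \<psi>1_def[abs_def],
          OF s(1) \<phi>R(1) R part(2) C\<theta> v1 one NP(1)]
      note cut2 = cut_shift[where \<phi> = \<phi>2 and \<theta> = \<theta> and v = v and n = n and C = C\<theta> and R = R and P = P, folded \<psi>2_def[abs_def],
          OF s(2) \<phi>R(2) R part(2) C\<theta> v1 one NP(2)]
      have s\<psi>: "smooth_on UNIV \<psi>1" "smooth_on UNIV \<psi>2" using cut1(1) cut2(1) by auto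
      \<comment> \<open>The k-th piece lives on the support of \<theta> k near
        \<open>closure \<omega>\<close>, shifted by v k. The ball makes the set compact, and the
        shifts place it inside \<omega>.\<close>
      define Q where "Q = (\<Union>k<n. (\<lambda>x. x + v k) ` (closure {y. \<theta> k y \<noteq> 0} \<inter> ({x. infdist x ?K \<le> \<eta>'} \<inter> cball 0 R)))"
      have Qc: "compact Q"
        unfolding Q_def
      proof (intro compact_UN ballI compact_continuous_image closed_Int_compact)
        show "closed {x. infdist x ?K \<le> \<eta>'}" by (rule closed_Collect_le) (auto intro!: continuous_intros)
      qed (auto intro!: continuous_intros)
      have Q\<omega>: "Q \<subseteq> \<omega>" unfolding Q_def using close by auto
      have Q0: "\<psi>1 x = 0 \<and> \<psi>2 x = 0" if x: "x \<notin> Q" for x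
      proof -
        have "\<theta> k (x - v k) * \<phi>1 (x - v k) = 0 \<and> \<theta> k (x - v k) * \<phi>2 (x - v k) = 0" if k: "k < n" for k
        proof (rule ccontr)
          assume c: "\<not> ?thesis"
          then have 1: "\<theta> k (x - v k) \<noteq> 0" "\<phi>1 (x - v k) \<noteq> 0 \<or> \<phi>2 (x - v k) \<noteq> 0" by auto
          then have "x - v k \<in> closure {y. \<theta> k y \<noteq> 0}" using closure_subset[of "{y. \<theta> k y \<noteq> 0}"] by blast
          moreover have "infdist (x - v k) ?K \<le> \<eta>'" using 1(2) van[of "x - v k"] by (cases "\<eta>' \<le> infdist (x - v k) ?K") auto
          moreover have "x - v k \<in> cball 0 R" using 1(2) \<phi>R[of "x - v k"] by (cases "R < norm (x - v k)") auto
          ultimately have "x \<in> (\<lambda>x. x + v k) ` (closure {y. \<theta> k y \<noteq> 0} \<inter> ({x. infdist x ?K \<le> \<eta>'} \<inter> cball 0 R))"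
            by (intro image_eqI[of _ _ "x - v k"]) auto
          then show False using x k unfolding Q_def by blast
        qed
        then show ?thesis unfolding \<psi>1_def \<psi>2_def by (intro conjI sum.neutral) auto
      qed
      have restr: "L2_norm \<omega> g = L2_norm (ball 0 (R + 2)) g" if g: "smooth_on UNIV g" "\<And>x. x \<notin> \<omega> \<Longrightarrow> g x = 0" for g :: "real^2 \<Rightarrow> real"
      proof -
        interpret \<Omega>: planar_domain "ball 0 (R + 2)" by unfold_locales auto
        have "g x = 0" if "x \<notin> ball 0 (R + 2)" for x
          using g(2)[of x] R0(2)[of x] \<omega>K that by (auto simp: R_def)
        then show ?thesis using L2_norm_lborel[OF g] \<Omega>.L2_norm_lborel[OF g(1)] by simp
      qed
      have t\<psi>: "\<psi>1 \<in> test_functions \<omega>" "\<psi>2 \<in> test_functions \<omega>"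
        by (rule test_functionsI[OF s\<psi>(1) Qc Q\<omega>], use Q0 in blast) (rule test_functionsI[OF s\<psi>(2) Qc Q\<omega>], use Q0 in blast)
      have NF: "L2_norm \<omega> \<psi>1 \<le> F" "L2_norm \<omega> \<psi>2 \<le> F" "L2_norm \<omega> (partial_deriv i \<psi>1) \<le> F" "L2_norm \<omega> (partial_deriv i \<psi>2) \<le> F" for i
        unfolding F_def
        using cut1(2,3) cut2(2,3) restr[OF s\<psi>(1) test_zero[OF t\<psi>(1)]] restr[OF s\<psi>(2) test_zero[OF t\<psi>(2)]]
          restr[OF smooth_partial_deriv[OF s\<psi>(1)] test_zero[OF test_partial_deriv[OF t\<psi>(1)]]]
          restr[OF smooth_partial_deriv[OF s\<psi>(2)] test_zero[OF test_partial_deriv[OF t\<psi>(2)]]] by simp_all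
      have L\<psi>: "\<bar>((\<integral>x. \<beta>1 x * partial_deriv 2 \<psi>1 x \<partial>lborel) - (\<integral>x. \<beta>2 x * partial_deriv 1 \<psi>1 x \<partial>lborel))
         + ((\<integral>x. \<beta>2 x * partial_deriv 2 \<psi>2 x \<partial>lborel) - (\<integral>x. \<beta>3 x * partial_deriv 1 \<psi>2 x \<partial>lborel))\<bar> \<le> h * (6 * F)"
        by (rule curl_pairing_bound[OF B H s\<psi> Qc Q\<omega> Q0 \<beta>1(1) \<beta>2(1) \<beta>3(1) eq NF])
      have sh: "\<bar>\<beta>1 (v k + x) - \<beta>1 x\<bar> \<le> d" "\<bar>\<beta>2 (v k + x) - \<beta>2 x\<bar> \<le> d" "\<bar>\<beta>3 (v k + x) - \<beta>3 x\<bar> \<le> d" if "k < n" for k x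
        using near[of "v k + x" x] v[OF that] by (simp_all add: dist_norm)
      have d0: "0 \<le> d" using d by simp
      have c1: "\<bar>(\<integral>x. \<beta> x * partial_deriv i \<psi>1 x \<partial>lborel) - (\<integral>x. \<beta> x * partial_deriv i \<phi>1 x \<partial>lborel)\<bar> \<le> d * (F * N1)"
        if "continuous_on UNIV \<beta>" "\<And>x. \<bar>\<beta> x\<bar> \<le> D" "\<And>k x. k < n \<Longrightarrow> \<bar>\<beta> (v k + x) - \<beta> x\<bar> \<le> d" for \<beta> D i
        unfolding F_def N1_def by (rule cut1(4)[where D = D and d = d]) (use that d0 in auto)
      have c2: "\<bar>(\<integral>x. \<beta> x * partial_deriv i \<psi>2 x \<partial>lborel) - (\<integral>x. \<beta> x * partial_deriv i \<phi>2 x \<partial>lborel)\<bar> \<le> d * (F * N1)"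
        if "continuous_on UNIV \<beta>" "\<And>x. \<bar>\<beta> x\<bar> \<le> D" "\<And>k x. k < n \<Longrightarrow> \<bar>\<beta> (v k + x) - \<beta> x\<bar> \<le> d" for \<beta> D i
        unfolding F_def N1_def by (rule cut2(4)[where D = D and d = d]) (use that d0 in auto)
      have S: "\<bar>(\<integral>x. \<beta>1 x * partial_deriv 2 \<psi>1 x \<partial>lborel) - (\<integral>x. \<beta>1 x * partial_deriv 2 \<phi>1 x \<partial>lborel)\<bar> \<le> d * (F * N1)"
        "\<bar>(\<integral>x. \<beta>2 x * partial_deriv 1 \<psi>1 x \<partial>lborel) - (\<integral>x. \<beta>2 x * partial_deriv 1 \<phi>1 x \<partial>lborel)\<bar> \<le> d * (F * N1)"
        "\<bar>(\<integral>x. \<beta>2 x * partial_deriv 2 \<psi>2 x \<partial>lborel) - (\<integral>x. \<beta>2 x * partial_deriv 2 \<phi>2 x \<partial>lborel)\<bar> \<le> d * (F * N1)"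
        "\<bar>(\<integral>x. \<beta>3 x * partial_deriv 1 \<psi>2 x \<partial>lborel) - (\<integral>x. \<beta>3 x * partial_deriv 1 \<phi>2 x \<partial>lborel)\<bar> \<le> d * (F * N1)"
        by (rule c1[OF \<beta>1(1) D1 sh(1)] c1[OF \<beta>2(1) D2 sh(2)] c2[OF \<beta>2(1) D2 sh(2)] c2[OF \<beta>3(1) D3 sh(3)]; assumption)+
      have pr: "\<bar>(\<integral>x. \<beta> x * conv m' (kern e) x \<partial>lborel) - mass * (\<integral>x. \<beta> x * m' x \<partial>lborel)\<bar> \<le> d * mass * (\<integral>x. \<bar>m' x\<bar> \<partial>lborel)"
        if "integrable lborel m'" "\<beta> \<in> borel_measurable borel" "\<And>x. \<bar>\<beta> x\<bar> \<le> D" "\<And>x y. dist x y < r \<Longrightarrow> \<bar>\<beta> x - \<beta> y\<bar> \<le> d" for \<beta> m' D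
        by (rule conv_kern_pairing[OF e(1) that(1,2,3)]) (use that(4) e(3) in \<open>auto simp: dist_norm\<close>)
      have T: "\<bar>(\<integral>x. \<beta>1 x * conv m1 (kern e) x \<partial>lborel) - mass * (\<integral>x. \<beta>1 x * m1 x \<partial>lborel)\<bar> \<le> d * mass * (\<integral>x. \<bar>m1 x\<bar> \<partial>lborel)"
        "\<bar>(\<integral>x. \<beta>2 x * conv m2 (kern e) x \<partial>lborel) - mass * (\<integral>x. \<beta>2 x * m2 x \<partial>lborel)\<bar> \<le> d * mass * (\<integral>x. \<bar>m2 x\<bar> \<partial>lborel)"
        "\<bar>(\<integral>x. \<beta>3 x * conv m3 (kern e) x \<partial>lborel) - mass * (\<integral>x. \<beta>3 x * m3 x \<partial>lborel)\<bar> \<le> d * mass * (\<integral>x. \<bar>m3 x\<bar> \<partial>lborel)"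
        by (rule pr[OF m(1) \<beta>b(1) D1 near(1)], assumption) (rule pr[OF m(2) \<beta>b(2) D2 near(2)], assumption, rule pr[OF m(3) \<beta>b(3) D3 near(3)], assumption)
      have int: "integrable lborel (\<lambda>x. \<beta> x * partial_deriv i g x)"
        if "continuous_on UNIV \<beta>" "smooth_on UNIV g" "\<And>x. R < norm x \<Longrightarrow> g x = 0" for \<beta> g :: "real^2 \<Rightarrow> real" and i
      proof (rule integrable_continuous_support[of _ R])
        show "continuous_on UNIV (\<lambda>x. \<beta> x * partial_deriv i g x)"
          by (intro continuous_on_mult that(1) smooth_continuous[OF smooth_partial_deriv[OF that(2)]])
        show "\<beta> x * partial_deriv i g x = 0" if "R < norm x" for x
          using partial_deriv_support[OF \<open>\<And>x. R < norm x \<Longrightarrow> g x = 0\<close> that] by simp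
      qed
      \<comment> \<open>Through the potential equations, the pairing of the mollified M with the
        extension of B becomes the curl pairing with \<phi>1 and \<phi>2. Four shift errors
        \<open>S\<close> and three mollification errors \<open>T\<close> add up to
        \<open>d * Z\<close>.\<close>
      have k1: "(\<integral>x. \<beta>1 x * conv m1 (kern e) x \<partial>lborel) = (\<integral>x. \<beta>1 x * partial_deriv 2 \<phi>1 x \<partial>lborel)"
        unfolding \<phi>1_def by (simp add: pot(5))
      have "(\<integral>x. \<beta>2 x * conv m2 (kern e) x \<partial>lborel) = (\<integral>x. \<beta>2 x * partial_deriv 2 \<phi>2 x - \<beta>2 x * partial_deriv 1 \<phi>1 x \<partial>lborel)"
        unfolding \<phi>1_def \<phi>2_def by (simp add: pot(4,7) algebra_simps)
      then have k2: "(\<integral>x. \<beta>2 x * conv m2 (kern e) x \<partial>lborel) = (\<integral>x. \<beta>2 x * partial_deriv 2 \<phi>2 x \<partial>lborel) - (\<integral>x. \<beta>2 x * partial_deriv 1 \<phi>1 x \<partial>lborel)"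
        using int[OF \<beta>2(1) s(2) \<phi>R(2), of 2] int[OF \<beta>2(1) s(1) \<phi>R(1), of 1] by simp
      have k3: "(\<integral>x. \<beta>3 x * conv m3 (kern e) x \<partial>lborel) = - (\<integral>x. \<beta>3 x * partial_deriv 1 \<phi>2 x \<partial>lborel)"
        unfolding \<phi>2_def by (simp add: pot(6))
      have "mass * inner_L2 M B = mass * (\<integral>x. \<beta>1 x * m1 x \<partial>lborel) + mass * (\<integral>x. \<beta>2 x * m2 x \<partial>lborel) + mass * (\<integral>x. \<beta>3 x * m3 x \<partial>lborel)"
        unfolding innerB by (simp add: algebra_simps)
      moreover have "d * Z = d * mass * (\<integral>x. \<bar>m1 x\<bar> \<partial>lborel) + d * mass * (\<integral>x. \<bar>m2 x\<bar> \<partial>lborel) + d * mass * (\<integral>x. \<bar>m3 x\<bar> \<partial>lborel) + 4 * (d * (F * N1))"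
        unfolding Z_def I_def by (simp add: algebra_simps)
      ultimately show ?thesis using L\<psi> S T unfolding k1 k2 k3 by linarith
    qed
    \<comment> \<open>\<open>Z\<close> is independent of d, so the error disappears as d tends to
      0.\<close>
    have "mass * inner_L2 M B \<le> h * (6 * F)"
    proof (rule field_le_epsilon)
      fix \<epsilon> :: real assume \<epsilon>: "0 < \<epsilon>"
      have "mass * inner_L2 M B \<le> h * (6 * F) + \<epsilon> / (Z + 1) * Z" by (rule step) (use \<epsilon> Z0 in simp)
      also have "\<epsilon> / (Z + 1) * Z \<le> \<epsilon>" using \<epsilon> Z0 by (simp add: field_simps)
      finally show "mass * inner_L2 M B \<le> h * (6 * F) + \<epsilon>" by simp
    qed
    also have "h * (6 * F) = mass * (C0 * h * A)" by (simp add: F_def P_def C0_def)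
    finally show ?thesis using mass_pos by (simp add: A_def)
  qed
  show ?thesis using C0 main by (intro exI[of _ C0]) blast
qed

end

section \<open>Conclusion\<close>

lemma square_add_le: "(x + y)\<^sup>2 \<le> 2 * x\<^sup>2 + 2 * y\<^sup>2" for x y :: real
  using zero_le_power2[of "x - y"] by (simp add: power2_eq_square algebra_simps)

lemma square_add3_le: "(x + (y + z))\<^sup>2 \<le> 2 * x\<^sup>2 + 2 * (2 * y\<^sup>2 + 2 * z\<^sup>2)" for x y z :: real
  using square_add_le[of x "y + z"] mult_left_mono[OF square_add_le[of y z], of 2] by simp

text \<open>Evaluates the functional at distance \<open>C0 * h\<close> from the Hessians. After
  squaring, only the monomials of the right side occur, so their coefficients may simply be added
  up.\<close>

lemma upper_polynomial_bound:
  fixes C0 h k s o1 \<beta> :: real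
  assumes "0 \<le> C0"
  shows "(C0 * h)\<^sup>2 + (k + s * (2 * (C0 * h)\<^sup>2 + 4 * (\<beta> * (C0 * h * o1))))\<^sup>2
    \<le> (C0\<^sup>2 + 16 * s\<^sup>2 * C0 ^ 4 + 64 * s\<^sup>2 * o1\<^sup>2 * C0\<^sup>2 + 3) * (h\<^sup>2 * (1 + \<beta>\<^sup>2 + h\<^sup>2) + k\<^sup>2)"
proof -
  define P Q T where "P = C0\<^sup>2" and "Q = 16 * s\<^sup>2 * C0 ^ 4" and "T = 64 * s\<^sup>2 * o1\<^sup>2 * C0\<^sup>2"
  have nn: "0 \<le> P" "0 \<le> Q" "0 \<le> T" by (auto simp: P_def Q_def T_def)
  define u w where "u = s * (2 * (C0 * h)\<^sup>2)" and "w = s * (4 * (\<beta> * (C0 * h * o1)))"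
  have "(k + s * (2 * (C0 * h)\<^sup>2 + 4 * (\<beta> * (C0 * h * o1))))\<^sup>2 = (k + (u + w))\<^sup>2"
    by (simp add: u_def w_def distrib_left)
  also have "\<dots> \<le> 2 * k\<^sup>2 + 2 * (2 * u\<^sup>2 + 2 * w\<^sup>2)" by (rule square_add3_le)
  also have "\<dots> = 2 * k\<^sup>2 + Q * (h\<^sup>2 * h\<^sup>2) + T * (h\<^sup>2 * \<beta>\<^sup>2)"
    by (simp add: u_def w_def Q_def T_def power_mult_distrib power2_eq_square power4_eq_xxxx)
  finally have 1: "(k + s * (2 * (C0 * h)\<^sup>2 + 4 * (\<beta> * (C0 * h * o1))))\<^sup>2 \<le> 2 * k\<^sup>2 + Q * (h\<^sup>2 * h\<^sup>2) + T * (h\<^sup>2 * \<beta>\<^sup>2)" .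
  have 2: "(C0 * h)\<^sup>2 = P * h\<^sup>2" by (simp add: P_def power_mult_distrib)
  define a b d where "a = h\<^sup>2" and "b = h\<^sup>2 * \<beta>\<^sup>2" and "d = h\<^sup>2 * h\<^sup>2"
  have ab: "0 \<le> a" "0 \<le> b" "0 \<le> d" "0 \<le> k\<^sup>2" by (auto simp: a_def b_def d_def)
  have "P * a + 2 * k\<^sup>2 + Q * d + T * b \<le> (P + Q + T + 3) * (a + b + d + k\<^sup>2)"
  proof -
    have "0 \<le> P * (b + d + k\<^sup>2) + Q * (a + b + k\<^sup>2) + T * (a + d + k\<^sup>2) + 3 * (a + b + d) + k\<^sup>2"
      using nn ab by simp
    then show ?thesis by (simp add: algebra_simps)
  qed
  moreover have "h\<^sup>2 * (1 + \<beta>\<^sup>2 + h\<^sup>2) + k\<^sup>2 = a + b + d + k\<^sup>2" by (simp add: a_def b_def d_def distrib_left)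
  ultimately show ?thesis using 1 unfolding 2 by (simp add: P_def Q_def T_def a_def b_def d_def)
qed

text \<open>Each of the two terms is shown to be at most half of the right side \<iota>: 1/32
  because the square of h is at most 16 \<iota>, and 1/(6L) because the square of k is at most 3L
  times \<iota> times the maximum.\<close>

lemma lower_polynomial_bound:
  fixes E g h k s o1 \<beta> c L :: real
  assumes nn: "0 \<le> E" "0 \<le> h" "0 \<le> k" and h: "h \<le> 4 * E"
    and k: "k \<le> g + s * (2 * E\<^sup>2 + 4 * (\<beta> * (E * o1)))"
  defines "L \<equiv> 2 + 16 * s\<^sup>2 + 64 * s\<^sup>2 * o1\<^sup>2"
  defines "c \<equiv> min (1 / 32) (1 / (6 * L))"
  defines "\<alpha> \<equiv> \<beta>\<^sup>2 + k\<^sup>2 + h\<^sup>2 * (1 + \<beta>\<^sup>2 + h\<^sup>2)"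
  shows "c * h\<^sup>2 + c / max 1 \<alpha> * k\<^sup>2 \<le> E\<^sup>2 + g\<^sup>2"
proof -
  define \<iota> where "\<iota> = E\<^sup>2 + g\<^sup>2"
  define m where "m = max 1 \<alpha>"
  have L: "2 \<le> L" by (simp add: L_def)
  have c: "0 < c" "c \<le> 1 / 32" "c \<le> 1 / (6 * L)" using L by (auto simp: c_def)
  have \<iota>: "0 \<le> \<iota>" "E\<^sup>2 \<le> \<iota>" "g\<^sup>2 \<le> \<iota>" by (auto simp: \<iota>_def)
  have "0 \<le> h\<^sup>2 * (1 + \<beta>\<^sup>2 + h\<^sup>2)" by (intro mult_nonneg_nonneg add_nonneg_nonneg) auto
  then have \<alpha>: "\<beta>\<^sup>2 \<le> \<alpha>" "k\<^sup>2 \<le> \<alpha>"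
    using zero_le_power2[of \<beta>] zero_le_power2[of k] by (auto simp only: \<alpha>_def)
  have m: "1 \<le> m" "\<beta>\<^sup>2 \<le> m" "k\<^sup>2 \<le> m" using \<alpha> by (auto simp: m_def)
  have first: "c * h\<^sup>2 \<le> \<iota> / 2"
  proof -
    have "h\<^sup>2 \<le> (4 * E)\<^sup>2" using nn(2) h by (intro power_mono) auto
    then have "h\<^sup>2 \<le> 16 * \<iota>" using \<iota>(2) by (simp add: power_mult_distrib)
    then have "c * h\<^sup>2 \<le> 1 / 32 * (16 * \<iota>)" using c by (intro mult_mono) auto
    then show ?thesis by simp
  qed
  have "c * k\<^sup>2 \<le> \<iota> / 2 * m"
  \<comment> \<open>For large \<iota> the square of k is dominated by the denominator, which
    contains it. For small \<iota> the fourth power of E is at most \<iota>, and the mixed term with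
    \<beta> is absorbed by the denominator.\<close>
  proof (cases "1 \<le> \<iota>")
    case True
    have "c * k\<^sup>2 \<le> 1 / 32 * m" using c m by (intro mult_mono) auto
    also have "\<dots> \<le> \<iota> / 2 * m" using True m by (intro mult_right_mono) auto
    finally show ?thesis .
  next
    case False
    define u w where "u = s * (2 * E\<^sup>2)" and "w = s * (4 * (\<beta> * (E * o1)))"
    have "k\<^sup>2 \<le> (g + (u + w))\<^sup>2" using k nn(3) by (intro power_mono) (auto simp: u_def w_def distrib_left)
    also have "\<dots> \<le> 2 * g\<^sup>2 + 2 * (2 * u\<^sup>2 + 2 * w\<^sup>2)" by (rule square_add3_le)
    also have "\<dots> = 2 * g\<^sup>2 + 16 * s\<^sup>2 * (E\<^sup>2 * E\<^sup>2) + 64 * s\<^sup>2 * o1\<^sup>2 * (\<beta>\<^sup>2 * E\<^sup>2)"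
      by (simp add: u_def w_def power_mult_distrib power2_eq_square)
    also have "\<dots> \<le> 2 * (3 * (\<iota> * m)) + 16 * s\<^sup>2 * (3 * (\<iota> * m)) + 64 * s\<^sup>2 * o1\<^sup>2 * (3 * (\<iota> * m))"
    proof (intro add_mono mult_left_mono)
      have im: "\<iota> \<le> \<iota> * m" using \<iota>(1) m(1) by (simp add: mult_le_cancel_left1)
      show "g\<^sup>2 \<le> 3 * (\<iota> * m)" using im \<iota> by linarith
      have "E\<^sup>2 * E\<^sup>2 \<le> \<iota> * 1" using \<iota> False by (intro mult_mono) auto
      then show "E\<^sup>2 * E\<^sup>2 \<le> 3 * (\<iota> * m)" using im \<iota> by linarith
      have "\<beta>\<^sup>2 * E\<^sup>2 \<le> m * \<iota>" using m \<iota> by (intro mult_mono) auto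
      moreover have "m * \<iota> = \<iota> * m" by simp
      ultimately show "\<beta>\<^sup>2 * E\<^sup>2 \<le> 3 * (\<iota> * m)" using im \<iota> by linarith
    qed auto
    also have "\<dots> = L * (3 * (\<iota> * m))" by (simp add: L_def algebra_simps)
    finally have "c * k\<^sup>2 \<le> 1 / (6 * L) * (L * (3 * (\<iota> * m)))" using c L by (intro mult_mono) auto
    also have "\<dots> = \<iota> / 2 * m" using L by simp
    finally show ?thesis .
  qed
  then have "c / m * k\<^sup>2 \<le> \<iota> / 2" using m(1) by (simp add: field_simps)
  then have "c * h\<^sup>2 + c / m * k\<^sup>2 \<le> \<iota>" using first by linarith
  then show ?thesis by (simp only: m_def \<iota>_def)
qed

section \<open>Assembling the two bounds\<close>

context planar_domain
begin

text \<open>The square of the norm of M equals its pairing with B, hence is at most C h times the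
  norm of M; cancelling one factor bounds the distance from the Hessians.\<close>

lemma near_minimizer:
  assumes sc: "simply_connected \<omega>" and lip: "lipschitz_boundary \<omega>"
  shows "\<exists>C\<ge>0. \<forall>B h e. smooth_sym_field \<omega> B \<longrightarrow> H_minus_norm 1 \<omega> (curl_rows B) = ennreal h \<longrightarrow> 0 \<le> h \<longrightarrow> 0 < e \<longrightarrow>
     (\<exists>v\<in>W2 2 \<omega>. L2_norm \<omega> (\<lambda>x. hessian \<omega> v x + B x) \<le> C * h + e)"
\<comment> \<open>The key inequality measures distances to \<open>closure \<omega>\<close>, which
  has to be nonempty.\<close>
proof (cases "\<omega> = {}")
  case True
  have 0: "(\<lambda>_. 0) \<in> W2 2 \<omega>" by (rule smooth_W2[OF smooth_const])
  have "L2_norm \<omega> f = 0" for f :: "real^2 \<Rightarrow> real^2^2"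
    unfolding L2_norm_def by (simp add: True integral_lebesgue_on)
  then show ?thesis using 0 by (intro exI[of _ 0]) auto
next
  case False
  obtain C where C: "0 \<le> C" and key: "\<And>B h M. smooth_sym_field \<omega> B \<Longrightarrow> H_minus_norm 1 \<omega> (curl_rows B) = ennreal h \<Longrightarrow> 0 \<le> h \<Longrightarrow> M \<in> L2 \<omega> \<Longrightarrow>
     (\<forall>w. smooth_on UNIV w \<longrightarrow> inner_L2 M (classical_hessian w) = 0) \<Longrightarrow> inner_L2 M B \<le> C * h * L2_norm \<omega> M"
    using key_inequality[OF sc lip False] by blast
  have "\<exists>v\<in>W2 2 \<omega>. L2_norm \<omega> (\<lambda>x. hessian \<omega> v x + B x) \<le> C * h + e"
    if B: "smooth_sym_field \<omega> B" and h: "H_minus_norm 1 \<omega> (curl_rows B) = ennreal h" "0 \<le> h" and e: "0 < e" for B h e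
  proof -
    have BL: "B \<in> L2 \<omega>" using B by (intro smooth_closure_L2) (auto simp: smooth_sym_field_def)
    obtain M where M: "M \<in> L2 \<omega>" "\<And>w. smooth_on UNIV w \<Longrightarrow> inner_L2 M (classical_hessian w) = 0"
      "(L2_norm \<omega> M)\<^sup>2 = inner_L2 M B"
      "\<And>e. 0 < e \<Longrightarrow> \<exists>v\<in>W2 2 \<omega>. L2_norm \<omega> (\<lambda>x. hessian \<omega> v x + B x) \<le> L2_norm \<omega> M + e"
      by (rule hessian_projection[OF BL]) blast
    have "L2_norm \<omega> M * L2_norm \<omega> M \<le> C * h * L2_norm \<omega> M"
      using key[OF B h M(1)] M(2,3) by (simp add: power2_eq_square)
    then have "L2_norm \<omega> M \<le> C * h"
      using C h(2) by (cases "L2_norm \<omega> M = 0") (auto simp: mult_le_cancel_right order.strict_iff_order)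
    then show ?thesis using M(4)[OF e] by force
  qed
  then show ?thesis using C by blast
qed

end

theorem proposition1p3:
  fixes \<omega> :: "(real^2) set"
  assumes "open \<omega>" and "bounded \<omega>" and "simply_connected \<omega>" and "lipschitz_boundary \<omega>"
  shows "\<exists>c C :: real. 0 < c \<and> 0 < C \<and>
    (\<forall>B S. smooth_sym_field \<omega> B \<and> smooth_sym_field \<omega> S \<longrightarrow>
      (let inf_I0 = (INF v\<in>W2 2 \<omega>. I0 \<omega> B S v);
           curlB = H_minus_norm 1 \<omega> (curl_rows B);
           detB = H_minus_norm 2 \<omega> (\<lambda>x. det (B x) + curlT_curl S x);
           normB = Linf_norm \<omega> B;
           a = normB\<^sup>2 + detB\<^sup>2 + curlB\<^sup>2 * (1 + normB\<^sup>2 + curlB\<^sup>2)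
       in inf_I0 \<le> ennreal C * curlB\<^sup>2 * (1 + normB\<^sup>2 + curlB\<^sup>2) + ennreal C * detB\<^sup>2 \<and>
          inf_I0 \<ge> ennreal c * curlB\<^sup>2 + ennreal c / max 1 a * detB\<^sup>2))"
proof -
  interpret planar_domain \<omega> by unfold_locales fact+
  obtain C0 where C0: "0 \<le> C0" and near: "\<And>B h e. smooth_sym_field \<omega> B \<Longrightarrow> H_minus_norm 1 \<omega> (curl_rows B) = ennreal h \<Longrightarrow> 0 \<le> h \<Longrightarrow> 0 < e \<Longrightarrow>
     \<exists>v\<in>W2 2 \<omega>. L2_norm \<omega> (\<lambda>x. hessian \<omega> v x + B x) \<le> C0 * h + e"
    using near_minimizer[OF assms(3,4)] by blast
  define s o1 where "s = sup_const" and "o1 = one_norm"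
  have s: "0 \<le> s" "0 \<le> o1" by (auto simp: s_def o1_def sup_const_nonneg one_norm_def)
  define L where "L = 2 + 16 * s\<^sup>2 + 64 * s\<^sup>2 * o1\<^sup>2"
  define c where "c = min (1 / 32) (1 / (6 * L))"
  define C where "C = C0\<^sup>2 + 16 * s\<^sup>2 * C0 ^ 4 + 64 * s\<^sup>2 * o1\<^sup>2 * C0\<^sup>2 + 3"
  have L: "2 \<le> L" by (simp add: L_def)
  have c: "0 < c" using L by (simp add: c_def)
  have C: "0 < C" unfolding C_def by (intro add_nonneg_pos add_nonneg_nonneg mult_nonneg_nonneg) (use C0 in auto)
  have main: "(INF v\<in>W2 2 \<omega>. I0 \<omega> B S v) \<le> ennreal C * H\<^sup>2 * (1 + N\<^sup>2 + H\<^sup>2) + ennreal C * K\<^sup>2"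
    "ennreal c * H\<^sup>2 + ennreal c / max 1 (N\<^sup>2 + K\<^sup>2 + H\<^sup>2 * (1 + N\<^sup>2 + H\<^sup>2)) * K\<^sup>2 \<le> (INF v\<in>W2 2 \<omega>. I0 \<omega> B S v)"
    if BS: "smooth_sym_field \<omega> B" "smooth_sym_field \<omega> S" and H_def: "H = H_minus_norm 1 \<omega> (curl_rows B)"
      and K_def: "K = H_minus_norm 2 \<omega> (\<lambda>x. det (B x) + curlT_curl S x)" and N_def: "N = Linf_norm \<omega> B" for B S H K N
  proof -
    have B: "smooth_on_closure \<omega> B" and S: "smooth_on_closure \<omega> S" using BS by (auto simp: smooth_sym_field_def)
    have "(\<lambda>_. 0) \<in> W2 2 \<omega>" by (rule smooth_W2[OF smooth_const])
    \<comment> \<open>The lower bound at v = 0 shows that the norm of the curl is finite.\<close>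
    from curl_lower_bound[OF this B] have "H \<noteq> top" unfolding H_def by (auto simp: top_unique)
    then obtain h where h: "0 \<le> h" "H = ennreal h" by (cases H) auto
    obtain \<beta> where \<beta>: "0 \<le> \<beta>" "N = ennreal \<beta>" and AE: "AE x in \<mu>. norm (B x) \<le> \<beta>"
      unfolding N_def by (rule Linf_norm_finite[OF B])
    define E where "E v = L2_norm \<omega> (\<lambda>x. hessian \<omega> v x + B x)" for v
    define G where "G v = H_minus_norm 2 \<omega> (\<lambda>x. det (hessian \<omega> v x) + curlT_curl S x)" for v
    define D where "D X = s * (2 * X\<^sup>2 + 4 * (\<beta> * (X * o1)))" for X :: real
    have E0: "0 \<le> E v" for v by (simp add: E_def)
    have I0: "I0 \<omega> B S v = ennreal (E v) ^ 2 + G v ^ 2" for v by (simp add: I0_def E_def G_def)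
    have comp: "G v \<le> K + ennreal (D (E v))" "K \<le> G v + ennreal (D (E v))" if "v \<in> W2 2 \<omega>" for v
      unfolding G_def K_def D_def E_def s_def o1_def using det_H_minus_compare[OF that B S \<beta>(1) AE] by auto
    have D_mono: "D X \<le> D Y" if "0 \<le> X" "X \<le> Y" for X Y
      unfolding D_def using that s \<beta>(1)
      by (intro mult_left_mono add_mono mult_right_mono power_mono) auto
    have D0: "0 \<le> D X" if "0 \<le> X" for X using that s \<beta>(1) by (simp add: D_def)
    show "(INF v\<in>W2 2 \<omega>. I0 \<omega> B S v) \<le> ennreal C * H\<^sup>2 * (1 + N\<^sup>2 + H\<^sup>2) + ennreal C * K\<^sup>2"
    proof (cases K)
      \<comment> \<open>The right side is infinite because C is positive.\<close>
      case top
      then show ?thesis using C by (simp add: ennreal_mult_top power2_eq_square)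
    next
      case (real k)
      define f where "f X = X\<^sup>2 + (k + D X)\<^sup>2" for X
      have le: "(INF v\<in>W2 2 \<omega>. I0 \<omega> B S v) \<le> ennreal (f (C0 * h + e))" if e: "0 < e" for e
      proof -
        obtain v where v: "v \<in> W2 2 \<omega>" "E v \<le> C0 * h + e"
          using near[OF BS(1) _ h(1) e] h(2) unfolding H_def E_def by blast
        have "G v \<le> ennreal (k + D (C0 * h + e))"
          using comp(1)[OF v(1)] D_mono[OF E0 v(2)] real D0[OF E0[of v]]
          by (metis (no_types, opaque_lifting) add_left_mono ennreal_leI ennreal_plus order_trans)
        then have "I0 \<omega> B S v \<le> ennreal (C0 * h + e) ^ 2 + ennreal (k + D (C0 * h + e)) ^ 2"
          unfolding I0 using v(2) by (intro add_mono power_mono ennreal_leI) auto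
        also have "\<dots> = ennreal (f (C0 * h + e))"
          using real(1) D0[of "C0 * h + e"] C0 h(1) e by (simp add: f_def ennreal_power flip: ennreal_plus)
        finally show ?thesis using v(1) by (meson INF_lower order_trans)
      qed
      then obtain x where x: "0 \<le> x" "(INF v\<in>W2 2 \<omega>. I0 \<omega> B S v) = ennreal x"
        using le[of 1] by (cases "INF v\<in>W2 2 \<omega>. I0 \<omega> B S v") (auto simp: top_unique)
      have f0: "0 \<le> f X" for X by (simp add: f_def)
      have "x \<le> f (C0 * h + e)" if "0 < e" for e using le[OF that] f0 by (simp add: x(2) ennreal_le_iff)
      then have ev: "\<forall>\<^sub>F e in at_right 0. x \<le> f (C0 * h + e)"
        by (auto simp: eventually_at_right_field intro!: exI[of _ 1])
      \<comment> \<open>Near minimizers are available with any excess e, and f is continuous, so e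
        may tend to 0.\<close>
      have "((\<lambda>e. f (C0 * h + e)) \<longlongrightarrow> f (C0 * h + 0)) (at_right 0)"
        unfolding f_def D_def by (intro tendsto_intros)
      from tendsto_lowerbound[OF this ev] have "x \<le> f (C0 * h)" by simp
      also have "\<dots> \<le> C * (h\<^sup>2 * (1 + \<beta>\<^sup>2 + h\<^sup>2) + k\<^sup>2)"
        unfolding f_def D_def C_def by (rule upper_polynomial_bound[OF C0])
      finally have "ennreal x \<le> ennreal (C * h\<^sup>2 * (1 + \<beta>\<^sup>2 + h\<^sup>2) + C * k\<^sup>2)" by (simp add: distrib_left mult.assoc ennreal_leI)
      also have "\<dots> = ennreal C * H\<^sup>2 * (1 + N\<^sup>2 + H\<^sup>2) + ennreal C * K\<^sup>2"
        using C h(1) \<beta>(1) real(1) unfolding h(2) \<beta>(2) real(2)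
        by (simp add: ennreal_power ennreal_mult ennreal_plus flip: ennreal_1)
      finally show ?thesis unfolding x(2) .
    qed
    show "ennreal c * H\<^sup>2 + ennreal c / max 1 (N\<^sup>2 + K\<^sup>2 + H\<^sup>2 * (1 + N\<^sup>2 + H\<^sup>2)) * K\<^sup>2 \<le> (INF v\<in>W2 2 \<omega>. I0 \<omega> B S v)"
    proof (rule INF_greatest)
      fix v :: "real^2 \<Rightarrow> real" assume v: "v \<in> W2 2 \<omega>"
      show "ennreal c * H\<^sup>2 + ennreal c / max 1 (N\<^sup>2 + K\<^sup>2 + H\<^sup>2 * (1 + N\<^sup>2 + H\<^sup>2)) * K\<^sup>2 \<le> I0 \<omega> B S v"
      proof (cases "G v")
        \<comment> \<open>The functional itself is infinite at v. Otherwise the comparison of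
          determinants makes K finite, and the claim becomes one about real numbers.\<close>
        case top
        then show ?thesis by (simp add: I0 power2_eq_square)
      next
        case (real g)
        have "K \<le> ennreal (g + D (E v))" using comp(2)[OF v] real D0[OF E0[of v]] by simp
        then obtain k where k: "0 \<le> k" "K = ennreal k" "k \<le> g + D (E v)"
          using real(1) D0[OF E0[of v]] by (cases K) (auto simp: top_unique simp flip: ennreal_plus)
        have hE: "h \<le> 4 * E v" using curl_lower_bound[OF v B, folded H_def E_def] h E0[of v] by (simp add: ennreal_le_iff)
        define \<alpha> where "\<alpha> = \<beta>\<^sup>2 + k\<^sup>2 + h\<^sup>2 * (1 + \<beta>\<^sup>2 + h\<^sup>2)"
        have \<alpha>: "N\<^sup>2 + K\<^sup>2 + H\<^sup>2 * (1 + N\<^sup>2 + H\<^sup>2) = ennreal \<alpha>"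
          using h(1) \<beta>(1) k(1) unfolding h(2) \<beta>(2) k(2) \<alpha>_def
          by (simp add: ennreal_power ennreal_mult ennreal_plus flip: ennreal_1)
        have m: "max 1 (ennreal \<alpha>) = ennreal (max 1 \<alpha>)" by (metis ennreal_1 ennreal_leI linorder_linear max.absorb1 max.absorb2)
        have "ennreal c * H\<^sup>2 + ennreal c / max 1 (ennreal \<alpha>) * K\<^sup>2 = ennreal (c * h\<^sup>2 + c / max 1 \<alpha> * k\<^sup>2)"
          using c h(1) k(1) unfolding m h(2) k(2)
          by (subst divide_ennreal) (auto simp: ennreal_power simp flip: ennreal_mult' ennreal_plus)
        also have "\<dots> \<le> ennreal ((E v)\<^sup>2 + g\<^sup>2)"
          unfolding c_def L_def \<alpha>_def
          by (intro ennreal_leI lower_polynomial_bound[OF E0 h(1) k(1) hE k(3)[unfolded D_def]])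
        also have "\<dots> = I0 \<omega> B S v" unfolding I0 real(2) using real(1) E0[of v] by (simp add: ennreal_power ennreal_plus)
        finally show ?thesis unfolding \<alpha> .
      qed
    qed
  qed
  show ?thesis
    unfolding Let_def
    by (intro exI[of _ c] exI[of _ C] conjI allI impI c C; elim conjE; rule main[OF _ _ refl refl refl]; assumption)
qed

end
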